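(* Let $\alpha>0$ and let $X,Y,\tau_\alpha,\tau,\bar g,(\mathcal{G}_t)_{0\le t\le T}$ be as defined in the context. Let $N_t:=\mathbf{1}_{[t\ge\tau]}$ and let $A$ be its $\mathcal{G}$-compensator, i.e. the continuous, increasing, $\mathcal{G}$-predictable process with $A_0=0$, given by the Doob–Meyer decomposition, such that $N-A$ is a $\mathcal{G}$-martingale. Then $\tau$ has a $\mathcal{G}$-intensity, that is, $A$ is of the form $$A_t=\int_0^{t\wedge\tau}\lambda_s\,ds .$$ Furthermore, $$\lambda_t=\mathbf{1}_{[t>\tau_\alpha]}\,\frac{1}{2\,[t-\bar g_{t-}]}\quad\text{for }0\le t\le\tau,\qquad \lambda_t=0\quad\text{for }t>\tau .$$
   Context: Let $T>0$ and let $(\Omega,\mathcal{F},(\mathcal{F}_t)_{0\le t\le T},\mathbb{Q})$ be a filtered probability space satisfying the usual conditions, carrying a standard $(\mathcal{F}_t)$-Brownian motion $W$. The firm's (normalized) cash balance process is $dX_t=\sigma\,dW_t$, $X_0=x$, normalized to $x=0$ and $\sigma=1$, so $X=W$. Time indices range over $[0,T]$, and $\inf\emptyset=\infty$. Define $g(t):=\sup\{s\le t: X_s=0\}$, with $g(t-)$ its left limit at $t$. For the constant $\alpha>0$ define $$\tau_\alpha:=\inf\Big\{t>0:\ t-g(t)\ge\tfrac{\alpha^2}{2},\ \text{where } X_s<0\text{ for } s\in(g(t-),t)\Big\},$$ the first time that $X$ has been continuously negative for at least $\alpha^2/2$ units of time. The default time is $$\tau:=\inf\{t>\tau_\alpha:\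 X_t=2X_{\tau_\alpha}\}.$$ Define the process $Y$ by $Y_t=X_t$ for $t<\tau_\alpha$ and $Y_t=2X_{\tau_\alpha}-X_t$ for $t\ge\tau_\alpha$. ($Y$ is again an $(\mathcal{F}_t)$-Brownian motion and $\tau=\inf\{t\ge\tau_\alpha: Y_t=0\}$.) Put $\bar g_t:=\sup\{s\le t: Y_s=0\}$, with $\bar g_{t-}$ its left limit at $t$. Let $\operatorname{sign}(x)=1$ if $x>0$ and $\operatorname{sign}(x)=-1$ if $x\le 0$. Set $\tilde{\mathcal{G}}_t:=\sigma\{\operatorname{sign}(Y_s);\ s\le t\}$, and let $(\mathcal{G}_t)_{0\le t\le T}$ be the $\mathbb{Q}$-complete and right-continuous version of $(\tilde{\mathcal{G}}_t)_{0\le t\le T}$ (the market's filtration). The random time $\tau$ is a $\mathcal{G}$-stopping time. *)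

theory Defs
  imports "HOL-Probability.Probability"
begin

text \<open>Processes are functions \<open>real \<Rightarrow> 'a \<Rightarrow> real\<close> and filtrations functions
  \<open>real \<Rightarrow> 'a measure\<close>; only their values at times in \<open>{0..T}\<close> are ever used. Of the measures
  \<open>F t\<close> only the space and the sigma-algebra matter. Random times are \<open>ereal\<close>-valued, so that
  \<open>Inf {} = \<infinity>\<close>.\<close>

section \<open>Filtrations, Brownian motion, martingales\<close>

definition filtration_usual :: "'a measure \<Rightarrow> real \<Rightarrow> (real \<Rightarrow> 'a measure) \<Rightarrow> bool" where
  "filtration_usual M T F \<longleftrightarrow>
     complete_measure M \<and>
     (\<forall>t\<in>{0..T}. subalgebra M (F t)) \<and>
     (\<forall>s\<in>{0..T}. \<forall>t\<in>{0..T}. s \<le> t \<longrightarrow> sets (F s) \<subseteq> sets (F t)) \<and>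
     null_sets M \<subseteq> sets (F 0) \<and>
     (\<forall>t\<in>{0..<T}. sets (F t) = (\<Inter>u\<in>{t<..T}. sets (F u)))"

definition brownian_motion ::
    "'a measure \<Rightarrow> real \<Rightarrow> (real \<Rightarrow> 'a measure) \<Rightarrow> (real \<Rightarrow> 'a \<Rightarrow> real) \<Rightarrow> bool" where
  "brownian_motion M T F W \<longleftrightarrow>
     (\<forall>t\<in>{0..T}. W t \<in> borel_measurable (F t)) \<and>
     (AE \<omega> in M. W 0 \<omega> = 0) \<and>
     (AE \<omega> in M. continuous_on {0..T} (\<lambda>t. W t \<omega>)) \<and>
     (\<forall>s\<in>{0..T}. \<forall>t\<in>{0..T}. s < t \<longrightarrow>
        prob_space.indep_set M (sets (F s))
          (sets (vimage_algebra (space M) (\<lambda>\<omega>. W t \<omega> - W s \<omega>) borel)) \<and>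
        distributed M lborel (\<lambda>\<omega>. W t \<omega> - W s \<omega>) (normal_density 0 (sqrt (t - s))))"

definition martingale_on ::
    "'a measure \<Rightarrow> real \<Rightarrow> (real \<Rightarrow> 'a measure) \<Rightarrow> (real \<Rightarrow> 'a \<Rightarrow> real) \<Rightarrow> bool" where
  "martingale_on M T G Z \<longleftrightarrow>
     (\<forall>t\<in>{0..T}. Z t \<in> borel_measurable (G t) \<and> integrable M (Z t)) \<and>
     (\<forall>s\<in>{0..T}. \<forall>t\<in>{0..T}. s \<le> t \<longrightarrow>
        (AE \<omega> in M. real_cond_exp M (G s) (Z t) \<omega> = Z s \<omega>))"

definition predictable_sigma ::
    "'a measure \<Rightarrow> real \<Rightarrow> (real \<Rightarrow> 'a measure) \<Rightarrow> (real \<times> 'a) measure" where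
  "predictable_sigma M T G = sigma ({0..T} \<times> space M)
     ({{0} \<times> B | B. B \<in> sets (G 0)} \<union>
      {{s<..t} \<times> B | s t B. 0 \<le> s \<and> s < t \<and> t \<le> T \<and> B \<in> sets (G s)})"

definition predictable ::
    "'a measure \<Rightarrow> real \<Rightarrow> (real \<Rightarrow> 'a measure) \<Rightarrow> (real \<Rightarrow> 'a \<Rightarrow> real) \<Rightarrow> bool" where
  "predictable M T G Z \<longleftrightarrow> (\<lambda>(t, \<omega>). Z t \<omega>) \<in> borel_measurable (predictable_sigma M T G)"

definition compensator ::
    "'a measure \<Rightarrow> real \<Rightarrow> (real \<Rightarrow> 'a measure) \<Rightarrow> (real \<Rightarrow> 'a \<Rightarrow> real) \<Rightarrow> (real \<Rightarrow> 'a \<Rightarrow> real) \<Rightarrow> bool"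
  where
  "compensator M T G N A \<longleftrightarrow>
     predictable M T G A \<and>
     (AE \<omega> in M. A 0 \<omega> = 0) \<and>
     (AE \<omega> in M. continuous_on {0..T} (\<lambda>t. A t \<omega>)) \<and>
     (AE \<omega> in M. mono_on {0..T} (\<lambda>t. A t \<omega>)) \<and>
     martingale_on M T G (\<lambda>t \<omega>. N t \<omega> - A t \<omega>)"

section \<open>The default time\<close>

definition last_zero :: "(real \<Rightarrow> 'a \<Rightarrow> real) \<Rightarrow> real \<Rightarrow> 'a \<Rightarrow> real" where
  "last_zero Z t \<omega> = Sup {s\<in>{0..t}. Z s \<omega> = 0}"

definition last_zero_left :: "(real \<Rightarrow> 'a \<Rightarrow> real) \<Rightarrow> real \<Rightarrow> 'a \<Rightarrow> real" where
  "last_zero_left Z t \<omega> = Lim (at_left t) (\<lambda>s. last_zero Z s \<omega>)"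

definition tau_alpha :: "real \<Rightarrow> real \<Rightarrow> (real \<Rightarrow> 'a \<Rightarrow> real) \<Rightarrow> 'a \<Rightarrow> ereal" where
  "tau_alpha \<alpha> T X \<omega> = Inf (ereal ` {t\<in>{0<..T}.
     t - last_zero X t \<omega> \<ge> \<alpha>\<^sup>2 / 2 \<and> (\<forall>s\<in>{last_zero_left X t \<omega><..<t}. X s \<omega> < 0)})"

text \<open>The value of \<open>X\<close> at \<open>tau_alpha\<close>. It is only used where \<open>tau_alpha\<close> is finite: for infinite
  \<open>tau_alpha\<close> it is the meaningless \<open>X 0\<close>, since \<open>real_of_ereal \<infinity> = 0\<close>.\<close>

definition X_tau_alpha :: "real \<Rightarrow> real \<Rightarrow> (real \<Rightarrow> 'a \<Rightarrow> real) \<Rightarrow> 'a \<Rightarrow> real" where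
  "X_tau_alpha \<alpha> T X \<omega> = X (real_of_ereal (tau_alpha \<alpha> T X \<omega>)) \<omega>"

definition default_time :: "real \<Rightarrow> real \<Rightarrow> (real \<Rightarrow> 'a \<Rightarrow> real) \<Rightarrow> 'a \<Rightarrow> ereal" where
  "default_time \<alpha> T X \<omega> =
     Inf (ereal ` {t\<in>{0..T}. ereal t > tau_alpha \<alpha> T X \<omega> \<and> X t \<omega> = 2 * X_tau_alpha \<alpha> T X \<omega>})"

definition default_indicator :: "real \<Rightarrow> real \<Rightarrow> (real \<Rightarrow> 'a \<Rightarrow> real) \<Rightarrow> real \<Rightarrow> 'a \<Rightarrow> real" where
  "default_indicator \<alpha> T X t \<omega> = of_bool (ereal t \<ge> default_time \<alpha> T X \<omega>)"

section \<open>The market's filtration\<close>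

definition Y_process :: "real \<Rightarrow> real \<Rightarrow> (real \<Rightarrow> 'a \<Rightarrow> real) \<Rightarrow> real \<Rightarrow> 'a \<Rightarrow> real" where
  "Y_process \<alpha> T X t \<omega> =
     (if ereal t < tau_alpha \<alpha> T X \<omega> then X t \<omega> else 2 * X_tau_alpha \<alpha> T X \<omega> - X t \<omega>)"

text \<open>Unlike \<^const>\<open>sgn\<close>, this takes the value \<open>-1\<close> at \<open>0\<close>.\<close>

definition sign_left :: "real \<Rightarrow> real" where
  "sign_left x = (if x > 0 then 1 else - 1)"

definition sign_filtration :: "'a measure \<Rightarrow> (real \<Rightarrow> 'a \<Rightarrow> real) \<Rightarrow> real \<Rightarrow> 'a measure" where
  "sign_filtration M Y t = sigma (space M)
     (\<Union>s\<in>{0..t}. {(\<lambda>\<omega>. sign_left (Y s \<omega>)) -` B \<inter> space M | B. B \<in> sets borel})"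

definition completed_filtration :: "'a measure \<Rightarrow> (real \<Rightarrow> 'a measure) \<Rightarrow> real \<Rightarrow> 'a measure" where
  "completed_filtration M H t = sigma (space M) (sets (H t) \<union> null_sets M)"

text \<open>There are no times after \<open>T\<close>, so the right limit is not taken at \<open>T\<close>.\<close>

definition right_cont_filtration ::
    "'a measure \<Rightarrow> real \<Rightarrow> (real \<Rightarrow> 'a measure) \<Rightarrow> real \<Rightarrow> 'a measure" where
  "right_cont_filtration M T H t = sigma (space M)
     (if t < T then (\<Inter>u\<in>{t<..T}. sets (H u)) else sets (H t))"

definition market_filtration ::
    "'a measure \<Rightarrow> real \<Rightarrow> real \<Rightarrow> (real \<Rightarrow> 'a \<Rightarrow> real) \<Rightarrow> real \<Rightarrow> 'a measure" where
  "market_filtration M \<alpha> T X =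
     right_cont_filtration M T (completed_filtration M (sign_filtration M (Y_process \<alpha> T X)))"

section \<open>The intensity\<close>

definition default_intensity :: "real \<Rightarrow> real \<Rightarrow> (real \<Rightarrow> 'a \<Rightarrow> real) \<Rightarrow> real \<Rightarrow> 'a \<Rightarrow> real" where
  "default_intensity \<alpha> T X t \<omega> =
     (if ereal t \<le> default_time \<alpha> T X \<omega>
      then of_bool (ereal t > tau_alpha \<alpha> T X \<omega>) *
             (1 / (2 * (t - last_zero_left (Y_process \<alpha> T X) t \<omega>)))
      else 0)"

end

theory Submission
  imports Defs
begin

text \<open>The signs of \<open>Y\<close> tell how long \<open>Y\<close> has been negative. By reflection and the strong Markov
  property, an excursion that has lasted for the time \<open>u\<close> reaches length \<open>v\<close> with conditional
  probability \<open>sqrt (u / v)\<close>; on the market's filtration this is all that is known about \<open>\<tau>\<close>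
  after \<open>\<tau>\<^sub>\<alpha>\<close>, because there \<open>Y\<close> keeps the sign it had throughout the excursion. The
  logarithmic derivative of the survival probability is the intensity. A candidate with this density
  has, on every short step, the right conditional increment up to a second order error, so that
  it is a compensator; uniqueness of the compensator gives the rest.\<close>

section \<open>The strong Markov property\<close>

text \<open>The start \<open>g = \<sigma> - delay\<close> of the first long excursion is a last exit
  and no stopping time, so the strong Markov property cannot be applied at it. The law of an
  excursion is therefore read off at deterministic times. Seen from a stopping time \<open>D\<close>
  with X = 0 at \<open>D\<close>, being negative on all of [w, v] puts a planar Gaussian vector into
  a sector. The angle of the sector is an arctangent, and its derivative in w is half the arcsine
  density, 1 / (2 pi sqrt ((y - D) (v - y))), for the last zero y before v. Between v = s and v = u
  the factor with \<open>D\<close> cancels and sqrt ((s - y) / (u - y)) remains: this is where the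
  square root comes from. For \<open>D\<close> one takes the first zero after the start of a cell no
  longer than \<open>delay\<close>, and then sums over cells. The age of the excursion is at least
  \<open>delay = \<alpha>\<^sup>2 / 2\<close> from \<sigma> on, so the intensity is bounded by 1 /
  (2 \<open>delay\<close>); this makes the errors of the steps uniformly of second order. Signs do
  not distinguish 0 from negative values, so \<sigma> and \<tau> are recovered from them only up to
  null sets, and completion of the filtration is essential.\<close>

lemma measurable_min_random_time:
  assumes le: "\<And>s. 0 \<le> s \<Longrightarrow> s \<le> t \<Longrightarrow> {\<omega>\<in>space N. \<rho> \<omega> \<le> ereal s} \<in> sets N"
    and nn: "\<And>\<omega>. \<omega> \<in> space N \<Longrightarrow> 0 \<le> \<rho> \<omega>"
  shows "(\<lambda>\<omega>. real_of_ereal (min (ereal t) (\<rho> \<omega>))) \<in> borel_measurable N"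
proof -
  have "(\<lambda>\<omega>. min (ereal t) (\<rho> \<omega>)) \<in> borel_measurable N"
  proof (rule borel_measurableI_le)
    fix y :: ereal
    show "{\<omega>\<in>space N. min (ereal t) (\<rho> \<omega>) \<le> y} \<in> sets N"
    proof (cases "ereal t \<le> y")
      case True
      then have "{\<omega>\<in>space N. min (ereal t) (\<rho> \<omega>) \<le> y} = space N" by (auto simp: min_le_iff_disj)
      then show ?thesis by (simp only: sets.top)
    next
      case False
      then have eq: "{\<omega>\<in>space N. min (ereal t) (\<rho> \<omega>) \<le> y} = {\<omega>\<in>space N. \<rho> \<omega> \<le> y}"
        by (auto simp: min_le_iff_disj)
      show ?thesis
      proof (cases "0 \<le> y")
        case True
        then obtain s where s: "y = ereal s" "0 \<le> s" "s \<le> t" using False by (cases y) auto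
        then show ?thesis using le[of s] unfolding eq unfolding s(1) by blast
      next
        case False
        then have "\<not> \<rho> \<omega> \<le> y" if "\<omega> \<in> space N" for \<omega>
          using nn[OF that] by (meson order_trans)
        then have "{\<omega>\<in>space N. \<rho> \<omega> \<le> y} = {}" by simp
        then show ?thesis by (simp only: eq sets.empty_sets)
      qed
    qed
  qed
  then show ?thesis by measurable
qed

text \<open>Starting value and continuity are required at every point of the space instead of almost
  surely, so that hitting times are attained minima and no null set has to be carried along; a
  version with these properties is constructed in the last section. \<open>incr\<close> merges
  independence of the past and the law of the normalised increment into one product formula, the
  probabilistic fact on which everything else rests.\<close>

locale brownian = prob_space M for M :: "'a measure" +
  fixes T :: real and F :: "real \<Rightarrow> 'a measure" and X :: "real \<Rightarrow> 'a \<Rightarrow> real"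
  assumes T_pos: "0 < T"
    and subalg: "t \<in> {0..T} \<Longrightarrow> subalgebra M (F t)"
    and F_mono: "0 \<le> s \<Longrightarrow> s \<le> t \<Longrightarrow> t \<le> T \<Longrightarrow> sets (F s) \<subseteq> sets (F t)"
    and adapted: "t \<in> {0..T} \<Longrightarrow> X t \<in> borel_measurable (F t)"
    and X_0: "\<omega> \<in> space M \<Longrightarrow> X 0 \<omega> = 0"
    and cont: "\<omega> \<in> space M \<Longrightarrow> continuous_on {0..T} (\<lambda>t. X t \<omega>)"
    and incr: "0 \<le> s \<Longrightarrow> s < t \<Longrightarrow> t \<le> T \<Longrightarrow> E \<in> sets (F s) \<Longrightarrow> S \<in> sets borel \<Longrightarrow>
       prob (E \<inter> {\<omega>\<in>space M. (X t \<omega> - X s \<omega>) / sqrt (t - s) \<in> S}) =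
       prob E * measure std_normal_distribution S"
begin

lemma space_F: "t \<in> {0..T} \<Longrightarrow> space (F t) = space M"
  using subalg by (auto simp: subalgebra_def)

lemma sets_F: "t \<in> {0..T} \<Longrightarrow> E \<in> sets (F t) \<Longrightarrow> E \<in> sets M"
  using subalg by (auto simp: subalgebra_def)

lemma F_monoD: "0 \<le> s \<Longrightarrow> s \<le> t \<Longrightarrow> t \<le> T \<Longrightarrow> E \<in> sets (F s) \<Longrightarrow> E \<in> sets (F t)"
  using F_mono by blast

lemma measurable_F: "t \<in> {0..T} \<Longrightarrow> f \<in> measurable (F t) N \<Longrightarrow> f \<in> measurable M N"
  using measurable_from_subalg subalg by blast

lemma measurable_F_mono:
  assumes "0 \<le> s" "s \<le> t" "t \<le> T" "f \<in> measurable (F s) N"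
  shows "f \<in> measurable (F t) N"
  using assms F_mono[of s t] space_F[of s] space_F[of t]
  by (auto simp: measurable_def)

lemma X_meas [measurable]: "t \<in> {0..T} \<Longrightarrow> X t \<in> borel_measurable M"
  using adapted measurable_F by blast

lemma space_F_in: "t \<in> {0..T} \<Longrightarrow> space M \<in> sets (F t)"
  using space_F sets.top by metis

section \<open>Stopping times with values in the horizon or infinity\<close>

definition stopping :: "('a \<Rightarrow> ereal) \<Rightarrow> bool" where
  "stopping \<sigma> \<longleftrightarrow> (\<forall>t\<in>{0..T}. {\<omega>\<in>space M. \<sigma> \<omega> \<le> ereal t} \<in> sets (F t)) \<and>
     (\<forall>\<omega>\<in>space M. \<sigma> \<omega> = \<infinity> \<or> (\<exists>t\<in>{0..T}. \<sigma> \<omega> = ereal t))"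

text \<open>The sigma-algebra of the past of a stopping time. Membership in \<open>sets M\<close> is
  demanded separately because the traces say nothing about the part where \<sigma> is infinite. The
  generating family is already a sigma-algebra, see \<open>sets_pre\<close>.\<close>

definition pre :: "('a \<Rightarrow> ereal) \<Rightarrow> 'a measure" where
  "pre \<sigma> = sigma (space M)
     {C \<in> sets M. \<forall>t\<in>{0..T}. C \<inter> {\<omega>\<in>space M. \<sigma> \<omega> \<le> ereal t} \<in> sets (F t)}"

text \<open>Where \<sigma> is infinite the value is \<open>X 0\<close>, because
  \<open>real_of_ereal\<close> sends infinity to 0. \<open>stopped_next_zero\<close> relies on this
  default to hold at every point.\<close>

definition stopped :: "('a \<Rightarrow> ereal) \<Rightarrow> 'a \<Rightarrow> real" where
  "stopped \<sigma> \<omega> = X (real_of_ereal (\<sigma> \<omega>)) \<omega>"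

lemma stoppingD: "stopping \<sigma> \<Longrightarrow> t \<in> {0..T} \<Longrightarrow> {\<omega>\<in>space M. \<sigma> \<omega> \<le> ereal t} \<in> sets (F t)"
  by (auto simp: stopping_def)

lemma stopping_cases:
  assumes "stopping \<sigma>" "\<omega> \<in> space M"
  obtains "\<sigma> \<omega> = \<infinity>" | t where "\<sigma> \<omega> = ereal t" "0 \<le> t" "t \<le> T"
  using assms by (auto simp: stopping_def)

lemma stopping_nonneg: "stopping \<sigma> \<Longrightarrow> \<omega> \<in> space M \<Longrightarrow> 0 \<le> \<sigma> \<omega>"
  by (erule (1) stopping_cases) auto

lemma stopping_lessE:
  assumes "stopping \<sigma>" "\<omega> \<in> space M" "\<sigma> \<omega> < ereal t"
  obtains s where "\<sigma> \<omega> = ereal s" "0 \<le> s" "s \<le> T" "s < t"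
proof (cases rule: stopping_cases[OF assms(1,2)])
  case 1 then show ?thesis using assms(3) by simp
next
  case (2 s) then show ?thesis using assms(3) that[of s] by simp
qed

lemma stopping_leE:
  assumes "stopping \<sigma>" "\<omega> \<in> space M" "\<sigma> \<omega> \<le> ereal t"
  obtains s where "\<sigma> \<omega> = ereal s" "0 \<le> s" "s \<le> T" "s \<le> t"
proof (cases rule: stopping_cases[OF assms(1,2)])
  case 1 then show ?thesis using assms(3) by simp
next
  case (2 s) then show ?thesis using assms(3) that[of s] by simp
qed

lemma space_pre [simp]: "space (pre \<sigma>) = space M"
  by (simp add: pre_def space_measure_of_conv)

lemma sets_pre:
  assumes "stopping \<sigma>"
  shows "C \<in> sets (pre \<sigma>) \<longleftrightarrow>
    C \<in> sets M \<and> (\<forall>t\<in>{0..T}. C \<inter> {\<omega>\<in>space M. \<sigma> \<omega> \<le> ereal t} \<in> sets (F t))"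
proof -
  let ?A = "{C \<in> sets M. \<forall>t\<in>{0..T}. C \<inter> {\<omega>\<in>space M. \<sigma> \<omega> \<le> ereal t} \<in> sets (F t)}"
  have "sigma_algebra (space M) ?A"
  proof (rule sigma_algebra_iff2[THEN iffD2], intro conjI ballI allI impI)
    show "?A \<subseteq> Pow (space M)" using sets.sets_into_space by blast
    show "{} \<in> ?A" by auto
    fix C assume C: "C \<in> ?A"
    have "(space M - C) \<inter> {\<omega>\<in>space M. \<sigma> \<omega> \<le> ereal t} =
        {\<omega>\<in>space M. \<sigma> \<omega> \<le> ereal t} - C \<inter> {\<omega>\<in>space M. \<sigma> \<omega> \<le> ereal t}" for t by auto
    then show "space M - C \<in> ?A"
      using C stoppingD[OF assms] by auto
  next
    fix C :: "nat \<Rightarrow> 'a set" assume C: "range C \<subseteq> ?A"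
    have "(\<Union>i. C i) \<inter> {\<omega>\<in>space M. \<sigma> \<omega> \<le> ereal t} \<in> sets (F t)" if "t \<in> {0..T}" for t
    proof -
      have "(\<Union>i. C i \<inter> {\<omega>\<in>space M. \<sigma> \<omega> \<le> ereal t}) \<in> sets (F t)"
        using C that by (intro sets.countable_nat_UN) blast
      then show ?thesis by simp
    qed
    then show "(\<Union>i. C i) \<in> ?A"
      using C by auto
  qed
  then have "sets (pre \<sigma>) = ?A"
    unfolding pre_def by (simp add: sigma_algebra.sets_measure_of_eq)
  then show ?thesis by auto
qed

lemma pre_subalg: "stopping \<sigma> \<Longrightarrow> subalgebra M (pre \<sigma>)"
  using sets_pre by (auto simp: subalgebra_def)

lemma pre_le_in:
  assumes "stopping \<sigma>" "C \<in> sets (pre \<sigma>)" "t \<in> {0..T}"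
  shows "C \<inter> {\<omega>\<in>space M. \<sigma> \<omega> \<le> ereal t} \<in> sets (F t)"
  using assms sets_pre by blast

lemma pre_less_in:
  assumes \<sigma>: "stopping \<sigma>" and C: "C \<in> sets (pre \<sigma>)" and t: "t \<in> {0..T}"
  shows "C \<inter> {\<omega>\<in>space M. \<sigma> \<omega> < ereal t} \<in> sets (F t)"
proof -
  have "C \<inter> {\<omega>\<in>space M. \<sigma> \<omega> < ereal t} =
      (\<Union>n. if t - 1 / Suc n \<ge> 0 then C \<inter> {\<omega>\<in>space M. \<sigma> \<omega> \<le> ereal (t - 1 / Suc n)} else {})" (is "?L = (\<Union>n. ?R n)")
  proof (intro equalityI subsetI)
    fix \<omega> assume w: "\<omega> \<in> ?L"
    then obtain s where s: "\<sigma> \<omega> = ereal s" "0 \<le> s" "s < t"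
      using stopping_lessE[OF \<sigma>, of \<omega> t] by auto
    then obtain n where "inverse (real (Suc n)) < t - s"
      using reals_Archimedean[of "t - s"] by auto
    then have "\<omega> \<in> ?R n" using w s by (auto simp: inverse_eq_divide)
    then show "\<omega> \<in> (\<Union>n. ?R n)" by blast
  next
    fix \<omega> assume "\<omega> \<in> (\<Union>n. ?R n)"
    then obtain n where n: "t - 1 / Suc n \<ge> 0" "\<omega> \<in> C" "\<omega> \<in> space M" "\<sigma> \<omega> \<le> ereal (t - 1 / Suc n)"
      by (auto split: if_splits)
    moreover have "ereal (t - 1 / Suc n) < ereal t" by simp
    ultimately have "\<sigma> \<omega> < ereal t" by (meson le_less_trans)
    then show "\<omega> \<in> ?L" using n by auto
  qed
  also have "\<dots> \<in> sets (F t)"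
  proof (rule sets.countable_nat_UN, clarify)
    fix n
    have "t - 1 / Suc n \<le> t" by simp
    then have "t - 1 / Suc n \<le> T" using t by (meson atLeastAtMost_iff order_trans)
    then show "?R n \<in> sets (F t)"
      using F_monoD[OF _ _ _ pre_le_in[OF \<sigma> C, of "t - 1 / Suc n"], of t] t
      by (auto simp del: of_nat_Suc)
  qed
  finally show ?thesis .
qed

lemma stopping_measurable_pre:
  assumes \<sigma>: "stopping \<sigma>"
  shows "\<sigma> \<in> borel_measurable (pre \<sigma>)"
proof (rule borel_measurableI_le)
  fix y :: ereal
  have le: "{\<omega>\<in>space M. \<sigma> \<omega> \<le> ereal s} \<in> sets (pre \<sigma>)" if s: "s \<in> {0..T}" for s
  proof -
    have "{\<omega>\<in>space M. \<sigma> \<omega> \<le> ereal s} \<inter> {\<omega>\<in>space M. \<sigma> \<omega> \<le> ereal t} = {\<omega>\<in>space M. \<sigma> \<omega> \<le> ereal (min s t)}" for t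
      using min.bounded_iff[of _ "ereal s" "ereal t"] by auto
    moreover have "{\<omega>\<in>space M. \<sigma> \<omega> \<le> ereal (min s t)} \<in> sets (F t)" if "t \<in> {0..T}" for t
      using F_monoD[OF _ _ _ stoppingD[OF \<sigma>, of "min s t"], of t] s that by (simp add: min.coboundedI1)
    ultimately show ?thesis
      using stoppingD[OF \<sigma> s] sets_F[OF s] unfolding sets_pre[OF \<sigma>] by (simp only:) blast
  qed
  consider "y = \<infinity>" | "y < 0" | s where "y = ereal s" "s \<in> {0..T}" | s where "y = ereal s" "T < s"
  proof (cases y)
    case (real s)
    consider "s < 0" | "s \<in> {0..T}" | "T < s" by fastforce
    then show ?thesis using real that(2) that(3,4)[OF real] by cases simp_all
  next
    case PInf then show ?thesis by (rule that(1))
  next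
    case MInf then show ?thesis by (intro that(2)) simp
  qed
  then show "{\<omega>\<in>space (pre \<sigma>). \<sigma> \<omega> \<le> y} \<in> sets (pre \<sigma>)"
  proof cases
    case 1 then show ?thesis using sets.top[of "pre \<sigma>"] by simp
  next
    case 2
    then have "\<not> \<sigma> \<omega> \<le> y" if "\<omega> \<in> space M" for \<omega>
      using stopping_nonneg[OF \<sigma> that] by (meson leD order_trans)
    then have "{\<omega>\<in>space (pre \<sigma>). \<sigma> \<omega> \<le> y} = {}" by simp
    then show ?thesis by (simp only: sets.empty_sets)
  next
    case (3 s) then show ?thesis using le by simp
  next
    case (4 s)
    then have "{\<omega>\<in>space (pre \<sigma>). \<sigma> \<omega> \<le> y} = {\<omega>\<in>space M. \<sigma> \<omega> \<le> ereal T}"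
    proof -
      have "\<sigma> \<omega> \<le> y \<longleftrightarrow> \<sigma> \<omega> \<le> ereal T" if "\<omega> \<in> space M" for \<omega>
        using that 4 by (cases rule: stopping_cases[OF \<sigma> that]) auto
      then show ?thesis by auto
    qed
    then show ?thesis using le[of T] T_pos by simp
  qed
qed

lemma stopping_measurable: "stopping \<sigma> \<Longrightarrow> \<sigma> \<in> borel_measurable M"
  using stopping_measurable_pre pre_subalg measurable_from_subalg by blast

lemma stopping_const:
  assumes "r \<in> {0..T}"
  shows "stopping (\<lambda>_. ereal r)"
  unfolding stopping_def
proof (intro conjI ballI)
  fix t assume "t \<in> {0..T}"
  then show "{\<omega>\<in>space M. ereal r \<le> ereal t} \<in> sets (F t)"
    using space_F_in[of t] by (cases "r \<le> t") auto
qed (use assms in auto)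

lemma pre_const:
  assumes "r \<in> {0..T}" "C \<in> sets (F r)"
  shows "C \<in> sets (pre (\<lambda>_. ereal r))"
  unfolding sets_pre[OF stopping_const[OF assms(1)]]
proof (intro conjI ballI)
  show "C \<in> sets M" using assms sets_F by blast
  then have C: "C \<subseteq> space M" using sets.sets_into_space by blast
  fix t assume t: "t \<in> {0..T}"
  show "C \<inter> {\<omega>\<in>space M. ereal r \<le> ereal t} \<in> sets (F t)"
  proof (cases "r \<le> t")
    case True
    then have "C \<inter> {\<omega>\<in>space M. ereal r \<le> ereal t} = C" using C by auto
    then show ?thesis using F_monoD[of r t C] assms t True by auto
  qed auto
qed

lemma pre_mono:
  assumes \<sigma>: "stopping \<sigma>" and \<rho>: "stopping \<rho>" and le: "\<And>\<omega>. \<omega> \<in> space M \<Longrightarrow> \<sigma> \<omega> \<le> \<rho> \<omega>"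
    and C: "C \<in> sets (pre \<sigma>)"
  shows "C \<in> sets (pre \<rho>)"
  unfolding sets_pre[OF \<rho>]
proof (intro conjI ballI)
  show "C \<in> sets M" using C sets_pre[OF \<sigma>] by auto
  fix t assume t: "t \<in> {0..T}"
  have "C \<inter> {\<omega>\<in>space M. \<rho> \<omega> \<le> ereal t} = (C \<inter> {\<omega>\<in>space M. \<sigma> \<omega> \<le> ereal t}) \<inter> {\<omega>\<in>space M. \<rho> \<omega> \<le> ereal t}"
    using le order_trans by blast
  then show "C \<inter> {\<omega>\<in>space M. \<rho> \<omega> \<le> ereal t} \<in> sets (F t)"
    using pre_le_in[OF \<sigma> C t] stoppingD[OF \<rho> t] by auto
qed

lemma measurable_pre_mono:
  assumes "stopping \<sigma>" "stopping \<rho>" "\<And>\<omega>. \<omega> \<in> space M \<Longrightarrow> \<sigma> \<omega> \<le> \<rho> \<omega>" "f \<in> measurable (pre \<sigma>) N"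
  shows "f \<in> measurable (pre \<rho>) N"
proof (rule measurableI)
  fix A assume "A \<in> sets N"
  then have "f -` A \<inter> space M \<in> sets (pre \<sigma>)" using measurable_sets[OF assms(4)] by simp
  then show "f -` A \<inter> space (pre \<rho>) \<in> sets (pre \<rho>)"
    using pre_mono[OF assms(1,2) assms(3)] by (simp only: space_pre)
qed (use measurable_space[OF assms(4)] in simp)

text \<open>Used with \<open>D = next_zero p\<close> and \<sigma> the start of the danger period
  \<open>tau_alpha\<close>: whether the zero comes first is known at the zero.\<close>

lemma stopping_le_pre:
  assumes \<sigma>: "stopping \<sigma>" and D: "stopping D"
  shows "{\<omega>\<in>space M. D \<omega> < \<sigma> \<omega>} \<in> sets (pre D)"
  unfolding sets_pre[OF D]
proof (intro conjI ballI)
  note [measurable] = stopping_measurable[OF \<sigma>] stopping_measurable[OF D]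
  show "{\<omega>\<in>space M. D \<omega> < \<sigma> \<omega>} \<in> sets M" by measurable
  fix t assume t: "t \<in> {0..T}"
  \<comment> \<open>A rational separates \<open>D\<close> from \<sigma> if \<sigma> is at most t.
    The point t is added for \<sigma> beyond t, where \<open>D = t\<close> would leave no room for a
    rational up to t.\<close>
  let ?Q = "(\<rat> \<inter> {0..t}) \<union> {t}"
  have "{\<omega>\<in>space M. D \<omega> < \<sigma> \<omega>} \<inter> {\<omega>\<in>space M. D \<omega> \<le> ereal t} =
     (\<Union>q\<in>?Q. {\<omega>\<in>space M. D \<omega> \<le> ereal q} - {\<omega>\<in>space M. \<sigma> \<omega> \<le> ereal q})" (is "?L = ?R")
  proof (intro equalityI subsetI)
    fix \<omega> assume w: "\<omega> \<in> ?L"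
    then obtain d where d: "D \<omega> = ereal d" "0 \<le> d" "d \<le> t"
      using stopping_leE[OF D, of \<omega> t] by auto
    show "\<omega> \<in> ?R"
    proof (cases "ereal t < \<sigma> \<omega>")
      case True then show ?thesis using w by (auto simp: not_le)
    next
      case False
      then obtain s where s: "\<sigma> \<omega> = ereal s" "s \<le> t"
        using w by (cases "\<sigma> \<omega>") (auto simp: d)
      then have "d < s" using w d by auto
      then obtain q where q: "q \<in> \<rat>" "d < q" "q < s" using Rats_dense_in_real by blast
      then show ?thesis using w s d by (auto intro!: bexI[of _ q])
    qed
  next
    fix \<omega> assume "\<omega> \<in> ?R"
    then obtain q where q: "q \<in> ?Q" "\<omega> \<in> space M" "D \<omega> \<le> ereal q" "\<not> \<sigma> \<omega> \<le> ereal q" by blast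
    then have "D \<omega> < \<sigma> \<omega>" "q \<le> t" using t by auto
    then show "\<omega> \<in> ?L" using q by (auto intro: order_trans[of _ "ereal q"])
  qed
  also have "\<dots> \<in> sets (F t)"
  proof (rule sets.countable_UN'')
    show "countable ?Q" using countable_rat by (auto intro: countable_subset)
    fix q assume q: "q \<in> ?Q"
    then have "q \<in> {0..T}" "0 \<le> q" "q \<le> t" using t by auto
    then show "{\<omega>\<in>space M. D \<omega> \<le> ereal q} - {\<omega>\<in>space M. \<sigma> \<omega> \<le> ereal q} \<in> sets (F t)"
      using F_monoD[OF _ _ _ stoppingD[OF \<sigma>, of q], of t] F_monoD[OF _ _ _ stoppingD[OF D, of q], of t] t by auto
  qed
  finally show "{\<omega>\<in>space M. D \<omega> < \<sigma> \<omega>} \<inter> {\<omega>\<in>space M. D \<omega> \<le> ereal t} \<in> sets (F t)" .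
qed

text \<open>Rounding the random time down to the grid of mesh 1 / (n + 1) never passes t, so each
  approximation reads X at times known to \<open>F t\<close> only, and path continuity gives the
  limit. The \<open>min t\<close> does not change the rounded time; it only makes every branch of
  the countable case distinction measurable.\<close>

lemma measurable_random_time:
  assumes t: "t \<in> {0..T}" and m: "m \<in> borel_measurable (F t)"
    and bd: "\<And>\<omega>. \<omega> \<in> space M \<Longrightarrow> 0 \<le> m \<omega> \<and> m \<omega> \<le> t"
  shows "(\<lambda>\<omega>. X (m \<omega>) \<omega>) \<in> borel_measurable (F t)"
proof -
  let ?i = "\<lambda>n \<omega>. nat \<lfloor>m \<omega> * real (Suc n)\<rfloor>"
  have Xt: "X (min t (real i / real (Suc n))) \<in> borel_measurable (F t)" for i n
    using t by (intro measurable_F_mono[OF _ _ _ adapted]) auto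
  have i: "?i n \<in> measurable (F t) (count_space UNIV)" for n
    using m by measurable
  have "(\<lambda>\<omega>. X (min t (real (?i n \<omega>) / real (Suc n))) \<omega>) \<in> borel_measurable (F t)" for n
    by (rule measurable_compose_countable[OF Xt i])
  then show ?thesis
  proof (rule borel_measurable_LIMSEQ_real[rotated])
    fix \<omega> assume "\<omega> \<in> space (F t)"
    then have w: "\<omega> \<in> space M" using space_F[OF t] by simp
    have le: "real (?i n \<omega>) / real (Suc n) \<le> m \<omega>" for n
    proof -
      have "0 \<le> \<lfloor>m \<omega> * real (Suc n)\<rfloor>" using bd[OF w] by simp
      then have "real (?i n \<omega>) \<le> m \<omega> * real (Suc n)" by linarith
      then show ?thesis by (subst pos_divide_le_eq) auto
    qed
    have ge: "m \<omega> - 1 / real (Suc n) \<le> real (?i n \<omega>) / real (Suc n)" for n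
    proof -
      have "m \<omega> * real (Suc n) - 1 \<le> real (?i n \<omega>)" by linarith
      then show ?thesis by (subst pos_le_divide_eq) (auto simp: algebra_simps)
    qed
    have lim: "(\<lambda>n. real (?i n \<omega>) / real (Suc n)) \<longlonglongrightarrow> m \<omega>"
    proof (rule tendsto_sandwich[OF always_eventually always_eventually])
      show "(\<lambda>n. m \<omega> - 1 / real (Suc n)) \<longlonglongrightarrow> m \<omega>"
        using tendsto_diff[OF tendsto_const LIMSEQ_inverse_real_of_nat, of "m \<omega>"] by (simp add: inverse_eq_divide)
      show "(\<lambda>n. m \<omega>) \<longlonglongrightarrow> m \<omega>" by simp
    qed (use le ge in blast)+
    have eq: "min t (real (?i n \<omega>) / real (Suc n)) = real (?i n \<omega>) / real (Suc n)" for n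
      using le[of n] bd[OF w] by linarith
    have "(\<lambda>n. X (real (?i n \<omega>) / real (Suc n)) \<omega>) \<longlonglongrightarrow> X (m \<omega>) \<omega>"
    proof (rule continuous_on_tendsto_compose[OF cont[OF w] lim])
      show "m \<omega> \<in> {0..T}" using bd[OF w] t by auto
      show "\<forall>\<^sub>F n in sequentially. real (?i n \<omega>) / real (Suc n) \<in> {0..T}"
        using le bd[OF w] t by (intro always_eventually) (auto intro: order_trans)
    qed
    then show "(\<lambda>n. X (min t (real (?i n \<omega>) / real (Suc n))) \<omega>) \<longlonglongrightarrow> X (m \<omega>) \<omega>"
      by (simp only: eq)
  qed
qed

lemma measurable_stopping_min:
  assumes \<sigma>: "stopping \<sigma>" and t: "t \<in> {0..T}"
  shows "(\<lambda>\<omega>. real_of_ereal (min (ereal t) (\<sigma> \<omega>))) \<in> borel_measurable (F t)"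
proof (rule measurable_min_random_time)
  show "{\<omega>\<in>space (F t). \<sigma> \<omega> \<le> ereal s} \<in> sets (F t)" if "0 \<le> s" "s \<le> t" for s
    using t that unfolding space_F[OF t] by (intro F_monoD[OF _ _ _ stoppingD[OF \<sigma>, of s]]) auto
qed (use stopping_nonneg[OF \<sigma>] space_F[OF t] in simp)

text \<open>On \<sigma> \<le> t the stopped value is X at the bounded time min t \<sigma>, to which
  \<open>measurable_random_time\<close> applies. Off \<sigma> \<le> T it is the default
  \<open>X 0\<close>.\<close>

lemma stopped_measurable_pre:
  assumes \<sigma>: "stopping \<sigma>"
  shows "stopped \<sigma> \<in> borel_measurable (pre \<sigma>)"
proof (rule measurableI)
  fix S :: "real set" assume S: "S \<in> sets borel"
  have le: "{\<omega>\<in>space M. stopped \<sigma> \<omega> \<in> S} \<inter> {\<omega>\<in>space M. \<sigma> \<omega> \<le> ereal t} \<in> sets (F t)" if t: "t \<in> {0..T}" for t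
  proof -
    let ?m = "\<lambda>\<omega>. real_of_ereal (min (ereal t) (\<sigma> \<omega>))"
    have "0 \<le> ?m \<omega> \<and> ?m \<omega> \<le> t" if "\<omega> \<in> space M" for \<omega>
      using that t by (cases rule: stopping_cases[OF \<sigma> that]) (auto simp: min_def)
    from measurable_random_time[OF t measurable_stopping_min[OF \<sigma> t] this]
    have "{\<omega>\<in>space (F t). X (?m \<omega>) \<omega> \<in> S} \<in> sets (F t)"
      using S by measurable
    moreover have "{\<omega>\<in>space M. stopped \<sigma> \<omega> \<in> S} \<inter> {\<omega>\<in>space M. \<sigma> \<omega> \<le> ereal t} =
      {\<omega>\<in>space (F t). X (?m \<omega>) \<omega> \<in> S} \<inter> {\<omega>\<in>space M. \<sigma> \<omega> \<le> ereal t}"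
      using space_F[OF t] by (auto simp: stopped_def min_absorb2)
    ultimately show ?thesis using stoppingD[OF \<sigma> t] by (simp only: sets.Int)
  qed
  have eq: "{\<omega>\<in>space M. stopped \<sigma> \<omega> \<in> S} =
    ({\<omega>\<in>space M. stopped \<sigma> \<omega> \<in> S} \<inter> {\<omega>\<in>space M. \<sigma> \<omega> \<le> ereal T}) \<union>
    ({\<omega>\<in>space M. X 0 \<omega> \<in> S} - {\<omega>\<in>space M. \<sigma> \<omega> \<le> ereal T})" (is "?A = ?B \<union> ?C")
  proof -
    have *: "\<sigma> \<omega> = \<infinity>" if "\<omega> \<in> space M" "\<not> \<sigma> \<omega> \<le> ereal T" for \<omega>
      using that by (cases rule: stopping_cases[OF \<sigma> that(1)]) auto
    show ?thesis
    proof (rule set_eqI)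
      fix \<omega>
      show "\<omega> \<in> ?A \<longleftrightarrow> \<omega> \<in> ?B \<union> ?C"
      proof (cases "\<omega> \<in> space M \<and> \<not> \<sigma> \<omega> \<le> ereal T")
        case True
        then have "\<sigma> \<omega> = \<infinity>" using * by blast
        then show ?thesis using True by (simp add: stopped_def)
      next
        case False
        then show ?thesis by simp blast
      qed
    qed
  qed
  have T: "T \<in> {0..T}" "0 \<in> {0..T}" using T_pos by auto
  moreover have "?B \<in> sets M" by (rule sets_F[OF T(1) le[OF T(1)]])
  moreover have "{\<omega>\<in>space M. X 0 \<omega> \<in> S} \<in> sets M" using X_meas[OF T(2)] S by measurable
  moreover have "{\<omega>\<in>space M. \<sigma> \<omega> \<le> ereal T} \<in> sets M"
    by (rule sets_F[OF T(1) stoppingD[OF \<sigma> T(1)]])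
  ultimately have "?A \<in> sets M" by (subst eq) (intro sets.Un sets.Diff)
  moreover have "stopped \<sigma> -` S \<inter> space (pre \<sigma>) = ?A" by auto
  ultimately show "stopped \<sigma> -` S \<inter> space (pre \<sigma>) \<in> sets (pre \<sigma>)"
    using le by (simp add: sets_pre[OF \<sigma>])
qed simp

lemma stopped_measurable: "stopping \<sigma> \<Longrightarrow> stopped \<sigma> \<in> borel_measurable M"
  using stopped_measurable_pre pre_subalg measurable_from_subalg by blast

text \<open>The increment runs to a fixed time w rather than over a fixed span after \<sigma>, so
  that nothing beyond T is read. Division by the random standard deviation makes it standard normal
  given the past of \<sigma>, on \<sigma> < w.\<close>

definition incr_after :: "('a \<Rightarrow> ereal) \<Rightarrow> real \<Rightarrow> 'a \<Rightarrow> real" where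
  "incr_after \<sigma> w \<omega> = (X w \<omega> - stopped \<sigma> \<omega>) / sqrt (w - real_of_ereal (\<sigma> \<omega>))"

lemma incr_after_measurable:
  assumes "stopping \<sigma>" "w \<in> {0..T}"
  shows "incr_after \<sigma> w \<in> borel_measurable M"
proof -
  note [measurable] = stopped_measurable[OF assms(1)] stopping_measurable[OF assms(1)] X_meas[OF assms(2)]
  show ?thesis unfolding incr_after_def by measurable
qed

text \<open>On an open set the indicator is lower semicontinuous, so the inequality survives the
  approximation of \<open>\<sigma>\<close> from above by stopping times with finitely many values.\<close>

lemma strong_markov_open:
  assumes \<sigma>: "stopping \<sigma>" and w: "w \<in> {0..T}" and C: "C \<in> sets (pre \<sigma>)" and U: "open U"
  shows "prob (C \<inter> {\<omega>\<in>space M. \<sigma> \<omega> < ereal w \<and> incr_after \<sigma> w \<omega> \<in> U}) \<le>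
    prob (C \<inter> {\<omega>\<in>space M. \<sigma> \<omega> < ereal w}) * measure std_normal_distribution U"
proof (cases "w = 0")
  case True
  then have "{\<omega>\<in>space M. \<sigma> \<omega> < ereal w} = {}"
    using stopping_nonneg[OF \<sigma>] by (auto simp: not_less zero_ereal_def)
  then have "C \<inter> {\<omega>\<in>space M. \<sigma> \<omega> < ereal w \<and> incr_after \<sigma> w \<omega> \<in> U} = {}" by blast
  then show ?thesis by (simp add: measure_nonneg)
next
  case False
  then have w0: "0 < w" using w by auto
  note [measurable] = stopped_measurable[OF \<sigma>] stopping_measurable[OF \<sigma>] incr_after_measurable[OF \<sigma> w] X_meas[OF w]
  have CM: "C \<in> sets M" using C sets_pre[OF \<sigma>] by blast
  have UB: "U \<in> sets borel" using U by simp
  \<comment> \<open>[0, w) is cut into n + 1 cells; on \<open>E n k\<close> the time \<sigma> lies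
    in the k-th cell and is replaced by its right end \<open>t n k\<close>. The cell k = n is left
    out throughout because its right end is w itself, where the increment could not be
    normalised.\<close>
  define t where "t = (\<lambda>n k. w * real (Suc k) / real (Suc n))"
  define E where "E = (\<lambda>n k. C \<inter> {\<omega>\<in>space M. \<sigma> \<omega> < ereal (t n k)} - {\<omega>\<in>space M. \<sigma> \<omega> < ereal (w * real k / real (Suc n))})"
  define H where "H = (\<lambda>n k. E n k \<inter> {\<omega>\<in>space M. (X w \<omega> - X (t n k) \<omega>) / sqrt (w - t n k) \<in> U})"
  have t: "0 < t n k" "t n k < w" if "k < n" for n k
  proof -
    show "0 < t n k" using w0 by (simp add: t_def)
    have "real (Suc k) < real (Suc n)" using that by simp
    then show "t n k < w" using w0 unfolding t_def by (subst pos_divide_less_eq) auto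
  qed
  have E: "E n k \<in> sets (F (t n k))" if "k < n" for n k
  proof -
    have 1: "C \<inter> {\<omega>\<in>space M. \<sigma> \<omega> < ereal (t n k)} \<in> sets (F (t n k))"
      using t[OF that] w by (intro pre_less_in[OF \<sigma> C]) auto
    have s: "0 \<le> w * real k / real (Suc n)" "w * real k / real (Suc n) \<le> t n k"
      using w0 by (auto simp: t_def intro!: divide_right_mono mult_left_mono)
    have "C \<inter> {\<omega>\<in>space M. \<sigma> \<omega> < ereal (w * real k / real (Suc n))} \<in> sets (F (t n k))"
      using t[OF that] w s by (intro F_monoD[OF s _ pre_less_in[OF \<sigma> C]]) auto
    moreover have "E n k = C \<inter> {\<omega>\<in>space M. \<sigma> \<omega> < ereal (t n k)} - C \<inter> {\<omega>\<in>space M. \<sigma> \<omega> < ereal (w * real k / real (Suc n))}"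
      by (auto simp: E_def)
    ultimately show ?thesis using 1 by (simp only: sets.Diff)
  qed
  have EM: "E n k \<in> sets M" for n k using CM unfolding E_def by measurable
  have HM: "H n k \<in> sets M" if "k < n" for n k
  proof -
    have [measurable]: "X (t n k) \<in> borel_measurable M" using t[OF that] w by (intro X_meas) auto
    show ?thesis using EM UB unfolding H_def by measurable
  qed
  have disj: "disjoint_family_on (E n) {..<n}" for n
    unfolding disjoint_family_on_def
  proof (intro ballI impI)
    have *: "E n i \<inter> E n j = {}" if "i < j" for i j
    proof -
      have "t n i \<le> w * real j / real (Suc n)"
        using that w0 unfolding t_def by (intro divide_right_mono mult_left_mono) auto
      then have "ereal (t n i) \<le> ereal (w * real j / real (Suc n))" by simp
      then have "\<sigma> \<omega> < ereal (t n i) \<Longrightarrow> \<sigma> \<omega> < ereal (w * real j / real (Suc n))" for \<omega>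
        by (rule less_le_trans[rotated])
      then show ?thesis unfolding E_def by blast
    qed
    fix i j :: nat assume "i \<noteq> j"
    then show "E n i \<inter> E n j = {}" using *[of i j] *[of j i] by (cases "i < j") auto
  qed
  have "prob (\<Union>k\<in>{..<n}. H n k) \<le> prob (C \<inter> {\<omega>\<in>space M. \<sigma> \<omega> < ereal w}) * measure std_normal_distribution U" (is "_ \<le> ?c") for n
  proof -
    have "disjoint_family_on (H n) {..<n}"
      using disj[of n] by (auto simp: disjoint_family_on_def H_def)
    then have "prob (\<Union>k\<in>{..<n}. H n k) = (\<Sum>k<n. prob (H n k))"
      using HM by (intro finite_measure_finite_Union) auto
    also have "\<dots> = (\<Sum>k<n. prob (E n k) * measure std_normal_distribution U)"
    proof (rule sum.cong)
      fix k assume "k \<in> {..<n}"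
      then have k: "k < n" by simp
      show "prob (H n k) = prob (E n k) * measure std_normal_distribution U"
        unfolding H_def using t[OF k] w by (intro incr[OF _ _ _ E[OF k] UB]) auto
    qed simp
    also have "\<dots> = prob (\<Union>k\<in>{..<n}. E n k) * measure std_normal_distribution U"
      using disj[of n] EM by (subst finite_measure_finite_Union) (auto simp: sum_distrib_right)
    also have "\<dots> \<le> ?c"
    proof (intro mult_right_mono finite_measure_mono)
      show "(\<Union>k\<in>{..<n}. E n k) \<subseteq> C \<inter> {\<omega>\<in>space M. \<sigma> \<omega> < ereal w}"
      proof (rule UN_least)
        fix k assume "k \<in> {..<n}"
        then have "ereal (t n k) \<le> ereal w" using t(2)[of k n] by simp
        then show "E n k \<subseteq> C \<inter> {\<omega>\<in>space M. \<sigma> \<omega> < ereal w}"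
          unfolding E_def using less_le_trans[of _ "ereal (t n k)" "ereal w"] by blast
      qed
    qed (use CM in \<open>auto simp: measure_nonneg\<close>)
    finally show ?thesis .
  qed
  note bd = this
  \<comment> \<open>The union of the \<open>B m\<close> is the lower limit of the approximating
    events, so the bound passes to it as in Fatou's lemma. A point of the target event belongs to it
    because U is open.\<close>
  define B where "B = (\<lambda>m. \<Inter>n\<in>{m..}. \<Union>k\<in>{..<n}. H n k)"
  have BM: "B m \<in> sets M" for m
    unfolding B_def using HM by (intro sets.countable_INT') auto
  have inc: "incseq B"
    unfolding B_def by (intro monoI INT_anti_mono) auto
  have "(\<lambda>m. prob (B m)) \<longlonglongrightarrow> prob (\<Union>m. B m)"
    using BM inc by (intro finite_Lim_measure_incseq) auto
  moreover have "prob (B m) \<le> ?c" for m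
  proof -
    have "prob (B m) \<le> prob (\<Union>k\<in>{..<m}. H m k)"
      using HM by (intro finite_measure_mono) (auto simp: B_def)
    then show ?thesis using bd[of m] by linarith
  qed
  ultimately have le: "prob (\<Union>m. B m) \<le> ?c"
    by (meson LIMSEQ_le_const2)
  have "C \<inter> {\<omega>\<in>space M. \<sigma> \<omega> < ereal w \<and> incr_after \<sigma> w \<omega> \<in> U} \<subseteq> (\<Union>m. B m)"
  proof
    fix \<omega> assume "\<omega> \<in> C \<inter> {\<omega>\<in>space M. \<sigma> \<omega> < ereal w \<and> incr_after \<sigma> w \<omega> \<in> U}"
    then have om: "\<omega> \<in> C" "\<omega> \<in> space M" "\<sigma> \<omega> < ereal w" "incr_after \<sigma> w \<omega> \<in> U" by auto
    obtain s where s: "\<sigma> \<omega> = ereal s" "0 \<le> s" "s < w"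
      using stopping_lessE[OF \<sigma> om(2,3)] by metis
    define k where "k = (\<lambda>n. nat \<lfloor>s * real (Suc n) / w\<rfloor>)"
    have k1: "w * real (k n) / real (Suc n) \<le> s" for n
    proof -
      have "0 \<le> s * real (Suc n) / w" using s w0 by simp
      then have "real (k n) \<le> s * real (Suc n) / w" unfolding k_def by linarith
      then have "w * real (k n) \<le> s * real (Suc n)" using w0 by (simp add: pos_le_divide_eq mult.commute)
      then show ?thesis by (subst pos_divide_le_eq) auto
    qed
    have k2: "s < t n (k n)" for n
    proof -
      have "s * real (Suc n) / w < real (Suc (k n))" unfolding k_def by linarith
      then have "s * real (Suc n) < w * real (Suc (k n))" using w0 by (simp add: pos_divide_less_eq mult.commute)
      then show ?thesis unfolding t_def by (subst pos_less_divide_eq) auto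
    qed
    have k3: "t n (k n) \<le> s + w * inverse (real (Suc n))" for n
    proof -
      have "t n (k n) = w * real (k n) / real (Suc n) + w * inverse (real (Suc n))"
        unfolding t_def divide_inverse by (simp only: of_nat_Suc[of "k n"] ring_distribs mult_1_right)
      then show ?thesis using k1[of n] by linarith
    qed
    have lim: "(\<lambda>n. t n (k n)) \<longlonglongrightarrow> s"
    proof (rule tendsto_sandwich[OF always_eventually always_eventually])
      show "(\<lambda>n. s) \<longlonglongrightarrow> s" by simp
      show "(\<lambda>n. s + w * inverse (real (Suc n))) \<longlonglongrightarrow> s"
        using tendsto_add[OF tendsto_const tendsto_mult[OF tendsto_const LIMSEQ_inverse_real_of_nat], of s w] by simp
    qed (use k2[THEN less_imp_le] k3 in blast)+
    have ev: "\<forall>\<^sub>F n in sequentially. t n (k n) < w"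
      using order_tendstoD(2)[OF lim s(3)] .
    have "(\<lambda>n. X (t n (k n)) \<omega>) \<longlonglongrightarrow> X s \<omega>"
    proof (rule continuous_on_tendsto_compose[OF cont[OF om(2)] lim])
      show "s \<in> {0..T}" using s w by auto
      show "\<forall>\<^sub>F n in sequentially. t n (k n) \<in> {0..T}"
        using ev
      proof eventually_elim
        case (elim n)
        then show ?case using k2[of n] s w by auto
      qed
    qed
    then have "(\<lambda>n. (X w \<omega> - X (t n (k n)) \<omega>) / sqrt (w - t n (k n))) \<longlonglongrightarrow> (X w \<omega> - X s \<omega>) / sqrt (w - s)"
      using s by (intro tendsto_intros lim) auto
    then have "\<forall>\<^sub>F n in sequentially. (X w \<omega> - X (t n (k n)) \<omega>) / sqrt (w - t n (k n)) \<in> U"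
      using U om(4) by (intro topological_tendstoD) (auto simp: incr_after_def stopped_def s)
    with ev have "\<forall>\<^sub>F n in sequentially. \<omega> \<in> (\<Union>k\<in>{..<n}. H n k)"
    proof eventually_elim
      case (elim n)
      have "k n < n"
      proof (rule ccontr)
        assume "\<not> k n < n"
        then have "w * real (Suc n) \<le> w * real (Suc (k n))" using w0 by (intro mult_left_mono) auto
        then have "w \<le> t n (k n)" unfolding t_def by (subst pos_le_divide_eq) auto
        then show False using elim by simp
      qed
      moreover have "\<omega> \<in> H n (k n)"
        unfolding H_def E_def using om elim k1[of n] k2[of n] by (auto simp: s not_less)
      ultimately show ?case by blast
    qed
    then obtain m where "\<forall>n\<ge>m. \<omega> \<in> (\<Union>k\<in>{..<n}. H n k)" unfolding eventually_sequentially by blast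
    then have "\<omega> \<in> B m" unfolding B_def by blast
    then show "\<omega> \<in> (\<Union>m. B m)" by blast
  qed
  then have "prob (C \<inter> {\<omega>\<in>space M. \<sigma> \<omega> < ereal w \<and> incr_after \<sigma> w \<omega> \<in> U}) \<le> prob (\<Union>m. B m)"
    using BM by (intro finite_measure_mono) auto
  with le show ?thesis by linarith
qed

end

lemma emeasure_std_normal: "emeasure std_normal_distribution S = ennreal (measure std_normal_distribution S)"
proof -
  interpret N: real_distribution std_normal_distribution by (rule real_dist_normal_dist)
  show ?thesis by (rule N.emeasure_eq_measure)
qed

context brownian
begin

text \<open>Outer regularity of the normal law carries the inequality from open to Borel sets.
  Applied to S and to its complement, the two inequalities add up to an equality of totals, so both
  are equalities.\<close>

lemma strong_markov_set:
  assumes \<sigma>: "stopping \<sigma>" and w: "w \<in> {0..T}" and C: "C \<in> sets (pre \<sigma>)" and S: "S \<in> sets borel"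
  shows "prob (C \<inter> {\<omega>\<in>space M. \<sigma> \<omega> < ereal w \<and> incr_after \<sigma> w \<omega> \<in> S}) =
    prob (C \<inter> {\<omega>\<in>space M. \<sigma> \<omega> < ereal w}) * measure std_normal_distribution S"
proof -
  interpret N: real_distribution std_normal_distribution by (rule real_dist_normal_dist)
  note [measurable] = stopping_measurable[OF \<sigma>] incr_after_measurable[OF \<sigma> w]
  have CM: "C \<in> sets M" using C sets_pre[OF \<sigma>] by blast
  define p where "p = prob (C \<inter> {\<omega>\<in>space M. \<sigma> \<omega> < ereal w})"
  define \<mu> where "\<mu> = (\<lambda>S. prob (C \<inter> {\<omega>\<in>space M. \<sigma> \<omega> < ereal w \<and> incr_after \<sigma> w \<omega> \<in> S}))"
  have SM: "C \<inter> {\<omega>\<in>space M. \<sigma> \<omega> < ereal w \<and> incr_after \<sigma> w \<omega> \<in> S} \<in> sets M" if "S \<in> sets borel" for S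
    using that CM by measurable
  have le: "\<mu> S \<le> p * N.prob S" if S: "S \<in> sets borel" for S
  proof (rule field_le_epsilon)
    fix e :: real assume e: "0 < e"
    have "emeasure std_normal_distribution S < ennreal (N.prob S + e)"
      using e by (simp add: emeasure_std_normal ennreal_less_iff measure_nonneg)
    moreover have "emeasure std_normal_distribution S = (INF U\<in>{U. S \<subseteq> U \<and> open U}. emeasure std_normal_distribution U)"
      using S by (intro outer_regular) auto
    ultimately obtain U where U: "S \<subseteq> U" "open U" "emeasure std_normal_distribution U < ennreal (N.prob S + e)"
      by (auto simp: INF_less_iff)
    then have "N.prob U < N.prob S + e"
      by (simp add: emeasure_std_normal ennreal_less_iff measure_nonneg)
    have "\<mu> S \<le> \<mu> U"
      unfolding \<mu>_def using U(1,2) SM[of U] by (intro finite_measure_mono) auto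
    also have "\<dots> \<le> p * N.prob U"
      unfolding \<mu>_def p_def by (rule strong_markov_open[OF \<sigma> w C U(2)])
    also have "\<dots> \<le> p * (N.prob S + e)"
      using \<open>N.prob U < N.prob S + e\<close> by (intro mult_left_mono) (auto simp: p_def measure_nonneg)
    also have "\<dots> \<le> p * N.prob S + e"
      using e mult_right_mono[of p 1 e] by (simp add: p_def algebra_simps)
    finally show "\<mu> S \<le> p * N.prob S + e" .
  qed
  have "\<mu> S + \<mu> (- S) = p"
  proof -
    have "\<mu> S + \<mu> (- S) = prob ((C \<inter> {\<omega>\<in>space M. \<sigma> \<omega> < ereal w \<and> incr_after \<sigma> w \<omega> \<in> S}) \<union>
        (C \<inter> {\<omega>\<in>space M. \<sigma> \<omega> < ereal w \<and> incr_after \<sigma> w \<omega> \<in> - S}))"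
      unfolding \<mu>_def using SM[OF S] SM[of "- S"] S borel_comp[OF S]
      by (intro finite_measure_Union[symmetric]) auto
    also have "\<dots> = p" unfolding p_def by (rule arg_cong[where f=prob]) auto
    finally show ?thesis .
  qed
  moreover have "p * N.prob (- S) = p - p * N.prob S"
    using N.prob_compl[of S] S by (simp add: Compl_eq_Diff_UNIV right_diff_distrib)
  ultimately have "\<mu> S = p * N.prob S"
    using le[OF S] le[OF borel_comp[OF S]] by linarith
  then show ?thesis by (simp add: \<mu>_def p_def)
qed

lemma stopping_less_pre:
  assumes "stopping \<sigma>"
  shows "{\<omega>\<in>space M. \<sigma> \<omega> < y} \<in> sets (pre \<sigma>)"
proof -
  note [measurable] = stopping_measurable_pre[OF assms]
  have "{\<omega>\<in>space (pre \<sigma>). \<sigma> \<omega> < y} \<in> sets (pre \<sigma>)" by measurable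
  then show ?thesis by simp
qed

text \<open>On \<sigma> < w the pair of the point and the normalised increment has a product law on
  \<open>pre \<sigma>\<close> times the normal distribution. Keeping the whole point as first
  coordinate lets h use any information from the past of \<sigma>.\<close>

lemma strong_markov:
  assumes \<sigma>: "stopping \<sigma>" and w: "w \<in> {0..T}" and h: "h \<in> borel_measurable (pre \<sigma> \<Otimes>\<^sub>M borel)"
  shows "(\<integral>\<^sup>+\<omega>. indicator {\<omega>\<in>space M. \<sigma> \<omega> < ereal w} \<omega> * h (\<omega>, incr_after \<sigma> w \<omega>) \<partial>M) =
    (\<integral>\<^sup>+\<omega>. indicator {\<omega>\<in>space M. \<sigma> \<omega> < ereal w} \<omega> * (\<integral>\<^sup>+z. h (\<omega>, z) \<partial>std_normal_distribution) \<partial>M)"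
proof -
  interpret N: real_distribution std_normal_distribution by (rule real_dist_normal_dist)
  let ?A = "{\<omega>\<in>space M. \<sigma> \<omega> < ereal w}"
  have A: "?A \<in> sets M"
    using stopping_less_pre[OF \<sigma>] sets_pre[OF \<sigma>] by blast
  have id: "(\<lambda>\<omega>. \<omega>) \<in> measurable M (pre \<sigma>)"
    using pre_subalg[OF \<sigma>] by (auto simp: measurable_def subalgebra_def)
  note [measurable] = incr_after_measurable[OF \<sigma> w] A id
  have pair[measurable]: "(\<lambda>\<omega>. (\<omega>, incr_after \<sigma> w \<omega>)) \<in> measurable M (pre \<sigma> \<Otimes>\<^sub>M borel)"
    by measurable
  \<comment> \<open>M restricted to \<sigma> < w, the event on which the increment is standard
    normal; it is a finite measure of mass possibly below 1.\<close>
  define Q where "Q = density M (indicator ?A)"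
  have Q: "sets Q = sets M" "space Q = space M" by (simp_all add: Q_def)
  have Qm: "emeasure Q B = emeasure M (?A \<inter> B)" if "B \<in> sets M" for B
    unfolding Q_def using that A by (simp add: emeasure_density flip: indicator_inter_arith)
  have mQ: "measurable Q N' = measurable M N'" for N' :: "'b measure" by (rule measurable_cong_sets) (simp_all add: Q)
  have mQ2: "measurable Q N' = measurable M N'" for N' :: "('a \<times> real) measure" by (rule measurable_cong_sets) (simp_all add: Q)
  have mQ1: "measurable Q N' = measurable M N'" for N' :: "'a measure" by (rule measurable_cong_sets) (simp_all add: Q)
  define P where "P = distr Q (pre \<sigma>) (\<lambda>\<omega>. \<omega>)"
  have "finite_measure Q"
    by (rule finite_measureI) (use Qm[of "space M"] in \<open>simp add: Q emeasure_eq_measure\<close>)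
  then interpret P: finite_measure P
    unfolding P_def using id by (intro finite_measure.finite_measure_distr) (simp_all add: mQ1)
  have eq: "P \<Otimes>\<^sub>M std_normal_distribution = distr Q (pre \<sigma> \<Otimes>\<^sub>M borel) (\<lambda>\<omega>. (\<omega>, incr_after \<sigma> w \<omega>))"
  proof (rule pair_measure_eqI)
    show "sigma_finite_measure P" by unfold_locales
    show "sigma_finite_measure std_normal_distribution" by unfold_locales
    show "sets (P \<Otimes>\<^sub>M std_normal_distribution) = sets (distr Q (pre \<sigma> \<Otimes>\<^sub>M borel) (\<lambda>\<omega>. (\<omega>, incr_after \<sigma> w \<omega>)))"
      unfolding P_def sets_distr by (rule sets_pair_measure_cong) simp_all
    fix C S assume "C \<in> sets P" "S \<in> sets std_normal_distribution"
    then have C: "C \<in> sets (pre \<sigma>)" and S: "S \<in> sets borel" by (simp_all add: P_def)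
    then have CM: "C \<in> sets M" using sets_pre[OF \<sigma>] by blast
    have sub: "C \<subseteq> space M" using CM sets.sets_into_space by blast
    have "emeasure P C = emeasure M (?A \<inter> C)"
      using C CM sub Qm[OF CM] by (simp add: P_def emeasure_distr mQ1 id Q Int_absorb2)
    then have 1: "emeasure P C = ennreal (prob (C \<inter> ?A))" by (simp add: emeasure_eq_measure Int_commute)
    have pre: "(\<lambda>\<omega>. (\<omega>, incr_after \<sigma> w \<omega>)) -` (C \<times> S) \<inter> space Q = C \<inter> {\<omega>\<in>space M. incr_after \<sigma> w \<omega> \<in> S}"
      using sub by (auto simp: Q)
    have "C \<inter> {\<omega>\<in>space M. incr_after \<sigma> w \<omega> \<in> S} \<in> sets M" using CM S by measurable
    then have "emeasure (distr Q (pre \<sigma> \<Otimes>\<^sub>M borel) (\<lambda>\<omega>. (\<omega>, incr_after \<sigma> w \<omega>))) (C \<times> S) =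
        emeasure M (?A \<inter> (C \<inter> {\<omega>\<in>space M. incr_after \<sigma> w \<omega> \<in> S}))"
      using C S pair pre Qm by (simp add: emeasure_distr mQ2)
    also have "?A \<inter> (C \<inter> {\<omega>\<in>space M. incr_after \<sigma> w \<omega> \<in> S}) = C \<inter> {\<omega>\<in>space M. \<sigma> \<omega> < ereal w \<and> incr_after \<sigma> w \<omega> \<in> S}"
      by auto
    finally show "emeasure P C * emeasure std_normal_distribution S =
        emeasure (distr Q (pre \<sigma> \<Otimes>\<^sub>M borel) (\<lambda>\<omega>. (\<omega>, incr_after \<sigma> w \<omega>))) (C \<times> S)"
      unfolding 1 emeasure_std_normal
      by (simp add: emeasure_eq_measure strong_markov_set[OF \<sigma> w C S] ennreal_mult measure_nonneg)
  qed
  have h': "h \<in> borel_measurable (P \<Otimes>\<^sub>M std_normal_distribution)"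
    unfolding eq using h by simp
  have "(\<lambda>\<omega>. \<integral>\<^sup>+z. h (\<omega>, z) \<partial>std_normal_distribution) \<in> borel_measurable P"
    by (rule N.borel_measurable_nn_integral_fst[OF h'])
  then have inner: "(\<lambda>\<omega>. \<integral>\<^sup>+z. h (\<omega>, z) \<partial>std_normal_distribution) \<in> borel_measurable (pre \<sigma>)"
    by (simp add: P_def)
  have "(\<integral>\<^sup>+\<omega>. indicator ?A \<omega> * h (\<omega>, incr_after \<sigma> w \<omega>) \<partial>M) = (\<integral>\<^sup>+\<omega>. h (\<omega>, incr_after \<sigma> w \<omega>) \<partial>Q)"
    unfolding Q_def using h pair by (subst nn_integral_density) (auto intro: measurable_compose)
  also have "\<dots> = (\<integral>\<^sup>+x. h x \<partial>(P \<Otimes>\<^sub>M std_normal_distribution))"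
    unfolding eq using h pair by (subst nn_integral_distr) (auto simp: mQ2)
  also have "\<dots> = (\<integral>\<^sup>+\<omega>. \<integral>\<^sup>+z. h (\<omega>, z) \<partial>std_normal_distribution \<partial>P)"
    using N.nn_integral_fst[OF h'] by simp
  also have "\<dots> = (\<integral>\<^sup>+\<omega>. \<integral>\<^sup>+z. h (\<omega>, z) \<partial>std_normal_distribution \<partial>Q)"
    unfolding P_def using id inner by (subst nn_integral_distr) (simp_all add: mQ1)
  also have "\<dots> = (\<integral>\<^sup>+\<omega>. indicator ?A \<omega> * (\<integral>\<^sup>+z. h (\<omega>, z) \<partial>std_normal_distribution) \<partial>M)"
    unfolding Q_def
    using A measurable_from_subalg[OF pre_subalg[OF \<sigma>] inner] by (subst nn_integral_density) auto
  finally show ?thesis .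
qed

end

section \<open>Hitting times and reflection\<close>

lemma Inf_ereal_compact:
  fixes S :: "real set"
  assumes "compact S" "S \<noteq> {}"
  obtains s where "s \<in> S" "Inf (ereal ` S) = ereal s" "\<And>t. t \<in> S \<Longrightarrow> s \<le> t"
proof -
  obtain s where s: "s \<in> S" "\<And>t. t \<in> S \<Longrightarrow> s \<le> t"
    using compact_attains_inf[OF assms] by blast
  then have "Inf (ereal ` S) = ereal s"
    by (intro cInf_eq_minimum) auto
  with s that show thesis by blast
qed

lemma std_normal_singleton: "emeasure std_normal_distribution {x} = 0"
proof -
  have "emeasure std_normal_distribution {x} = (\<integral>\<^sup>+z. ennreal (std_normal_density z) * indicator {x} z \<partial>lborel)"
    by (subst emeasure_density) auto
  also have "\<dots> = (\<integral>\<^sup>+z. 0 \<partial>(lborel :: real measure))"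
    using AE_lborel_singleton[of x] by (intro nn_integral_cong_AE) (auto elim!: eventually_mono)
  finally show ?thesis by simp
qed

lemma std_normal_half:
  assumes "0 \<le> c" "s = 1 \<or> s = - 1"
  shows "2 * emeasure std_normal_distribution {z. c < s * z} = emeasure std_normal_distribution {z. c < \<bar>z\<bar>}"
proof -
  have "emeasure std_normal_distribution {z. c < - z} = emeasure std_normal_distribution {z. c < z}"
  proof -
    have "emeasure std_normal_distribution {z. c < - z} = (\<integral>\<^sup>+z. ennreal (std_normal_density z) * indicator {z. c < - z} z \<partial>lborel)"
      by (subst emeasure_density) auto
    also have "\<dots> = (\<integral>\<^sup>+z. ennreal (std_normal_density (- z)) * indicator {z. c < - z} (- z) \<partial>lborel)"
      by (subst nn_integral_real_affine[where c="-1" and t=0]) auto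
    also have "\<dots> = (\<integral>\<^sup>+z. ennreal (std_normal_density z) * indicator {z. c < z} z \<partial>lborel)"
      by (intro nn_integral_cong) (auto simp: normal_density_def indicator_def)
    also have "\<dots> = emeasure std_normal_distribution {z. c < z}"
      by (subst emeasure_density) auto
    finally show ?thesis .
  qed
  then have "emeasure std_normal_distribution {z. c < s * z} = emeasure std_normal_distribution {z. c < z}"
    "emeasure std_normal_distribution {z. c < - z} = emeasure std_normal_distribution {z. c < z}"
    using assms(2) by auto
  moreover have "emeasure std_normal_distribution {z. c < \<bar>z\<bar>} =
      emeasure std_normal_distribution {z. c < z} + emeasure std_normal_distribution {z. c < - z}"
  proof (subst plus_emeasure)
    show "{z. c < z} \<inter> {z. c < - z} = {}" using assms(1) by auto
    show "emeasure std_normal_distribution {z. c < \<bar>z\<bar>} = emeasure std_normal_distribution ({z. c < z} \<union> {z. c < - z})"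
      by (rule arg_cong[where f="emeasure std_normal_distribution"]) auto
  qed auto
  ultimately show ?thesis by (simp add: mult_2)
qed

context brownian
begin

text \<open>The offset l is random but known at \<sigma>, so that one reflection principle serves
  for the next zero (\<open>- X w\<close>), for default (\<open>stopped \<sigma>\<close>), for the
  end of the excursion (\<open>- stopped \<sigma>\<close>) and for small constant levels.\<close>

definition hit :: "('a \<Rightarrow> ereal) \<Rightarrow> ('a \<Rightarrow> real) \<Rightarrow> 'a \<Rightarrow> ereal" where
  "hit \<sigma> l \<omega> = Inf (ereal ` {t\<in>{0..T}. \<sigma> \<omega> \<le> ereal t \<and> X t \<omega> = stopped \<sigma> \<omega> + l \<omega>})"

lemma hit_cases:
  assumes \<sigma>: "stopping \<sigma>" and w: "\<omega> \<in> space M"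
  obtains "hit \<sigma> l \<omega> = \<infinity>" "\<And>t. 0 \<le> t \<Longrightarrow> t \<le> T \<Longrightarrow> \<sigma> \<omega> \<le> ereal t \<Longrightarrow> X t \<omega> \<noteq> stopped \<sigma> \<omega> + l \<omega>"
  | s where "hit \<sigma> l \<omega> = ereal s" "0 \<le> s" "s \<le> T" "\<sigma> \<omega> \<le> ereal s" "X s \<omega> = stopped \<sigma> \<omega> + l \<omega>"
     "\<And>t. 0 \<le> t \<Longrightarrow> t \<le> T \<Longrightarrow> \<sigma> \<omega> \<le> ereal t \<Longrightarrow> X t \<omega> = stopped \<sigma> \<omega> + l \<omega> \<Longrightarrow> s \<le> t"
proof -
  let ?S = "{t\<in>{0..T}. \<sigma> \<omega> \<le> ereal t \<and> X t \<omega> = stopped \<sigma> \<omega> + l \<omega>}"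
  show thesis
  proof (cases "?S = {}")
    case True
    then have "hit \<sigma> l \<omega> = \<infinity>" unfolding hit_def True by (simp add: top_ereal_def)
    moreover have "X t \<omega> \<noteq> stopped \<sigma> \<omega> + l \<omega>" if "0 \<le> t" "t \<le> T" "\<sigma> \<omega> \<le> ereal t" for t
      using True that by simp
    ultimately show thesis using that(1) by blast
  next
    case False
    then obtain t where "\<sigma> \<omega> \<le> ereal t" by blast
    from stopping_leE[OF \<sigma> w this] obtain r where r: "\<sigma> \<omega> = ereal r" "0 \<le> r" by metis
    have "?S = {t\<in>{r..T}. X t \<omega> = stopped \<sigma> \<omega> + l \<omega>}" using r by auto
    moreover have "closed \<dots>"
      using r by (intro continuous_closed_preimage_constant continuous_on_subset[OF cont[OF w]]) auto
    moreover have "bounded \<dots>" by (rule bounded_subset[of "{r..T}"]) auto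
    ultimately have "compact ?S" by (simp add: compact_eq_bounded_closed)
    then obtain s where s: "s \<in> ?S" "Inf (ereal ` ?S) = ereal s" "\<And>t. t \<in> ?S \<Longrightarrow> s \<le> t"
      using Inf_ereal_compact[of ?S] False by blast
    show thesis
    proof (rule that(2))
      show "hit \<sigma> l \<omega> = ereal s" unfolding hit_def by (rule s(2))
      show "0 \<le> s" "s \<le> T" "\<sigma> \<omega> \<le> ereal s" "X s \<omega> = stopped \<sigma> \<omega> + l \<omega>"
        using s(1) by simp_all
      show "s \<le> t" if "0 \<le> t" "t \<le> T" "\<sigma> \<omega> \<le> ereal t" "X t \<omega> = stopped \<sigma> \<omega> + l \<omega>" for t
        by (rule s(3)) (use that in simp)
    qed
qed
qed

lemma hit_le_iff:
  assumes \<sigma>: "stopping \<sigma>" and w: "\<omega> \<in> space M" and t: "t \<in> {0..T}"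
  shows "hit \<sigma> l \<omega> \<le> ereal t \<longleftrightarrow> (\<exists>s\<in>{0..t}. \<sigma> \<omega> \<le> ereal s \<and> X s \<omega> = stopped \<sigma> \<omega> + l \<omega>)"
proof (cases rule: hit_cases[OF \<sigma> w, of l])
  case 1
  then have "\<not> (\<exists>s\<in>{0..t}. \<sigma> \<omega> \<le> ereal s \<and> X s \<omega> = stopped \<sigma> \<omega> + l \<omega>)"
    using t by (meson atLeastAtMost_iff order_trans)
  then show ?thesis using 1(1) by simp
next
  case (2 s)
  show ?thesis
  proof
    assume "hit \<sigma> l \<omega> \<le> ereal t"
    then show "\<exists>s\<in>{0..t}. \<sigma> \<omega> \<le> ereal s \<and> X s \<omega> = stopped \<sigma> \<omega> + l \<omega>"
      using 2(1-5) by (intro bexI[of _ s]) auto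
  next
    assume "\<exists>s\<in>{0..t}. \<sigma> \<omega> \<le> ereal s \<and> X s \<omega> = stopped \<sigma> \<omega> + l \<omega>"
    then obtain r where "r \<in> {0..t}" "\<sigma> \<omega> \<le> ereal r" "X r \<omega> = stopped \<sigma> \<omega> + l \<omega>" by blast
    then show "hit \<sigma> l \<omega> \<le> ereal t" using 2(6)[of r] t by (simp add: 2(1))
  qed
qed

lemma le_hit:
  assumes "stopping \<sigma>" "\<omega> \<in> space M"
  shows "\<sigma> \<omega> \<le> hit \<sigma> l \<omega>"
  by (cases rule: hit_cases[OF assms, of l]) auto

lemma pre_restrict:
  assumes \<sigma>: "stopping \<sigma>" and g: "g \<in> borel_measurable (pre \<sigma>)" and q: "q \<in> {0..T}"
  shows "(\<lambda>\<omega>. if \<sigma> \<omega> \<le> ereal q then g \<omega> else (0::real)) \<in> borel_measurable (F q)"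
proof (rule measurableI)
  fix S :: "real set" assume S: "S \<in> sets borel"
  have "g -` S \<inter> space (pre \<sigma>) \<in> sets (pre \<sigma>)" by (rule measurable_sets[OF g S])
  then have 1: "g -` S \<inter> space M \<inter> {\<omega>\<in>space M. \<sigma> \<omega> \<le> ereal q} \<in> sets (F q)"
    using pre_le_in[OF \<sigma> _ q] by simp
  have 2: "(if 0 \<in> S then space (F q) - {\<omega>\<in>space M. \<sigma> \<omega> \<le> ereal q} else {}) \<in> sets (F q)"
    using stoppingD[OF \<sigma> q] by auto
  have "(\<lambda>\<omega>. if \<sigma> \<omega> \<le> ereal q then g \<omega> else 0) -` S \<inter> space (F q) =
    (g -` S \<inter> space M \<inter> {\<omega>\<in>space M. \<sigma> \<omega> \<le> ereal q}) \<union> (if 0 \<in> S then space (F q) - {\<omega>\<in>space M. \<sigma> \<omega> \<le> ereal q} else {})"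
    using space_F[OF q] by (auto split: if_splits)
  then show "(\<lambda>\<omega>. if \<sigma> \<omega> \<le> ereal q then g \<omega> else 0) -` S \<inter> space (F q) \<in> sets (F q)"
    using sets.Un[OF 1 2] by simp
qed simp

text \<open>The level is reached by time t iff for every n some rational time between \<sigma> and
  t, or t itself, brings X within 1 / (n + 1) of it: the distance to the level attains its minimum
  on the compact interval, and this minimum is then 0. Countably many conditions remain, each known
  by time t.\<close>

lemma stopping_hit:
  assumes \<sigma>: "stopping \<sigma>" and l: "l \<in> borel_measurable (pre \<sigma>)"
  shows "stopping (hit \<sigma> l)"
  unfolding stopping_def
proof (intro conjI ballI)
  fix \<omega> assume "\<omega> \<in> space M"
  then show "hit \<sigma> l \<omega> = \<infinity> \<or> (\<exists>t\<in>{0..T}. hit \<sigma> l \<omega> = ereal t)"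
    by (cases rule: hit_cases[OF \<sigma>, of \<omega> l]) auto
next
  fix t assume t: "t \<in> {0..T}"
  let ?g = "\<lambda>\<omega>. stopped \<sigma> \<omega> + l \<omega>"
  let ?Q = "(\<rat> \<inter> {0..t}) \<union> {t}"
  \<comment> \<open>The level belongs to the past of \<sigma> and is known at time q only where
    \<sigma> \<le> q. Cutting it off to 0 elsewhere makes it \<open>F q\<close>-measurable by
    \<open>pre_restrict\<close> and is harmless inside the first event.\<close>
  let ?E = "\<lambda>n q. {\<omega>\<in>space M. \<sigma> \<omega> \<le> ereal q} \<inter> {\<omega>\<in>space (F q). \<bar>X q \<omega> - (if \<sigma> \<omega> \<le> ereal q then ?g \<omega> else 0)\<bar> < 1 / real (Suc n)}"
  have g: "?g \<in> borel_measurable (pre \<sigma>)"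
    using stopped_measurable_pre[OF \<sigma>] l by measurable
  have Q: "countable ?Q" using countable_rat by (auto intro: countable_subset)
  have qT: "q \<in> {0..T}" "0 \<le> q" "q \<le> t" if "q \<in> ?Q" for q using that t by auto
  have E: "?E n q \<in> sets (F t)" if q: "q \<in> ?Q" for n q
  proof -
    note [measurable] = adapted[OF qT(1)[OF q]] pre_restrict[OF \<sigma> g qT(1)[OF q]]
    have "{\<omega>\<in>space (F q). \<bar>X q \<omega> - (if \<sigma> \<omega> \<le> ereal q then ?g \<omega> else 0)\<bar> < 1 / real (Suc n)} \<in> sets (F q)"
      by measurable
    then have "?E n q \<in> sets (F q)" using stoppingD[OF \<sigma> qT(1)[OF q]] by (rule sets.Int[rotated])
    then show ?thesis using qT[OF q] t by (intro F_monoD[of q t]) simp_all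
  qed
  have "{\<omega>\<in>space M. hit \<sigma> l \<omega> \<le> ereal t} = (\<Inter>n. \<Union>q\<in>?Q. ?E n q)"
  proof (rule set_eqI)
    fix \<omega>
    show "\<omega> \<in> {\<omega>\<in>space M. hit \<sigma> l \<omega> \<le> ereal t} \<longleftrightarrow> \<omega> \<in> (\<Inter>n. \<Union>q\<in>?Q. ?E n q)"
    proof
      assume "\<omega> \<in> {\<omega>\<in>space M. hit \<sigma> l \<omega> \<le> ereal t}"
      then have w: "\<omega> \<in> space M" and "hit \<sigma> l \<omega> \<le> ereal t" by auto
      then obtain s where s: "0 \<le> s" "s \<le> t" "\<sigma> \<omega> \<le> ereal s" "X s \<omega> = ?g \<omega>"
        using hit_le_iff[OF \<sigma> w t] by auto
      have "\<exists>q\<in>?Q. \<omega> \<in> ?E n q" for n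
      proof (cases "s = t")
        case True
        then show ?thesis using s w space_F[OF t] by (intro bexI[of _ t]) auto
      next
        case False
        have "continuous (at s within {0..T}) (\<lambda>t. X t \<omega>)"
          using cont[OF w] s t by (auto simp: continuous_on_eq_continuous_within)
        then obtain d where d: "d > 0" "\<And>y. y \<in> {0..T} \<Longrightarrow> dist y s < d \<Longrightarrow> dist (X y \<omega>) (X s \<omega>) < 1 / real (Suc n)"
          unfolding continuous_within_eps_delta by (metis of_nat_0_less_iff zero_less_Suc zero_less_divide_1_iff)
        obtain q where q: "q \<in> \<rat>" "s < q" "q < min t (s + d)"
          using Rats_dense_in_real[of s "min t (s + d)"] False s d by auto
        have "dist (X q \<omega>) (X s \<omega>) < 1 / real (Suc n)"
          using q s t by (intro d) (auto simp: dist_real_def)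
        moreover have "\<sigma> \<omega> \<le> ereal q" using s(3) q(2) by (meson ereal_less_eq(3) less_imp_le order_trans)
        moreover have "q \<in> ?Q" using q s by auto
        ultimately show ?thesis using w space_F[OF qT(1), of q] s(4) by (intro bexI[of _ q]) (auto simp: dist_real_def)
      qed
      then show "\<omega> \<in> (\<Inter>n. \<Union>q\<in>?Q. ?E n q)" by blast
    next
      assume "\<omega> \<in> (\<Inter>n. \<Union>q\<in>?Q. ?E n q)"
      then have ex: "\<exists>q\<in>?Q. \<omega> \<in> ?E n q" for n by blast
      have w: "\<omega> \<in> space M" using ex[of 0] by auto
      have ex': "\<exists>q\<in>{0..t}. \<sigma> \<omega> \<le> ereal q \<and> \<bar>X q \<omega> - ?g \<omega>\<bar> < 1 / real (Suc n)" for n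
      proof -
        obtain q where q: "q \<in> ?Q" "\<omega> \<in> ?E n q" using ex by blast
        then show ?thesis using qT[OF q(1)] by (intro bexI[of _ q]) auto
      qed
      obtain q0 where q0: "\<sigma> \<omega> \<le> ereal q0" "q0 \<le> t" using ex'[of 0] by (meson atLeastAtMost_iff)
      obtain r where r: "\<sigma> \<omega> = ereal r" "0 \<le> r" "r \<le> t"
      proof -
        obtain r where "\<sigma> \<omega> = ereal r" "0 \<le> r" "r \<le> q0" by (rule stopping_leE[OF \<sigma> w q0(1)])
        then show thesis using q0(2) by (intro that[of r]) simp_all
      qed
      have "continuous_on {r..t} (\<lambda>s. \<bar>X s \<omega> - ?g \<omega>\<bar>)"
        using r t by (intro continuous_intros continuous_on_subset[OF cont[OF w]]) auto
      then obtain s where s: "s \<in> {r..t}" "\<And>y. y \<in> {r..t} \<Longrightarrow> \<bar>X s \<omega> - ?g \<omega>\<bar> \<le> \<bar>X y \<omega> - ?g \<omega>\<bar>"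
        using continuous_attains_inf[of "{r..t}" "\<lambda>s. \<bar>X s \<omega> - ?g \<omega>\<bar>"] r(3) compact_Icc by auto
      have "\<bar>X s \<omega> - ?g \<omega>\<bar> < inverse (real (Suc n))" for n
      proof -
        obtain q where "q \<in> {0..t}" "\<sigma> \<omega> \<le> ereal q" "\<bar>X q \<omega> - ?g \<omega>\<bar> < 1 / real (Suc n)" using ex' by blast
        then show ?thesis using s(2)[of q] r by (simp add: inverse_eq_divide)
      qed
      then have "X s \<omega> = ?g \<omega>"
        using reals_Archimedean[of "\<bar>X s \<omega> - ?g \<omega>\<bar>"] by (metis abs_le_zero_iff eq_iff_diff_eq_0 not_less less_asym)
      then have "hit \<sigma> l \<omega> \<le> ereal t" using hit_le_iff[OF \<sigma> w t] s(1) r by auto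
      then show "\<omega> \<in> {\<omega>\<in>space M. hit \<sigma> l \<omega> \<le> ereal t}" using w by blast
    qed
  qed
  also have "\<dots> \<in> sets (F t)"
    using E Q by (intro sets.countable_INT sets.countable_UN'' image_subsetI) auto
  finally show "{\<omega>\<in>space M. hit \<sigma> l \<omega> \<le> ereal t} \<in> sets (F t)" .
qed

lemma measurable_pre_M: "stopping \<sigma> \<Longrightarrow> f \<in> measurable (pre \<sigma>) N \<Longrightarrow> f \<in> measurable M N"
  using measurable_from_subalg[OF pre_subalg] .

text \<open>One event, the path being beyond the level at time v, is evaluated twice: at \<sigma>,
  where it is a one-sided Gaussian tail, and at the hitting time, where continuing to the far side
  has probability 1/2. Doubling gives the two-sided tail. The weight W carries the conditioning on
  the past of \<sigma>, and c is the distance to the level in units of the standard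
  deviation.\<close>

lemma reflection:
  fixes l :: "'a \<Rightarrow> real"
  assumes \<sigma>: "stopping \<sigma>" and l: "l \<in> borel_measurable (pre \<sigma>)" and v: "v \<in> {0..T}"
    and W: "W \<in> borel_measurable (pre \<sigma>)"
  defines "c \<equiv> \<lambda>\<omega>. \<bar>l \<omega>\<bar> / sqrt (v - real_of_ereal (\<sigma> \<omega>))"
  shows hit_eq_null: "AE \<omega> in M. \<sigma> \<omega> < ereal v \<longrightarrow> hit \<sigma> l \<omega> \<noteq> ereal v"
    and hit_le_prob: "(\<integral>\<^sup>+\<omega>. W \<omega> * indicator {\<omega>\<in>space M. \<sigma> \<omega> < ereal v \<and> hit \<sigma> l \<omega> \<le> ereal v} \<omega> \<partial>M) =
      (\<integral>\<^sup>+\<omega>. W \<omega> * indicator {\<omega>\<in>space M. \<sigma> \<omega> < ereal v} \<omega> * emeasure std_normal_distribution {z. c \<omega> < \<bar>z\<bar>} \<partial>M)"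
proof -
  interpret N: real_distribution std_normal_distribution by (rule real_dist_normal_dist)
  let ?\<rho> = "hit \<sigma> l"
  have \<rho>: "stopping ?\<rho>" by (rule stopping_hit[OF \<sigma> l])
  \<comment> \<open>The direction in which the level lies; the choice 1 for l = 0 is
    arbitrary.\<close>
  define s where "s = (\<lambda>\<omega>. if l \<omega> < 0 then - 1 else (1::real))"
  have s12: "s \<omega> = 1 \<or> s \<omega> = - 1" for \<omega> by (simp add: s_def)
  have sl: "s \<omega> * l \<omega> = \<bar>l \<omega>\<bar>" for \<omega> by (simp add: s_def)
  note m\<sigma>[measurable] = stopping_measurable_pre[OF \<sigma>] l W
  have [measurable]: "s \<in> borel_measurable (pre \<sigma>)" unfolding s_def by measurable
  have [measurable]: "c \<in> borel_measurable (pre \<sigma>)" unfolding c_def by measurable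
  have up1: "W \<in> borel_measurable (pre ?\<rho>)" "s \<in> borel_measurable (pre ?\<rho>)" "\<sigma> \<in> borel_measurable (pre ?\<rho>)"
    by (rule measurable_pre_mono[OF \<sigma> \<rho> le_hit[OF \<sigma>]], measurable)+
  have mM[measurable]: "W \<in> borel_measurable M" "l \<in> borel_measurable M" "\<sigma> \<in> borel_measurable M"
    "?\<rho> \<in> borel_measurable M" "X v \<in> borel_measurable M" "c \<in> borel_measurable M"
    by (rule stopping_measurable[OF \<rho>] X_meas[OF v] | rule measurable_pre_M[OF \<sigma>], measurable)+
  have norm: "X v \<omega> - stopped \<sigma> \<omega> = sqrt (v - r) * incr_after \<sigma> v \<omega>" if "\<sigma> \<omega> = ereal r" "r < v" for \<omega> r
    using that by (simp add: incr_after_def)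
  \<comment> \<open>By the intermediate value theorem the path is strictly beyond the level at v iff
    it met the level before v and has since moved further in the same direction.\<close>
  have key: "\<sigma> \<omega> < ereal v \<and> c \<omega> < s \<omega> * incr_after \<sigma> v \<omega> \<longleftrightarrow> \<sigma> \<omega> < ereal v \<and> ?\<rho> \<omega> < ereal v \<and> 0 < s \<omega> * incr_after ?\<rho> v \<omega>"
    if w: "\<omega> \<in> space M" for \<omega>
  proof (cases "\<sigma> \<omega> < ereal v")
    case False then show ?thesis by simp
  next
    case True
    then obtain r where r: "\<sigma> \<omega> = ereal r" "0 \<le> r" "r < v" using stopping_lessE[OF \<sigma> w] by metis
    have st: "stopped \<sigma> \<omega> = X r \<omega>" by (simp add: stopped_def r)
    have sq: "0 < sqrt (v - r)" using r by simp
    have 1: "c \<omega> < s \<omega> * incr_after \<sigma> v \<omega> \<longleftrightarrow> \<bar>l \<omega>\<bar> < s \<omega> * (X v \<omega> - X r \<omega>)"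
      using r(3) by (auto simp: c_def incr_after_def st r(1) divide_less_cancel)
    have 2: "0 < s \<omega> * incr_after ?\<rho> v \<omega> \<longleftrightarrow> 0 < s \<omega> * (X v \<omega> - X r \<omega>) - \<bar>l \<omega>\<bar>" if lt: "?\<rho> \<omega> < ereal v"
    proof (cases rule: hit_cases[OF \<sigma> w, of l])
      case 1 then show ?thesis using lt by simp
    next
      case (2 t)
      have "stopped ?\<rho> \<omega> = X r \<omega> + l \<omega>" using 2(1,5) st by (simp add: stopped_def)
      moreover have "0 < sqrt (v - t)" using lt 2(1) by simp
      ultimately have "0 < s \<omega> * incr_after ?\<rho> v \<omega> \<longleftrightarrow> 0 < s \<omega> * (X v \<omega> - (X r \<omega> + l \<omega>))"
        using 2(1) by (simp add: incr_after_def zero_less_divide_iff)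
      also have "s \<omega> * (X v \<omega> - (X r \<omega> + l \<omega>)) = s \<omega> * (X v \<omega> - X r \<omega>) - \<bar>l \<omega>\<bar>"
        using sl[of \<omega>] by (simp add: algebra_simps)
      finally show ?thesis .
    qed
    have 3: "?\<rho> \<omega> < ereal v" if gt: "\<bar>l \<omega>\<bar> < s \<omega> * (X v \<omega> - X r \<omega>)"
    proof -
      have "continuous_on {r..v} (\<lambda>t. s \<omega> * (X t \<omega> - X r \<omega>))"
        using r v by (intro continuous_intros continuous_on_subset[OF cont[OF w]]) auto
      then obtain t where t: "r \<le> t" "t \<le> v" "s \<omega> * (X t \<omega> - X r \<omega>) = \<bar>l \<omega>\<bar>"
        using IVT'[of "\<lambda>t. s \<omega> * (X t \<omega> - X r \<omega>)" r "\<bar>l \<omega>\<bar>" v] gt r by auto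
      have "t \<noteq> v" using t(3) gt by auto
      have "s \<omega> * (X t \<omega> - X r \<omega>) = s \<omega> * l \<omega>" using t(3) sl by simp
      then have "X t \<omega> = stopped \<sigma> \<omega> + l \<omega>" using s12[of \<omega>] st by auto
      then have "?\<rho> \<omega> \<le> ereal t"
        using t(1,2) r v by (subst hit_le_iff[OF \<sigma> w]) auto
      also have "ereal t < ereal v" using t(2) \<open>t \<noteq> v\<close> by simp
      finally show ?thesis .
    qed
    show ?thesis using 1 2 3 True by auto
  qed
  \<comment> \<open>Hitting the level exactly at v prescribes the value of the normalised increment,
    and the normal law has no atoms.\<close>
  have point: "(\<integral>\<^sup>+\<omega>. indicator {\<omega>\<in>space M. \<sigma> \<omega> < ereal v} \<omega> * indicator {x\<in>space (pre \<sigma> \<Otimes>\<^sub>M borel). snd x = l (fst x) / sqrt (v - real_of_ereal (\<sigma> (fst x)))} (\<omega>, incr_after \<sigma> v \<omega>) \<partial>M) = 0"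
  proof (subst strong_markov[OF \<sigma> v])
    have "(\<integral>\<^sup>+z. indicator {x\<in>space (pre \<sigma> \<Otimes>\<^sub>M borel). snd x = l (fst x) / sqrt (v - real_of_ereal (\<sigma> (fst x)))} (\<omega>, z) \<partial>std_normal_distribution) = 0" for \<omega>
    proof -
      have "(\<integral>\<^sup>+z. indicator {x\<in>space (pre \<sigma> \<Otimes>\<^sub>M borel). snd x = l (fst x) / sqrt (v - real_of_ereal (\<sigma> (fst x)))} (\<omega>, z) \<partial>std_normal_distribution) \<le>
        (\<integral>\<^sup>+z. indicator {l \<omega> / sqrt (v - real_of_ereal (\<sigma> \<omega>))} z \<partial>std_normal_distribution)"
        by (intro nn_integral_mono) (auto simp: indicator_def)
      also have "\<dots> = 0" by (simp add: std_normal_singleton del: emeasure_density)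
      finally show ?thesis by simp
    qed
    then show "(\<integral>\<^sup>+\<omega>. indicator {\<omega>\<in>space M. \<sigma> \<omega> < ereal v} \<omega> *
       (\<integral>\<^sup>+z. indicator {x\<in>space (pre \<sigma> \<Otimes>\<^sub>M borel). snd x = l (fst x) / sqrt (v - real_of_ereal (\<sigma> (fst x)))} (\<omega>, z) \<partial>std_normal_distribution) \<partial>M) = 0" by simp
  qed measurable
  have mA: "{\<omega>\<in>space M. \<sigma> \<omega> < ereal v} \<in> sets M" by measurable
  have inc[measurable]: "incr_after \<sigma> v \<in> borel_measurable M" "incr_after ?\<rho> v \<in> borel_measurable M"
    using incr_after_measurable \<sigma> \<rho> v by auto
  have id: "(\<lambda>\<omega>. \<omega>) \<in> measurable M (pre \<sigma>)"
    using pre_subalg[OF \<sigma>] by (auto simp: measurable_def subalgebra_def)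
  have "(\<lambda>\<omega>. (\<omega>, incr_after \<sigma> v \<omega>)) \<in> measurable M (pre \<sigma> \<Otimes>\<^sub>M borel)"
    using id inc(1) by (rule measurable_Pair)
  have "AE \<omega> in M. \<sigma> \<omega> < ereal v \<longrightarrow> incr_after \<sigma> v \<omega> \<noteq> l \<omega> / sqrt (v - real_of_ereal (\<sigma> \<omega>))"
  proof -
    have "(\<integral>\<^sup>+\<omega>. indicator {\<omega>\<in>space M. \<sigma> \<omega> < ereal v \<and> incr_after \<sigma> v \<omega> = l \<omega> / sqrt (v - real_of_ereal (\<sigma> \<omega>))} \<omega> \<partial>M) = 0"
      unfolding point[symmetric]
      by (intro nn_integral_cong) (auto simp: indicator_def space_pair_measure)
    moreover have B: "{\<omega>\<in>space M. \<sigma> \<omega> < ereal v \<and> incr_after \<sigma> v \<omega> = l \<omega> / sqrt (v - real_of_ereal (\<sigma> \<omega>))} \<in> sets M" (is "?B \<in> _")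
      by measurable
    ultimately have "?B \<in> null_sets M" by (simp add: null_sets_def)
    from AE_not_in[OF this] show ?thesis
    proof (rule AE_mp, intro AE_I2 impI)
      fix \<omega> assume "\<omega> \<in> space M" "\<omega> \<notin> ?B" "\<sigma> \<omega> < ereal v"
      then show "incr_after \<sigma> v \<omega> \<noteq> l \<omega> / sqrt (v - real_of_ereal (\<sigma> \<omega>))" by blast
    qed
  qed
  then show null: "AE \<omega> in M. \<sigma> \<omega> < ereal v \<longrightarrow> ?\<rho> \<omega> \<noteq> ereal v"
  proof (rule AE_mp, intro AE_I2 impI notI)
    fix \<omega> assume w: "\<omega> \<in> space M" and lt: "\<sigma> \<omega> < ereal v" and eq: "?\<rho> \<omega> = ereal v"
      and ne: "\<sigma> \<omega> < ereal v \<longrightarrow> incr_after \<sigma> v \<omega> \<noteq> l \<omega> / sqrt (v - real_of_ereal (\<sigma> \<omega>))"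
    have "X v \<omega> = stopped \<sigma> \<omega> + l \<omega>"
      by (cases rule: hit_cases[OF \<sigma> w, of l]) (use eq in auto)
    then show False using ne lt by (simp add: incr_after_def)
  qed
  let ?A = "\<lambda>\<omega>. indicator {\<omega>\<in>space M. \<sigma> \<omega> < ereal v} \<omega> :: ennreal"
  let ?N = "\<lambda>\<omega>. emeasure std_normal_distribution {z. c \<omega> < \<bar>z\<bar>}"
  have c0: "0 \<le> c \<omega>" if c0: "\<omega> \<in> space M" "\<sigma> \<omega> < ereal v" for \<omega>
  proof -
    obtain r where "\<sigma> \<omega> = ereal r" "r < v" by (rule stopping_lessE[OF \<sigma> c0])
    then show ?thesis by (simp add: c_def)
  qed
  define h1 where "h1 = (\<lambda>x. W (fst x) * indicator {x\<in>space (pre \<sigma> \<Otimes>\<^sub>M borel). c (fst x) < s (fst x) * snd x} x)"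
  have h1: "h1 \<in> borel_measurable (pre \<sigma> \<Otimes>\<^sub>M borel)" unfolding h1_def by measurable
  define h2 where "h2 = (\<lambda>x. W (fst x) * indicator {x\<in>space (pre ?\<rho> \<Otimes>\<^sub>M borel). \<sigma> (fst x) < ereal v \<and> 0 < s (fst x) * snd x} x)"
  have h2: "h2 \<in> borel_measurable (pre ?\<rho> \<Otimes>\<^sub>M borel)"
  proof -
    note [measurable] = up1
    show ?thesis unfolding h2_def by measurable
  qed
  have "(\<integral>\<^sup>+\<omega>. ?A \<omega> * h1 (\<omega>, incr_after \<sigma> v \<omega>) \<partial>M) = (\<integral>\<^sup>+\<omega>. indicator {\<omega>\<in>space M. ?\<rho> \<omega> < ereal v} \<omega> * h2 (\<omega>, incr_after ?\<rho> v \<omega>) \<partial>M)"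
    using key by (intro nn_integral_cong) (auto simp: h1_def h2_def indicator_def space_pair_measure)
  \<comment> \<open>The factor 2 turns the one-sided tail on the left into the two-sided one and the
    probability 1/2 on the right into 1.\<close>
  then have E: "2 * (\<integral>\<^sup>+\<omega>. ?A \<omega> * (\<integral>\<^sup>+z. h1 (\<omega>, z) \<partial>std_normal_distribution) \<partial>M) =
      2 * (\<integral>\<^sup>+\<omega>. indicator {\<omega>\<in>space M. ?\<rho> \<omega> < ereal v} \<omega> * (\<integral>\<^sup>+z. h2 (\<omega>, z) \<partial>std_normal_distribution) \<partial>M)"
    unfolding strong_markov[OF \<sigma> v h1] strong_markov[OF \<rho> v h2] by simp
  have hh1: "(\<integral>\<^sup>+z. h1 (\<omega>, z) \<partial>std_normal_distribution) = W \<omega> * emeasure std_normal_distribution {z. c \<omega> < s \<omega> * z}" if "\<omega> \<in> space M" for \<omega>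
  proof -
    have "(\<integral>\<^sup>+z. h1 (\<omega>, z) \<partial>std_normal_distribution) = (\<integral>\<^sup>+z. W \<omega> * indicator {z. c \<omega> < s \<omega> * z} z \<partial>std_normal_distribution)"
      using that by (intro nn_integral_cong) (auto simp: h1_def indicator_def space_pair_measure)
    also have "\<dots> = W \<omega> * emeasure std_normal_distribution {z. c \<omega> < s \<omega> * z}"
      by (subst nn_integral_cmult_indicator) auto
    finally show ?thesis .
  qed
  have hh2: "(\<integral>\<^sup>+z. h2 (\<omega>, z) \<partial>std_normal_distribution) = W \<omega> * ?A \<omega> * emeasure std_normal_distribution {z. 0 < s \<omega> * z}" if "\<omega> \<in> space M" for \<omega>
  proof -
    have "(\<integral>\<^sup>+z. h2 (\<omega>, z) \<partial>std_normal_distribution) = (\<integral>\<^sup>+z. W \<omega> * ?A \<omega> * indicator {z. 0 < s \<omega> * z} z \<partial>std_normal_distribution)"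
      using that by (intro nn_integral_cong) (auto simp: h2_def indicator_def space_pair_measure)
    also have "\<dots> = W \<omega> * ?A \<omega> * emeasure std_normal_distribution {z. 0 < s \<omega> * z}"
      by (subst nn_integral_cmult_indicator) auto
    finally show ?thesis .
  qed
  have full: "2 * emeasure std_normal_distribution {z. 0 < s \<omega> * z} = 1" for \<omega>
  proof -
    have "emeasure std_normal_distribution {z. 0 < \<bar>z\<bar>} = emeasure std_normal_distribution (UNIV - {0})"
      by (rule arg_cong[where f="emeasure std_normal_distribution"]) auto
    also have "\<dots> = emeasure std_normal_distribution UNIV - emeasure std_normal_distribution {0}"
      using std_normal_singleton[of 0] by (intro emeasure_Diff) auto
    also have "\<dots> = 1" using std_normal_singleton[of 0] N.emeasure_space_1 by simp
    finally show ?thesis using std_normal_half[OF order_refl s12] by simp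
  qed
  have L: "2 * (\<integral>\<^sup>+\<omega>. ?A \<omega> * (\<integral>\<^sup>+z. h1 (\<omega>, z) \<partial>std_normal_distribution) \<partial>M) = (\<integral>\<^sup>+\<omega>. W \<omega> * ?A \<omega> * ?N \<omega> \<partial>M)"
  proof -
    have "(\<lambda>\<omega>. \<integral>\<^sup>+z. h1 (\<omega>, z) \<partial>std_normal_distribution) \<in> borel_measurable (pre \<sigma>)"
      using h1 by (intro N.borel_measurable_nn_integral_fst) simp
    from measurable_pre_M[OF \<sigma> this] have "2 * (\<integral>\<^sup>+\<omega>. ?A \<omega> * (\<integral>\<^sup>+z. h1 (\<omega>, z) \<partial>std_normal_distribution) \<partial>M) = (\<integral>\<^sup>+\<omega>. 2 * (?A \<omega> * (\<integral>\<^sup>+z. h1 (\<omega>, z) \<partial>std_normal_distribution)) \<partial>M)"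
      using mA by (intro nn_integral_cmult[symmetric]) auto
    also have "\<dots> = (\<integral>\<^sup>+\<omega>. W \<omega> * ?A \<omega> * ?N \<omega> \<partial>M)"
    proof (intro nn_integral_cong)
      fix \<omega> assume w: "\<omega> \<in> space M"
      show "2 * (?A \<omega> * (\<integral>\<^sup>+z. h1 (\<omega>, z) \<partial>std_normal_distribution)) = W \<omega> * ?A \<omega> * ?N \<omega>"
      proof (cases "\<sigma> \<omega> < ereal v")
        case True
        have "2 * (?A \<omega> * (\<integral>\<^sup>+z. h1 (\<omega>, z) \<partial>std_normal_distribution)) = W \<omega> * ?A \<omega> * (2 * emeasure std_normal_distribution {z. c \<omega> < s \<omega> * z})"
          unfolding hh1[OF w] by (simp only: mult_ac)
        then show ?thesis by (simp only: std_normal_half[OF c0[OF w True] s12])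
      qed simp
    qed
    finally show ?thesis .
  qed
  have R: "2 * (\<integral>\<^sup>+\<omega>. indicator {\<omega>\<in>space M. ?\<rho> \<omega> < ereal v} \<omega> * (\<integral>\<^sup>+z. h2 (\<omega>, z) \<partial>std_normal_distribution) \<partial>M) =
      (\<integral>\<^sup>+\<omega>. W \<omega> * indicator {\<omega>\<in>space M. \<sigma> \<omega> < ereal v \<and> ?\<rho> \<omega> \<le> ereal v} \<omega> \<partial>M)"
  proof -
    have "(\<lambda>\<omega>. \<integral>\<^sup>+z. h2 (\<omega>, z) \<partial>std_normal_distribution) \<in> borel_measurable (pre ?\<rho>)"
      using h2 by (intro N.borel_measurable_nn_integral_fst) simp
    then have [measurable]: "(\<lambda>\<omega>. \<integral>\<^sup>+z. h2 (\<omega>, z) \<partial>std_normal_distribution) \<in> borel_measurable M"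
      using measurable_from_subalg[OF pre_subalg[OF \<rho>]] by blast
    have "2 * (\<integral>\<^sup>+\<omega>. indicator {\<omega>\<in>space M. ?\<rho> \<omega> < ereal v} \<omega> * (\<integral>\<^sup>+z. h2 (\<omega>, z) \<partial>std_normal_distribution) \<partial>M) =
       (\<integral>\<^sup>+\<omega>. 2 * (indicator {\<omega>\<in>space M. ?\<rho> \<omega> < ereal v} \<omega> * (\<integral>\<^sup>+z. h2 (\<omega>, z) \<partial>std_normal_distribution)) \<partial>M)"
      by (intro nn_integral_cmult[symmetric]) measurable
    also have "\<dots> = (\<integral>\<^sup>+\<omega>. W \<omega> * indicator {\<omega>\<in>space M. \<sigma> \<omega> < ereal v \<and> ?\<rho> \<omega> \<le> ereal v} \<omega> \<partial>M)"
    proof (rule nn_integral_cong_AE)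
      show "AE \<omega> in M. 2 * (indicator {\<omega>\<in>space M. ?\<rho> \<omega> < ereal v} \<omega> * (\<integral>\<^sup>+z. h2 (\<omega>, z) \<partial>std_normal_distribution)) =
        W \<omega> * indicator {\<omega>\<in>space M. \<sigma> \<omega> < ereal v \<and> ?\<rho> \<omega> \<le> ereal v} \<omega>"
        using null
      proof (rule AE_mp, intro AE_I2 impI)
        fix \<omega> assume w: "\<omega> \<in> space M" and ne: "\<sigma> \<omega> < ereal v \<longrightarrow> ?\<rho> \<omega> \<noteq> ereal v"
        have "2 * (indicator {\<omega>\<in>space M. ?\<rho> \<omega> < ereal v} \<omega> * (\<integral>\<^sup>+z. h2 (\<omega>, z) \<partial>std_normal_distribution)) =
          W \<omega> * ?A \<omega> * indicator {\<omega>\<in>space M. ?\<rho> \<omega> < ereal v} \<omega> * (2 * emeasure std_normal_distribution {z. 0 < s \<omega> * z})"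
          unfolding hh2[OF w] by (simp only: mult_ac)
        also have "\<dots> = W \<omega> * indicator {\<omega>\<in>space M. \<sigma> \<omega> < ereal v \<and> ?\<rho> \<omega> \<le> ereal v} \<omega>"
          unfolding full using ne w by (auto simp: indicator_def order_le_less)
        finally show "2 * (indicator {\<omega>\<in>space M. ?\<rho> \<omega> < ereal v} \<omega> * (\<integral>\<^sup>+z. h2 (\<omega>, z) \<partial>std_normal_distribution)) =
          W \<omega> * indicator {\<omega>\<in>space M. \<sigma> \<omega> < ereal v \<and> ?\<rho> \<omega> \<le> ereal v} \<omega>" .
      qed
    qed
    finally show ?thesis .
  qed
  show "(\<integral>\<^sup>+\<omega>. W \<omega> * indicator {\<omega>\<in>space M. \<sigma> \<omega> < ereal v \<and> ?\<rho> \<omega> \<le> ereal v} \<omega> \<partial>M) = (\<integral>\<^sup>+\<omega>. W \<omega> * ?A \<omega> * ?N \<omega> \<partial>M)"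
    using E unfolding L R by simp
qed

end

lemma measure_eqI_Iio:
  fixes \<mu> \<nu> :: "real measure"
  assumes sets: "sets \<mu> = sets borel" "sets \<nu> = sets borel"
    and fin: "\<And>x. emeasure \<mu> {..<x} \<noteq> \<infinity>"
    and eq: "\<And>x. emeasure \<mu> {..<x} = emeasure \<nu> {..<x}"
  shows "\<mu> = \<nu>"
proof (rule measure_eqI_generator_eq[where E="range lessThan" and \<Omega>=UNIV and A="\<lambda>n. {..<real n}"])
  show "Int_stable (range (lessThan :: real \<Rightarrow> real set))"
  proof (rule Int_stableI)
    fix A B :: "real set" assume "A \<in> range lessThan" "B \<in> range lessThan"
    then obtain a b where "A = {..<a}" "B = {..<b}" by blast
    then have "A \<inter> B = {..<min a b}" by auto
    then show "A \<inter> B \<in> range lessThan" by simp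
  qed
  show "sets \<mu> = sigma_sets UNIV (range lessThan)" "sets \<nu> = sigma_sets UNIV (range lessThan)"
    unfolding sets borel_Iio by (rule sets_measure_of, simp)+
  show "(\<Union>n. {..<real n}) = UNIV" using reals_Archimedean2 by fastforce
qed (use eq fin in auto)

context brownian
begin

text \<open>The complement of \<open>hit_le_prob\<close>. The bound on W keeps the integrals finite,
  so that equal sums in \<open>ennreal\<close> may be cancelled.\<close>

lemma hit_greater_prob:
  fixes l :: "'a \<Rightarrow> real"
  assumes \<sigma>: "stopping \<sigma>" and l: "l \<in> borel_measurable (pre \<sigma>)" and v: "v \<in> {0..T}"
    and W: "W \<in> borel_measurable (pre \<sigma>)" and W1: "\<And>\<omega>. W \<omega> \<le> 1"
  shows "(\<integral>\<^sup>+\<omega>. W \<omega> * indicator {\<omega>\<in>space M. \<sigma> \<omega> < ereal v \<and> ereal v < hit \<sigma> l \<omega>} \<omega> \<partial>M) =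
      (\<integral>\<^sup>+\<omega>. W \<omega> * indicator {\<omega>\<in>space M. \<sigma> \<omega> < ereal v} \<omega> *
        emeasure std_normal_distribution {z. \<bar>z\<bar> \<le> \<bar>l \<omega>\<bar> / sqrt (v - real_of_ereal (\<sigma> \<omega>))} \<partial>M)"
proof -
  interpret N: real_distribution std_normal_distribution by (rule real_dist_normal_dist)
  let ?c = "\<lambda>\<omega>. \<bar>l \<omega>\<bar> / sqrt (v - real_of_ereal (\<sigma> \<omega>))"
  let ?A = "\<lambda>\<omega>. indicator {\<omega>\<in>space M. \<sigma> \<omega> < ereal v} \<omega> :: ennreal"
  let ?le = "\<integral>\<^sup>+\<omega>. W \<omega> * indicator {\<omega>\<in>space M. \<sigma> \<omega> < ereal v \<and> hit \<sigma> l \<omega> \<le> ereal v} \<omega> \<partial>M"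
  let ?gt = "\<integral>\<^sup>+\<omega>. W \<omega> * indicator {\<omega>\<in>space M. \<sigma> \<omega> < ereal v \<and> ereal v < hit \<sigma> l \<omega>} \<omega> \<partial>M"
  let ?R = "\<integral>\<^sup>+\<omega>. W \<omega> * ?A \<omega> * emeasure std_normal_distribution {z. \<bar>z\<bar> \<le> ?c \<omega>} \<partial>M"
  let ?all = "\<integral>\<^sup>+\<omega>. W \<omega> * ?A \<omega> \<partial>M"
  note [measurable] = measurable_pre_M[OF \<sigma> W] measurable_pre_M[OF \<sigma> l] stopping_measurable[OF \<sigma>]
    stopping_measurable[OF stopping_hit[OF \<sigma> l]]
  have "?all \<le> (\<integral>\<^sup>+\<omega>. 1 \<partial>M)"
    using W1 by (intro nn_integral_mono) (auto simp: indicator_def)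
  then have fin: "?all < \<infinity>" using emeasure_space_1 by (simp add: top.not_eq_extremum le_less_trans)
  have "?le + ?gt = ?all"
    by (subst nn_integral_add[symmetric]) (measurable, auto intro!: nn_integral_cong simp: indicator_def)
  moreover have "?le + ?R = ?all"
  proof -
    have meas: "(\<lambda>\<omega>. emeasure std_normal_distribution {z. \<bar>z\<bar> \<le> ?c \<omega>}) \<in> borel_measurable M"
      "(\<lambda>\<omega>. emeasure std_normal_distribution {z. ?c \<omega> < \<bar>z\<bar>}) \<in> borel_measurable M"
    proof -
      have "{x \<in> space (M \<Otimes>\<^sub>M std_normal_distribution). \<bar>snd x\<bar> \<le> ?c (fst x)} \<in> sets (M \<Otimes>\<^sub>M std_normal_distribution)"
        "{x \<in> space (M \<Otimes>\<^sub>M std_normal_distribution). ?c (fst x) < \<bar>snd x\<bar>} \<in> sets (M \<Otimes>\<^sub>M std_normal_distribution)"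
        by measurable
      from this[THEN N.measurable_emeasure_Pair]
      show "(\<lambda>\<omega>. emeasure std_normal_distribution {z. \<bar>z\<bar> \<le> ?c \<omega>}) \<in> borel_measurable M"
      "(\<lambda>\<omega>. emeasure std_normal_distribution {z. ?c \<omega> < \<bar>z\<bar>}) \<in> borel_measurable M"
        by (auto elim!: measurable_cong[THEN iffD1, rotated] intro!: arg_cong[where f="emeasure std_normal_distribution"] simp: space_pair_measure)
    qed
    have split: "emeasure std_normal_distribution {z. c < \<bar>z\<bar>} + emeasure std_normal_distribution {z. \<bar>z\<bar> \<le> c} = 1" for c
    proof (subst plus_emeasure)
      have "{z. c < \<bar>z\<bar>} \<union> {z. \<bar>z\<bar> \<le> c} = UNIV" by auto
      then show "emeasure std_normal_distribution ({z. c < \<bar>z\<bar>} \<union> {z. \<bar>z\<bar> \<le> c}) = 1" using N.emeasure_space_1 by simp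
    qed auto
    have "?le + ?R = (\<integral>\<^sup>+\<omega>. W \<omega> * ?A \<omega> * emeasure std_normal_distribution {z. ?c \<omega> < \<bar>z\<bar>} +
        W \<omega> * ?A \<omega> * emeasure std_normal_distribution {z. \<bar>z\<bar> \<le> ?c \<omega>} \<partial>M)"
      unfolding hit_le_prob[OF \<sigma> l v W] using meas by (intro nn_integral_add[symmetric]) measurable
    also have "\<dots> = ?all"
      by (simp only: distrib_left[symmetric] split mult_1_right)
    finally show ?thesis .
  qed
  ultimately have "?le + ?gt = ?le + ?R" by (simp only:)
  moreover have "?le \<le> ?all" by (intro nn_integral_mono mult_left_mono) (auto simp: indicator_def)
  then have "?le \<noteq> \<infinity>" using fin le_less_trans[of ?le ?all \<infinity>] less_top[of ?le] by simp
  ultimately show ?thesis by (simp only: ennreal_add_left_cancel) simp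
qed

text \<open>Not reaching the level 1 / (n + 1) on the chosen side by time v has the probability that
  a normal variable stays within a multiple of 1 / (n + 1) of 0, which tends to 0 by dominated
  convergence. Rational times v lie below every later time, so a single null set serves for all
  v.\<close>

lemma crosses_after:
  assumes \<sigma>: "stopping \<sigma>" and s: "s = 1 \<or> s = - 1"
  shows "AE \<omega> in M. \<forall>v\<in>{0..T}. \<sigma> \<omega> < ereal v \<longrightarrow> (\<exists>t. \<sigma> \<omega> < ereal t \<and> t < v \<and> 0 < s * (X t \<omega> - stopped \<sigma> \<omega>))"
proof -
  interpret N: real_distribution std_normal_distribution by (rule real_dist_normal_dist)
  define l where "l = (\<lambda>n::nat. \<lambda>\<omega>::'a. s / real (Suc n))"
  have lm: "l n \<in> borel_measurable (pre \<sigma>)" for n by (simp add: l_def)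
  have fixed: "AE \<omega> in M. \<sigma> \<omega> < ereal v \<longrightarrow> (\<exists>n. hit \<sigma> (l n) \<omega> \<le> ereal v)" if v: "v \<in> {0..T}" for v
  proof -
    note [measurable] = stopping_measurable[OF \<sigma>] stopping_measurable[OF stopping_hit[OF \<sigma> lm]]
    let ?c = "\<lambda>n \<omega>. \<bar>l n \<omega>\<bar> / sqrt (v - real_of_ereal (\<sigma> \<omega>))"
    let ?B = "\<lambda>n. {\<omega>\<in>space M. \<sigma> \<omega> < ereal v \<and> ereal v < hit \<sigma> (l n) \<omega>}"
    let ?p = "\<lambda>n \<omega>. indicator {\<omega>\<in>space M. \<sigma> \<omega> < ereal v} \<omega> * emeasure std_normal_distribution {z. \<bar>z\<bar> \<le> ?c n \<omega>}"
    have B: "emeasure M (?B n) = (\<integral>\<^sup>+\<omega>. ?p n \<omega> \<partial>M)" for n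
      using hit_greater_prob[OF \<sigma> lm[of n] v, of "\<lambda>_. 1"] by simp
    have meas: "?p n \<in> borel_measurable M" for n
    proof -
      have "{x \<in> space (M \<Otimes>\<^sub>M std_normal_distribution). \<bar>snd x\<bar> \<le> ?c n (fst x)} \<in> sets (M \<Otimes>\<^sub>M std_normal_distribution)"
        unfolding l_def by measurable
      from this[THEN N.measurable_emeasure_Pair]
      have [measurable]: "(\<lambda>\<omega>. emeasure std_normal_distribution {z. \<bar>z\<bar> \<le> ?c n \<omega>}) \<in> borel_measurable M"
        by (auto elim!: measurable_cong[THEN iffD1, rotated] intro!: arg_cong[where f="emeasure std_normal_distribution"] simp: space_pair_measure)
      show ?thesis by measurable
    qed
    have "(\<lambda>n. \<integral>\<^sup>+\<omega>. ?p n \<omega> \<partial>M) \<longlonglongrightarrow> (\<integral>\<^sup>+\<omega>. 0 \<partial>M)"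
    proof (rule nn_integral_dominated_convergence[where w="\<lambda>_. 1"])
      show "AE \<omega> in M. (\<lambda>n. ?p n \<omega>) \<longlonglongrightarrow> 0"
      proof (intro AE_I2)
        fix \<omega> assume w: "\<omega> \<in> space M"
        show "(\<lambda>n. ?p n \<omega>) \<longlonglongrightarrow> 0"
        proof (cases "\<sigma> \<omega> < ereal v")
          case True
          define k where "k = 1 / sqrt (v - real_of_ereal (\<sigma> \<omega>))"
          have k: "0 \<le> k"
          proof -
            obtain r where "\<sigma> \<omega> = ereal r" "r < v" by (rule stopping_lessE[OF \<sigma> w True])
            then show ?thesis by (simp add: k_def)
          qed
          have c: "?c n \<omega> = k * inverse (real (Suc n))" for n
            using s by (auto simp: l_def k_def divide_inverse)
          have "(\<lambda>n. emeasure std_normal_distribution {z. \<bar>z\<bar> \<le> ?c n \<omega>}) \<longlonglongrightarrow> emeasure std_normal_distribution (\<Inter>n. {z. \<bar>z\<bar> \<le> ?c n \<omega>})"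
          proof (rule Lim_emeasure_decseq)
            show "decseq (\<lambda>n. {z. \<bar>z\<bar> \<le> ?c n \<omega>})"
              unfolding c decseq_def
            proof (intro allI impI subsetI, clarify)
              fix m n :: nat and z :: real assume "m \<le> n" "\<bar>z\<bar> \<le> k * inverse (real (Suc n))"
              moreover have "k * inverse (real (Suc n)) \<le> k * inverse (real (Suc m))"
                using \<open>m \<le> n\<close> k by (intro mult_left_mono le_imp_inverse_le) auto
              ultimately show "\<bar>z\<bar> \<le> k * inverse (real (Suc m))" by linarith
            qed
          qed auto
          also have "(\<Inter>n. {z. \<bar>z\<bar> \<le> ?c n \<omega>}) = {0}"
          proof -
            have "z = 0" if z: "\<And>n. \<bar>z\<bar> \<le> k * inverse (real (Suc n))" for z
            proof -
              have "(\<lambda>n. k * inverse (real (Suc n))) \<longlonglongrightarrow> k * 0"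
                by (intro tendsto_mult tendsto_const LIMSEQ_inverse_real_of_nat)
              then have "\<bar>z\<bar> \<le> k * 0" by (rule LIMSEQ_le_const) (use z in auto)
              then show ?thesis by simp
            qed
            then show ?thesis unfolding c using k by auto
          qed
          finally show ?thesis using True w by (simp add: std_normal_singleton)
        qed simp
      qed
      show "AE \<omega> in M. ?p n \<omega> \<le> 1" for n
        using N.prob_space_axioms by (intro AE_I2) (auto simp: indicator_def intro!: N.emeasure_le_1)
      show "?p n \<in> borel_measurable M" for n by (rule meas)
      show "(\<integral>\<^sup>+\<omega>. 1 \<partial>M) < \<infinity>" using emeasure_space_1 by simp
    qed simp_all
    then have lim: "(\<lambda>n. emeasure M (?B n)) \<longlonglongrightarrow> 0" unfolding B by simp
    have "emeasure M (\<Inter>n. ?B n) \<le> emeasure M (?B n)" for n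
      by (intro emeasure_mono) auto
    then have "emeasure M (\<Inter>n. ?B n) \<le> 0"
      by (intro LIMSEQ_le_const[OF lim]) auto
    then have "(\<Inter>n. ?B n) \<in> null_sets M" by (auto simp: null_sets_def)
    from AE_not_in[OF this] show ?thesis
    proof (rule AE_mp, intro AE_I2 impI)
      fix \<omega> assume "\<omega> \<in> space M" "\<omega> \<notin> (\<Inter>n. ?B n)" "\<sigma> \<omega> < ereal v"
      then obtain n where "\<not> ereal v < hit \<sigma> (l n) \<omega>" by blast
      then show "\<exists>n. hit \<sigma> (l n) \<omega> \<le> ereal v" by (meson not_le)
    qed
  qed
  have "AE \<omega> in M. \<forall>v\<in>\<rat> \<inter> {0..T}. \<sigma> \<omega> < ereal v \<longrightarrow> (\<exists>n. hit \<sigma> (l n) \<omega> \<le> ereal v)"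
  proof (subst AE_ball_countable)
    show "countable (\<rat> \<inter> {0..T})" using countable_rat by (auto intro: countable_subset)
    show "\<forall>v\<in>\<rat> \<inter> {0..T}. AE \<omega> in M. \<sigma> \<omega> < ereal v \<longrightarrow> (\<exists>n. hit \<sigma> (l n) \<omega> \<le> ereal v)"
      using fixed by blast
  qed
  then show ?thesis
  proof (rule AE_mp, intro AE_I2 impI ballI)
    fix \<omega> v assume w: "\<omega> \<in> space M" and v: "v \<in> {0..T}" and lt: "\<sigma> \<omega> < ereal v"
      and all: "\<forall>v\<in>\<rat> \<inter> {0..T}. \<sigma> \<omega> < ereal v \<longrightarrow> (\<exists>n. hit \<sigma> (l n) \<omega> \<le> ereal v)"
    obtain r where r: "\<sigma> \<omega> = ereal r" "0 \<le> r" "r < v" by (rule stopping_lessE[OF \<sigma> w lt])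
    obtain q where q: "q \<in> \<rat>" "r < q" "q < v" using Rats_dense_in_real[OF r(3)] by blast
    then have "q \<in> \<rat> \<inter> {0..T}" "\<sigma> \<omega> < ereal q" using r v by auto
    then obtain n where "hit \<sigma> (l n) \<omega> \<le> ereal q" using all by blast
    moreover have "q \<in> {0..T}" using q r v by auto
    ultimately obtain t where t: "t \<in> {0..q}" "\<sigma> \<omega> \<le> ereal t" "X t \<omega> = stopped \<sigma> \<omega> + l n \<omega>"
      using hit_le_iff[OF \<sigma> w, of q "l n"] by blast
    have "s * (X t \<omega> - stopped \<sigma> \<omega>) = 1 / real (Suc n)" using t(3) s by (auto simp: l_def)
    then have pos: "0 < s * (X t \<omega> - stopped \<sigma> \<omega>)" by simp
    have "t \<noteq> r" using pos by (auto simp: stopped_def r(1))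
    then have "\<sigma> \<omega> < ereal t" using t(2) r(1) by simp
    then show "\<exists>t. \<sigma> \<omega> < ereal t \<and> t < v \<and> 0 < s * (X t \<omega> - stopped \<sigma> \<omega>)"
      using t(1) q(3) pos by (intro exI[of _ t]) auto
  qed
qed

lemma zero_null:
  assumes "0 < w" "w \<le> T"
  shows "AE \<omega> in M. X w \<omega> \<noteq> 0"
proof -
  have 0: "0 \<in> {0..T}" and w: "w \<in> {0..T}" using assms by auto
  have "prob (space M \<inter> {\<omega>\<in>space M. (\<lambda>_. ereal 0) \<omega> < ereal w \<and> incr_after (\<lambda>_. ereal 0) w \<omega> \<in> {0}}) = 0"
    by (subst strong_markov_set[OF stopping_const[OF 0] w pre_const[OF 0 space_F_in[OF 0]]])
      (simp_all add: measure_def std_normal_singleton del: emeasure_density)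
  moreover have "space M \<inter> {\<omega>\<in>space M. (\<lambda>_. ereal 0) \<omega> < ereal w \<and> incr_after (\<lambda>_. ereal 0) w \<omega> \<in> {0}} = {\<omega>\<in>space M. X w \<omega> = 0}"
    using assms X_0 by (auto simp: incr_after_def stopped_def)
  ultimately have "prob {\<omega>\<in>space M. X w \<omega> = 0} = 0" by (simp only:)
  moreover have "{\<omega>\<in>space M. X w \<omega> = 0} \<in> sets M" using X_meas[OF w] by measurable
  ultimately have "{\<omega>\<in>space M. X w \<omega> = 0} \<in> null_sets M"
    by (simp add: null_sets_def emeasure_eq_measure)
  from AE_not_in[OF this] show ?thesis
    by (rule AE_mp) simp
qed

end

section \<open>Excursions\<close>

lemma std_normal_le_eq:
  assumes c: "0 \<le> c" and z: "z \<noteq> 0"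
  shows "emeasure std_normal_distribution {y. \<bar>y\<bar> \<le> c * \<bar>z\<bar>} =
    (\<integral>\<^sup>+x. ennreal (\<bar>z\<bar> * std_normal_density (z * x)) * indicator {-c..c} x \<partial>lborel)"
proof -
  have "emeasure std_normal_distribution {y. \<bar>y\<bar> \<le> c * \<bar>z\<bar>} =
      (\<integral>\<^sup>+y. ennreal (std_normal_density y) * indicator {y. \<bar>y\<bar> \<le> c * \<bar>z\<bar>} y \<partial>lborel)"
    by (subst emeasure_density) auto
  \<comment> \<open>The substitution y = z x introduces the slope x, whose range [-c, c] no longer
    depends on z; this prepares the exchange of integrals in \<open>gaussian_sector\<close>.\<close>
  also have "\<dots> = ennreal \<bar>z\<bar> * (\<integral>\<^sup>+x. ennreal (std_normal_density (0 + z * x)) * indicator {y. \<bar>y\<bar> \<le> c * \<bar>z\<bar>} (0 + z * x) \<partial>lborel)"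
    using z by (intro nn_integral_real_affine) auto
  also have "\<dots> = (\<integral>\<^sup>+x. ennreal \<bar>z\<bar> * (ennreal (std_normal_density (0 + z * x)) * indicator {y. \<bar>y\<bar> \<le> c * \<bar>z\<bar>} (0 + z * x)) \<partial>lborel)"
    by (intro nn_integral_cmult[symmetric]) measurable
  also have "\<dots> = (\<integral>\<^sup>+x. ennreal (\<bar>z\<bar> * std_normal_density (z * x)) * indicator {-c..c} x \<partial>lborel)"
  proof (intro nn_integral_cong)
    fix x :: real
    have "\<bar>0 + z * x\<bar> \<le> c * \<bar>z\<bar> \<longleftrightarrow> x \<in> {-c..c}"
      using z by (simp add: abs_mult mult.commute abs_le_iff) (simp add: abs_le_iff[symmetric], linarith)
    then show "ennreal \<bar>z\<bar> * (ennreal (std_normal_density (0 + z * x)) * indicator {y. \<bar>y\<bar> \<le> c * \<bar>z\<bar>} (0 + z * x)) =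
        ennreal (\<bar>z\<bar> * std_normal_density (z * x)) * indicator {-c..c} x"
      by (simp add: ennreal_mult indicator_def)
  qed
  finally show ?thesis .
qed

lemma gaussian_half_line:
  assumes k: "0 < k"
  shows "(\<integral>\<^sup>+z. ennreal (z * exp (- k * z\<^sup>2 / 2)) * indicator {0..} z \<partial>lborel) = ennreal (1 / k)"
proof -
  have "(\<integral>\<^sup>+z. ennreal (z * exp (- k * z\<^sup>2 / 2)) * indicator {0..} z \<partial>lborel) = ennreal (0 - (- (1 / k) * exp (- k * 0\<^sup>2 / 2)))"
  proof (rule nn_integral_FTC_atLeast)
    show "((\<lambda>z. - (1 / k) * exp (- k * z\<^sup>2 / 2)) has_real_derivative z * exp (- k * z\<^sup>2 / 2)) (at z)" for z
      using k by (auto intro!: derivative_eq_intros)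
    have "filterlim (\<lambda>z::real. k * z\<^sup>2 / 2) at_top at_top"
      using k by real_asymp
    then have "((\<lambda>z. exp (- (k * z\<^sup>2 / 2))) \<longlongrightarrow> 0) at_top"
      by (intro filterlim_compose[OF exp_at_bot] filterlim_compose[OF filterlim_uminus_at_bot_at_top])
    then have "((\<lambda>z. - (1 / k) * exp (- (k * z\<^sup>2 / 2))) \<longlongrightarrow> - (1 / k) * 0) at_top"
      by (intro tendsto_mult tendsto_const)
    then show "((\<lambda>z. - (1 / k) * exp (- k * z\<^sup>2 / 2)) \<longlongrightarrow> 0) at_top" by simp
  qed auto
  then show ?thesis by simp
qed

text \<open>The left-hand side is the probability that a planar Gaussian vector lies in the double-cone
  sector of slope at most \<open>c\<close> in the left half plane.\<close>

lemma gaussian_sector: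
  assumes c: "0 \<le> c"
  shows "(\<integral>\<^sup>+z. indicator {..<0} z * emeasure std_normal_distribution {y. \<bar>y\<bar> \<le> c * \<bar>z\<bar>} \<partial>std_normal_distribution) =
    ennreal (arctan c / pi)"
proof -
  define g where "g = (\<lambda>z x. ennreal (\<bar>z\<bar> * std_normal_density (z * x) * std_normal_density z) * indicator {..<0} z * indicator {-c..c} x)"
  have meas: "case_prod g \<in> borel_measurable (lborel \<Otimes>\<^sub>M lborel)"
    unfolding g_def by measurable
  have "(\<lambda>z. emeasure std_normal_distribution {y. \<bar>y\<bar> \<le> c * \<bar>z\<bar>}) \<in> borel_measurable borel"
  proof -
    interpret N: real_distribution std_normal_distribution by (rule real_dist_normal_dist)
    have "{x \<in> space (borel \<Otimes>\<^sub>M std_normal_distribution). \<bar>snd x\<bar> \<le> c * \<bar>fst x\<bar>} \<in> sets (borel \<Otimes>\<^sub>M std_normal_distribution)"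
      by measurable
    from this[THEN N.measurable_emeasure_Pair] show ?thesis
      by (simp add: space_pair_measure)
  qed
  then have "(\<integral>\<^sup>+z. indicator {..<0} z * emeasure std_normal_distribution {y. \<bar>y\<bar> \<le> c * \<bar>z\<bar>} \<partial>std_normal_distribution) =
      (\<integral>\<^sup>+z. ennreal (std_normal_density z) * (indicator {..<0} z * emeasure std_normal_distribution {y. \<bar>y\<bar> \<le> c * \<bar>z\<bar>}) \<partial>lborel)"
    by (subst nn_integral_density) auto
  also have "\<dots> = (\<integral>\<^sup>+z. \<integral>\<^sup>+x. g z x \<partial>lborel \<partial>lborel)"
  proof (intro nn_integral_cong)
    fix z :: real
    show "ennreal (std_normal_density z) * (indicator {..<0} z * emeasure std_normal_distribution {y. \<bar>y\<bar> \<le> c * \<bar>z\<bar>}) = (\<integral>\<^sup>+x. g z x \<partial>lborel)"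
    proof (cases "z < 0")
      case True
      have "(\<integral>\<^sup>+x. g z x \<partial>lborel) = (\<integral>\<^sup>+x. ennreal (std_normal_density z) * (ennreal (\<bar>z\<bar> * std_normal_density (z * x)) * indicator {-c..c} x) \<partial>lborel)"
      proof (intro nn_integral_cong)
        fix x :: real
        have "ennreal (\<bar>z\<bar> * std_normal_density (z * x) * std_normal_density z) =
          ennreal (std_normal_density z) * ennreal (\<bar>z\<bar> * std_normal_density (z * x))"
          by (subst ennreal_mult'[symmetric]) (simp_all add: mult_ac)
        then show "g z x = ennreal (std_normal_density z) * (ennreal (\<bar>z\<bar> * std_normal_density (z * x)) * indicator {-c..c} x)"
          unfolding g_def using True by (simp only:) (simp add: indicator_def)
      qed
      also have "\<dots> = ennreal (std_normal_density z) * emeasure std_normal_distribution {y. \<bar>y\<bar> \<le> c * \<bar>z\<bar>}"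
        using True unfolding std_normal_le_eq[OF c less_imp_neq[OF True]] by (intro nn_integral_cmult) measurable
      finally show ?thesis using True by simp
    qed (simp add: g_def)
  qed
  \<comment> \<open>With the slope x outermost, the integral over z is elementary and leaves a
    multiple of 1 / (1 + x^2), the derivative of the arctangent.\<close>
  also have "\<dots> = (\<integral>\<^sup>+x. \<integral>\<^sup>+z. g z x \<partial>lborel \<partial>lborel)"
    using lborel_pair.Fubini'[OF meas] by simp
  also have "\<dots> = (\<integral>\<^sup>+x. ennreal (1 / (1 + x\<^sup>2) / (2 * pi)) * indicator {-c..c} x \<partial>lborel)"
  proof (intro nn_integral_cong)
    fix x :: real
    have k: "0 < 1 + x\<^sup>2" by (simp add: add_pos_nonneg)
    have "(\<integral>\<^sup>+z. g z x \<partial>lborel) = (\<integral>\<^sup>+z. g (0 + (-1) * z) x \<partial>lborel)"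
      using nn_integral_real_affine[of "\<lambda>z. g z x" "-1" 0] by (simp add: g_def)
    also have "\<dots> = (\<integral>\<^sup>+z. (ennreal (1 / (2 * pi)) * indicator {-c..c} x) * (ennreal (z * exp (- (1 + x\<^sup>2) * z\<^sup>2 / 2)) * indicator {0..} z) \<partial>lborel)"
    proof (intro nn_integral_cong)
      fix z :: real
      have "std_normal_density (z * x) * std_normal_density z = 1 / (2 * pi) * exp (- (1 + x\<^sup>2) * z\<^sup>2 / 2)"
        by (simp add: normal_density_def power_mult_distrib exp_add[symmetric] field_simps real_sqrt_mult_self)
      moreover have "std_normal_density (- z * x) = std_normal_density (z * x)" "std_normal_density (- z) = std_normal_density z"
        by (simp_all add: normal_density_def)
      ultimately show "g (0 + (-1) * z) x = ennreal (1 / (2 * pi)) * indicator {-c..c} x * (ennreal (z * exp (- (1 + x\<^sup>2) * z\<^sup>2 / 2)) * indicator {0..} z)"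
        by (cases "z = 0") (auto simp: g_def indicator_def ennreal_mult[symmetric] mult_ac)
    qed
    also have "\<dots> = (ennreal (1 / (2 * pi)) * indicator {-c..c} x) * ennreal (1 / (1 + x\<^sup>2))"
      using gaussian_half_line[OF k] by (subst nn_integral_cmult) auto
    also have "\<dots> = ennreal (1 / (1 + x\<^sup>2) / (2 * pi)) * indicator {-c..c} x"
      using k by (simp add: ennreal_mult[symmetric] indicator_def)
    finally show "(\<integral>\<^sup>+z. g z x \<partial>lborel) = ennreal (1 / (1 + x\<^sup>2) / (2 * pi)) * indicator {-c..c} x" .
  qed
  also have "\<dots> = ennreal (arctan c / (2 * pi) - arctan (- c) / (2 * pi))"
  proof (rule nn_integral_FTC_Icc)
    show "((\<lambda>x. arctan x / (2 * pi)) has_real_derivative 1 / (1 + x\<^sup>2) / (2 * pi)) (at x)" for x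
      using DERIV_cdivide[OF DERIV_arctan[of x], of "2 * pi"]
      by (simp only: inverse_eq_divide)
  qed (use c in auto)
  also have "arctan c / (2 * pi) - arctan (- c) / (2 * pi) = arctan c / pi"
    by (simp add: arctan_minus field_simps)
  finally show ?thesis .
qed

text \<open>For a Brownian path at 0 at time d, the last zero before u has the arcsine density; the
  extra factor 1/2 selects a negative excursion. The integrand is singular at d, so the primitive is
  evaluated through one-sided limits; w < u stays away from the other singularity.\<close>

lemma arcsine_density:
  fixes d w u :: real
  assumes "d < w" "w < u"
  shows "(\<integral>\<^sup>+y. ennreal (1 / (2 * pi * sqrt ((y - d) * (u - y)))) * indicator {d<..<w} y \<partial>lborel) =
    ennreal (arctan (sqrt ((w - d) / (u - w))) / pi)"
proof -
  let ?F = "\<lambda>y. arctan (sqrt ((y - d) / (u - y))) / pi"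
  let ?f = "\<lambda>y. 1 / (2 * pi * sqrt ((y - d) * (u - y)))"
  have der: "(?F has_real_derivative ?f y) (at y)" if y: "d < y" "y < w" for y
  proof -
    let ?q = "(y - d) / (u - y)"
    have u: "0 < u - y" "0 < y - d" using y assms by auto
    then have q: "0 < ?q" by simp
    have "((\<lambda>y. (y - d) / (u - y)) has_real_derivative (u - d) / (u - y)\<^sup>2) (at y)"
      using u by (auto intro!: derivative_eq_intros simp: power2_eq_square field_simps)
    from DERIV_chain2[OF DERIV_real_sqrt[OF q] this]
    have "((\<lambda>y. sqrt ((y - d) / (u - y))) has_real_derivative inverse (sqrt ?q) / 2 * ((u - d) / (u - y)\<^sup>2)) (at y)" .
    from DERIV_chain2[OF DERIV_arctan this]
    have "((\<lambda>y. arctan (sqrt ((y - d) / (u - y)))) has_real_derivative inverse (1 + (sqrt ?q)\<^sup>2) * (inverse (sqrt ?q) / 2 * ((u - d) / (u - y)\<^sup>2))) (at y)" .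
    from DERIV_cdivide[OF this, of pi]
    have D: "(?F has_real_derivative inverse (1 + (sqrt ?q)\<^sup>2) * (inverse (sqrt ?q) / 2 * ((u - d) / (u - y)\<^sup>2)) / pi) (at y)" .
    have "1 + (sqrt ?q)\<^sup>2 = (u - d) / (u - y)" using q u by (simp add: field_simps)
    moreover have "sqrt ((y - d) * (u - y)) = sqrt ?q * (u - y)"
    proof -
      have "(y - d) * (u - y) = ?q * (u - y)\<^sup>2" using u by (simp add: power2_eq_square field_simps)
      then have "sqrt ((y - d) * (u - y)) = sqrt ?q * sqrt ((u - y)\<^sup>2)" by (simp only: real_sqrt_mult)
      then show ?thesis using u by (simp only: real_sqrt_abs abs_of_pos)
    qed
    moreover have "inverse (m / p) * (inverse r / 2 * (m / p\<^sup>2)) / pi = 1 / (2 * pi * (r * p))"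
      if "0 < m" "0 < p" "0 < r" for m p r :: real
      using that by (simp add: power2_eq_square field_simps)
    ultimately have "inverse (1 + (sqrt ?q)\<^sup>2) * (inverse (sqrt ?q) / 2 * ((u - d) / (u - y)\<^sup>2)) / pi = ?f y"
      using u q assms by (simp only: real_sqrt_gt_0_iff)
    with D show ?thesis by simp
  qed
  have contF: "continuous_on {d..w} ?F"
    using assms by (intro continuous_intros) auto
  have limA: "((?F \<circ> real_of_ereal) \<longlongrightarrow> 0) (at_right (ereal d))"
  proof -
    have "(?F \<longlongrightarrow> ?F d) (at_right d)"
      by (rule continuous_on_Icc_at_rightD[OF contF assms(1)])
    then show ?thesis unfolding ereal_tendsto_simps by (simp only: diff_self div_0 real_sqrt_zero arctan_zero_zero)
  qed
  have limB: "((?F \<circ> real_of_ereal) \<longlongrightarrow> ?F w) (at_left (ereal w))"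
  proof -
    have "(?F \<longlongrightarrow> ?F w) (at_left w)"
      by (rule continuous_on_Icc_at_leftD[OF contF assms(1)])
    then show ?thesis unfolding ereal_tendsto_simps .
  qed
  have isC: "isCont ?f y" if "d < y" "y < w" for y
    using that assms by (auto intro!: continuous_intros)
  have ft: "set_integrable lborel (einterval d w) ?f" "(LBINT y=d..w. ?f y) = ?F w - 0"
  proof -
    have d: "\<And>y. ereal d < ereal y \<Longrightarrow> ereal y < ereal w \<Longrightarrow> DERIV ?F y :> ?f y" using der by simp
    have i: "\<And>y. ereal d < ereal y \<Longrightarrow> ereal y < ereal w \<Longrightarrow> isCont ?f y" using isC by simp
    have n: "AE y in lborel. ereal d < ereal y \<longrightarrow> ereal y < ereal w \<longrightarrow> 0 \<le> ?f y"
      using assms by (intro AE_I2) simp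
    have dw: "ereal d < ereal w" using assms by simp
    show "set_integrable lborel (einterval d w) ?f" "(LBINT y=d..w. ?f y) = ?F w - 0"
      using interval_integral_FTC_nonneg[OF dw d i n limA limB] by blast+
  qed
  have "(\<integral>\<^sup>+y. ennreal (?f y) * indicator {d<..<w} y \<partial>lborel) = (\<integral>\<^sup>+y. ennreal (indicator {d<..<w} y *\<^sub>R ?f y) \<partial>lborel)"
    by (intro nn_integral_cong) (simp add: indicator_def)
  also have "\<dots> = ennreal (LBINT y:{d<..<w}. ?f y)"
    unfolding set_lebesgue_integral_def
    using ft(1) assms by (intro nn_integral_eq_integral) (auto simp: set_integrable_def indicator_def)
  also have "(LBINT y:{d<..<w}. ?f y) = ?F w"
    using ft(2) assms by (simp add: interval_lebesgue_integral_def)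
  finally show ?thesis .
qed

section \<open>Last and next zeros of a continuous path\<close>

lemma last_zero_eqI:
  assumes "0 \<le> g" "g \<le> t" "Z g \<omega> = 0" "\<And>s. g < s \<Longrightarrow> s \<le> t \<Longrightarrow> Z s \<omega> \<noteq> 0"
  shows "last_zero Z t \<omega> = g"
  unfolding last_zero_def
proof (rule cSup_eq_maximum)
  show "g \<in> {s\<in>{0..t}. Z s \<omega> = 0}" using assms by simp
  show "s \<le> g" if "s \<in> {s\<in>{0..t}. Z s \<omega> = 0}" for s
    using assms(4)[of s] that by (cases "g < s") auto
qed

lemma last_zero_spec:
  assumes c: "continuous_on {0..t} (\<lambda>s. Z s \<omega>)" and z: "Z 0 \<omega> = 0" and t: "0 \<le> t"
  shows "0 \<le> last_zero Z t \<omega>" "last_zero Z t \<omega> \<le> t" "Z (last_zero Z t \<omega>) \<omega> = 0"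
    "\<And>s. last_zero Z t \<omega> < s \<Longrightarrow> s \<le> t \<Longrightarrow> Z s \<omega> \<noteq> 0"
proof -
  let ?S = "{s\<in>{0..t}. Z s \<omega> = 0}"
  have "closed ?S" using c by (intro continuous_closed_preimage_constant) auto
  moreover have "bounded ?S" by (rule bounded_subset[of "{0..t}"]) auto
  ultimately have "compact ?S" by (simp add: compact_eq_bounded_closed)
  moreover have "?S \<noteq> {}" using z t by (auto intro!: exI[of _ 0])
  ultimately obtain g where g: "g \<in> ?S" "\<And>s. s \<in> ?S \<Longrightarrow> s \<le> g"
    using compact_attains_sup[of ?S] by blast
  have ne: "Z s \<omega> \<noteq> 0" if "g < s" "s \<le> t" for s
    using g(2)[of s] g(1) that by auto
  have "last_zero Z t \<omega> = g" using g(1) ne by (intro last_zero_eqI) auto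
  then show "0 \<le> last_zero Z t \<omega>" "last_zero Z t \<omega> \<le> t" "Z (last_zero Z t \<omega>) \<omega> = 0"
    "\<And>s. last_zero Z t \<omega> < s \<Longrightarrow> s \<le> t \<Longrightarrow> Z s \<omega> \<noteq> 0"
    using g(1) ne by auto
qed

lemma continuous_no_zero_neg:
  fixes f :: "real \<Rightarrow> real"
  assumes c: "continuous_on {a..b} f" and nz: "\<And>s. a \<le> s \<Longrightarrow> s \<le> b \<Longrightarrow> f s \<noteq> 0"
    and p: "p \<in> {a..b}" "f p < 0" and q: "q \<in> {a..b}"
  shows "f q < 0"
proof (rule ccontr)
  assume "\<not> f q < 0"
  then have fq: "0 \<le> f q" by simp
  show False
  proof (cases "p \<le> q")
    case True
    have "continuous_on {p..q} f" using c p q by (intro continuous_on_subset[OF c]) auto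
    then obtain x where "p \<le> x" "x \<le> q" "f x = 0" using IVT'[of f p 0 q] p fq True by auto
    then show False using nz[of x] p q by auto
  next
    case False
    have "continuous_on {q..p} f" using c p q by (intro continuous_on_subset[OF c]) auto
    then obtain x where "q \<le> x" "x \<le> p" "f x = 0" using IVT2'[of f p 0 q] p fq False by auto
    then show False using nz[of x] p q by auto
  qed
qed

lemma std_normal_abs_measurable: "(\<lambda>c. emeasure std_normal_distribution {z. \<bar>z\<bar> \<le> c}) \<in> borel_measurable borel"
proof -
  interpret N: real_distribution std_normal_distribution by (rule real_dist_normal_dist)
  have "{x \<in> space (borel \<Otimes>\<^sub>M std_normal_distribution). \<bar>snd x\<bar> \<le> fst x} \<in> sets (borel \<Otimes>\<^sub>M std_normal_distribution)"
    by measurable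
  from this[THEN N.measurable_emeasure_Pair] show ?thesis
    by (simp add: space_pair_measure)
qed

context brownian
begin

lemma last_zero_X:
  assumes "\<omega> \<in> space M" "t \<in> {0..T}"
  shows "0 \<le> last_zero X t \<omega>" "last_zero X t \<omega> \<le> t" "X (last_zero X t \<omega>) \<omega> = 0"
    "\<And>s. last_zero X t \<omega> < s \<Longrightarrow> s \<le> t \<Longrightarrow> X s \<omega> \<noteq> 0"
proof -
  have c: "continuous_on {0..t} (\<lambda>s. X s \<omega>)"
    using assms by (intro continuous_on_subset[OF cont]) auto
  have t: "0 \<le> t" using assms by simp
  note spec = last_zero_spec[where Z=X, OF c X_0[OF assms(1)] t]
  show "0 \<le> last_zero X t \<omega>" "last_zero X t \<omega> \<le> t" "X (last_zero X t \<omega>) \<omega> = 0"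
    by (rule spec)+
  show "X s \<omega> \<noteq> 0" if "last_zero X t \<omega> < s" "s \<le> t" for s
    using that by (rule spec(4))
qed

definition next_zero :: "real \<Rightarrow> 'a \<Rightarrow> ereal" where
  "next_zero w = hit (\<lambda>_. ereal w) (\<lambda>\<omega>. - X w \<omega>)"

lemma pre_const_measurable:
  assumes "w \<in> {0..T}" "f \<in> measurable (F w) N"
  shows "f \<in> measurable (pre (\<lambda>_. ereal w)) N"
proof (rule measurableI)
  fix A assume "A \<in> sets N"
  then have "f -` A \<inter> space (F w) \<in> sets (F w)" using assms(2) by (rule measurable_sets[rotated])
  then show "f -` A \<inter> space (pre (\<lambda>_. ereal w)) \<in> sets (pre (\<lambda>_. ereal w))"
    unfolding space_pre space_F[OF assms(1)] by (rule pre_const[OF assms(1)])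
qed (use measurable_space[OF assms(2)] space_F[OF assms(1)] in simp)

lemma stopping_next_zero: "w \<in> {0..T} \<Longrightarrow> stopping (next_zero w)"
  unfolding next_zero_def using adapted
  by (intro stopping_hit stopping_const pre_const_measurable borel_measurable_uminus)

lemma stopped_const [simp]: "stopped (\<lambda>_. ereal w) \<omega> = X w \<omega>"
  by (simp add: stopped_def)

lemma next_zero_cases:
  assumes w: "w \<in> {0..T}" and om: "\<omega> \<in> space M"
  obtains "next_zero w \<omega> = \<infinity>" "\<And>t. w \<le> t \<Longrightarrow> t \<le> T \<Longrightarrow> X t \<omega> \<noteq> 0"
  | s where "next_zero w \<omega> = ereal s" "w \<le> s" "s \<le> T" "X s \<omega> = 0"
     "\<And>t. w \<le> t \<Longrightarrow> t < s \<Longrightarrow> X t \<omega> \<noteq> 0"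
proof (cases rule: hit_cases[OF stopping_const[OF w] om, of "\<lambda>\<omega>. - X w \<omega>"])
  case 1
  show thesis
  proof (rule that(1))
    show "next_zero w \<omega> = \<infinity>" using 1(1) by (simp add: next_zero_def)
    show "X t \<omega> \<noteq> 0" if "w \<le> t" "t \<le> T" for t using 1(2)[of t] that w by simp
  qed
next
  case (2 s)
  show thesis
  proof (rule that(2))
    show "next_zero w \<omega> = ereal s" using 2(1) by (simp add: next_zero_def)
    show "w \<le> s" "s \<le> T" "X s \<omega> = 0" using 2(2-5) by simp_all
    show "X t \<omega> \<noteq> 0" if "w \<le> t" "t < s" for t using 2(6)[of t] 2(3) that w by auto
  qed
qed

lemma next_zero_greater_iff:
  assumes w: "w \<in> {0..T}" and om: "\<omega> \<in> space M" and v: "v \<in> {0..T}"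
  shows "ereal v < next_zero w \<omega> \<longleftrightarrow> (\<forall>s\<in>{w..v}. X s \<omega> \<noteq> 0)"
proof (cases rule: next_zero_cases[OF w om])
  case 1
  then show ?thesis using v by auto
next
  case (2 s)
  then show ?thesis using v w by (auto simp: 2(1))
qed

lemma stopped_next_zero:
  assumes "w \<in> {0..T}" "\<omega> \<in> space M"
  shows "stopped (next_zero w) \<omega> = 0"
  by (cases rule: next_zero_cases[OF assms]) (use assms in \<open>auto simp: stopped_def X_0\<close>)

text \<open>Last zeros are not stopping times but next zeros are; this duality reduces every event
  about \<open>last_zero\<close> to a hitting time and yields its adaptedness.\<close>

lemma last_zero_less_iff:
  assumes om: "\<omega> \<in> space M" and v: "v \<in> {0..T}" and w: "0 \<le> w" "w \<le> v"
  shows "last_zero X v \<omega> < w \<longleftrightarrow> ereal v < next_zero w \<omega>"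
proof -
  have w': "w \<in> {0..T}" using w v by auto
  show ?thesis unfolding next_zero_greater_iff[OF w' om v]
  proof
    assume "last_zero X v \<omega> < w"
    then show "\<forall>s\<in>{w..v}. X s \<omega> \<noteq> 0" using last_zero_X(4)[OF om v] by auto
  next
    assume nz: "\<forall>s\<in>{w..v}. X s \<omega> \<noteq> 0"
    show "last_zero X v \<omega> < w"
      using last_zero_X(2,3)[OF om v] nz by (meson atLeastAtMost_iff not_le)
  qed
qed

lemma last_zero_adapted:
  assumes v: "v \<in> {0..T}"
  shows "last_zero X v \<in> borel_measurable (F v)"
proof (rule borel_measurableI_less)
  fix w :: real
  consider "w < 0" | "0 \<le> w" "w \<le> v" | "v < w" by linarith
  then show "{\<omega>\<in>space (F v). last_zero X v \<omega> < w} \<in> sets (F v)"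
    unfolding space_F[OF v]
  proof cases
    case 1
    then have "{\<omega>\<in>space M. last_zero X v \<omega> < w} = {}" using last_zero_X(1)[OF _ v] by fastforce
    then show "{\<omega>\<in>space M. last_zero X v \<omega> < w} \<in> sets (F v)" by (simp only: sets.empty_sets)
  next
    case 2
    then have "{\<omega>\<in>space M. last_zero X v \<omega> < w} = space M - {\<omega>\<in>space M. next_zero w \<omega> \<le> ereal v}"
      using last_zero_less_iff[OF _ v] by (auto simp: not_le)
    moreover have "\<dots> \<in> sets (F v)"
    proof -
      have "w \<in> {0..T}" using 2 v by auto
      from stoppingD[OF stopping_next_zero[OF this] v] show ?thesis
        using space_F_in[OF v] by (rule sets.Diff[rotated])
    qed
    ultimately show "{\<omega>\<in>space M. last_zero X v \<omega> < w} \<in> sets (F v)" by (simp only:)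
  next
    case 3
    then have "{\<omega>\<in>space M. last_zero X v \<omega> < w} = space M" using last_zero_X(2)[OF _ v] by fastforce
    then show "{\<omega>\<in>space M. last_zero X v \<omega> < w} \<in> sets (F v)" using space_F_in[OF v] by (simp only:)
  qed
qed

lemma last_zero_measurable: "v \<in> {0..T} \<Longrightarrow> last_zero X v \<in> borel_measurable M"
  by (rule measurable_F[OF _ last_zero_adapted])

section \<open>The law of the last zero on a negative excursion\<close>

definition neg_excursion :: "('a \<Rightarrow> ereal) \<Rightarrow> real \<Rightarrow> real \<Rightarrow> 'a set" where
  "neg_excursion D r v = {\<omega>\<in>space M. D \<omega> < ereal r \<and> last_zero X v \<omega> < r \<and> X v \<omega> < 0}"

lemma neg_excursion_meas:
  assumes "stopping D" "v \<in> {0..T}"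
  shows "neg_excursion D r v \<in> sets M"
proof -
  note [measurable] = stopping_measurable[OF assms(1)] last_zero_measurable[OF assms(2)] X_meas[OF assms(2)]
  show ?thesis unfolding neg_excursion_def by measurable
qed

text \<open>The event says that the path is negative at the fixed time w and has no zero on [w, v].
  Reflection at w turns the second part into |y| \<le> |X w| / sqrt (v - w) with y normal; the
  strong Markov property at \<open>D\<close> writes X w as sqrt (w - D) z with z normal. So (z, y)
  lies in a sector of slope sqrt ((w - D) / (v - w)), whose probability is given by
  \<open>gaussian_sector\<close>.\<close>

lemma neg_excursion_prob:
  assumes D: "stopping D" and D0: "\<And>\<omega>. \<omega> \<in> space M \<Longrightarrow> stopped D \<omega> = 0"
    and C: "C \<in> sets (pre D)" and w: "0 < w" "w < v" "v \<le> T"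
  shows "emeasure M (C \<inter> neg_excursion D w v) =
    (\<integral>\<^sup>+\<omega>. indicator (C \<inter> {\<omega>\<in>space M. D \<omega> < ereal w}) \<omega> *
      ennreal (arctan (sqrt ((w - real_of_ereal (D \<omega>)) / (v - w))) / pi) \<partial>M)"
proof -
  interpret N: real_distribution std_normal_distribution by (rule real_dist_normal_dist)
  have wT: "w \<in> {0..T}" and vT: "v \<in> {0..T}" using w by auto
  have CM: "C \<in> sets M" using C sets_pre[OF D] by blast
  have sub: "C \<subseteq> space M" using CM sets.sets_into_space by blast
  let ?B = "C \<inter> {\<omega>\<in>space M. D \<omega> < ereal w} \<inter> {\<omega>\<in>space M. X w \<omega> < 0}"
  have B: "?B \<in> sets (F w)"
  proof (rule sets.Int[OF pre_less_in[OF D C wT]])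
    have "{\<omega>\<in>space (F w). X w \<omega> < 0} \<in> sets (F w)"
      using adapted[OF wT] by measurable
    then show "{\<omega>\<in>space M. X w \<omega> < 0} \<in> sets (F w)" by (simp only: space_F[OF wT])
  qed
  have Xw: "X w \<in> borel_measurable (pre (\<lambda>_. ereal w))"
    by (rule pre_const_measurable[OF wT adapted[OF wT]])
  have eq: "C \<inter> neg_excursion D w v = ?B \<inter> {\<omega>\<in>space M. ereal v < next_zero w \<omega>}"
  proof (rule set_eqI)
    fix \<omega>
    show "\<omega> \<in> C \<inter> neg_excursion D w v \<longleftrightarrow> \<omega> \<in> ?B \<inter> {\<omega>\<in>space M. ereal v < next_zero w \<omega>}"
    proof (cases "\<omega> \<in> C")
      case True
      then have om: "\<omega> \<in> space M" using sub by blast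
      have l: "last_zero X v \<omega> < w \<longleftrightarrow> ereal v < next_zero w \<omega>"
        using w by (intro last_zero_less_iff[OF om vT]) auto
      have sgn: "X v \<omega> < 0 \<longleftrightarrow> X w \<omega> < 0" if "ereal v < next_zero w \<omega>"
      proof -
        have nz: "\<And>s. w \<le> s \<Longrightarrow> s \<le> v \<Longrightarrow> X s \<omega> \<noteq> 0"
          using that next_zero_greater_iff[OF wT om vT] by simp
        have c: "continuous_on {w..v} (\<lambda>s. X s \<omega>)"
          using w by (intro continuous_on_subset[OF cont[OF om]]) auto
        show ?thesis
          using continuous_no_zero_neg[OF c nz, of w v] continuous_no_zero_neg[OF c nz, of v w] w by auto
      qed
      show ?thesis using True om l sgn unfolding neg_excursion_def by blast
    qed simp
  qed
  have "emeasure M (C \<inter> neg_excursion D w v) =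
     (\<integral>\<^sup>+\<omega>. indicator ?B \<omega> * indicator {\<omega>\<in>space M. ereal w < ereal v \<and> ereal v < hit (\<lambda>_. ereal w) (\<lambda>\<omega>. - X w \<omega>) \<omega>} \<omega> \<partial>M)"
  proof -
    have "?B \<inter> {\<omega>\<in>space M. ereal v < next_zero w \<omega>} \<in> sets M"
      unfolding eq[symmetric] using CM neg_excursion_meas[OF D vT] by blast
    then have "emeasure M (C \<inter> neg_excursion D w v) = (\<integral>\<^sup>+\<omega>. indicator (?B \<inter> {\<omega>\<in>space M. ereal v < next_zero w \<omega>}) \<omega> \<partial>M)"
      by (simp only: eq nn_integral_indicator)
    then show ?thesis using w(2) by (simp only: indicator_inter_arith next_zero_def less_ereal.simps simp_thms)
  qed
  also have "\<dots> = (\<integral>\<^sup>+\<omega>. indicator ?B \<omega> * indicator {\<omega>\<in>space M. ereal w < ereal v} \<omega> *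
      emeasure std_normal_distribution {z. \<bar>z\<bar> \<le> \<bar>- X w \<omega>\<bar> / sqrt (v - real_of_ereal (ereal w))} \<partial>M)"
  proof (rule hit_greater_prob[OF stopping_const[OF wT] _ vT])
    show "(\<lambda>\<omega>. - X w \<omega>) \<in> borel_measurable (pre (\<lambda>_. ereal w))" using Xw by measurable
    show "indicator ?B \<in> borel_measurable (pre (\<lambda>_. ereal w))"
      by (rule borel_measurable_indicator[OF pre_const[OF wT B]])
  qed (simp add: indicator_def)
  also have "\<dots> = (\<integral>\<^sup>+\<omega>. indicator {\<omega>\<in>space M. D \<omega> < ereal w} \<omega> *
      (\<lambda>(\<omega>, z). indicator C \<omega> * (indicator {..<0} z * emeasure std_normal_distribution {y. \<bar>y\<bar> \<le> sqrt ((w - real_of_ereal (D \<omega>)) / (v - w)) * \<bar>z\<bar>}))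
         (\<omega>, incr_after D w \<omega>) \<partial>M)"
  proof (rule nn_integral_cong)
    fix \<omega> assume om: "\<omega> \<in> space M"
    show "indicator ?B \<omega> * indicator {\<omega>\<in>space M. ereal w < ereal v} \<omega> *
        emeasure std_normal_distribution {z. \<bar>z\<bar> \<le> \<bar>- X w \<omega>\<bar> / sqrt (v - real_of_ereal (ereal w))} =
      indicator {\<omega>\<in>space M. D \<omega> < ereal w} \<omega> *
      (\<lambda>(\<omega>, z). indicator C \<omega> * (indicator {..<0} z * emeasure std_normal_distribution {y. \<bar>y\<bar> \<le> sqrt ((w - real_of_ereal (D \<omega>)) / (v - w)) * \<bar>z\<bar>}))
         (\<omega>, incr_after D w \<omega>)"
    proof (cases "D \<omega> < ereal w")
      case True
      obtain d where d: "D \<omega> = ereal d" "d < w" by (rule stopping_lessE[OF D om True])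
      have i: "incr_after D w \<omega> = X w \<omega> / sqrt (w - d)" using D0[OF om] d by (simp add: incr_after_def)
      have neg: "incr_after D w \<omega> < 0 \<longleftrightarrow> X w \<omega> < 0" using d(2) by (simp add: i divide_less_0_iff)
      have "sqrt ((w - d) / (v - w)) * \<bar>incr_after D w \<omega>\<bar> = \<bar>X w \<omega>\<bar> / sqrt (v - w)"
        using d(2) w by (simp add: i real_sqrt_divide abs_divide)
      then show ?thesis using om True neg w(2) d(1) by (auto simp: indicator_def)
    qed simp
  qed
  also have "\<dots> = (\<integral>\<^sup>+\<omega>. indicator {\<omega>\<in>space M. D \<omega> < ereal w} \<omega> *
      (\<integral>\<^sup>+z. (\<lambda>(\<omega>, z). indicator C \<omega> * (indicator {..<0} z * emeasure std_normal_distribution {y. \<bar>y\<bar> \<le> sqrt ((w - real_of_ereal (D \<omega>)) / (v - w)) * \<bar>z\<bar>}))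
         (\<omega>, z) \<partial>std_normal_distribution) \<partial>M)"
  proof (rule strong_markov[OF D wT])
    note [measurable] = stopping_measurable_pre[OF D] C
    have "(\<lambda>x. sqrt ((w - real_of_ereal (D (fst x))) / (v - w)) * \<bar>snd x\<bar>) \<in> borel_measurable (pre D \<Otimes>\<^sub>M (borel :: real measure))"
      by measurable
    from measurable_compose[OF this std_normal_abs_measurable]
    have [measurable]: "(\<lambda>x. emeasure std_normal_distribution {y. \<bar>y\<bar> \<le> sqrt ((w - real_of_ereal (D (fst x))) / (v - w)) * \<bar>snd x\<bar>}) \<in> borel_measurable (pre D \<Otimes>\<^sub>M (borel :: real measure))" .
    show "(\<lambda>(\<omega>, z). indicator C \<omega> * (indicator {..<0} z * emeasure std_normal_distribution {y. \<bar>y\<bar> \<le> sqrt ((w - real_of_ereal (D \<omega>)) / (v - w)) * \<bar>z\<bar>})) \<in> borel_measurable (pre D \<Otimes>\<^sub>M (borel :: real measure))"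
      unfolding case_prod_beta by measurable
  qed
  also have "\<dots> = (\<integral>\<^sup>+\<omega>. indicator (C \<inter> {\<omega>\<in>space M. D \<omega> < ereal w}) \<omega> *
      ennreal (arctan (sqrt ((w - real_of_ereal (D \<omega>)) / (v - w))) / pi) \<partial>M)"
  proof (rule nn_integral_cong)
    fix \<omega> assume om: "\<omega> \<in> space M"
    show "indicator {\<omega>\<in>space M. D \<omega> < ereal w} \<omega> *
      (\<integral>\<^sup>+z. (\<lambda>(\<omega>, z). indicator C \<omega> * (indicator {..<0} z * emeasure std_normal_distribution {y. \<bar>y\<bar> \<le> sqrt ((w - real_of_ereal (D \<omega>)) / (v - w)) * \<bar>z\<bar>}))
         (\<omega>, z) \<partial>std_normal_distribution) = indicator (C \<inter> {\<omega>\<in>space M. D \<omega> < ereal w}) \<omega> *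
      ennreal (arctan (sqrt ((w - real_of_ereal (D \<omega>)) / (v - w))) / pi)"
    proof (cases "D \<omega> < ereal w")
      case True
      obtain d where d: "D \<omega> = ereal d" "d < w" by (rule stopping_lessE[OF D om True])
      then have "0 \<le> sqrt ((w - real_of_ereal (D \<omega>)) / (v - w))" using w by simp
      from gaussian_sector[OF this] show ?thesis using True om
        by (cases "\<omega> \<in> C") (simp_all add: indicator_inter_arith)
    qed simp
  qed
  finally show ?thesis .
qed

text \<open>The halved arcsine density of the last zero before v for a path that vanishes at
  \<open>D\<close>, averaged over \<open>D\<close> on C.\<close>

definition excursion_density :: "('a \<Rightarrow> ereal) \<Rightarrow> 'a set \<Rightarrow> real \<Rightarrow> real \<Rightarrow> ennreal" where
  "excursion_density D C v y = (\<integral>\<^sup>+\<omega>. indicator C \<omega> * indicator {\<omega>\<in>space M. D \<omega> < ereal y} \<omega> *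
     ennreal (1 / (2 * pi * sqrt ((y - real_of_ereal (D \<omega>)) * (v - y)))) \<partial>M)"

lemma excursion_density_pair_measurable:
  assumes D: "stopping D" and C: "C \<in> sets M"
  shows "(\<lambda>(y, \<omega>). indicator C \<omega> * indicator {\<omega>\<in>space M. D \<omega> < ereal y} \<omega> *
     ennreal (1 / (2 * pi * sqrt ((y - real_of_ereal (D \<omega>)) * (v - y))))) \<in> borel_measurable (lborel \<Otimes>\<^sub>M M)"
proof -
  note [measurable] = stopping_measurable[OF D] C
  have "{p\<in>space (lborel \<Otimes>\<^sub>M M). D (snd p) < ereal (fst p)} \<in> sets (lborel \<Otimes>\<^sub>M M)"
    by measurable
  then have "(\<lambda>p. indicator C (snd p) * indicator {p\<in>space (lborel \<Otimes>\<^sub>M M). D (snd p) < ereal (fst p)} p *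
     ennreal (1 / (2 * pi * sqrt ((fst p - real_of_ereal (D (snd p))) * (v - fst p))))) \<in> borel_measurable (lborel \<Otimes>\<^sub>M M)"
    by measurable
  then show ?thesis
    by (rule measurable_cong[THEN iffD1, rotated]) (auto simp: space_pair_measure indicator_def)
qed

lemma excursion_density_measurable:
  assumes D: "stopping D" and C: "C \<in> sets M"
  shows "excursion_density D C v \<in> borel_measurable lborel"
proof -
  from borel_measurable_nn_integral_fst[OF excursion_density_pair_measurable[OF D C, of v]]
  show ?thesis unfolding excursion_density_def by simp
qed

text \<open>Both sides integrate h against a measure on the line. The two measures agree on
  half-lines because \<open>arcsine_density\<close> integrates to the arctangent of
  \<open>neg_excursion_prob\<close>, with Fubini exchanging y and the random
  \<open>D\<close>.\<close>

lemma neg_excursion_law: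
  assumes D: "stopping D" and D0: "\<And>\<omega>. \<omega> \<in> space M \<Longrightarrow> stopped D \<omega> = 0"
    and C: "C \<in> sets (pre D)" and r: "0 < r" "r < v" "v \<le> T" and h: "h \<in> borel_measurable borel"
  shows "(\<integral>\<^sup>+\<omega>. indicator (C \<inter> neg_excursion D r v) \<omega> * h (last_zero X v \<omega>) \<partial>M) =
    (\<integral>\<^sup>+y. excursion_density D C v y * indicator {0<..<r} y * h y \<partial>lborel)"
proof -
  interpret L: pair_sigma_finite lborel M ..
  have vT: "v \<in> {0..T}" using r by auto
  have CM: "C \<in> sets M" using C sets_pre[OF D] by blast
  let ?A = "C \<inter> neg_excursion D r v"
  have A: "?A \<in> sets M" using CM neg_excursion_meas[OF D vT] by blast
  note [measurable] = A last_zero_measurable[OF vT] h excursion_density_measurable[OF D CM]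
  define \<mu> where "\<mu> = distr (density M (indicator ?A)) borel (last_zero X v)"
  define \<nu> where "\<nu> = density lborel (\<lambda>y. excursion_density D C v y * indicator {0<..<r} y)"
  have lm: "last_zero X v \<in> borel_measurable (density M (indicator ?A))" by simp
  have emu: "emeasure \<mu> {..<x} = emeasure M (?A \<inter> {\<omega>\<in>space M. last_zero X v \<omega> < x})" for x
  proof -
    have e: "last_zero X v -` {..<x} \<inter> space M = {\<omega>\<in>space M. last_zero X v \<omega> < x}" by auto
    have "{\<omega>\<in>space M. last_zero X v \<omega> < x} \<in> sets M" by measurable
    then show ?thesis unfolding \<mu>_def
      by (simp add: emeasure_distr[OF lm] e emeasure_density A flip: indicator_inter_arith)
  qed
  have enu: "emeasure \<nu> {..<x} = (\<integral>\<^sup>+y. excursion_density D C v y * indicator {0<..<min x r} y \<partial>lborel)" for x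
    unfolding \<nu>_def by (subst emeasure_density) (auto intro!: nn_integral_cong simp: indicator_def)
  have "\<mu> = \<nu>"
  proof (rule measure_eqI_Iio)
    show "sets \<mu> = sets borel" "sets \<nu> = sets borel" by (simp_all add: \<mu>_def \<nu>_def)
    fix x
    show "emeasure \<mu> {..<x} \<noteq> \<infinity>" unfolding emu by (simp add: emeasure_eq_measure)
    show "emeasure \<mu> {..<x} = emeasure \<nu> {..<x}"
    proof (cases "x \<le> 0")
      case True
      then have "{\<omega>\<in>space M. last_zero X v \<omega> < x} = {}" using last_zero_X(1)[OF _ vT] by fastforce
      then have "emeasure \<mu> {..<x} = 0" unfolding emu by (simp only: Int_empty_right emeasure_empty)
      moreover have "{0<..<min x r} = {}" using True by simp
      then have "emeasure \<nu> {..<x} = 0" unfolding enu by (simp only:) simp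
      ultimately show ?thesis by (simp only:)
    next
      case False
      define w where "w = min x r"
      have w: "0 < w" "w < v" "w \<le> r" using False r by (auto simp: w_def)
      have wT: "w \<in> {0..T}" using w r by auto
      have "?A \<inter> {\<omega>\<in>space M. last_zero X v \<omega> < x} = C \<inter> neg_excursion D w v"
      proof (rule set_eqI)
        fix \<omega>
        \<comment> \<open>The zero at \<open>D\<close> bounds the last zero from below. Lowering the
          threshold for the last zero from r to w therefore lowers it for \<open>D\<close> too, and
          the event keeps the shape of \<open>neg_excursion\<close>.\<close>
        have "D \<omega> < ereal w" if om: "\<omega> \<in> space M" and Dr: "D \<omega> < ereal r" and lt: "last_zero X v \<omega> < w"
        proof -
          obtain d where d: "D \<omega> = ereal d" "0 \<le> d" "d < r" by (rule stopping_lessE[OF D om Dr])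
          have "X d \<omega> = 0" using D0[OF om] d by (simp add: stopped_def)
          then have "d \<le> last_zero X v \<omega>" using last_zero_X(4)[OF om vT, of d] d r by force
          then show ?thesis using lt d by simp
        qed
        moreover have "D \<omega> < ereal w \<Longrightarrow> D \<omega> < ereal r" using w(3) less_le_trans[of "D \<omega>" "ereal w" "ereal r"] by simp
        moreover have "last_zero X v \<omega> < r \<and> last_zero X v \<omega> < x \<longleftrightarrow> last_zero X v \<omega> < w" by (auto simp: w_def)
        ultimately show "\<omega> \<in> ?A \<inter> {\<omega>\<in>space M. last_zero X v \<omega> < x} \<longleftrightarrow> \<omega> \<in> C \<inter> neg_excursion D w v"
          unfolding neg_excursion_def by blast
      qed
      then have "emeasure \<mu> {..<x} = (\<integral>\<^sup>+\<omega>. indicator (C \<inter> {\<omega>\<in>space M. D \<omega> < ereal w}) \<omega> *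
          ennreal (arctan (sqrt ((w - real_of_ereal (D \<omega>)) / (v - w))) / pi) \<partial>M)"
        unfolding emu by (simp only: neg_excursion_prob[OF D D0 C w(1,2) r(3)])
      also have "\<dots> = (\<integral>\<^sup>+\<omega>. \<integral>\<^sup>+y. indicator C \<omega> * indicator {\<omega>\<in>space M. D \<omega> < ereal y} \<omega> *
            ennreal (1 / (2 * pi * sqrt ((y - real_of_ereal (D \<omega>)) * (v - y)))) * indicator {0<..<w} y \<partial>lborel \<partial>M)"
      proof (rule nn_integral_cong)
        fix \<omega> assume om: "\<omega> \<in> space M"
        let ?I = "\<integral>\<^sup>+y. indicator C \<omega> * indicator {\<omega>\<in>space M. D \<omega> < ereal y} \<omega> *
            ennreal (1 / (2 * pi * sqrt ((y - real_of_ereal (D \<omega>)) * (v - y)))) * indicator {0<..<w} y \<partial>lborel"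
        show "indicator (C \<inter> {\<omega>\<in>space M. D \<omega> < ereal w}) \<omega> *
          ennreal (arctan (sqrt ((w - real_of_ereal (D \<omega>)) / (v - w))) / pi) = ?I"
        proof (cases "D \<omega> < ereal w")
          case True
          obtain d where d: "D \<omega> = ereal d" "0 \<le> d" "d < w" by (rule stopping_lessE[OF D om True])
          have "?I = (\<integral>\<^sup>+y. indicator C \<omega> * (ennreal (1 / (2 * pi * sqrt ((y - d) * (v - y)))) * indicator {d<..<w} y) \<partial>lborel)"
            using om d by (intro nn_integral_cong) (auto simp: indicator_def)
          also have "\<dots> = indicator C \<omega> * ennreal (arctan (sqrt ((w - d) / (v - w))) / pi)"
            by (subst nn_integral_cmult) (simp_all add: arcsine_density[OF d(3) w(2)])
          finally show ?thesis using True om d(1) by (simp add: indicator_inter_arith)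
        next
          case False
          have "\<not> D \<omega> < ereal y" if "y < w" for y
            using False that by (meson less_ereal.simps(1) less_trans)
          then have "?I = (\<integral>\<^sup>+y. 0 \<partial>(lborel :: real measure))"
            by (intro nn_integral_cong) (auto simp: indicator_def)
          then show ?thesis using False by simp
        qed
      qed
      also have "\<dots> = (\<integral>\<^sup>+y. \<integral>\<^sup>+\<omega>. indicator C \<omega> * indicator {\<omega>\<in>space M. D \<omega> < ereal y} \<omega> *
            ennreal (1 / (2 * pi * sqrt ((y - real_of_ereal (D \<omega>)) * (v - y)))) * indicator {0<..<w} y \<partial>M \<partial>lborel)"
      proof (rule L.Fubini')
        note [measurable] = excursion_density_pair_measurable[OF D CM, of v]
        have "(\<lambda>p. (case p of (y, \<omega>) \<Rightarrow> indicator C \<omega> * indicator {\<omega>\<in>space M. D \<omega> < ereal y} \<omega> *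
            ennreal (1 / (2 * pi * sqrt ((y - real_of_ereal (D \<omega>)) * (v - y))))) * indicator {0<..<w} (fst p)) \<in> borel_measurable (lborel \<Otimes>\<^sub>M M)"
          by (intro borel_measurable_times_ennreal excursion_density_pair_measurable[OF D CM, of v]) measurable
        then show "(\<lambda>(y, \<omega>). indicator C \<omega> * indicator {\<omega>\<in>space M. D \<omega> < ereal y} \<omega> *
            ennreal (1 / (2 * pi * sqrt ((y - real_of_ereal (D \<omega>)) * (v - y)))) * indicator {0<..<w} y) \<in> borel_measurable (lborel \<Otimes>\<^sub>M M)"
          by (simp add: case_prod_beta)
      qed
      also have "\<dots> = (\<integral>\<^sup>+y. excursion_density D C v y * indicator {0<..<w} y \<partial>lborel)"
      proof (rule nn_integral_cong)
        fix y :: real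
        show "(\<integral>\<^sup>+\<omega>. indicator C \<omega> * indicator {\<omega>\<in>space M. D \<omega> < ereal y} \<omega> *
            ennreal (1 / (2 * pi * sqrt ((y - real_of_ereal (D \<omega>)) * (v - y)))) * indicator {0<..<w} y \<partial>M) =
            excursion_density D C v y * indicator {0<..<w} y"
          unfolding excursion_density_def by (simp add: indicator_def)
      qed
      finally show ?thesis unfolding enu w_def .
    qed
  qed
  have "(\<integral>\<^sup>+\<omega>. indicator ?A \<omega> * h (last_zero X v \<omega>) \<partial>M) = (\<integral>\<^sup>+y. h y \<partial>\<mu>)"
    unfolding \<mu>_def by (subst nn_integral_distr[OF lm]) (simp_all add: nn_integral_density)
  also have "\<dots> = (\<integral>\<^sup>+y. excursion_density D C v y * indicator {0<..<r} y * h y \<partial>lborel)"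
    unfolding \<open>\<mu> = \<nu>\<close> \<nu>_def by (subst nn_integral_density) auto
  finally show ?thesis .
qed

text \<open>Conditioning on the last zero is avoided by comparing densities: those at times s and u
  differ by the factor sqrt ((s - y) / (u - y)), in which neither \<open>D\<close> nor C occurs. As
  y is the last zero, this is the root of the ratio of the ages at s and u.\<close>

lemma neg_excursion_survival:
  assumes D: "stopping D" and D0: "\<And>\<omega>. \<omega> \<in> space M \<Longrightarrow> stopped D \<omega> = 0"
    and C: "C \<in> sets (pre D)" and r: "0 < r" "r < s" "s \<le> u" "u \<le> T"
  shows "emeasure M (C \<inter> neg_excursion D r u) =
    (\<integral>\<^sup>+\<omega>. indicator (C \<inter> neg_excursion D r s) \<omega> *
       ennreal (sqrt ((s - last_zero X s \<omega>) / (u - last_zero X s \<omega>))) \<partial>M)"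
proof -
  have uT: "u \<in> {0..T}" using r by auto
  have CM: "C \<in> sets M" using C sets_pre[OF D] by blast
  have "C \<inter> neg_excursion D r u \<in> sets M" using CM neg_excursion_meas[OF D uT] by blast
  then have "emeasure M (C \<inter> neg_excursion D r u) = (\<integral>\<^sup>+\<omega>. indicator (C \<inter> neg_excursion D r u) \<omega> * 1 \<partial>M)"
    by simp
  also have "\<dots> = (\<integral>\<^sup>+y. excursion_density D C u y * indicator {0<..<r} y * 1 \<partial>lborel)"
    using r by (intro neg_excursion_law[OF D D0 C]) auto
  also have "\<dots> = (\<integral>\<^sup>+y. excursion_density D C s y * indicator {0<..<r} y * ennreal (sqrt ((s - y) / (u - y))) \<partial>lborel)"
  proof (rule nn_integral_cong)
    fix y :: real
    show "excursion_density D C u y * indicator {0<..<r} y * 1 = excursion_density D C s y * indicator {0<..<r} y * ennreal (sqrt ((s - y) / (u - y)))"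
    proof (cases "y \<in> {0<..<r}")
      case True
      then have y: "0 < s - y" "0 < u - y" using r by auto
      let ?k = "ennreal (sqrt ((s - y) / (u - y)))"
      have [measurable]: "D \<in> borel_measurable M" "C \<in> sets M" using stopping_measurable[OF D] CM by auto
      have "excursion_density D C s y * ?k = (\<integral>\<^sup>+\<omega>. indicator C \<omega> * indicator {\<omega>\<in>space M. D \<omega> < ereal y} \<omega> *
     ennreal (1 / (2 * pi * sqrt ((y - real_of_ereal (D \<omega>)) * (s - y)))) * ?k \<partial>M)"
        unfolding excursion_density_def by (intro nn_integral_multc[symmetric]) measurable
      also have "\<dots> = excursion_density D C u y"
        unfolding excursion_density_def
      proof (rule nn_integral_cong)
        fix \<omega> assume om: "\<omega> \<in> space M"
        show "indicator C \<omega> * indicator {\<omega>\<in>space M. D \<omega> < ereal y} \<omega> *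
     ennreal (1 / (2 * pi * sqrt ((y - real_of_ereal (D \<omega>)) * (s - y)))) * ?k = indicator C \<omega> * indicator {\<omega>\<in>space M. D \<omega> < ereal y} \<omega> *
     ennreal (1 / (2 * pi * sqrt ((y - real_of_ereal (D \<omega>)) * (u - y))))"
        proof (cases "D \<omega> < ereal y")
          case True
          obtain d where d: "D \<omega> = ereal d" "d < y" by (rule stopping_lessE[OF D om True])
          have "1 / (2 * pi * sqrt ((y - d) * (s - y))) * sqrt ((s - y) / (u - y)) = 1 / (2 * pi * sqrt ((y - d) * (u - y)))"
            using y d by (simp add: real_sqrt_mult real_sqrt_divide)
          moreover have "0 \<le> 1 / (2 * pi * sqrt ((y - d) * (s - y)))" using y d by simp
          ultimately have "ennreal (1 / (2 * pi * sqrt ((y - d) * (s - y)))) * ?k = ennreal (1 / (2 * pi * sqrt ((y - d) * (u - y))))"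
            by (metis ennreal_mult')
          then show ?thesis by (simp add: d(1) mult.assoc)
        qed simp
      qed
      finally show ?thesis using True by simp
    qed simp
  qed
  also have "\<dots> = (\<integral>\<^sup>+\<omega>. indicator (C \<inter> neg_excursion D r s) \<omega> *
       ennreal (sqrt ((s - last_zero X s \<omega>) / (u - last_zero X s \<omega>))) \<partial>M)"
    using r by (intro neg_excursion_law[OF D D0 C, symmetric]) auto
  finally show ?thesis .
qed

end

section \<open>The default time\<close>

lemma last_zero_left_eqI:
  assumes "z < t" "\<And>s. z < s \<Longrightarrow> s < t \<Longrightarrow> last_zero Z s \<omega> = z"
  shows "last_zero_left Z t \<omega> = z"
  unfolding last_zero_left_def
proof (rule tendsto_Lim)
  show "at_left t \<noteq> bot" by simp
  have "\<forall>\<^sub>F s in at_left t. z < s \<and> s < t"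
    using assms(1) eventually_at_left_field by blast
  then have "\<forall>\<^sub>F s in at_left t. last_zero Z s \<omega> = z"
    by (rule eventually_mono) (use assms(2) in blast)
  then show "((\<lambda>s. last_zero Z s \<omega>) \<longlongrightarrow> z) (at_left t)"
    by (rule tendsto_eventually)
qed

locale cash_balance = brownian M T F X for M :: "'a measure" and T F X +
  fixes \<alpha> :: real
  assumes \<alpha>_pos: "0 < \<alpha>"
begin

definition delay :: real where "delay = \<alpha>\<^sup>2 / 2"

abbreviation "\<sigma> \<equiv> tau_alpha \<alpha> T X"
abbreviation "\<tau> \<equiv> default_time \<alpha> T X"

lemma delay_pos: "0 < delay"
  using \<alpha>_pos by (simp add: delay_def)

text \<open>An age of at least \<open>delay\<close> > 0 puts the last zero strictly before t, so
  \<open>last_zero\<close> is constant just before t and its left limit is the same zero. Without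
  zeros in between, the sign at t decides the sign on the whole stretch.\<close>

lemma long_negative_iff:
  assumes om: "\<omega> \<in> space M" and t: "0 < t" "t \<le> T"
  shows "t - last_zero X t \<omega> \<ge> \<alpha>\<^sup>2 / 2 \<and> (\<forall>s\<in>{last_zero_left X t \<omega><..<t}. X s \<omega> < 0) \<longleftrightarrow>
    t - last_zero X t \<omega> \<ge> delay \<and> X t \<omega> < 0"
    and long_negative_neg: "X t \<omega> < 0 \<Longrightarrow> last_zero X t \<omega> < s \<Longrightarrow> s \<le> t \<Longrightarrow> X s \<omega> < 0"
proof -
  have tT: "t \<in> {0..T}" using t by auto
  let ?z = "last_zero X t \<omega>"
  have z: "0 \<le> ?z" "?z \<le> t" "X ?z \<omega> = 0" "\<And>s. ?z < s \<Longrightarrow> s \<le> t \<Longrightarrow> X s \<omega> \<noteq> 0"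
    by (rule last_zero_X[OF om tT])+
  have sgn: "X s' \<omega> < 0" if s: "?z < s" "s \<le> t" "X s \<omega> < 0" and s': "?z < s'" "s' \<le> t" for s s'
  proof (rule continuous_no_zero_neg[of "min s s'" t "\<lambda>s. X s \<omega>" s s'])
    show "continuous_on {min s s'..t} (\<lambda>s. X s \<omega>)"
      using t z(1) s s' by (intro continuous_on_subset[OF cont[OF om]]) (auto simp: min_def)
    show "X r \<omega> \<noteq> 0" if "min s s' \<le> r" "r \<le> t" for r
      using z(4)[of r] that s(1) s'(1) by linarith
  qed (use s s' in auto)
  show "X s \<omega> < 0" if "X t \<omega> < 0" "?z < s" "s \<le> t"
    using sgn[of t s] that by auto
  have lz: "last_zero X s \<omega> = ?z" if "?z < s" "s < t" for s
    using that z by (intro last_zero_eqI) auto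
  have left: "last_zero_left X t \<omega> = ?z" if "?z < t"
    using that lz by (intro last_zero_left_eqI) auto
  show "t - ?z \<ge> \<alpha>\<^sup>2 / 2 \<and> (\<forall>s\<in>{last_zero_left X t \<omega><..<t}. X s \<omega> < 0) \<longleftrightarrow> t - ?z \<ge> delay \<and> X t \<omega> < 0"
  proof (cases "t - ?z \<ge> delay")
    case True
    then have zt: "?z < t" using delay_pos by linarith
    have "(\<forall>s\<in>{?z<..<t}. X s \<omega> < 0) \<longleftrightarrow> X t \<omega> < 0"
    proof
      assume "\<forall>s\<in>{?z<..<t}. X s \<omega> < 0"
      then have "X ((?z + t) / 2) \<omega> < 0" using zt by auto
      then show "X t \<omega> < 0" using sgn[of "(?z + t) / 2" t] zt by auto
    next
      assume "X t \<omega> < 0"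
      then show "\<forall>s\<in>{?z<..<t}. X s \<omega> < 0" using sgn[of t] zt by auto
    qed
    then show ?thesis unfolding left[OF zt] delay_def by blast
  qed (simp add: delay_def)
qed

lemma tau_alpha_eq:
  assumes om: "\<omega> \<in> space M"
  shows "\<sigma> \<omega> = Inf (ereal ` {t\<in>{0<..T}. t - last_zero X t \<omega> \<ge> delay \<and> X t \<omega> < 0})"
proof -
  have "{t\<in>{0<..T}. t - last_zero X t \<omega> \<ge> \<alpha>\<^sup>2 / 2 \<and> (\<forall>s\<in>{last_zero_left X t \<omega><..<t}. X s \<omega> < 0)} =
    {t\<in>{0<..T}. t - last_zero X t \<omega> \<ge> delay \<and> X t \<omega> < 0}"
    using long_negative_iff[OF om] by auto
  then show ?thesis unfolding tau_alpha_def by (simp only:)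
qed

text \<open>The infimum is attained, at the moment when the first long negative excursion, started
  at g, reaches the age \<open>delay\<close>. All later arguments use this description instead of
  the infimum.\<close>

lemma tau_alpha_cases:
  assumes om: "\<omega> \<in> space M"
  obtains "\<sigma> \<omega> = \<infinity>" "\<And>t. 0 \<le> t \<Longrightarrow> t \<le> T \<Longrightarrow> X t \<omega> < 0 \<Longrightarrow> t - last_zero X t \<omega> < delay"
  | g where "\<sigma> \<omega> = ereal (g + delay)" "0 \<le> g" "g + delay \<le> T" "X g \<omega> = 0"
      "\<And>s. g < s \<Longrightarrow> s \<le> g + delay \<Longrightarrow> X s \<omega> < 0"
      "\<And>t. 0 \<le> t \<Longrightarrow> t \<le> T \<Longrightarrow> X t \<omega> < 0 \<Longrightarrow> t - last_zero X t \<omega> \<ge> delay \<Longrightarrow> g + delay \<le> t"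
proof (cases "{t\<in>{0<..T}. t - last_zero X t \<omega> \<ge> delay \<and> X t \<omega> < 0} = {}")
  case True
  then have "\<sigma> \<omega> = \<infinity>" unfolding tau_alpha_eq[OF om] True by (simp add: top_ereal_def)
  moreover have "t - last_zero X t \<omega> < delay" if "0 \<le> t" "t \<le> T" "X t \<omega> < 0" for t
  proof -
    have "0 < t" using that X_0[OF om] by (cases "t = 0") auto
    show ?thesis
    proof (rule ccontr)
      assume "\<not> t - last_zero X t \<omega> < delay"
      then have "t \<in> {t\<in>{0<..T}. t - last_zero X t \<omega> \<ge> delay \<and> X t \<omega> < 0}"
        using \<open>0 < t\<close> that(2,3) by simp
      then show False unfolding True by simp
    qed
  qed
  ultimately show thesis using that(1) by blast
next
  case False
  let ?S = "{t\<in>{0<..T}. t - last_zero X t \<omega> \<ge> delay \<and> X t \<omega> < 0}"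
  have bdd: "bdd_below ?S" by (rule bdd_belowI[of _ 0]) auto
  \<comment> \<open>A member within \<open>delay\<close> of the infimum must belong to the first
    long excursion: an earlier member would lie after g = \<open>last_zero X t \<omega>\<close> and
    yet have its own last zero before g, forcing X to be negative at g.\<close>
  obtain t where t: "t \<in> ?S" "t < Inf ?S + delay"
    using cInf_lessD[OF False, of "Inf ?S + delay"] delay_pos by auto
  let ?g = "last_zero X t \<omega>"
  have tT: "0 < t" "t \<le> T" "t \<in> {0..T}" using t by auto
  have neg: "X s \<omega> < 0" if "?g < s" "s \<le> t" for s
    using long_negative_neg[OF om tT(1,2) _ that] t(1) by simp
  have g: "0 \<le> ?g" "?g + delay \<le> t" "X ?g \<omega> = 0"
    using last_zero_X[OF om tT(3)] t(1) by auto
  have lz: "last_zero X (?g + delay) \<omega> = ?g"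
    using g delay_pos neg by (intro last_zero_eqI) force+
  have inS: "?g + delay \<in> ?S"
    using g delay_pos neg[of "?g + delay"] tT by (simp add: lz)
  have min: "?g + delay \<le> t'" if t': "t' \<in> ?S" for t'
  proof (rule ccontr)
    assume lt: "\<not> ?g + delay \<le> t'"
    have t'T: "0 < t'" "t' \<le> T" "t' \<in> {0..T}" using t' by auto
    have "Inf ?S \<le> t'" using t' bdd by (rule cInf_lower)
    then have "?g < t'" using t(2) g(2) by linarith
    moreover have "last_zero X t' \<omega> < ?g" using lt t' by auto
    ultimately have "X ?g \<omega> < 0" using long_negative_neg[OF om t'T(1,2)] t' by auto
    then show False using g(3) by simp
  qed
  have "\<sigma> \<omega> = ereal (?g + delay)"
    unfolding tau_alpha_eq[OF om] using inS min by (intro cInf_eq_minimum) auto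
  then show thesis
  proof (rule that(2))
    show "X s \<omega> < 0" if "?g < s" "s \<le> ?g + delay" for s
      using neg that g(2) by auto
    show "?g + delay \<le> t'" if "0 \<le> t'" "t' \<le> T" "X t' \<omega> < 0" "t' - last_zero X t' \<omega> \<ge> delay" for t'
      using min[of t'] that X_0[OF om] by (cases "t' = 0") auto
  qed (use g tT in auto)
qed

text \<open>X is strictly negative at g + \<open>delay\<close>, so by continuity the excursion lasts
  a little longer and a rational time sees it, unless g + \<open>delay\<close> is t itself. This
  makes the event a countable union and \<sigma> a stopping time.\<close>

lemma tau_alpha_le_iff:
  assumes om: "\<omega> \<in> space M" and t: "t \<in> {0..T}"
  shows "\<sigma> \<omega> \<le> ereal t \<longleftrightarrow> (\<exists>q\<in>(\<rat> \<inter> {0..t}) \<union> {t}. X q \<omega> < 0 \<and> delay \<le> q - last_zero X q \<omega>)"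
proof
  assume "\<exists>q\<in>(\<rat> \<inter> {0..t}) \<union> {t}. X q \<omega> < 0 \<and> delay \<le> q - last_zero X q \<omega>"
  then obtain q where q: "0 \<le> q" "q \<le> t" "X q \<omega> < 0" "delay \<le> q - last_zero X q \<omega>" using t by auto
  show "\<sigma> \<omega> \<le> ereal t"
  proof (cases rule: tau_alpha_cases[OF om])
    case 1
    have "q \<le> T" using q t by simp
    then show ?thesis using 1(2)[of q] q by linarith
  next
    case (2 g)
    have "q \<le> T" using q t by simp
    then have "g + delay \<le> q" using 2(6)[of q] q by simp
    then show ?thesis using q(2) 2(1) by simp
  qed
next
  assume le: "\<sigma> \<omega> \<le> ereal t"
  show "\<exists>q\<in>(\<rat> \<inter> {0..t}) \<union> {t}. X q \<omega> < 0 \<and> delay \<le> q - last_zero X q \<omega>"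
  proof (cases rule: tau_alpha_cases[OF om])
    case 1
    then show ?thesis using le by simp
  next
    case (2 g)
    have gt: "g + delay \<le> t" using le 2(1) by simp
    have X: "X (g + delay) \<omega> < 0" using 2(5)[of "g + delay"] delay_pos by simp
    show ?thesis
    proof (cases "g + delay = t")
      case True
      have "last_zero X t \<omega> = g"
        using 2 True delay_pos by (intro last_zero_eqI) force+
      then show ?thesis using X True by auto
    next
      case False
      have "continuous (at (g + delay) within {0..T}) (\<lambda>t. X t \<omega>)"
        using cont[OF om] 2 delay_pos by (auto simp: continuous_on_eq_continuous_within)
      then obtain d where d: "d > 0" "\<And>y. y \<in> {0..T} \<Longrightarrow> dist y (g + delay) < d \<Longrightarrow> dist (X y \<omega>) (X (g + delay) \<omega>) < - X (g + delay) \<omega>"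
        unfolding continuous_within_eps_delta using X by (metis neg_0_less_iff_less)
      obtain q where q: "q \<in> \<rat>" "g + delay < q" "q < min t (g + delay + d)"
        using Rats_dense_in_real[of "g + delay" "min t (g + delay + d)"] False gt d by auto
      have neg: "X y \<omega> < 0" if "g < y" "y \<le> q" for y
      proof (cases "y \<le> g + delay")
        case True then show ?thesis using 2(5) that by simp
      next
        case False
        have "dist (X y \<omega>) (X (g + delay) \<omega>) < - X (g + delay) \<omega>"
          using q False that 2 t delay_pos by (intro d(2)) (auto simp: dist_real_def)
        then show ?thesis by (simp add: dist_real_def)
      qed
      have "last_zero X q \<omega> = g"
        using 2 q delay_pos neg by (intro last_zero_eqI) force+
      then show ?thesis using q neg[of q] 2(2) delay_pos by (intro bexI[of _ q]) auto
    qed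
  qed
qed

lemma stopping_tau_alpha: "stopping \<sigma>"
  unfolding stopping_def
proof (intro conjI ballI)
  fix \<omega> assume "\<omega> \<in> space M"
  then show "\<sigma> \<omega> = \<infinity> \<or> (\<exists>t\<in>{0..T}. \<sigma> \<omega> = ereal t)"
  proof (cases rule: tau_alpha_cases)
    case (2 g)
    then show ?thesis using delay_pos by (intro disjI2 bexI[of _ "g + delay"]) auto
  qed simp
next
  fix t assume t: "t \<in> {0..T}"
  let ?Q = "(\<rat> \<inter> {0..t}) \<union> {t}"
  have "{\<omega>\<in>space M. \<sigma> \<omega> \<le> ereal t} = (\<Union>q\<in>?Q. {\<omega>\<in>space M. X q \<omega> < 0 \<and> delay \<le> q - last_zero X q \<omega>})"
  proof (rule set_eqI)
    fix \<omega>
    show "\<omega> \<in> {\<omega>\<in>space M. \<sigma> \<omega> \<le> ereal t} \<longleftrightarrow> \<omega> \<in> (\<Union>q\<in>?Q. {\<omega>\<in>space M. X q \<omega> < 0 \<and> delay \<le> q - last_zero X q \<omega>})"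
    proof (cases "\<omega> \<in> space M")
      case True
      show ?thesis using tau_alpha_le_iff[OF True t] True by (simp only: mem_Collect_eq UN_iff simp_thms)
    qed simp
  qed
  also have "\<dots> \<in> sets (F t)"
  proof (rule sets.countable_UN'')
    show "countable ?Q" using countable_rat by (auto intro: countable_subset)
    fix q assume "q \<in> ?Q"
    then have q: "q \<in> {0..T}" "0 \<le> q" "q \<le> t" using t by auto
    note [measurable] = adapted[OF q(1)] last_zero_adapted[OF q(1)]
    have "{\<omega>\<in>space (F q). X q \<omega> < 0 \<and> delay \<le> q - last_zero X q \<omega>} \<in> sets (F q)" by measurable
    then have "{\<omega>\<in>space M. X q \<omega> < 0 \<and> delay \<le> q - last_zero X q \<omega>} \<in> sets (F q)" by (simp only: space_F[OF q(1)])
    moreover have "t \<le> T" using t by simp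
    ultimately show "{\<omega>\<in>space M. X q \<omega> < 0 \<and> delay \<le> q - last_zero X q \<omega>} \<in> sets (F t)"
      using F_monoD[OF q(2,3)] by blast
  qed
  finally show "{\<omega>\<in>space M. \<sigma> \<omega> \<le> ereal t} \<in> sets (F t)" .
qed

lemma X_tau_alpha_eq: "X_tau_alpha \<alpha> T X = stopped \<sigma>"
  by (simp add: X_tau_alpha_def stopped_def fun_eq_iff)

lemma stopped_tau_alpha_neg:
  assumes "\<omega> \<in> space M" "\<sigma> \<omega> < \<infinity>"
  shows "stopped \<sigma> \<omega> < 0"
proof (cases rule: tau_alpha_cases[OF assms(1)])
  case 1 then show ?thesis using assms by simp
next
  case (2 g) then show ?thesis using delay_pos 2(5)[of "g + delay"] by (simp add: stopped_def)
qed

text \<open>The definition asks for times strictly after \<sigma>, \<open>hit\<close> for times from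
  \<sigma> on. They agree because X at \<sigma> is negative and hence differs from its double; if
  \<sigma> is infinite, no time qualifies on either side.\<close>

lemma default_time_eq:
  assumes om: "\<omega> \<in> space M"
  shows "\<tau> \<omega> = hit \<sigma> (stopped \<sigma>) \<omega>"
proof -
  have "ereal t > \<sigma> \<omega> \<and> X t \<omega> = 2 * stopped \<sigma> \<omega> \<longleftrightarrow> \<sigma> \<omega> \<le> ereal t \<and> X t \<omega> = stopped \<sigma> \<omega> + stopped \<sigma> \<omega>" for t
  proof -
    have "X t \<omega> \<noteq> 2 * stopped \<sigma> \<omega>" if "\<sigma> \<omega> = ereal t"
      using stopped_tau_alpha_neg[OF om] that by (auto simp: stopped_def)
    then show ?thesis by (auto simp: order_le_less)
  qed
  then show ?thesis
    unfolding default_time_def hit_def X_tau_alpha_eq by simp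
qed

text \<open>The return of X to 0 after \<sigma>, the true end of its excursion. Level 0 lies as far
  above X at \<sigma> as the default level lies below, so this time is the mirror image of \<tau>,
  and it is the one whose law the excursion computations give.\<close>

definition excursion_end :: "'a \<Rightarrow> ereal" ("\<eta>") where
  "\<eta> = hit \<sigma> (\<lambda>\<omega>. - stopped \<sigma> \<omega>)"

lemma stopping_excursion_end: "stopping \<eta>"
  unfolding excursion_end_def
  using stopped_measurable_pre[OF stopping_tau_alpha]
  by (intro stopping_hit[OF stopping_tau_alpha] borel_measurable_uminus)

lemma stopping_default: "stopping (hit \<sigma> (stopped \<sigma>))"
  by (intro stopping_hit[OF stopping_tau_alpha] stopped_measurable_pre stopping_tau_alpha)

lemma excursion_end_greater_iff:
  assumes om: "\<omega> \<in> space M" and g: "\<sigma> \<omega> = ereal (g + delay)" "0 \<le> g" "X g \<omega> = 0"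
    "\<And>s. g < s \<Longrightarrow> s \<le> g + delay \<Longrightarrow> X s \<omega> < 0" and v: "g + delay \<le> v" "v \<le> T"
  shows "ereal v < \<eta> \<omega> \<longleftrightarrow> X v \<omega> < 0 \<and> last_zero X v \<omega> = g"
proof -
  have vT: "v \<in> {0..T}" using v g delay_pos by auto
  have iff: "ereal v < \<eta> \<omega> \<longleftrightarrow> (\<forall>s\<in>{g + delay..v}. X s \<omega> \<noteq> 0)"
  proof -
    have "\<eta> \<omega> \<le> ereal v \<longleftrightarrow> (\<exists>s\<in>{0..v}. \<sigma> \<omega> \<le> ereal s \<and> X s \<omega> = 0)"
      unfolding excursion_end_def hit_le_iff[OF stopping_tau_alpha om vT] by simp
    also have "\<dots> \<longleftrightarrow> (\<exists>s\<in>{g + delay..v}. X s \<omega> = 0)"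
      using g(1,2) delay_pos by auto
    finally show ?thesis by (simp only: not_le[symmetric]) blast
  qed
  show ?thesis
  proof
    assume "ereal v < \<eta> \<omega>"
    then have nz: "\<And>s. g + delay \<le> s \<Longrightarrow> s \<le> v \<Longrightarrow> X s \<omega> \<noteq> 0" using iff by simp
    have "X v \<omega> < 0"
    proof (rule continuous_no_zero_neg[of "g + delay" v "\<lambda>s. X s \<omega>" "g + delay" v])
      show "continuous_on {g + delay..v} (\<lambda>s. X s \<omega>)"
        using v g delay_pos by (intro continuous_on_subset[OF cont[OF om]]) auto
    qed (use nz g(4) v delay_pos in auto)
    moreover have "last_zero X v \<omega> = g"
    proof (rule last_zero_eqI)
      show "X s \<omega> \<noteq> 0" if "g < s" "s \<le> v" for s
        using nz[of s] g(4)[of s] that by (cases "s \<le> g + delay") auto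
    qed (use g v delay_pos in auto)
    ultimately show "X v \<omega> < 0 \<and> last_zero X v \<omega> = g" by simp
  next
    assume "X v \<omega> < 0 \<and> last_zero X v \<omega> = g"
    then have "\<And>s. g < s \<Longrightarrow> s \<le> v \<Longrightarrow> X s \<omega> \<noteq> 0" using last_zero_X(4)[OF om vT] by auto
    then show "ereal v < \<eta> \<omega>" unfolding iff using delay_pos by auto
  qed
qed

text \<open>Since \<sigma> - \<open>delay\<close> is the start of the first long excursion, the
  shifted bounds say that this start lies in [p, q).\<close>

definition long_excursion :: "real \<Rightarrow> real \<Rightarrow> real \<Rightarrow> 'a set" where
  "long_excursion p q v = {\<omega>\<in>space M. ereal (p + delay) \<le> \<sigma> \<omega> \<and> \<sigma> \<omega> < ereal (q + delay) \<and> ereal v < \<eta> \<omega>}"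

lemma long_excursion_meas: "long_excursion p q v \<in> sets M"
proof -
  note [measurable] = stopping_measurable[OF stopping_tau_alpha] stopping_measurable[OF stopping_excursion_end]
  show ?thesis unfolding long_excursion_def by measurable
qed

lemma long_excursion_empty:
  assumes "q \<le> p"
  shows "long_excursion p q v = {}"
proof -
  have "\<not> \<sigma> \<omega> < ereal (q + delay)" if "ereal (p + delay) \<le> \<sigma> \<omega>" for \<omega>
  proof -
    have "ereal (q + delay) \<le> ereal (p + delay)" using assms by simp
    then show ?thesis using that by (meson leD order_trans)
  qed
  then show ?thesis unfolding long_excursion_def by blast
qed

lemma long_excursion_last_zero:
  assumes om: "\<omega> \<in> long_excursion p q v" and v: "q + delay \<le> v" "v \<le> T"
  shows "last_zero X v \<omega> = real_of_ereal (\<sigma> \<omega>) - delay"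
proof -
  have w: "\<omega> \<in> space M" "\<sigma> \<omega> < ereal (q + delay)" "ereal v < \<eta> \<omega>"
    using om by (auto simp: long_excursion_def)
  show ?thesis
  proof (cases rule: tau_alpha_cases[OF w(1)])
    case 1 then show ?thesis using w(2) by simp
  next
    case (2 g)
    then have "g + delay \<le> v" using w(2) v(1) by simp
    then show ?thesis using excursion_end_greater_iff[OF w(1) 2(1,2,4,5)] v(2) w(3) 2(1) by simp
  qed
qed

text \<open>A cell shorter than \<open>delay\<close> leaves no room for two long excursions, so that the first long
  excursion is recognised by looking at the single time \<open>v\<close>.\<close>

lemma long_excursion_cell:
  assumes p: "0 \<le> p" "p < q" "q \<le> p + delay" and v: "q + delay \<le> v" "v \<le> T"
  shows "long_excursion p q v = {\<omega>\<in>space M. next_zero p \<omega> < \<sigma> \<omega>} \<inter> neg_excursion (next_zero p) q v"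
proof (rule set_eqI)
  fix \<omega>
  have pT: "p \<in> {0..T}" and vT: "v \<in> {0..T}" and pv: "p < v" "q < v" using p v delay_pos by auto
  show "\<omega> \<in> long_excursion p q v \<longleftrightarrow> \<omega> \<in> {\<omega>\<in>space M. next_zero p \<omega> < \<sigma> \<omega>} \<inter> neg_excursion (next_zero p) q v"
  proof
    assume l: "\<omega> \<in> long_excursion p q v"
    then have w: "\<omega> \<in> space M" "ereal (p + delay) \<le> \<sigma> \<omega>" "\<sigma> \<omega> < ereal (q + delay)" "ereal v < \<eta> \<omega>"
      by (auto simp: long_excursion_def)
    show "\<omega> \<in> {\<omega>\<in>space M. next_zero p \<omega> < \<sigma> \<omega>} \<inter> neg_excursion (next_zero p) q v"
    proof (cases rule: tau_alpha_cases[OF w(1)])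
      case 1 then show ?thesis using w(3) by simp
    next
      case (2 g)
      have g: "p \<le> g" "g < q" using w 2(1) by auto
      have "X v \<omega> < 0 \<and> last_zero X v \<omega> = g"
        using excursion_end_greater_iff[OF w(1) 2(1,2,4,5), of v] w(4) g v by simp
      moreover have "next_zero p \<omega> \<le> ereal g"
      proof (cases rule: next_zero_cases[OF pT w(1)])
        case 1 then show ?thesis using 1(2)[of g] 2 g delay_pos by simp
      next
        case (2 s)
        then show ?thesis using \<open>X g \<omega> = 0\<close> g(1) by (cases "g < s") auto
      qed
      then have "next_zero p \<omega> < ereal q" "next_zero p \<omega> < \<sigma> \<omega>"
        using g(2) delay_pos le_less_trans[of "next_zero p \<omega>" "ereal g" "ereal q"]
          le_less_trans[of "next_zero p \<omega>" "ereal g" "ereal (g + delay)"] 2(1) by auto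
      ultimately show ?thesis using w(1) g by (simp add: neg_excursion_def)
    qed
  next
    assume "\<omega> \<in> {\<omega>\<in>space M. next_zero p \<omega> < \<sigma> \<omega>} \<inter> neg_excursion (next_zero p) q v"
    then have w: "\<omega> \<in> space M" "next_zero p \<omega> < \<sigma> \<omega>" "next_zero p \<omega> < ereal q" "last_zero X v \<omega> < q" "X v \<omega> < 0"
      by (auto simp: neg_excursion_def)
    obtain d where d: "next_zero p \<omega> = ereal d" "p \<le> d" "d < q" "X d \<omega> = 0"
      by (cases rule: next_zero_cases[OF pT w(1)]) (use w(3) in auto)
    let ?z = "last_zero X v \<omega>"
    have dz: "d \<le> ?z" using last_zero_X(4)[OF w(1) vT, of d] d pv by force
    show "\<omega> \<in> long_excursion p q v"
    proof (cases rule: tau_alpha_cases[OF w(1)])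
      case 1
      have "v - ?z < delay" using 1(2)[of v] vT w(5) by simp
      then show ?thesis using w(4) v by simp
    next
      case (2 g)
      have gv: "g + delay \<le> v" using 2(6)[of v] vT w(4,5) v by simp
      have gz: "g \<le> ?z" using last_zero_X(4)[OF w(1) vT, of g] 2(4) gv delay_pos by force
      \<comment> \<open>A zero before g + \<open>delay\<close> cannot lie inside the excursion from
        g, hence d \<le> g; this is the purpose of demanding that the next zero precede \<sigma>. A
        last zero beyond g would be beyond g + \<open>delay\<close>, hence beyond p +
        \<open>delay\<close> and q, which is excluded.\<close>
      have dg: "d < g + delay" using w(2) d(1) 2(1) by simp
      have "?z = g"
      proof (rule ccontr)
        assume "?z \<noteq> g"
        then have "g < ?z" using gz by simp
        then have "g + delay < ?z" using 2(5)[of ?z] last_zero_X(3)[OF w(1) vT] by force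
        moreover have "d \<le> g" using 2(5)[of d] d(4) dg by force
        ultimately show False using w(4) p(3) d(2) by simp
      qed
      then have "ereal v < \<eta> \<omega>"
        using excursion_end_greater_iff[OF w(1) 2(1,2,4,5) gv v(2)] w(5) by simp
      then show ?thesis
        using w(1,4) dz d(2) \<open>?z = g\<close> by (simp add: long_excursion_def 2(1))
    qed
  qed
qed

text \<open>The root of the ratio of the excursion's ages at s and u. Written through \<sigma> -
  \<open>delay\<close> instead of a last zero it is a function of \<sigma>, so it belongs to the
  past of \<sigma> and may serve as a weight in the reflection.\<close>

abbreviation survival_ratio :: "real \<Rightarrow> real \<Rightarrow> 'a \<Rightarrow> real" where
  "survival_ratio s u \<omega> \<equiv> sqrt ((s - (real_of_ereal (\<sigma> \<omega>) - delay)) / (u - (real_of_ereal (\<sigma> \<omega>) - delay)))"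

text \<open>Events of \<open>F p\<close> lie in the past of the stopping time
  \<open>next_zero p\<close>, from which \<open>neg_excursion_survival\<close> can be started;
  within the cell the excursion found in this way is the first long one.\<close>

lemma long_excursion_cell_survival:
  assumes p: "0 \<le> p" "p < q" "q \<le> p + delay" and s: "q + delay \<le> s" "s \<le> u" "u \<le> T" and B: "B \<in> sets (F p)"
  shows "emeasure M (B \<inter> long_excursion p q u) =
    (\<integral>\<^sup>+\<omega>. indicator (B \<inter> long_excursion p q s) \<omega> * ennreal (survival_ratio s u \<omega>) \<partial>M)"
proof -
  have pT: "p \<in> {0..T}" using p s delay_pos by auto
  let ?C = "B \<inter> {\<omega>\<in>space M. next_zero p \<omega> < \<sigma> \<omega>}"
  note nz = stopping_next_zero[OF pT]
  have "B \<in> sets (pre (next_zero p))"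
    unfolding next_zero_def
    by (rule pre_mono[OF stopping_const[OF pT] nz[unfolded next_zero_def] le_hit[OF stopping_const[OF pT]] pre_const[OF pT B]])
  then have C: "?C \<in> sets (pre (next_zero p))"
    using stopping_le_pre[OF stopping_tau_alpha nz] by (rule sets.Int)
  have cell: "B \<inter> long_excursion p q v = ?C \<inter> neg_excursion (next_zero p) q v" if "s \<le> v" "v \<le> T" for v
  proof -
    have "q + delay \<le> v" using that s(1) by simp
    from long_excursion_cell[OF p this that(2)] show ?thesis by blast
  qed
  have su: "s \<le> T" using s by simp
  have "emeasure M (B \<inter> long_excursion p q u) = emeasure M (?C \<inter> neg_excursion (next_zero p) q u)"
    by (simp only: cell[OF s(2,3)])
  also have "\<dots> = (\<integral>\<^sup>+\<omega>. indicator (?C \<inter> neg_excursion (next_zero p) q s) \<omega> *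
       ennreal (sqrt ((s - last_zero X s \<omega>) / (u - last_zero X s \<omega>))) \<partial>M)"
    using p s delay_pos by (intro neg_excursion_survival[OF nz _ C]) (auto intro: stopped_next_zero[OF pT])
  also have "\<dots> = (\<integral>\<^sup>+\<omega>. indicator (B \<inter> long_excursion p q s) \<omega> * ennreal (survival_ratio s u \<omega>) \<partial>M)"
    unfolding cell[OF order_refl su, symmetric]
  proof (rule nn_integral_cong)
    fix \<omega>
    show "indicator (B \<inter> long_excursion p q s) \<omega> * ennreal (sqrt ((s - last_zero X s \<omega>) / (u - last_zero X s \<omega>))) =
      indicator (B \<inter> long_excursion p q s) \<omega> * ennreal (survival_ratio s u \<omega>)"
    proof (cases "\<omega> \<in> long_excursion p q s")
      case True
      from long_excursion_last_zero[OF this s(1) su] show ?thesis by simp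
    qed simp
  qed
  finally show ?thesis .
qed

text \<open>Induction on the number n of cells of length \<open>delay\<close> that cover [p, q). The
  event B stays the same while the left end moves to the right, since it remains in the growing
  \<open>F\<close>.\<close>

lemma long_excursion_survival:
  assumes "0 \<le> p" "q \<le> p + real n * delay" "q + delay \<le> s" "s \<le> u" "u \<le> T" "B \<in> sets (F p)"
  shows "emeasure M (B \<inter> long_excursion p q u) =
    (\<integral>\<^sup>+\<omega>. indicator (B \<inter> long_excursion p q s) \<omega> * ennreal (survival_ratio s u \<omega>) \<partial>M)"
  using assms
proof (induction n arbitrary: p B)
  case (0 p B)
  then show ?case by (simp add: long_excursion_empty)
next
  case (Suc n p B)
  consider "q \<le> p" | "p < q" "q \<le> p + delay" | "p + delay < q" by linarith
  then show ?case
  proof cases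
    case 1
    then show ?thesis by (simp add: long_excursion_empty)
  next
    case 2
    then show ?thesis using Suc.prems by (intro long_excursion_cell_survival) auto
  next
    case 3
    let ?m = "p + delay"
    have m: "0 \<le> ?m" "p \<le> ?m" "p < ?m" "?m \<le> T" using Suc.prems 3 delay_pos by auto
    have Bm: "B \<in> sets (F ?m)" using F_monoD[of p ?m B] Suc.prems m by blast
    have BM: "B \<in> sets M" using sets_F[of p B] Suc.prems m by auto
    have split: "long_excursion p q v = long_excursion p ?m v \<union> long_excursion ?m q v" for v
    proof -
      have "ereal (p + delay) \<le> ereal (?m + delay)" "ereal (?m + delay) \<le> ereal (q + delay)" using m 3 by auto
      then have "\<And>\<omega>. ereal (?m + delay) \<le> \<sigma> \<omega> \<Longrightarrow> ereal (p + delay) \<le> \<sigma> \<omega>"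
        "\<And>\<omega>. \<sigma> \<omega> < ereal (?m + delay) \<Longrightarrow> \<sigma> \<omega> < ereal (q + delay)"
        by (blast intro: order_trans less_le_trans)+
      moreover have "\<And>\<omega>. \<sigma> \<omega> < ereal (?m + delay) \<or> ereal (?m + delay) \<le> \<sigma> \<omega>"
        using le_less_linear by blast
      ultimately show ?thesis unfolding long_excursion_def by blast
    qed
    have disj: "long_excursion p ?m v \<inter> long_excursion ?m q v = {}" for v
      unfolding long_excursion_def by (auto dest: leD)
    have 1: "emeasure M (B \<inter> long_excursion p ?m u) =
      (\<integral>\<^sup>+\<omega>. indicator (B \<inter> long_excursion p ?m s) \<omega> * ennreal (survival_ratio s u \<omega>) \<partial>M)"
      using Suc.prems 3 m by (intro long_excursion_cell_survival) auto
    have 2: "emeasure M (B \<inter> long_excursion ?m q u) =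
      (\<integral>\<^sup>+\<omega>. indicator (B \<inter> long_excursion ?m q s) \<omega> * ennreal (survival_ratio s u \<omega>) \<partial>M)"
      using Suc.prems(2-5) m(1) Bm by (intro Suc.IH) (auto simp: algebra_simps)
    have "emeasure M (B \<inter> long_excursion p q u) = emeasure M (B \<inter> long_excursion p ?m u) + emeasure M (B \<inter> long_excursion ?m q u)"
    proof -
      have "B \<inter> long_excursion p q u = (B \<inter> long_excursion p ?m u) \<union> (B \<inter> long_excursion ?m q u)"
        unfolding split by blast
      then show ?thesis using BM long_excursion_meas disj[of u]
        by (simp only:) (intro plus_emeasure[symmetric], auto)
    qed
    also have "\<dots> = (\<integral>\<^sup>+\<omega>. indicator (B \<inter> long_excursion p ?m s) \<omega> * ennreal (survival_ratio s u \<omega>) +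
        indicator (B \<inter> long_excursion ?m q s) \<omega> * ennreal (survival_ratio s u \<omega>) \<partial>M)"
    proof -
      note [measurable] = BM long_excursion_meas stopping_measurable[OF stopping_tau_alpha]
      show ?thesis unfolding 1 2 by (intro nn_integral_add[symmetric]) measurable
    qed
    also have "\<dots> = (\<integral>\<^sup>+\<omega>. indicator (B \<inter> long_excursion p q s) \<omega> * ennreal (survival_ratio s u \<omega>) \<partial>M)"
    proof (rule nn_integral_cong)
      fix \<omega>
      show "indicator (B \<inter> long_excursion p ?m s) \<omega> * ennreal (survival_ratio s u \<omega>) +
        indicator (B \<inter> long_excursion ?m q s) \<omega> * ennreal (survival_ratio s u \<omega>) =
        indicator (B \<inter> long_excursion p q s) \<omega> * ennreal (survival_ratio s u \<omega>)"
        using disj[of s] unfolding split by (cases "\<omega> \<in> B \<inter> long_excursion p ?m s"; cases "\<omega> \<in> B \<inter> long_excursion ?m q s") auto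
    qed
    finally show ?thesis .
  qed
qed

text \<open>The value s forces a zero at s - \<open>delay\<close>, a null event if that time is
  positive. For s = \<open>delay\<close> the excursion would start at time 0, but the path almost
  surely takes positive values immediately after 0.\<close>

lemma tau_alpha_neq:
  assumes s: "s \<in> {0..T}"
  shows "AE \<omega> in M. \<sigma> \<omega> \<noteq> ereal s"
proof -
  consider "s < delay" | "s = delay" | "delay < s" by linarith
  then show ?thesis
  proof cases
    case 1
    have "\<sigma> \<omega> \<noteq> ereal s" if "\<omega> \<in> space M" for \<omega>
      using 1 by (cases rule: tau_alpha_cases[OF that]) auto
    then show ?thesis by (rule AE_I2)
  next
    case 2
    have 0: "0 \<in> {0..T}" using T_pos by simp
    show ?thesis
      using crosses_after[OF stopping_const[OF 0] disjI1[OF refl]]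
    proof (rule AE_mp, intro AE_I2 impI notI)
      fix \<omega> assume om: "\<omega> \<in> space M" and eq: "\<sigma> \<omega> = ereal s"
        and c: "\<forall>v\<in>{0..T}. ereal 0 < ereal v \<longrightarrow> (\<exists>t. ereal 0 < ereal t \<and> t < v \<and> 0 < 1 * (X t \<omega> - stopped (\<lambda>_. ereal 0) \<omega>))"
      obtain t where t: "0 < t" "t < delay" "0 < X t \<omega>"
        using c[rule_format, of s] s 2 delay_pos X_0[OF om] by auto
      show False
      proof (cases rule: tau_alpha_cases[OF om])
        case 1 then show ?thesis using eq by simp
      next
        case (2 g)
        then have "g = 0" using eq \<open>s = delay\<close> by simp
        then show ?thesis using 2(5)[of t] t by simp
      qed
    qed
  next
    case 3
    have z: "AE \<omega> in M. X (s - delay) \<omega> \<noteq> 0"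
      using 3 s delay_pos by (intro zero_null) auto
    show ?thesis
      using z
    proof (rule AE_mp, intro AE_I2 impI notI)
      fix \<omega> assume om: "\<omega> \<in> space M" and eq: "\<sigma> \<omega> = ereal s" and "X (s - delay) \<omega> \<noteq> 0"
      then show False by (cases rule: tau_alpha_cases[OF om]) auto
    qed
  qed
qed

text \<open>With q = s - \<open>delay\<close> the bound \<sigma> < q + \<open>delay\<close> of
  \<open>long_excursion\<close> reads \<sigma> < s; the remaining case \<sigma> = s is a null
  event.\<close>

lemma excursion_survival:
  assumes r: "r \<in> {0..T}" and s: "0 \<le> s" "s \<le> u" "u \<le> T" and B: "B \<in> sets (F r)"
  shows "emeasure M (B \<inter> {\<omega>\<in>space M. ereal (r + delay) \<le> \<sigma> \<omega> \<and> \<sigma> \<omega> \<le> ereal s \<and> ereal u < \<eta> \<omega>}) =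
    (\<integral>\<^sup>+\<omega>. indicator (B \<inter> {\<omega>\<in>space M. ereal (r + delay) \<le> \<sigma> \<omega> \<and> \<sigma> \<omega> \<le> ereal s \<and> ereal s < \<eta> \<omega>}) \<omega> *
       ennreal (survival_ratio s u \<omega>) \<partial>M)"
proof -
  have sT: "s \<in> {0..T}" using s by auto
  have BM: "B \<in> sets M" using sets_F[OF r B] .
  note [measurable] = BM long_excursion_meas stopping_measurable[OF stopping_tau_alpha] stopping_measurable[OF stopping_excursion_end]
  obtain n where "s - delay - r < real n * delay"
    using reals_Archimedean3[OF delay_pos] by blast
  then have n: "s - delay \<le> r + real n * delay" by simp
  have AEeq: "AE \<omega> in M. \<omega> \<in> {\<omega>\<in>space M. ereal (r + delay) \<le> \<sigma> \<omega> \<and> \<sigma> \<omega> \<le> ereal s \<and> ereal v < \<eta> \<omega>} \<longleftrightarrow> \<omega> \<in> long_excursion r (s - delay) v" for v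
    using tau_alpha_neq[OF sT]
    by (rule AE_mp) (auto intro!: AE_I2 simp: long_excursion_def order_le_less)
  have "emeasure M (B \<inter> {\<omega>\<in>space M. ereal (r + delay) \<le> \<sigma> \<omega> \<and> \<sigma> \<omega> \<le> ereal s \<and> ereal u < \<eta> \<omega>}) =
     emeasure M (B \<inter> long_excursion r (s - delay) u)"
  proof (rule emeasure_eq_AE)
    show "AE \<omega> in M. \<omega> \<in> B \<inter> {\<omega>\<in>space M. ereal (r + delay) \<le> \<sigma> \<omega> \<and> \<sigma> \<omega> \<le> ereal s \<and> ereal u < \<eta> \<omega>} \<longleftrightarrow> \<omega> \<in> B \<inter> long_excursion r (s - delay) u"
      using AEeq[of u] by (rule AE_mp) (auto intro!: AE_I2)
  qed measurable
  also have "\<dots> = (\<integral>\<^sup>+\<omega>. indicator (B \<inter> long_excursion r (s - delay) s) \<omega> * ennreal (survival_ratio s u \<omega>) \<partial>M)"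
    using r n s B by (intro long_excursion_survival[of r _ n]) auto
  also have "\<dots> = (\<integral>\<^sup>+\<omega>. indicator (B \<inter> {\<omega>\<in>space M. ereal (r + delay) \<le> \<sigma> \<omega> \<and> \<sigma> \<omega> \<le> ereal s \<and> ereal s < \<eta> \<omega>}) \<omega> *
       ennreal (survival_ratio s u \<omega>) \<partial>M)"
    using AEeq[of s] by (intro nn_integral_cong_AE, elim AE_mp) (auto intro!: AE_I2 simp: indicator_def)
  finally show ?thesis .
qed

text \<open>By symmetry, from \<open>\<sigma>\<close> on, returning to \<open>0\<close> is as likely as falling to \<open>2 * X\<^sub>\<sigma>\<close>.\<close>

lemma reflected_survival:
  assumes v: "v \<in> {0..T}" and W: "W \<in> borel_measurable (pre \<sigma>)" "\<And>\<omega>. W \<omega> \<le> 1"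
  shows "(\<integral>\<^sup>+\<omega>. W \<omega> * indicator {\<omega>\<in>space M. \<sigma> \<omega> \<le> ereal v \<and> ereal v < \<tau> \<omega>} \<omega> \<partial>M) =
    (\<integral>\<^sup>+\<omega>. W \<omega> * indicator {\<omega>\<in>space M. \<sigma> \<omega> \<le> ereal v \<and> ereal v < \<eta> \<omega>} \<omega> \<partial>M)"
proof -
  note m = stopped_measurable_pre[OF stopping_tau_alpha]
  have AEeq: "AE \<omega> in M. indicator {\<omega>\<in>space M. \<sigma> \<omega> \<le> ereal v \<and> ereal v < \<rho> \<omega>} \<omega> = (indicator {\<omega>\<in>space M. \<sigma> \<omega> < ereal v \<and> ereal v < \<rho> \<omega>} \<omega> :: ennreal)" for \<rho> :: "'a \<Rightarrow> ereal"
    using tau_alpha_neq[OF v] by (rule AE_mp) (auto intro!: AE_I2 simp: order_le_less indicator_def)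
  have "(\<integral>\<^sup>+\<omega>. W \<omega> * indicator {\<omega>\<in>space M. \<sigma> \<omega> \<le> ereal v \<and> ereal v < \<tau> \<omega>} \<omega> \<partial>M) =
    (\<integral>\<^sup>+\<omega>. W \<omega> * indicator {\<omega>\<in>space M. \<sigma> \<omega> \<le> ereal v \<and> ereal v < hit \<sigma> (stopped \<sigma>) \<omega>} \<omega> \<partial>M)"
    by (intro nn_integral_cong) (simp add: default_time_eq indicator_def)
  also have "\<dots> = (\<integral>\<^sup>+\<omega>. W \<omega> * indicator {\<omega>\<in>space M. \<sigma> \<omega> < ereal v \<and> ereal v < hit \<sigma> (stopped \<sigma>) \<omega>} \<omega> \<partial>M)"
    using AEeq[of "hit \<sigma> (stopped \<sigma>)"] by (intro nn_integral_cong_AE) (auto elim!: eventually_mono)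
  also have "\<dots> = (\<integral>\<^sup>+\<omega>. W \<omega> * indicator {\<omega>\<in>space M. \<sigma> \<omega> < ereal v} \<omega> *
        emeasure std_normal_distribution {z. \<bar>z\<bar> \<le> \<bar>stopped \<sigma> \<omega>\<bar> / sqrt (v - real_of_ereal (\<sigma> \<omega>))} \<partial>M)"
    by (rule hit_greater_prob[OF stopping_tau_alpha m v W])
  also have "\<dots> = (\<integral>\<^sup>+\<omega>. W \<omega> * indicator {\<omega>\<in>space M. \<sigma> \<omega> < ereal v} \<omega> *
        emeasure std_normal_distribution {z. \<bar>z\<bar> \<le> \<bar>- stopped \<sigma> \<omega>\<bar> / sqrt (v - real_of_ereal (\<sigma> \<omega>))} \<partial>M)"
    by simp
  also have "\<dots> = (\<integral>\<^sup>+\<omega>. W \<omega> * indicator {\<omega>\<in>space M. \<sigma> \<omega> < ereal v \<and> ereal v < hit \<sigma> (\<lambda>\<omega>. - stopped \<sigma> \<omega>) \<omega>} \<omega> \<partial>M)"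
    by (rule hit_greater_prob[OF stopping_tau_alpha _ v W, symmetric]) (use m in measurable)
  also have "\<dots> = (\<integral>\<^sup>+\<omega>. W \<omega> * indicator {\<omega>\<in>space M. \<sigma> \<omega> \<le> ereal v \<and> ereal v < \<eta> \<omega>} \<omega> \<partial>M)"
    unfolding excursion_end_def using AEeq[of "hit \<sigma> (\<lambda>\<omega>. - stopped \<sigma> \<omega>)"]
    by (intro nn_integral_cong_AE) (auto elim!: eventually_mono)
  finally show ?thesis .
qed

definition before_excursion :: "'a set set" where
  "before_excursion = {B \<inter> {\<omega>\<in>space M. ereal (r + delay) \<le> \<sigma> \<omega>} | r B. r \<in> {0..T} \<and> B \<in> sets (F r)}"

text \<open>For r > t the trace on \<sigma> \<le> t is empty, and otherwise \<open>F t\<close> knows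
  B. Lying in the past of \<sigma>, these events are admissible weights in
  \<open>reflected_survival\<close>.\<close>

lemma before_excursion_pre:
  assumes r: "r \<in> {0..T}" and B: "B \<in> sets (F r)"
  shows "B \<inter> {\<omega>\<in>space M. ereal (r + delay) \<le> \<sigma> \<omega>} \<in> sets (pre \<sigma>)"
  unfolding sets_pre[OF stopping_tau_alpha]
proof (intro conjI ballI)
  have eq: "{\<omega>\<in>space M. ereal (r + delay) \<le> \<sigma> \<omega>} = space M - {\<omega>\<in>space M. \<sigma> \<omega> < ereal (r + delay)}"
    by (auto simp: not_less)
  have S: "{\<omega>\<in>space M. ereal (r + delay) \<le> \<sigma> \<omega>} \<in> sets (pre \<sigma>)"
    unfolding eq using stopping_less_pre[OF stopping_tau_alpha, of "ereal (r + delay)"] sets.top[of "pre \<sigma>"]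
    by (simp only: space_pre sets.Diff)
  then have "{\<omega>\<in>space M. ereal (r + delay) \<le> \<sigma> \<omega>} \<in> sets M" using sets_pre[OF stopping_tau_alpha] by blast
  with sets_F[OF r B] show "B \<inter> {\<omega>\<in>space M. ereal (r + delay) \<le> \<sigma> \<omega>} \<in> sets M" by (rule sets.Int)
  fix t assume t: "t \<in> {0..T}"
  show "B \<inter> {\<omega>\<in>space M. ereal (r + delay) \<le> \<sigma> \<omega>} \<inter> {\<omega>\<in>space M. \<sigma> \<omega> \<le> ereal t} \<in> sets (F t)"
  proof (cases "r \<le> t")
    case True
    have "B \<in> sets (F t)" using F_monoD[of r t B] True r t B by auto
    from sets.Int[OF this pre_le_in[OF stopping_tau_alpha S t]] show ?thesis by (simp only: Int_assoc)
  next
    case False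
    then have "ereal t < ereal (r + delay)" using delay_pos by simp
    then have "B \<inter> {\<omega>\<in>space M. ereal (r + delay) \<le> \<sigma> \<omega>} \<inter> {\<omega>\<in>space M. \<sigma> \<omega> \<le> ereal t} = {}"
      using le_less_trans leD by blast
    then show ?thesis by (simp only: sets.empty_sets)
  qed
qed

text \<open>Reflection at time u exchanges \<tau> for \<eta>, the excursion law lowers u to s at the
  price of \<open>survival_ratio\<close>, and reflection at time s returns to \<tau>. The second
  reflection is legitimate because the ratio is a function of \<sigma> and at most 1 on \<sigma>
  \<le> s.\<close>

lemma before_excursion_survival:
  assumes C: "C \<in> before_excursion" and s: "0 \<le> s" "s \<le> u" "u \<le> T"
  shows "emeasure M (C \<inter> {\<omega>\<in>space M. \<sigma> \<omega> \<le> ereal s \<and> ereal u < \<tau> \<omega>}) =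
    (\<integral>\<^sup>+\<omega>. indicator (C \<inter> {\<omega>\<in>space M. \<sigma> \<omega> \<le> ereal s \<and> ereal s < \<tau> \<omega>}) \<omega> * ennreal (survival_ratio s u \<omega>) \<partial>M)"
proof -
  obtain r B where rB: "r \<in> {0..T}" "B \<in> sets (F r)" "C = B \<inter> {\<omega>\<in>space M. ereal (r + delay) \<le> \<sigma> \<omega>}"
    using C by (auto simp: before_excursion_def)
  have sT: "s \<in> {0..T}" and uT: "u \<in> {0..T}" using s by auto
  let ?S = "{\<omega>\<in>space M. \<sigma> \<omega> \<le> ereal s}"
  have pre: "C \<inter> ?S \<in> sets (pre \<sigma>)"
  proof -
    have "{\<omega>\<in>space (pre \<sigma>). \<sigma> \<omega> \<le> ereal s} \<in> sets (pre \<sigma>)"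
      using stopping_measurable_pre[OF stopping_tau_alpha] by measurable
    then have "?S \<in> sets (pre \<sigma>)" by (simp only: space_pre)
    with before_excursion_pre[OF rB(1,2)] show ?thesis unfolding rB(3) by (rule sets.Int)
  qed
  have preM: "C \<inter> ?S \<in> sets M" using pre sets_pre[OF stopping_tau_alpha] by blast
  note [measurable] = preM stopping_measurable[OF stopping_tau_alpha] stopping_measurable[OF stopping_excursion_end]
  have \<tau>M: "{\<omega>\<in>space M. ereal v < \<tau> \<omega>} \<in> sets M" for v
  proof -
    have "{\<omega>\<in>space M. ereal v < \<tau> \<omega>} = {\<omega>\<in>space M. ereal v < hit \<sigma> (stopped \<sigma>) \<omega>}" by (auto simp: default_time_eq)
    also have "\<dots> \<in> sets M" using stopping_measurable[OF stopping_default] by measurable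
    finally show ?thesis .
  qed
  have le: "\<sigma> \<omega> \<le> ereal s \<Longrightarrow> \<sigma> \<omega> \<le> ereal u" for \<omega> using s(2) order_trans[of "\<sigma> \<omega>" "ereal s" "ereal u"] by simp
  have ratio: "survival_ratio s u \<omega> \<le> 1" "0 \<le> survival_ratio s u \<omega>" if "\<omega> \<in> space M" "\<sigma> \<omega> \<le> ereal s" for \<omega>
  proof -
    have "0 < s - (real_of_ereal (\<sigma> \<omega>) - delay)"
      using that(2) delay_pos by (cases rule: tau_alpha_cases[OF that(1)]) auto
    then show "survival_ratio s u \<omega> \<le> 1" "0 \<le> survival_ratio s u \<omega>" using s(2) by (auto simp: divide_le_eq_1)
  qed
  let ?W = "\<lambda>\<omega>. indicator (C \<inter> ?S) \<omega> * ennreal (survival_ratio s u \<omega>)"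
  have W: "?W \<in> borel_measurable (pre \<sigma>)"
  proof -
    note [measurable] = stopping_measurable_pre[OF stopping_tau_alpha] pre
    show ?thesis by measurable
  qed
  have W1: "?W \<omega> \<le> 1" for \<omega>
  proof (cases "\<omega> \<in> C \<inter> ?S")
    case True
    then show ?thesis using ratio(1)[of \<omega>] by (simp add: ennreal_le_1)
  qed simp
  have "emeasure M (C \<inter> {\<omega>\<in>space M. \<sigma> \<omega> \<le> ereal s \<and> ereal u < \<tau> \<omega>}) =
    (\<integral>\<^sup>+\<omega>. indicator (C \<inter> ?S) \<omega> * indicator {\<omega>\<in>space M. \<sigma> \<omega> \<le> ereal u \<and> ereal u < \<tau> \<omega>} \<omega> \<partial>M)"
  proof -
    have "C \<inter> {\<omega>\<in>space M. \<sigma> \<omega> \<le> ereal s \<and> ereal u < \<tau> \<omega>} = (C \<inter> ?S) \<inter> {\<omega>\<in>space M. ereal u < \<tau> \<omega>}" by blast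
    then have "emeasure M (C \<inter> {\<omega>\<in>space M. \<sigma> \<omega> \<le> ereal s \<and> ereal u < \<tau> \<omega>}) = (\<integral>\<^sup>+\<omega>. indicator ((C \<inter> ?S) \<inter> {\<omega>\<in>space M. ereal u < \<tau> \<omega>}) \<omega> \<partial>M)"
      using sets.Int[OF preM \<tau>M] by (simp only: nn_integral_indicator)
    also have "\<dots> = (\<integral>\<^sup>+\<omega>. indicator (C \<inter> ?S) \<omega> * indicator {\<omega>\<in>space M. \<sigma> \<omega> \<le> ereal u \<and> ereal u < \<tau> \<omega>} \<omega> \<partial>M)"
      using le by (intro nn_integral_cong) (auto simp: indicator_def)
    finally show ?thesis .
  qed
  also have "\<dots> = (\<integral>\<^sup>+\<omega>. indicator (C \<inter> ?S) \<omega> * indicator {\<omega>\<in>space M. \<sigma> \<omega> \<le> ereal u \<and> ereal u < \<eta> \<omega>} \<omega> \<partial>M)"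
    by (rule reflected_survival[OF uT borel_measurable_indicator[OF pre]]) (simp add: indicator_def)
  also have "\<dots> = emeasure M (B \<inter> {\<omega>\<in>space M. ereal (r + delay) \<le> \<sigma> \<omega> \<and> \<sigma> \<omega> \<le> ereal s \<and> ereal u < \<eta> \<omega>})"
  proof -
    have "B \<inter> {\<omega>\<in>space M. ereal (r + delay) \<le> \<sigma> \<omega> \<and> \<sigma> \<omega> \<le> ereal s \<and> ereal u < \<eta> \<omega>} = (C \<inter> ?S) \<inter> {\<omega>\<in>space M. ereal u < \<eta> \<omega>}"
      unfolding rB(3) by blast
    moreover have "\<dots> \<in> sets M" by measurable
    ultimately have "emeasure M (B \<inter> {\<omega>\<in>space M. ereal (r + delay) \<le> \<sigma> \<omega> \<and> \<sigma> \<omega> \<le> ereal s \<and> ereal u < \<eta> \<omega>}) =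
      (\<integral>\<^sup>+\<omega>. indicator ((C \<inter> ?S) \<inter> {\<omega>\<in>space M. ereal u < \<eta> \<omega>}) \<omega> \<partial>M)"
      by (simp only: nn_integral_indicator)
    also have "\<dots> = (\<integral>\<^sup>+\<omega>. indicator (C \<inter> ?S) \<omega> * indicator {\<omega>\<in>space M. \<sigma> \<omega> \<le> ereal u \<and> ereal u < \<eta> \<omega>} \<omega> \<partial>M)"
      using le by (intro nn_integral_cong) (auto simp: indicator_def)
    finally show ?thesis by simp
  qed
  also have "\<dots> = (\<integral>\<^sup>+\<omega>. indicator (B \<inter> {\<omega>\<in>space M. ereal (r + delay) \<le> \<sigma> \<omega> \<and> \<sigma> \<omega> \<le> ereal s \<and> ereal s < \<eta> \<omega>}) \<omega> *
       ennreal (survival_ratio s u \<omega>) \<partial>M)"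
    by (rule excursion_survival[OF rB(1) s rB(2)])
  also have "\<dots> = (\<integral>\<^sup>+\<omega>. ?W \<omega> * indicator {\<omega>\<in>space M. \<sigma> \<omega> \<le> ereal s \<and> ereal s < \<eta> \<omega>} \<omega> \<partial>M)"
    unfolding rB(3) by (intro nn_integral_cong) (auto simp: indicator_def)
  also have "\<dots> = (\<integral>\<^sup>+\<omega>. ?W \<omega> * indicator {\<omega>\<in>space M. \<sigma> \<omega> \<le> ereal s \<and> ereal s < \<tau> \<omega>} \<omega> \<partial>M)"
    by (rule reflected_survival[OF sT W W1, symmetric])
  also have "\<dots> = (\<integral>\<^sup>+\<omega>. indicator (C \<inter> {\<omega>\<in>space M. \<sigma> \<omega> \<le> ereal s \<and> ereal s < \<tau> \<omega>}) \<omega> * ennreal (survival_ratio s u \<omega>) \<partial>M)"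
    by (intro nn_integral_cong) (auto simp: indicator_def)
  finally show ?thesis .
qed

lemma before_excursion_sub: "before_excursion \<subseteq> sets M"
  using before_excursion_pre sets_pre[OF stopping_tau_alpha] by (auto simp: before_excursion_def)

lemma Int_stable_before_excursion: "Int_stable before_excursion"
proof (rule Int_stableI)
  have *: "(B \<inter> {\<omega>\<in>space M. ereal (r + delay) \<le> \<sigma> \<omega>}) \<inter> (B' \<inter> {\<omega>\<in>space M. ereal (r' + delay) \<le> \<sigma> \<omega>}) \<in> before_excursion"
    if "r \<in> {0..T}" "r' \<in> {0..T}" "r \<le> r'" "B \<in> sets (F r)" "B' \<in> sets (F r')" for r r' B B'
  proof -
    have "B \<in> sets (F r')" using F_monoD[of r r' B] that by auto
    then have "B \<inter> B' \<in> sets (F r')" using that(5) by (rule sets.Int)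
    moreover have "ereal (r + delay) \<le> \<sigma> \<omega>" if "ereal (r' + delay) \<le> \<sigma> \<omega>" for \<omega>
      using that \<open>r \<le> r'\<close> order_trans[of "ereal (r + delay)" "ereal (r' + delay)"] by simp
    then have "(B \<inter> {\<omega>\<in>space M. ereal (r + delay) \<le> \<sigma> \<omega>}) \<inter> (B' \<inter> {\<omega>\<in>space M. ereal (r' + delay) \<le> \<sigma> \<omega>}) =
      (B \<inter> B') \<inter> {\<omega>\<in>space M. ereal (r' + delay) \<le> \<sigma> \<omega>}" by blast
    ultimately show ?thesis unfolding before_excursion_def using that(2) by blast
  qed
  fix A A' assume "A \<in> before_excursion" "A' \<in> before_excursion"
  then obtain r B r' B' where A: "A = B \<inter> {\<omega>\<in>space M. ereal (r + delay) \<le> \<sigma> \<omega>}" "r \<in> {0..T}" "B \<in> sets (F r)"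
    "A' = B' \<inter> {\<omega>\<in>space M. ereal (r' + delay) \<le> \<sigma> \<omega>}" "r' \<in> {0..T}" "B' \<in> sets (F r')"
    unfolding before_excursion_def by blast
  show "A \<inter> A' \<in> before_excursion"
  proof (cases "r \<le> r'")
    case True then show ?thesis using *[of r r' B B'] A by simp
  next
    case False then show ?thesis using *[of r' r B' B] A by (simp add: Int_commute)
  qed
qed

lemma space_before_excursion: "space M \<in> before_excursion"
proof -
  have 0: "0 \<in> {0..T}" using T_pos by simp
  have "ereal (0 + delay) \<le> \<sigma> \<omega>" if "\<omega> \<in> space M" for \<omega>
    by (cases rule: tau_alpha_cases[OF that]) auto
  then have "space M = space M \<inter> {\<omega>\<in>space M. ereal (0 + delay) \<le> \<sigma> \<omega>}" by blast
  then show ?thesis unfolding before_excursion_def using 0 space_F_in[OF 0] by blast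
qed

text \<open>Both sides are finite measures in C, and \<open>before_excursion\<close> is a pi-system
  containing the whole space.\<close>

lemma default_survival:
  assumes C: "C \<in> sigma_sets (space M) before_excursion" and s: "0 \<le> s" "s \<le> u" "u \<le> T"
  shows "emeasure M (C \<inter> {\<omega>\<in>space M. \<sigma> \<omega> \<le> ereal s \<and> ereal u < \<tau> \<omega>}) =
    (\<integral>\<^sup>+\<omega>. indicator (C \<inter> {\<omega>\<in>space M. \<sigma> \<omega> \<le> ereal s \<and> ereal s < \<tau> \<omega>}) \<omega> * ennreal (survival_ratio s u \<omega>) \<partial>M)"
proof -
  let ?H = "sigma (space M) before_excursion"
  have sub: "before_excursion \<subseteq> Pow (space M)" using before_excursion_sub sets.sets_into_space by blast
  have HM: "sets ?H \<subseteq> sets M"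
    using before_excursion_sub by (simp add: sub sets.sigma_sets_subset)
  have id: "(\<lambda>\<omega>. \<omega>) \<in> measurable M ?H"
    using HM by (auto simp: measurable_def space_measure_of_conv dest: sets.Int_space_eq2)
  have \<tau>m: "\<tau> \<in> borel_measurable M"
    using stopping_measurable[OF stopping_default] by (rule measurable_cong[THEN iffD2, rotated]) (rule default_time_eq)
  note [measurable] = stopping_measurable[OF stopping_tau_alpha] \<tau>m
  define f1 where "f1 = (indicator {\<omega>\<in>space M. \<sigma> \<omega> \<le> ereal s \<and> ereal u < \<tau> \<omega>} :: 'a \<Rightarrow> ennreal)"
  define f2 where "f2 = (\<lambda>\<omega>. indicator {\<omega>\<in>space M. \<sigma> \<omega> \<le> ereal s \<and> ereal s < \<tau> \<omega>} \<omega> * ennreal (survival_ratio s u \<omega>))"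
  have f: "f1 \<in> borel_measurable M" "f2 \<in> borel_measurable M" unfolding f1_def f2_def by measurable
  have E: "emeasure (distr (density M f) ?H (\<lambda>\<omega>. \<omega>)) C = (\<integral>\<^sup>+\<omega>. f \<omega> * indicator C \<omega> \<partial>M)"
    if "f \<in> borel_measurable M" "C \<in> sets ?H" for f C
  proof -
    have "C \<in> sets M" using that HM by blast
    moreover then have "C \<inter> space M = C" using sets.sets_into_space by blast
    ultimately show ?thesis using that id by (simp add: emeasure_distr emeasure_density)
  qed
  have i1: "(\<integral>\<^sup>+\<omega>. f1 \<omega> * indicator C \<omega> \<partial>M) = emeasure M (C \<inter> {\<omega>\<in>space M. \<sigma> \<omega> \<le> ereal s \<and> ereal u < \<tau> \<omega>})" if "C \<in> sets M" for C
  proof -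
    have "(\<integral>\<^sup>+\<omega>. f1 \<omega> * indicator C \<omega> \<partial>M) = (\<integral>\<^sup>+\<omega>. indicator (C \<inter> {\<omega>\<in>space M. \<sigma> \<omega> \<le> ereal s \<and> ereal u < \<tau> \<omega>}) \<omega> \<partial>M)"
      unfolding f1_def by (intro nn_integral_cong) (auto simp: indicator_def)
    moreover have "C \<inter> {\<omega>\<in>space M. \<sigma> \<omega> \<le> ereal s \<and> ereal u < \<tau> \<omega>} \<in> sets M" using that by measurable
    ultimately show ?thesis by simp
  qed
  have i2: "(\<integral>\<^sup>+\<omega>. f2 \<omega> * indicator C \<omega> \<partial>M) =
     (\<integral>\<^sup>+\<omega>. indicator (C \<inter> {\<omega>\<in>space M. \<sigma> \<omega> \<le> ereal s \<and> ereal s < \<tau> \<omega>}) \<omega> * ennreal (survival_ratio s u \<omega>) \<partial>M)" for C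
    unfolding f2_def by (intro nn_integral_cong) (auto simp: indicator_def)
  have "distr (density M f1) ?H (\<lambda>\<omega>. \<omega>) = distr (density M f2) ?H (\<lambda>\<omega>. \<omega>)"
  proof (rule measure_eqI_generator_eq[OF Int_stable_before_excursion sub, where A="\<lambda>_. space M"])
    fix C assume C: "C \<in> before_excursion"
    then have "C \<in> sets ?H" "C \<in> sets M" using before_excursion_sub by (auto simp: sub)
    then show "emeasure (distr (density M f1) ?H (\<lambda>\<omega>. \<omega>)) C = emeasure (distr (density M f2) ?H (\<lambda>\<omega>. \<omega>)) C"
      by (simp only: E[OF f(1)] E[OF f(2)] i1 i2 before_excursion_survival[OF C s])
  next
    show "emeasure (distr (density M f1) ?H (\<lambda>\<omega>. \<omega>)) (space M) \<noteq> \<infinity>"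
    proof -
      have "space M \<in> sets ?H" using space_before_excursion by (simp add: sub)
      then show ?thesis by (simp only: E[OF f(1)] i1[OF sets.top]) (simp add: emeasure_eq_measure)
    qed
  qed (use space_before_excursion in \<open>auto simp: sub\<close>)
  moreover have "C \<in> sets ?H" using C by (simp add: sub)
  moreover then have "C \<in> sets M" using HM by blast
  ultimately show ?thesis using E[OF f(1), of C] E[OF f(2), of C] i1[of C] i2[of C] by simp
qed

end

section \<open>The market's filtration\<close>

lemma AE_complete_sets:
  assumes M: "complete_measure M" and AE: "AE \<omega> in M. P \<omega>"
  shows "{\<omega>\<in>space M. \<not> P \<omega>} \<in> null_sets M"
proof -
  interpret complete_measure M by fact
  obtain N where N: "N \<in> null_sets M" "\<And>\<omega>. \<omega> \<in> space M - N \<Longrightarrow> P \<omega>"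
    using AE_E3[OF AE] by metis
  have "{\<omega>\<in>space M. \<not> P \<omega>} \<subseteq> N" using N(2) by blast
  then show ?thesis using N(1) complete null_sets_subset by blast
qed

lemma space_sign_filtration [simp]: "space (sign_filtration M Y t) = space M"
  by (simp add: sign_filtration_def space_measure_of_conv)

text \<open>Gives every completed event an almost surely equal representative from before the
  completion; integrals over events of \<open>K\<close> are reduced to events of \<open>H\<close>
  through it.\<close>

lemma sets_completed_iff:
  assumes M: "complete_measure M" and sp: "space (H t) = space M" and sub: "sets (H t) \<subseteq> sets M"
  shows "B \<in> sets (completed_filtration M H t) \<longleftrightarrow>
    B \<subseteq> space M \<and> (\<exists>B'\<in>sets (H t). AE \<omega> in M. \<omega> \<in> B \<longleftrightarrow> \<omega> \<in> B')"
proof -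
  have Pow: "sets (H t) \<union> null_sets M \<subseteq> Pow (space M)"
    using sub sets.sets_into_space null_setsD2 by blast
  have eq: "sets (completed_filtration M H t) = sigma_sets (space M) (sets (H t) \<union> null_sets M)"
    unfolding completed_filtration_def using Pow by simp
  show ?thesis
  proof
    assume "B \<in> sets (completed_filtration M H t)"
    then have B: "B \<in> sigma_sets (space M) (sets (H t) \<union> null_sets M)" unfolding eq .
    have "B \<subseteq> space M" using sigma_sets_into_sp[OF Pow B] .
    moreover from B have "\<exists>B'\<in>sets (H t). AE \<omega> in M. \<omega> \<in> B \<longleftrightarrow> \<omega> \<in> B'"
    proof induction
      case (Basic A)
      then show ?case
      proof
        assume "A \<in> sets (H t)" then show ?thesis by blast
      next
        assume "A \<in> null_sets M"
        from AE_not_in[OF this] have "AE \<omega> in M. \<omega> \<in> A \<longleftrightarrow> \<omega> \<in> {}" by simp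
        then show ?thesis using sets.empty_sets by blast
      qed
    next
      case Empty
      then show ?case by (intro bexI[of _ "{}"]) auto
    next
      case (Compl A)
      then obtain B' where B': "B' \<in> sets (H t)" "AE \<omega> in M. \<omega> \<in> A \<longleftrightarrow> \<omega> \<in> B'" by blast
      have "AE \<omega> in M. \<omega> \<in> space M - A \<longleftrightarrow> \<omega> \<in> space M - B'"
        using B'(2) by (rule AE_mp) simp
      moreover have "space M - B' \<in> sets (H t)" using B'(1) sp sets.compl_sets by metis
      ultimately show ?case by blast
    next
      case (Union A)
      then obtain B' where B': "\<And>i::nat. B' i \<in> sets (H t)" "\<And>i. AE \<omega> in M. \<omega> \<in> A i \<longleftrightarrow> \<omega> \<in> B' i" by metis
      have "AE \<omega> in M. \<forall>i. \<omega> \<in> A i \<longleftrightarrow> \<omega> \<in> B' i" using B'(2) AE_all_countable[of "\<lambda>i \<omega>. \<omega> \<in> A i \<longleftrightarrow> \<omega> \<in> B' i" M] by blast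
      then have "AE \<omega> in M. \<omega> \<in> (\<Union>i. A i) \<longleftrightarrow> \<omega> \<in> (\<Union>i. B' i)" by (rule AE_mp) simp
      moreover have "(\<Union>i. B' i) \<in> sets (H t)" using B'(1) by blast
      ultimately show ?case by blast
    qed
    ultimately show "B \<subseteq> space M \<and> (\<exists>B'\<in>sets (H t). AE \<omega> in M. \<omega> \<in> B \<longleftrightarrow> \<omega> \<in> B')" by blast
  next
    assume "B \<subseteq> space M \<and> (\<exists>B'\<in>sets (H t). AE \<omega> in M. \<omega> \<in> B \<longleftrightarrow> \<omega> \<in> B')"
    then obtain B' where B: "B \<subseteq> space M" "B' \<in> sets (H t)" "AE \<omega> in M. \<omega> \<in> B \<longleftrightarrow> \<omega> \<in> B'" by blast
    have N: "{\<omega>\<in>space M. \<not> (\<omega> \<in> B \<longleftrightarrow> \<omega> \<in> B')} \<in> null_sets M" by (rule AE_complete_sets[OF M B(3)])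
    interpret complete_measure M by fact
    have B'sp: "B' \<subseteq> space M" using B(2) sub sets.sets_into_space by blast
    have "B - B' \<subseteq> {\<omega>\<in>space M. \<not> (\<omega> \<in> B \<longleftrightarrow> \<omega> \<in> B')}" "B' - B \<subseteq> {\<omega>\<in>space M. \<not> (\<omega> \<in> B \<longleftrightarrow> \<omega> \<in> B')}"
      using B(1) B'sp by auto
    then have n: "B - B' \<in> null_sets M" "B' - B \<in> null_sets M"
      using N complete null_sets_subset by blast+
    have gen: "A \<in> sets (completed_filtration M H t)" if "A \<in> sets (H t) \<union> null_sets M" for A
      unfolding eq using that by (rule sigma_sets.Basic)
    have "B = (B' - (B' - B)) \<union> (B - B')" by blast
    moreover have "(B' - (B' - B)) \<union> (B - B') \<in> sets (completed_filtration M H t)"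
      by (rule sets.Un[OF sets.Diff[OF gen gen] gen]) (simp_all add: B(2) n)
    ultimately show "B \<in> sets (completed_filtration M H t)" by simp
  qed
qed

lemma sets_right_cont_filtration:
  assumes sp: "\<And>u. u \<in> {0..T} \<Longrightarrow> space (K u) = space M" and t: "t \<in> {0..T}"
  shows "sets (right_cont_filtration M T K t) = (if t < T then (\<Inter>u\<in>{t<..T}. sets (K u)) else sets (K t))"
proof (cases "t < T")
  case True
  have S: "sigma_algebra (space M) (\<Inter>u\<in>{t<..T}. sets (K u))"
  proof (rule sigma_algebra_iff2[THEN iffD2], intro conjI ballI allI impI)
    have "sets (K T) \<subseteq> Pow (space M)" using sp[of T] t sets.space_closed[of "K T"] by auto
    then show "(\<Inter>u\<in>{t<..T}. sets (K u)) \<subseteq> Pow (space M)" using True by fastforce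
    show "{} \<in> (\<Inter>u\<in>{t<..T}. sets (K u))" by auto
    show "space M - A \<in> (\<Inter>u\<in>{t<..T}. sets (K u))" if A: "A \<in> (\<Inter>u\<in>{t<..T}. sets (K u))" for A
    proof
      fix u assume u: "u \<in> {t<..T}"
      then have "space (K u) - A \<in> sets (K u)" using A by blast
      then show "space M - A \<in> sets (K u)" using sp[of u] u t by simp
    qed
    show "(\<Union>i. A i) \<in> (\<Inter>u\<in>{t<..T}. sets (K u))" if "range A \<subseteq> (\<Inter>u\<in>{t<..T}. sets (K u))" for A :: "nat \<Rightarrow> 'a set"
      using that by (intro INT_I sets.countable_nat_UN) blast
  qed
  show ?thesis unfolding right_cont_filtration_def using True
    by (simp add: sigma_algebra.sets_measure_of_eq[OF S])
next
  case False
  have "sets (K t) \<subseteq> Pow (space M)" using sp[OF t] sets.space_closed[of "K t"] by auto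
  then show ?thesis unfolding right_cont_filtration_def using False sp[OF t] sets.sigma_sets_eq[of "K t"]
    by (simp add: sets_measure_of)
qed

locale market = cash_balance M T F X \<alpha> for M :: "'a measure" and T F X \<alpha> +
  assumes complete: "complete_measure M"
begin

abbreviation "Y \<equiv> Y_process \<alpha> T X"
abbreviation "H \<equiv> sign_filtration M Y"
abbreviation "K \<equiv> completed_filtration M H"
abbreviation "G \<equiv> market_filtration M \<alpha> T X"

lemma Y_measurable:
  assumes t: "t \<in> {0..T}"
  shows "Y t \<in> borel_measurable M"
proof -
  note [measurable] = X_meas[OF t] stopped_measurable[OF stopping_tau_alpha] stopping_measurable[OF stopping_tau_alpha]
  have "Y t = (\<lambda>\<omega>. if ereal t < \<sigma> \<omega> then X t \<omega> else 2 * stopped \<sigma> \<omega> - X t \<omega>)"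
    by (simp add: Y_process_def X_tau_alpha_eq fun_eq_iff)
  then show ?thesis by simp
qed

lemma sign_left_measurable: "sign_left \<in> borel_measurable borel"
  unfolding sign_left_def[abs_def] by measurable

lemma sign_gen_sub:
  assumes "t \<in> {0..T}"
  shows "(\<Union>s\<in>{0..t}. {(\<lambda>\<omega>. sign_left (Y s \<omega>)) -` B \<inter> space M | B. B \<in> sets borel}) \<subseteq> sets M"
proof (clarify)
  fix s B assume "s \<in> {0..t}" "B \<in> sets (borel :: real measure)"
  then show "(\<lambda>\<omega>. sign_left (Y s \<omega>)) -` B \<inter> space M \<in> sets M"
    using assms measurable_compose[OF Y_measurable[of s] sign_left_measurable] by (intro measurable_sets) auto
qed

lemma sets_H:
  assumes "t \<in> {0..T}"
  shows "sets (H t) = sigma_sets (space M) (\<Union>s\<in>{0..t}. {(\<lambda>\<omega>. sign_left (Y s \<omega>)) -` B \<inter> space M | B. B \<in> sets borel})"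
  unfolding sign_filtration_def
  by (rule sets_measure_of) (use sign_gen_sub[OF assms] sets.sets_into_space in blast)

lemma H_sub: "t \<in> {0..T} \<Longrightarrow> sets (H t) \<subseteq> sets M"
  unfolding sets_H by (rule sets.sigma_sets_subset[OF sign_gen_sub])

lemma H_mono:
  assumes "0 \<le> s" "s \<le> t" "t \<le> T"
  shows "sets (H s) \<subseteq> sets (H t)"
proof -
  have "s \<in> {0..T}" "t \<in> {0..T}" using assms by auto
  note sets_H[OF this(1)] sets_H[OF this(2)]
  moreover have "{0..s} \<subseteq> {0..t}" using assms by auto
  ultimately show ?thesis by (simp only:) (intro sigma_sets_mono' UN_mono order_refl)
qed

lemma space_K [simp]: "space (K t) = space M"
  by (simp add: completed_filtration_def space_measure_of_conv)

lemma sets_K_iff: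
  "t \<in> {0..T} \<Longrightarrow> B \<in> sets (K t) \<longleftrightarrow> B \<subseteq> space M \<and> (\<exists>B'\<in>sets (H t). AE \<omega> in M. \<omega> \<in> B \<longleftrightarrow> \<omega> \<in> B')"
  by (rule sets_completed_iff[OF complete, of H t]) (simp_all add: H_sub)

lemma H_K: "t \<in> {0..T} \<Longrightarrow> B \<in> sets (H t) \<Longrightarrow> B \<in> sets (K t)"
  unfolding sets_K_iff using H_sub sets.sets_into_space by blast

lemma K_AE_cong:
  assumes t: "t \<in> {0..T}" and B: "B \<in> sets (K t)" and A: "A \<subseteq> space M" "AE \<omega> in M. \<omega> \<in> A \<longleftrightarrow> \<omega> \<in> B"
  shows "A \<in> sets (K t)"
proof -
  obtain B' where B': "B' \<in> sets (H t)" "AE \<omega> in M. \<omega> \<in> B \<longleftrightarrow> \<omega> \<in> B'" using B sets_K_iff[OF t] by blast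
  have "AE \<omega> in M. \<omega> \<in> A \<longleftrightarrow> \<omega> \<in> B'" using A(2) B'(2) by eventually_elim simp
  then show ?thesis using sets_K_iff[OF t] A(1) B'(1) by blast
qed

lemma K_mono: "0 \<le> s \<Longrightarrow> s \<le> t \<Longrightarrow> t \<le> T \<Longrightarrow> sets (K s) \<subseteq> sets (K t)"
  using H_mono[of s t] sets_K_iff[of s] sets_K_iff[of t] by (intro subsetI) auto

lemma K_sub:
  assumes "t \<in> {0..T}" shows "sets (K t) \<subseteq> sets M"
proof
  fix B assume "B \<in> sets (K t)"
  from this[unfolded sets_K_iff[OF assms]]
  obtain B' where B': "B' \<in> sets (H t)" and B: "B \<subseteq> space M" "AE \<omega> in M. \<omega> \<in> B \<longleftrightarrow> \<omega> \<in> B'"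
    by (elim conjE bexE)
  have B'M: "B' \<in> sets M" using H_sub[OF assms] B' by (rule subsetD)
  have N: "{\<omega>\<in>space M. \<not> (\<omega> \<in> B \<longleftrightarrow> \<omega> \<in> B')} \<in> null_sets M" (is "?N \<in> _") by (rule AE_complete_sets[OF complete B(2)])
  interpret complete_measure M by (rule complete)
  have "B - B' \<subseteq> ?N" "B' - B \<subseteq> ?N" using B(1) sets.sets_into_space[OF B'M] by auto
  then have D: "B - B' \<in> sets M" "B' - B \<in> sets M" using N complete by blast+
  have "(B' - (B' - B)) \<union> (B - B') \<in> sets M" by (rule sets.Un[OF sets.Diff[OF B'M D(2)] D(1)])
  moreover have "(B' - (B' - B)) \<union> (B - B') = B" by blast
  ultimately show "B \<in> sets M" by (simp only:)
qed

lemma sets_G: "t \<in> {0..T} \<Longrightarrow> sets (G t) = (if t < T then (\<Inter>u\<in>{t<..T}. sets (K u)) else sets (K t))"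
  unfolding market_filtration_def by (rule sets_right_cont_filtration) simp

lemma space_G [simp]: "space (G t) = space M"
  by (simp add: market_filtration_def right_cont_filtration_def space_measure_of_conv)

lemma K_sub_G: "t \<in> {0..T} \<Longrightarrow> sets (K t) \<subseteq> sets (G t)"
proof (cases "t < T")
  case True
  assume t: "t \<in> {0..T}"
  have "sets (K t) \<subseteq> sets (K u)" if "u \<in> {t<..T}" for u using K_mono[of t u] that t by simp
  then show ?thesis unfolding sets_G[OF t] if_P[OF True] by (rule INT_greatest)
qed (simp add: sets_G)

lemma G_sub_K: "0 \<le> t \<Longrightarrow> t < u \<Longrightarrow> u \<le> T \<Longrightarrow> sets (G t) \<subseteq> sets (K u)"
  using sets_G[of t] by auto

lemma G_sub: "t \<in> {0..T} \<Longrightarrow> sets (G t) \<subseteq> sets M"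
  using sets_G[of t] K_sub[of t] K_sub[of T] T_pos by (cases "t < T") auto

lemma subalgebra_G: "t \<in> {0..T} \<Longrightarrow> subalgebra M (G t)"
  using G_sub by (simp add: subalgebra_def)

text \<open>At \<sigma> the path is above twice its own (negative) value there, and by the
  intermediate value theorem it stays above until it meets that level. Hence \<tau> is strictly
  later than \<sigma> whenever \<sigma> is finite.\<close>

lemma default_cases:
  assumes om: "\<omega> \<in> space M"
  obtains "\<sigma> \<omega> = \<infinity>" "\<tau> \<omega> = \<infinity>"
  | g where "\<sigma> \<omega> = ereal (g + delay)" "0 \<le> g" "g + delay \<le> T" "X g \<omega> = 0"
      "\<And>s. g < s \<Longrightarrow> s \<le> g + delay \<Longrightarrow> X s \<omega> < 0" "\<tau> \<omega> = \<infinity>"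
      "\<And>t. g + delay \<le> t \<Longrightarrow> t \<le> T \<Longrightarrow> 2 * X (g + delay) \<omega> < X t \<omega>"
  | g e where "\<sigma> \<omega> = ereal (g + delay)" "0 \<le> g" "g + delay \<le> T" "X g \<omega> = 0"
      "\<And>s. g < s \<Longrightarrow> s \<le> g + delay \<Longrightarrow> X s \<omega> < 0" "\<tau> \<omega> = ereal e" "g + delay < e" "e \<le> T"
      "X e \<omega> = 2 * X (g + delay) \<omega>"
      "\<And>t. g + delay \<le> t \<Longrightarrow> t < e \<Longrightarrow> 2 * X (g + delay) \<omega> < X t \<omega>"
proof (cases rule: tau_alpha_cases[OF om])
  case 1
  have "\<tau> \<omega> = \<infinity>" using le_hit[OF stopping_tau_alpha om, of "stopped \<sigma>"] 1(1) by (simp add: default_time_eq[OF om])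
  with 1 show thesis using that(1) by blast
next
  case (2 g)
  have st: "stopped \<sigma> \<omega> = X (g + delay) \<omega>" by (simp add: stopped_def 2(1))
  have neg: "X (g + delay) \<omega> < 0" using 2(5)[of "g + delay"] delay_pos by simp
  have above: "2 * X (g + delay) \<omega> < X t \<omega>"
    if t: "g + delay \<le> t" "t \<le> T" and ne: "\<And>s. g + delay \<le> s \<Longrightarrow> s \<le> t \<Longrightarrow> X s \<omega> \<noteq> 2 * X (g + delay) \<omega>" for t
  proof (rule ccontr)
    assume "\<not> 2 * X (g + delay) \<omega> < X t \<omega>"
    then have "X t \<omega> \<le> 2 * X (g + delay) \<omega>" by simp
    moreover have "continuous_on {g + delay..t} (\<lambda>s. X s \<omega>)"
      using 2(2) delay_pos t by (intro continuous_on_subset[OF cont[OF om]]) auto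
    ultimately obtain s where "g + delay \<le> s" "s \<le> t" "X s \<omega> = 2 * X (g + delay) \<omega>"
      using IVT2'[of "\<lambda>s. X s \<omega>" t "2 * X (g + delay) \<omega>" "g + delay"] neg t by auto
    then show False using ne by blast
  qed
  show thesis
  proof (cases rule: hit_cases[OF stopping_tau_alpha om, of "stopped \<sigma>"])
    case 1
    have ne: "X s \<omega> \<noteq> 2 * X (g + delay) \<omega>" if "g + delay \<le> s" "s \<le> T" for s
      using 1(2)[of s] that 2(1,2) delay_pos by (simp add: st)
    show thesis
    proof (rule that(2)[OF 2(1-5)])
      show "\<tau> \<omega> = \<infinity>" using 1(1) by (simp add: default_time_eq[OF om])
      show "2 * X (g + delay) \<omega> < X t \<omega>" if "g + delay \<le> t" "t \<le> T" for t
        using above[OF that] ne that(2) by (meson order_trans)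
    qed
  next
    case (2 e)
    have e: "g + delay \<le> e" "X e \<omega> = 2 * X (g + delay) \<omega>" using 2(4,5) \<open>\<sigma> \<omega> = ereal (g + delay)\<close> by (simp_all add: st)
    have ne: "X s \<omega> \<noteq> 2 * X (g + delay) \<omega>" if s: "g + delay \<le> s" "s < e" for s
    proof
      assume "X s \<omega> = 2 * X (g + delay) \<omega>"
      then have "e \<le> s" using 2(3) s \<open>\<sigma> \<omega> = ereal (g + delay)\<close> \<open>0 \<le> g\<close> delay_pos by (intro 2(6)) (auto simp: st)
      then show False using s(2) by simp
    qed
    show thesis
    proof (rule that(3)[OF \<open>\<sigma> \<omega> = ereal (g + delay)\<close> \<open>0 \<le> g\<close> \<open>g + delay \<le> T\<close> \<open>X g \<omega> = 0\<close>])
      show "X s \<omega> < 0" if "g < s" "s \<le> g + delay" for s by (rule \<open>\<And>s. g < s \<Longrightarrow> s \<le> g + delay \<Longrightarrow> X s \<omega> < 0\<close>[OF that])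
      show "\<tau> \<omega> = ereal e" using 2(1) by (simp add: default_time_eq[OF om])
      show "g + delay < e" using e neg by (cases "e = g + delay") auto
      show "e \<le> T" by (rule 2(3))
      show "X e \<omega> = 2 * X (g + delay) \<omega>" by (rule e(2))
      show "2 * X (g + delay) \<omega> < X t \<omega>" if t: "g + delay \<le> t" "t < e" for t
      proof (rule above)
        show "t \<le> T" using t 2(3) by simp
        show "X s \<omega> \<noteq> 2 * X (g + delay) \<omega>" if "g + delay \<le> s" "s \<le> t" for s
          using ne[of s] that t by simp
      qed (rule t(1))
    qed
  qed
qed

lemma Y_before: "ereal t < \<sigma> \<omega> \<Longrightarrow> Y t \<omega> = X t \<omega>"
  by (simp add: Y_process_def)

lemma Y_after: "\<sigma> \<omega> = ereal s \<Longrightarrow> s \<le> t \<Longrightarrow> Y t \<omega> = 2 * X s \<omega> - X t \<omega>"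
  by (simp add: Y_process_def X_tau_alpha_def)

text \<open>Before \<sigma> this is the negative excursion of X; from \<sigma> on X stays above the
  default level until \<tau>, which for the reflected path means negativity. The market thus sees
  one uninterrupted negative excursion from g to \<tau>.\<close>

lemma Y_neg:
  assumes om: "\<omega> \<in> space M" and g: "\<sigma> \<omega> = ereal (g + delay)" and t: "g < t" "ereal t < \<tau> \<omega>" "t \<le> T"
  shows "Y t \<omega> < 0"
proof (cases rule: default_cases[OF om])
  case 1 then show ?thesis using g by simp
next
  case (2 g')
  then have [simp]: "g' = g" using g by simp
  show ?thesis
  proof (cases "t < g + delay")
    case True then show ?thesis using 2(5)[of t] t g by (simp add: Y_before)
  next
    case False then show ?thesis using 2(7)[of t] t by (simp add: Y_after[OF g])
  qed
next
  case (3 g' e)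
  then have [simp]: "g' = g" using g by simp
  show ?thesis
  proof (cases "t < g + delay")
    case True then show ?thesis using 3(5)[of t] t g by (simp add: Y_before)
  next
    case False then show ?thesis using 3(10)[of t] t 3(6) by (simp add: Y_after[OF g])
  qed
qed

lemma sign_pos_H:
  assumes "s \<in> {0..t}" "t \<in> {0..T}"
  shows "{\<omega>\<in>space M. 0 < Y s \<omega>} \<in> sets (H t)" "{\<omega>\<in>space M. Y s \<omega> \<le> 0} \<in> sets (H t)"
proof -
  have gen: "(\<lambda>\<omega>. sign_left (Y s \<omega>)) -` B \<inter> space M \<in> sets (H t)" if "B \<in> sets borel" for B
    unfolding sets_H[OF assms(2)] using assms(1) that by (intro sigma_sets.Basic) blast
  have "(\<lambda>\<omega>. sign_left (Y s \<omega>)) -` {1} \<inter> space M = {\<omega>\<in>space M. 0 < Y s \<omega>}"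
    "(\<lambda>\<omega>. sign_left (Y s \<omega>)) -` {- 1} \<inter> space M = {\<omega>\<in>space M. Y s \<omega> \<le> 0}"
    by (auto simp: sign_left_def split: if_splits)
  then show "{\<omega>\<in>space M. 0 < Y s \<omega>} \<in> sets (H t)" "{\<omega>\<in>space M. Y s \<omega> \<le> 0} \<in> sets (H t)"
    using gen[of "{1}"] gen[of "{- 1}"] by auto
qed

text \<open>While the first long excursion lasts, the signs observed since its start are all \<open>-1\<close>, so
  they carry no more information than \<open>before_excursion\<close>.\<close>

lemma trace_H:
  assumes t: "t \<in> {0..T}" and B: "B \<in> sets (H t)"
  shows "\<exists>C\<in>sigma_sets (space M) before_excursion.
    B \<inter> {\<omega>\<in>space M. \<sigma> \<omega> \<le> ereal t \<and> ereal t < \<tau> \<omega>} = C \<inter> {\<omega>\<in>space M. \<sigma> \<omega> \<le> ereal t \<and> ereal t < \<tau> \<omega>}"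
    (is "\<exists>C\<in>?S. B \<inter> ?E = C \<inter> ?E")
proof -
  have sub: "before_excursion \<subseteq> Pow (space M)" using before_excursion_sub sets.sets_into_space by blast
  interpret S: sigma_algebra "space M" ?S by (rule sigma_algebra_sigma_sets[OF sub])
  show ?thesis
    using B unfolding sets_H[OF t]
  proof induction
    case (Basic A)
    then obtain s B where s: "s \<in> {0..t}" "B \<in> sets borel" and A: "A = (\<lambda>\<omega>. sign_left (Y s \<omega>)) -` B \<inter> space M" by blast
    have sT: "s \<in> {0..T}" using s t by auto
    \<comment> \<open>On ?E a positive sign at time s is possible only if s is at most the start of
      the excursion, where Y is still X. The second event says exactly this and makes ?P a generator
      of \<open>before_excursion\<close>.\<close>
    let ?P = "{\<omega>\<in>space M. 0 < X s \<omega>} \<inter> {\<omega>\<in>space M. ereal (s + delay) \<le> \<sigma> \<omega>}"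
    have "{\<omega>\<in>space (F s). 0 < X s \<omega>} \<in> sets (F s)" using adapted[OF sT] by measurable
    then have "?P \<in> before_excursion"
      unfolding before_excursion_def space_F[OF sT] using sT by blast
    then have P: "?P \<in> ?S" by (rule sigma_sets.Basic)
    have iff: "0 < Y s \<omega> \<longleftrightarrow> \<omega> \<in> ?P" if om: "\<omega> \<in> ?E" for \<omega>
    proof -
      have w: "\<omega> \<in> space M" "\<sigma> \<omega> \<le> ereal t" "ereal t < \<tau> \<omega>" using om by auto
      obtain g where g: "\<sigma> \<omega> = ereal (g + delay)"
        by (cases rule: default_cases[OF w(1)]) (use w(2) in auto)
      show ?thesis
      proof (cases "g < s")
        case True
        have "ereal s \<le> ereal t" using s(1) by simp
        then have "ereal s < \<tau> \<omega>" using w(3) by (rule le_less_trans)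
        then have "Y s \<omega> < 0" using Y_neg[OF w(1) g True] sT by simp
        then show ?thesis using True g by simp
      next
        case False
        then have "ereal s < \<sigma> \<omega>" using g delay_pos by simp
        then show ?thesis using False g w(1) by (simp add: Y_before)
      qed
    qed
    \<comment> \<open>\<open>sign_left\<close> has only the values 1 and -1, so a preimage is
      determined by which of the two belong to B.\<close>
    have "A \<inter> ?E = (if 1 \<in> B then (if - 1 \<in> B then space M else ?P) else (if - 1 \<in> B then space M - ?P else {})) \<inter> ?E"
    proof (rule set_eqI)
      fix \<omega>
      show "\<omega> \<in> A \<inter> ?E \<longleftrightarrow> \<omega> \<in> (if 1 \<in> B then (if - 1 \<in> B then space M else ?P) else (if - 1 \<in> B then space M - ?P else {})) \<inter> ?E"
      proof (cases "\<omega> \<in> ?E")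
        case True
        then have w: "\<omega> \<in> space M" by simp
        show ?thesis using iff[OF True] w True unfolding A sign_left_def by (cases "\<omega> \<in> ?P") auto
      next
        case False
        then show ?thesis by (simp only: Int_iff simp_thms)
      qed
    qed
    moreover have "(if 1 \<in> B then (if - 1 \<in> B then space M else ?P) else (if - 1 \<in> B then space M - ?P else {})) \<in> ?S"
      using P S.top S.empty_sets S.compl_sets[OF P] by simp
    ultimately show ?case by blast
  next
    case Empty
    then show ?case by (intro bexI[of _ "{}"]) auto
  next
    case (Compl A)
    then obtain C where C: "C \<in> ?S" "A \<inter> ?E = C \<inter> ?E" by blast
    have "(space M - A) \<inter> ?E = (space M - C) \<inter> ?E" using C(2) by blast
    then show ?case using S.compl_sets[OF C(1)] by blast
  next
    case (Union A)
    then have "\<forall>i. \<exists>C. C \<in> ?S \<and> A i \<inter> ?E = C \<inter> ?E" by blast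
    then obtain C where C: "\<forall>i::nat. C i \<in> ?S \<and> A i \<inter> ?E = C i \<inter> ?E" by (rule choice[THEN exE])
    have "(\<Union>i. A i) \<inter> ?E = (\<Union>i. C i) \<inter> ?E" using C by blast
    moreover have "(\<Union>i. C i) \<in> ?S" using C by (intro sigma_sets.Union) blast
    ultimately show ?case by blast
  qed
qed

lemma default_survival_H:
  assumes B: "B \<in> sets (H s)" and s: "0 \<le> s" "s \<le> u" "u \<le> T"
  shows "emeasure M (B \<inter> {\<omega>\<in>space M. \<sigma> \<omega> \<le> ereal s \<and> ereal u < \<tau> \<omega>}) =
    (\<integral>\<^sup>+\<omega>. indicator (B \<inter> {\<omega>\<in>space M. \<sigma> \<omega> \<le> ereal s \<and> ereal s < \<tau> \<omega>}) \<omega> * ennreal (survival_ratio s u \<omega>) \<partial>M)"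
proof -
  have sT: "s \<in> {0..T}" using s by auto
  obtain C where C: "C \<in> sigma_sets (space M) before_excursion"
    "B \<inter> {\<omega>\<in>space M. \<sigma> \<omega> \<le> ereal s \<and> ereal s < \<tau> \<omega>} = C \<inter> {\<omega>\<in>space M. \<sigma> \<omega> \<le> ereal s \<and> ereal s < \<tau> \<omega>}"
    using trace_H[OF sT B] by blast
  have "ereal s < \<tau> \<omega>" if "ereal u < \<tau> \<omega>" for \<omega>
    using that s(2) le_less_trans[of "ereal s" "ereal u" "\<tau> \<omega>"] by simp
  then have "B \<inter> {\<omega>\<in>space M. \<sigma> \<omega> \<le> ereal s \<and> ereal u < \<tau> \<omega>} = C \<inter> {\<omega>\<in>space M. \<sigma> \<omega> \<le> ereal s \<and> ereal u < \<tau> \<omega>}"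
    using C(2) by blast
  then show ?thesis unfolding C(2) using default_survival[OF C(1) s] by (simp only:)
qed

lemma default_neq:
  assumes u: "u \<in> {0..T}"
  shows "AE \<omega> in M. \<tau> \<omega> \<noteq> ereal u"
proof -
  have "AE \<omega> in M. \<sigma> \<omega> < ereal u \<longrightarrow> hit \<sigma> (stopped \<sigma>) \<omega> \<noteq> ereal u"
    by (rule hit_eq_null[OF stopping_tau_alpha stopped_measurable_pre[OF stopping_tau_alpha] u, of "\<lambda>_. 1"]) simp
  then show ?thesis
  proof (rule AE_mp, intro AE_I2 impI notI)
    fix \<omega> assume om: "\<omega> \<in> space M" and i: "\<sigma> \<omega> < ereal u \<longrightarrow> hit \<sigma> (stopped \<sigma>) \<omega> \<noteq> ereal u" and eq: "\<tau> \<omega> = ereal u"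
    have "\<sigma> \<omega> < ereal u" by (cases rule: default_cases[OF om]) (use eq in auto)
    then show False using i eq default_time_eq[OF om] by simp
  qed
qed

section \<open>Recovering \<sigma> and \<tau> from the signs of Y\<close>

lemma positive_after_zero:
  "AE \<omega> in M. \<forall>r\<in>\<rat> \<inter> {0..T}. \<forall>v\<in>{0..T}. next_zero r \<omega> < ereal v \<longrightarrow> (\<exists>t. next_zero r \<omega> < ereal t \<and> t < v \<and> 0 < X t \<omega>)"
proof (subst AE_ball_countable)
  show "countable (\<rat> \<inter> {0..T})" using countable_rat by (auto intro: countable_subset)
  show "\<forall>r\<in>\<rat> \<inter> {0..T}. AE \<omega> in M. \<forall>v\<in>{0..T}. next_zero r \<omega> < ereal v \<longrightarrow> (\<exists>t. next_zero r \<omega> < ereal t \<and> t < v \<and> 0 < X t \<omega>)"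
  proof
    fix r assume "r \<in> \<rat> \<inter> {0..T}"
    then have r: "r \<in> {0..T}" by simp
    show "AE \<omega> in M. \<forall>v\<in>{0..T}. next_zero r \<omega> < ereal v \<longrightarrow> (\<exists>t. next_zero r \<omega> < ereal t \<and> t < v \<and> 0 < X t \<omega>)"
      using crosses_after[OF stopping_next_zero[OF r] disjI1[OF refl]]
      by (rule AE_mp) (rule AE_I2, simp add: stopped_next_zero[OF r])
  qed
qed

lemma rational_between_near:
  assumes om: "\<omega> \<in> space M" and t: "0 \<le> t" "t < u" "u \<le> T" and lt: "X t \<omega> < c"
  obtains r where "r \<in> \<rat>" "t < r" "r < u" "X r \<omega> < c"
proof -
  have "continuous (at t within {0..T}) (\<lambda>t. X t \<omega>)"
    using cont[OF om] t by (auto simp: continuous_on_eq_continuous_within)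
  moreover have "0 < c - X t \<omega>" using lt by simp
  ultimately obtain d where d: "d > 0" "\<And>y. y \<in> {0..T} \<Longrightarrow> dist y t < d \<Longrightarrow> dist (X y \<omega>) (X t \<omega>) < c - X t \<omega>"
    unfolding continuous_within_eps_delta by metis
  obtain r where r: "r \<in> \<rat>" "t < r" "r < min u (t + d)"
    using Rats_dense_in_real[of t "min u (t + d)"] t d by auto
  have "dist (X r \<omega>) (X t \<omega>) < c - X t \<omega>" using r t by (intro d(2)) (auto simp: dist_real_def)
  then show thesis using that[of r] r by (auto simp: dist_real_def)
qed

text \<open>The event is detected by an interval longer than \<open>delay\<close>, ending before u,
  at whose rational points Y is not positive. Since the sign -1 also stands for 0, zeros inside the
  interval must be excluded: such a zero is preceded by a rational r in the interval, and after
  \<open>next_zero r\<close> the path almost surely turns positive at once. So the detection is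
  correct up to a null set, which is why \<open>K\<close> appears.\<close>

lemma tau_alpha_less_K:
  assumes u: "u \<in> {0..T}"
  shows "{\<omega>\<in>space M. \<sigma> \<omega> < ereal u} \<in> sets (K u)"
proof -
  let ?Q = "\<rat> \<inter> {0..<u}"
  define S where "S = (\<Union>p\<in>?Q. \<Union>q\<in>{q\<in>?Q. p + delay < q}. \<Inter>r\<in>\<rat> \<inter> {p..q}. {\<omega>\<in>space M. Y r \<omega> \<le> 0})"
  have cQ: "countable ?Q" using countable_rat by (auto intro: countable_subset)
  have S: "S \<in> sets (H u)"
    unfolding S_def
  proof (intro sets.countable_UN'' cQ)
    fix p assume p: "p \<in> ?Q"
    show "countable {q\<in>?Q. p + delay < q}" by (rule countable_subset[OF _ cQ]) blast
    fix q assume q: "q \<in> {q\<in>?Q. p + delay < q}"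
    show "(\<Inter>r\<in>\<rat> \<inter> {p..q}. {\<omega>\<in>space M. Y r \<omega> \<le> 0}) \<in> sets (H u)"
    proof (rule sets.countable_INT')
      show "\<rat> \<inter> {p..q} \<noteq> {}" using p q delay_pos by auto
      show "countable (\<rat> \<inter> {p..q})" using countable_rat by (auto intro: countable_subset)
      have "{\<omega>\<in>space M. Y r \<omega> \<le> 0} \<in> sets (H u)" if "r \<in> \<rat> \<inter> {p..q}" for r
        using that p q u by (intro sign_pos_H(2)) auto
      then show "(\<lambda>r. {\<omega>\<in>space M. Y r \<omega> \<le> 0}) ` (\<rat> \<inter> {p..q}) \<subseteq> sets (H u)" by blast
    qed
  qed
  show ?thesis
  proof (rule K_AE_cong[OF u H_K[OF u S]])
    show "AE \<omega> in M. \<omega> \<in> {\<omega>\<in>space M. \<sigma> \<omega> < ereal u} \<longleftrightarrow> \<omega> \<in> S"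
      using positive_after_zero
    proof (rule AE_mp, intro AE_I2 impI)
      fix \<omega> assume om: "\<omega> \<in> space M"
        and pos: "\<forall>r\<in>\<rat> \<inter> {0..T}. \<forall>v\<in>{0..T}. next_zero r \<omega> < ereal v \<longrightarrow> (\<exists>t. next_zero r \<omega> < ereal t \<and> t < v \<and> 0 < X t \<omega>)"
      show "\<omega> \<in> {\<omega>\<in>space M. \<sigma> \<omega> < ereal u} \<longleftrightarrow> \<omega> \<in> S"
      proof
        assume "\<omega> \<in> {\<omega>\<in>space M. \<sigma> \<omega> < ereal u}"
        then have lt: "\<sigma> \<omega> < ereal u" by simp
        \<comment> \<open>As \<sigma> is strictly below both u and \<tau>, the negative stretch (g,
          e) of Y is strictly longer than \<open>delay\<close>, which leaves room for rational end
          points more than \<open>delay\<close> apart.\<close>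
        have "\<exists>g e. \<sigma> \<omega> = ereal (g + delay) \<and> 0 \<le> g \<and> g + delay < e \<and> e \<le> u \<and> ereal e \<le> \<tau> \<omega>"
        proof (cases rule: default_cases[OF om])
          case 1 then show ?thesis using lt by simp
        next
          case (2 g) then show ?thesis using lt by (intro exI[of _ g] exI[of _ u]) simp
        next
          case (3 g e) then show ?thesis using lt by (intro exI[of _ g] exI[of _ "min u e"]) simp
        qed
        then obtain g e where g: "\<sigma> \<omega> = ereal (g + delay)" "0 \<le> g" "g + delay < e" "e \<le> u" "ereal e \<le> \<tau> \<omega>" by blast
        have neg: "Y t \<omega> < 0" if "g < t" "t < e" for t
        proof (rule Y_neg[OF om g(1) that(1)])
          show "ereal t < \<tau> \<omega>" using that(2) g(5) by (meson less_ereal.simps(1) less_le_trans)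
          show "t \<le> T" using that(2) g(4) u by simp
        qed
        obtain p where p: "p \<in> \<rat>" "g < p" "p < e - delay" using Rats_dense_in_real[of g "e - delay"] g(3) by auto
        obtain q where q: "q \<in> \<rat>" "p + delay < q" "q < e" using Rats_dense_in_real[of "p + delay" e] p(3) by auto
        have "p \<in> ?Q" "q \<in> {q\<in>?Q. p + delay < q}" using p q g delay_pos by auto
        moreover have "\<omega> \<in> (\<Inter>r\<in>\<rat> \<inter> {p..q}. {\<omega>\<in>space M. Y r \<omega> \<le> 0})"
          using neg p(2) q(3) om by (auto intro: less_imp_le)
        ultimately show "\<omega> \<in> S" unfolding S_def by blast
      next
        assume "\<omega> \<in> S"
        then obtain p q where pq: "p \<in> ?Q" "q \<in> ?Q" "p + delay < q" and Yn: "\<And>r. r \<in> \<rat> \<inter> {p..q} \<Longrightarrow> Y r \<omega> \<le> 0"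
          unfolding S_def by blast
        have qT: "0 \<le> p" "q < u" "u \<le> T" "p < q" using pq u delay_pos by auto
        have "\<sigma> \<omega> \<le> ereal q"
        proof (rule ccontr)
          assume nle: "\<not> \<sigma> \<omega> \<le> ereal q"
          have YX: "Y r \<omega> = X r \<omega>" if "r \<le> q" for r
          proof (rule Y_before)
            have "ereal r \<le> ereal q" using that by simp
            then show "ereal r < \<sigma> \<omega>" using nle by (meson not_le le_less_trans)
          qed
          have Xn: "X t \<omega> \<le> 0" if t: "p \<le> t" "t < q" for t
          proof (rule ccontr)
            assume "\<not> X t \<omega> \<le> 0"
            have "continuous (at t within {0..T}) (\<lambda>t. X t \<omega>)"
              using cont[OF om] t qT by (auto simp: continuous_on_eq_continuous_within)
            moreover have Xp: "0 < X t \<omega>" using \<open>\<not> X t \<omega> \<le> 0\<close> by simp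
            ultimately obtain d where d: "d > 0" "\<And>y. y \<in> {0..T} \<Longrightarrow> dist y t < d \<Longrightarrow> dist (X y \<omega>) (X t \<omega>) < X t \<omega>"
              unfolding continuous_within_eps_delta by metis
            obtain r where r: "r \<in> \<rat>" "t < r" "r < min q (t + d)"
              using Rats_dense_in_real[of t "min q (t + d)"] t d by auto
            have "dist (X r \<omega>) (X t \<omega>) < X t \<omega>" using r t qT by (intro d(2)) (auto simp: dist_real_def)
            then have "0 < X r \<omega>" by (simp add: dist_real_def)
            then show False using Yn[of r] YX[of r] r t by auto
          qed
          have Xneg: "X t \<omega> < 0" if t: "p < t" "t < q" for t
          proof (rule ccontr)
            assume "\<not> X t \<omega> < 0"
            then have X0: "X t \<omega> = 0" using Xn[of t] t by simp
            obtain r where r: "r \<in> \<rat>" "p < r" "r < t" using Rats_dense_in_real[OF t(1)] by blast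
            have rT: "r \<in> \<rat> \<inter> {0..T}" "r \<in> {0..T}" "q \<in> {0..T}" using r t qT by auto
            have "next_zero r \<omega> < ereal q"
            proof (cases rule: next_zero_cases[OF rT(2) om])
              case 1 then show ?thesis using 1(2)[of t] X0 r t qT by simp
            next
              case (2 s) then show ?thesis using 2(5)[of t] X0 r t by (cases "t < s") auto
            qed
            then obtain v where v: "next_zero r \<omega> < ereal v" "v < q" "0 < X v \<omega>"
              using pos rT by blast
            have "r \<le> v"
              by (cases rule: next_zero_cases[OF rT(2) om]) (use v(1) in auto)
            then show False using Xn[of v] v r by simp
          qed
          obtain t where t: "p + delay < t" "t < q" using dense[OF pq(3)] by blast
          have tT: "t \<in> {0..T}" "p < t" using t qT delay_pos by auto
          have "last_zero X t \<omega> \<le> p"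
          proof (rule ccontr)
            assume "\<not> last_zero X t \<omega> \<le> p"
            then show False using Xneg[of "last_zero X t \<omega>"] last_zero_X(2,3)[OF om tT(1)] t(2) by simp
          qed
          then have "\<sigma> \<omega> \<le> ereal t"
            using tau_alpha_le_iff[OF om tT(1)] Xneg[OF tT(2) t(2)] t(1) by auto
          moreover have "ereal t \<le> ereal q" using t(2) by simp
          ultimately have "\<sigma> \<omega> \<le> ereal q" by (rule order_trans)
          then show False using nle by simp
        qed
        moreover have "ereal q < ereal u" using qT by simp
        ultimately have "\<sigma> \<omega> < ereal u" by (rule le_less_trans)
        then show "\<omega> \<in> {\<omega>\<in>space M. \<sigma> \<omega> < ereal u}" using om by simp
      qed
    qed
  qed blast
qed

text \<open>After \<sigma>, Y is negative until \<tau>, and immediately after \<tau> it almost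
  surely takes positive values because X falls below the default level at once. Hence a default
  before u shows as a positive sign at a rational time after \<sigma>.\<close>

lemma default_less_K:
  assumes u: "u \<in> {0..T}"
  shows "{\<omega>\<in>space M. \<tau> \<omega> < ereal u} \<in> sets (K u)"
proof -
  let ?Q = "\<rat> \<inter> {0..<u}"
  define S where "S = (\<Union>r\<in>?Q. {\<omega>\<in>space M. \<sigma> \<omega> < ereal r} \<inter> {\<omega>\<in>space M. 0 < Y r \<omega>})"
  have S: "S \<in> sets (K u)"
    unfolding S_def
  proof (intro sets.countable_UN'' sets.Int)
    show "countable ?Q" using countable_rat by (auto intro: countable_subset)
    fix r assume "r \<in> ?Q"
    then have r: "r \<in> {0..T}" "0 \<le> r" "r \<le> u" "r \<in> {0..u}" using u by auto
    have "sets (K r) \<subseteq> sets (K u)" using K_mono[OF r(2,3)] u by simp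
    then show "{\<omega>\<in>space M. \<sigma> \<omega> < ereal r} \<in> sets (K u)" using tau_alpha_less_K[OF r(1)] by (rule subsetD)
    show "{\<omega>\<in>space M. 0 < Y r \<omega>} \<in> sets (K u)" by (rule H_K[OF u sign_pos_H(1)[OF r(4) u]])
  qed
  show ?thesis
  proof (rule K_AE_cong[OF u S])
    show "AE \<omega> in M. \<omega> \<in> {\<omega>\<in>space M. \<tau> \<omega> < ereal u} \<longleftrightarrow> \<omega> \<in> S"
      using crosses_after[OF stopping_default disjI2[OF refl]]
    proof (rule AE_mp, intro AE_I2 impI)
      fix \<omega> assume om: "\<omega> \<in> space M"
        and c: "\<forall>v\<in>{0..T}. hit \<sigma> (stopped \<sigma>) \<omega> < ereal v \<longrightarrow> (\<exists>t. hit \<sigma> (stopped \<sigma>) \<omega> < ereal t \<and> t < v \<and> 0 < - 1 * (X t \<omega> - stopped (hit \<sigma> (stopped \<sigma>)) \<omega>))"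
      have \<tau>: "hit \<sigma> (stopped \<sigma>) \<omega> = \<tau> \<omega>" by (simp add: default_time_eq[OF om])
      show "\<omega> \<in> {\<omega>\<in>space M. \<tau> \<omega> < ereal u} \<longleftrightarrow> \<omega> \<in> S"
      proof
        assume "\<omega> \<in> {\<omega>\<in>space M. \<tau> \<omega> < ereal u}"
        then have lt: "\<tau> \<omega> < ereal u" by simp
        show "\<omega> \<in> S"
        proof (cases rule: default_cases[OF om])
          case 1 then show ?thesis using lt by simp
        next
          case (2 g) then show ?thesis using lt by simp
        next
          case (3 g e)
          have st: "stopped (hit \<sigma> (stopped \<sigma>)) \<omega> = 2 * X (g + delay) \<omega>"
            unfolding stopped_def[of "hit \<sigma> (stopped \<sigma>)"] \<tau> using 3 by simp
          obtain t where t: "e < t" "t < u" "X t \<omega> < 2 * X (g + delay) \<omega>"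
            using c[rule_format, OF u] lt unfolding \<tau> st using 3(6) by auto
          have "0 \<le> t" "u \<le> T" using t 3 delay_pos u by auto
          obtain r where r: "r \<in> \<rat>" "t < r" "r < u" "X r \<omega> < 2 * X (g + delay) \<omega>"
            by (rule rational_between_near[OF om \<open>0 \<le> t\<close> t(2) \<open>u \<le> T\<close> t(3)])
          have "0 < Y r \<omega>" using r t 3 by (simp add: Y_after[OF 3(1)])
          moreover have "\<sigma> \<omega> < ereal r" using r t 3 by simp
          moreover have "r \<in> ?Q" using r \<open>0 \<le> t\<close> by simp
          ultimately show ?thesis unfolding S_def using om by blast
        qed
      next
        assume "\<omega> \<in> S"
        then obtain r where r: "r \<in> ?Q" "\<sigma> \<omega> < ereal r" "0 < Y r \<omega>" unfolding S_def by blast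
        obtain g where g: "\<sigma> \<omega> = ereal (g + delay)"
          by (cases rule: default_cases[OF om]) (use r(2) in auto)
        have "\<not> ereal r < \<tau> \<omega>"
        proof
          assume lt: "ereal r < \<tau> \<omega>"
          have "Y r \<omega> < 0"
            using r(1,2) g u delay_pos by (intro Y_neg[OF om g _ lt]) auto
          then show False using r(3) by simp
        qed
        then have "\<tau> \<omega> \<le> ereal r" by simp
        also have "ereal r < ereal u" using r(1) by simp
        finally show "\<omega> \<in> {\<omega>\<in>space M. \<tau> \<omega> < ereal u}" using om by simp
      qed
    qed
  qed blast
qed

lemma tau_alpha_le_K:
  assumes u: "u \<in> {0..T}"
  shows "{\<omega>\<in>space M. \<sigma> \<omega> \<le> ereal u} \<in> sets (K u)"
proof (rule K_AE_cong[OF u tau_alpha_less_K[OF u]])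
  show "AE \<omega> in M. \<omega> \<in> {\<omega>\<in>space M. \<sigma> \<omega> \<le> ereal u} \<longleftrightarrow> \<omega> \<in> {\<omega>\<in>space M. \<sigma> \<omega> < ereal u}"
    using tau_alpha_neq[OF u] by eventually_elim (simp add: order_le_less)
qed blast

lemma default_le_K:
  assumes u: "u \<in> {0..T}"
  shows "{\<omega>\<in>space M. \<tau> \<omega> \<le> ereal u} \<in> sets (K u)"
proof (rule K_AE_cong[OF u default_less_K[OF u]])
  show "AE \<omega> in M. \<omega> \<in> {\<omega>\<in>space M. \<tau> \<omega> \<le> ereal u} \<longleftrightarrow> \<omega> \<in> {\<omega>\<in>space M. \<tau> \<omega> < ereal u}"
    using default_neq[OF u] by eventually_elim (simp add: order_le_less)
qed blast

end

section \<open>The compensator\<close>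

lemma sum_step_indicator_le:
  fixes f :: "nat \<Rightarrow> real" and x :: ereal
  assumes "incseq f"
  shows "(\<Sum>i<n. of_bool (ereal (f i) < x \<and> x \<le> ereal (f (Suc i)))) \<le> (1::real)"
proof -
  have "of_bool (ereal (f i) < x \<and> x \<le> ereal (f (Suc i))) = - (of_bool (ereal (f (Suc i)) < x) - of_bool (ereal (f i) < x) :: real)" for i
  proof -
    have "ereal (f i) \<le> ereal (f (Suc i))" using assms by (simp add: incseq_SucD)
    then have "ereal (f i) < x" if "ereal (f (Suc i)) < x" using that by (rule le_less_trans)
    then show ?thesis by (auto simp: not_le)
  qed
  then have "(\<Sum>i<n. of_bool (ereal (f i) < x \<and> x \<le> ereal (f (Suc i)))) =
      - (\<Sum>i<n. of_bool (ereal (f (Suc i)) < x) - of_bool (ereal (f i) < x) :: real)"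
    by (simp only: sum_negf)
  also have "\<dots> = of_bool (ereal (f 0) < x) - of_bool (ereal (f n) < x)"
    by (subst sum_lessThan_telescope[where f="\<lambda>i. of_bool (ereal (f i) < x) :: real"]) simp
  also have "\<dots> \<le> 1" by (simp add: of_bool_def)
  finally show ?thesis .
qed

context market
begin

text \<open>The candidate compensator in closed form. The difference of the truncated times is the
  time spent between \<sigma> and \<tau> up to t; adding \<open>delay\<close>, the age at \<sigma>,
  gives the age of the excursion. The survival probability is sqrt (delay / age), and this is minus
  its logarithm. Truncating at t before \<open>real_of_ereal\<close> keeps infinite \<sigma> and
  \<tau> harmless.\<close>

definition hazard :: "real \<Rightarrow> 'a \<Rightarrow> real" where
  "hazard t \<omega> = ln ((real_of_ereal (min (ereal t) (\<tau> \<omega>)) - real_of_ereal (min (ereal t) (\<sigma> \<omega>)) + delay) / delay) / 2"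

definition compensated :: "real \<Rightarrow> 'a \<Rightarrow> real" where
  "compensated t \<omega> = default_indicator \<alpha> T X t \<omega> - hazard t \<omega>"

lemma hazard_before: "ereal t \<le> \<sigma> \<omega> \<Longrightarrow> ereal t \<le> \<tau> \<omega> \<Longrightarrow> hazard t \<omega> = 0"
  using delay_pos by (simp add: hazard_def min_absorb1)

lemma hazard_during: "\<sigma> \<omega> = ereal (g + delay) \<Longrightarrow> g + delay \<le> t \<Longrightarrow> ereal t \<le> \<tau> \<omega> \<Longrightarrow> hazard t \<omega> = ln ((t - g) / delay) / 2"
  by (simp add: hazard_def min_absorb1 min_absorb2)

lemma hazard_after: "\<sigma> \<omega> = ereal (g + delay) \<Longrightarrow> g + delay \<le> e \<Longrightarrow> \<tau> \<omega> = ereal e \<Longrightarrow> e \<le> t \<Longrightarrow> hazard t \<omega> = ln ((e - g) / delay) / 2"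
  by (simp add: hazard_def min_absorb1 min_absorb2)

lemma tau_alpha_le_default:
  assumes "\<omega> \<in> space M" shows "\<sigma> \<omega> \<le> \<tau> \<omega>"
  by (cases rule: default_cases[OF assms]) auto

lemma hazard_bounds:
  assumes om: "\<omega> \<in> space M" and t: "t \<in> {0..T}"
  shows "0 \<le> hazard t \<omega>" "hazard t \<omega> \<le> ln ((T + delay) / delay) / 2"
proof -
  let ?a = "real_of_ereal (min (ereal t) (\<sigma> \<omega>))" and ?b = "real_of_ereal (min (ereal t) (\<tau> \<omega>))"
  have "0 \<le> ?a \<and> ?a \<le> ?b \<and> ?b \<le> t"
    by (cases rule: default_cases[OF om]) (use t delay_pos in \<open>auto simp: min_def\<close>)
  then have ab: "0 \<le> ?b - ?a" "?b - ?a \<le> T" using t by auto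
  have "ln ((?b - ?a + delay) / delay) \<ge> 0"
    using ab delay_pos by (intro ln_ge_zero) (simp add: le_divide_eq)
  then show "0 \<le> hazard t \<omega>" unfolding hazard_def by simp
  have "ln ((?b - ?a + delay) / delay) \<le> ln ((T + delay) / delay)"
    using ab delay_pos by (intro ln_mono divide_right_mono) auto
  then show "hazard t \<omega> \<le> ln ((T + delay) / delay) / 2" unfolding hazard_def by simp
qed

lemma hazard_measurable_K:
  assumes t: "t \<in> {0..T}"
  shows "hazard t \<in> borel_measurable (K t)"
proof -
  have le: "{\<omega>\<in>space (K t). \<sigma> \<omega> \<le> ereal s} \<in> sets (K t)" "{\<omega>\<in>space (K t). \<tau> \<omega> \<le> ereal s} \<in> sets (K t)" if s: "0 \<le> s" "s \<le> t" for s
  proof -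
    have "s \<in> {0..T}" "t \<le> T" using s t by auto
    note in_K = K_mono[OF s this(2), THEN subsetD] and sT = this(1)
    show "{\<omega>\<in>space (K t). \<sigma> \<omega> \<le> ereal s} \<in> sets (K t)" "{\<omega>\<in>space (K t). \<tau> \<omega> \<le> ereal s} \<in> sets (K t)"
      unfolding space_K by (rule in_K[OF tau_alpha_le_K[OF sT]], rule in_K[OF default_le_K[OF sT]])
  qed
  have nn: "0 \<le> \<sigma> \<omega>" "0 \<le> \<tau> \<omega>" if "\<omega> \<in> space (K t)" for \<omega>
    using stopping_nonneg[OF stopping_tau_alpha, of \<omega>] tau_alpha_le_default[of \<omega>] that by (auto intro: order_trans)
  have [measurable]: "(\<lambda>\<omega>. real_of_ereal (min (ereal t) (\<sigma> \<omega>))) \<in> borel_measurable (K t)"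
    "(\<lambda>\<omega>. real_of_ereal (min (ereal t) (\<tau> \<omega>))) \<in> borel_measurable (K t)"
    by (rule measurable_min_random_time[OF le(1) nn(1)], assumption+)
      (rule measurable_min_random_time[OF le(2) nn(2)], assumption+)
  show ?thesis unfolding hazard_def[abs_def] by measurable
qed

lemma default_indicator_measurable_K:
  assumes t: "t \<in> {0..T}"
  shows "default_indicator \<alpha> T X t \<in> borel_measurable (K t)"
proof -
  have "{\<omega>\<in>space (K t). \<tau> \<omega> \<le> ereal t} \<in> sets (K t)" using default_le_K[OF t] by simp
  then have "(\<lambda>\<omega>. indicator {\<omega>\<in>space (K t). \<tau> \<omega> \<le> ereal t} \<omega> :: real) \<in> borel_measurable (K t)" by measurable
  then show ?thesis
    by (rule measurable_cong[THEN iffD1, rotated]) (simp add: default_indicator_def indicator_def)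
qed

lemma measurable_K_G: "t \<in> {0..T} \<Longrightarrow> f \<in> measurable (K t) N \<Longrightarrow> f \<in> measurable (G t) N"
  using K_sub_G[of t] by (auto simp: measurable_def)

lemma measurable_G_M: "t \<in> {0..T} \<Longrightarrow> f \<in> measurable (G t) N \<Longrightarrow> f \<in> measurable M N"
  using measurable_from_subalg[OF subalgebra_G] .

lemma compensated_measurable_G:
  assumes "t \<in> {0..T}"
  shows "compensated t \<in> borel_measurable (G t)"
  unfolding compensated_def[abs_def]
  using measurable_K_G[OF assms default_indicator_measurable_K[OF assms]] measurable_K_G[OF assms hazard_measurable_K[OF assms]]
  by measurable

definition hazard_bound :: real where "hazard_bound = ln ((T + delay) / delay) / 2"

lemma compensated_bound:
  assumes om: "\<omega> \<in> space M" and t: "t \<in> {0..T}"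
  shows "\<bar>compensated t \<omega>\<bar> \<le> 1 + hazard_bound"
  using hazard_bounds[OF assms] by (auto simp: compensated_def default_indicator_def hazard_bound_def)

lemma compensated_integrable:
  assumes t: "t \<in> {0..T}"
  shows "integrable M (compensated t)"
  using compensated_bound[OF _ t] measurable_G_M[OF t compensated_measurable_G[OF t]]
  by (intro integrable_const_bound[where B="1 + hazard_bound"]) (auto intro!: AE_I2)

section \<open>The martingale property along partitions\<close>

definition step_mean :: "real \<Rightarrow> real \<Rightarrow> 'a \<Rightarrow> real" where
  "step_mean s u \<omega> = of_bool (\<sigma> \<omega> \<le> ereal s \<and> ereal s < \<tau> \<omega>) * (of_bool (\<tau> \<omega> \<le> ereal u) - 1 + survival_ratio s u \<omega>)"

text \<open>x is the age at the start of a step, h the length of the step and w, half the logarithm,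
  the growth of the hazard. Then exp (- w) is exactly the survival ratio, so the third bound
  compares exp (- w) with 1 - w, up to w^2 / 2. Because ages are at least \<open>delay\<close>, w is
  at most h / (2 \<open>delay\<close>) uniformly.\<close>

lemma half_ln_bounds:
  fixes x h :: real
  assumes x: "delay \<le> x" and h: "0 \<le> h"
  shows "0 \<le> ln ((x + h) / x) / 2" "ln ((x + h) / x) / 2 \<le> h / (2 * delay)"
    "\<bar>1 - sqrt (x / (x + h)) - ln ((x + h) / x) / 2\<bar> \<le> (h / (2 * delay))\<^sup>2 / 2"
proof -
  let ?w = "ln ((x + h) / x) / 2" and ?c = "h / (2 * delay)"
  have x0: "0 < x" using x delay_pos by simp
  then have q: "1 \<le> (x + h) / x" using h by (simp add: le_divide_eq)
  show w0: "0 \<le> ?w" using q by simp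
  have "ln ((x + h) / x) = ln (1 + h / x)" using x0 by (simp add: add_divide_distrib)
  also have "\<dots> \<le> h / x" using h x0 by (intro ln_add_one_self_le_self) simp
  also have "\<dots> \<le> h / delay" using h x delay_pos by (intro divide_left_mono) auto
  finally show wc: "?w \<le> ?c" by simp
  have "exp (2 * ?w) = (x + h) / x" using q by simp
  then have "exp ?w = sqrt ((x + h) / x)"
    by (metis exp_ge_zero exp_double real_sqrt_abs abs_of_nonneg)
  then have "exp (- ?w) = sqrt (x / (x + h))"
    by (simp add: exp_minus real_sqrt_inverse[symmetric] inverse_divide)
  moreover have "1 - ?w \<le> exp (- ?w)" using exp_ge_add_one_self[of "- ?w"] by simp
  \<comment> \<open>The difference of the two sides vanishes at 0 and has derivative y - 1 + exp (-
    y), which is nonnegative.\<close>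
  moreover have "exp (- ?w) \<le> 1 - ?w + ?w\<^sup>2 / 2"
  proof -
    have "(\<lambda>y::real. 1 - y + y\<^sup>2 / 2 - exp (- y)) 0 \<le> (\<lambda>y. 1 - y + y\<^sup>2 / 2 - exp (- y)) ?w"
    proof (rule DERIV_nonneg_imp_nondecreasing[OF w0])
      fix y :: real assume "0 \<le> y"
      have "((\<lambda>y. 1 - y + y\<^sup>2 / 2 - exp (- y)) has_real_derivative - 1 + y + exp (- y)) (at y)"
        by (auto intro!: derivative_eq_intros)
      moreover have "0 \<le> - 1 + y + exp (- y)" using exp_ge_add_one_self[of "- y"] by simp
      ultimately show "\<exists>d. ((\<lambda>y. 1 - y + y\<^sup>2 / 2 - exp (- y)) has_real_derivative d) (at y) \<and> 0 \<le> d" by blast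
    qed
    then show ?thesis by simp
  qed
  moreover have "?w\<^sup>2 \<le> ?c\<^sup>2" using w0 wc by (intro power_mono)
  ultimately show "\<bar>1 - sqrt (x / (x + h)) - ?w\<bar> \<le> ?c\<^sup>2 / 2" by simp
qed

text \<open>\<open>step_mean\<close> is the compensated increment computed from the law of the excursion length; it
  differs from the increment of \<open>compensated\<close> only to second order, except when \<open>\<sigma>\<close> or \<open>\<tau>\<close>
  falls into the step.\<close>

lemma step_error:
  assumes om: "\<omega> \<in> space M" and s: "0 \<le> s" "s \<le> u" "u \<le> T"
  defines "c \<equiv> (u - s) / (2 * delay)"
  shows "\<bar>compensated u \<omega> - compensated s \<omega> - step_mean s u \<omega>\<bar> \<le>
    of_bool (ereal s < \<sigma> \<omega> \<and> \<sigma> \<omega> \<le> ereal u) * (of_bool (\<tau> \<omega> \<le> \<sigma> \<omega> + ereal (u - s)) + c) +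
    of_bool (ereal s < \<tau> \<omega> \<and> \<tau> \<omega> \<le> ereal u) * c + c\<^sup>2 / 2"
proof -
  have c0: "0 \<le> c" using s delay_pos by (simp add: c_def)
  have sq: "0 \<le> c\<^sup>2 / 2" by simp
  have N: "default_indicator \<alpha> T X t \<omega> = of_bool (\<tau> \<omega> \<le> ereal t)" for t by (simp add: default_indicator_def)
  have \<sigma>\<tau>: "\<sigma> \<omega> \<le> \<tau> \<omega>" by (rule tau_alpha_le_default[OF om])
  consider "ereal u < \<sigma> \<omega>" | "ereal s < \<sigma> \<omega>" "\<sigma> \<omega> \<le> ereal u" | "\<sigma> \<omega> \<le> ereal s" "ereal s < \<tau> \<omega>" | "\<tau> \<omega> \<le> ereal s"
    by (metis not_le)
  then show ?thesis
  proof cases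
    case 1
    have su: "ereal s \<le> ereal u" using s by simp
    have a: "ereal s < \<sigma> \<omega>" "ereal s < \<tau> \<omega>" "ereal u < \<tau> \<omega>"
      using le_less_trans[OF su 1] less_le_trans[OF 1 \<sigma>\<tau>] le_less_trans[OF su] by auto
    have "compensated u \<omega> = 0" "compensated s \<omega> = 0" "step_mean s u \<omega> = 0"
      using 1 a by (simp_all add: compensated_def N step_mean_def hazard_before not_le)
    then show ?thesis using c0 by simp
  next
    \<comment> \<open>\<sigma> falls into the step. \<open>step_mean\<close> looks at the left end s
      only and is 0, so all of \<open>compensated u \<omega>\<close> is error: a hazard of at most
      c, and a jump only if default follows \<sigma> within u - s.\<close>
    case 2
    obtain g where g: "\<sigma> \<omega> = ereal (g + delay)"
      by (cases rule: default_cases[OF om]) (use 2(2) in auto)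
    have gs: "s < g + delay" "g + delay \<le> u" using 2 g by auto
    have s0: "compensated s \<omega> = 0" "step_mean s u \<omega> = 0"
      using 2(1) less_le_trans[OF 2(1) \<sigma>\<tau>] by (simp_all add: compensated_def N step_mean_def hazard_before not_le)
    have h: "0 \<le> hazard u \<omega>" "hazard u \<omega> \<le> c"
    proof -
      have "\<exists>y. g + delay \<le> y \<and> y \<le> u \<and> hazard u \<omega> = ln ((delay + (y - g - delay)) / delay) / 2"
      proof (cases "ereal u \<le> \<tau> \<omega>")
        case True then show ?thesis using hazard_during[OF g gs(2)] gs by (intro exI[of _ u]) simp
      next
        case False
        then obtain e where "\<tau> \<omega> = ereal e" "g + delay \<le> e" "e \<le> u" using \<sigma>\<tau> g by (cases "\<tau> \<omega>") auto
        then show ?thesis using hazard_after[OF g, of e u] by (intro exI[of _ e]) simp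
      qed
      then obtain y where y: "g + delay \<le> y" "y \<le> u" "hazard u \<omega> = ln ((delay + (y - g - delay)) / delay) / 2" by blast
      show "0 \<le> hazard u \<omega>" unfolding y(3) using y by (intro half_ln_bounds) auto
      have "hazard u \<omega> \<le> (y - g - delay) / (2 * delay)" unfolding y(3) using y by (intro half_ln_bounds) auto
      also have "\<dots> \<le> c" unfolding c_def using y gs delay_pos by (intro divide_right_mono) auto
      finally show "hazard u \<omega> \<le> c" .
    qed
    have "of_bool (\<tau> \<omega> \<le> ereal u) \<le> (of_bool (\<tau> \<omega> \<le> \<sigma> \<omega> + ereal (u - s)) :: real)"
    proof -
      have "ereal u \<le> \<sigma> \<omega> + ereal (u - s)" using gs by (simp add: g)
      then have "\<tau> \<omega> \<le> ereal u \<Longrightarrow> \<tau> \<omega> \<le> \<sigma> \<omega> + ereal (u - s)" by (rule order_trans[rotated])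
      then show ?thesis by simp
    qed
    moreover have "compensated u \<omega> = of_bool (\<tau> \<omega> \<le> ereal u) - hazard u \<omega>" by (simp only: compensated_def N)
    moreover have "(0::real) \<le> of_bool (\<tau> \<omega> \<le> ereal u)" by simp
    ultimately have "\<bar>compensated u \<omega>\<bar> \<le> of_bool (\<tau> \<omega> \<le> \<sigma> \<omega> + ereal (u - s)) + c" using h by linarith
    moreover have "0 \<le> of_bool (ereal s < \<tau> \<omega> \<and> \<tau> \<omega> \<le> ereal u) * c" using c0 by simp
    moreover have "of_bool (ereal s < \<sigma> \<omega> \<and> \<sigma> \<omega> \<le> ereal u) = (1::real)" using 2 by simp
    ultimately show ?thesis using sq by (simp only: s0 mult_1_left diff_zero)
  next
    case 3
    obtain g where g: "\<sigma> \<omega> = ereal (g + delay)" "0 \<le> g"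
      by (cases rule: default_cases[OF om]) (use 3(1) in auto)
    have gs: "g + delay \<le> s" using 3(1) g by simp
    have ns: "\<not> ereal s < \<sigma> \<omega>" "\<not> \<tau> \<omega> \<le> ereal s" using 3 by auto
    have hs: "hazard s \<omega> = ln ((s - g) / delay) / 2" using hazard_during[OF g(1) gs] 3(2) by simp
    have cs: "compensated s \<omega> = - (ln ((s - g) / delay) / 2)" using ns(2) hs by (simp add: compensated_def N)
    have ratio: "survival_ratio s u \<omega> = sqrt ((s - g) / (s - g + (u - s)))" by (simp add: g)
    have pos: "0 < s - g" "delay \<le> s - g" using gs delay_pos by auto
    have diff: "ln ((y - g) / delay) / 2 - ln ((s - g) / delay) / 2 = ln ((s - g + (y - s)) / (s - g)) / 2" if "s \<le> y" for y
    proof -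
      have "ln ((y - g) / delay) = ln (y - g) - ln delay" "ln ((s - g) / delay) = ln (s - g) - ln delay"
        "ln ((y - g) / (s - g)) = ln (y - g) - ln (s - g)"
        using pos that delay_pos by (simp_all add: ln_divide_pos)
      then show ?thesis by (simp add: field_simps)
    qed
    show ?thesis
    proof (cases "\<tau> \<omega> \<le> ereal u")
      case False
      then have "compensated u \<omega> = - (ln ((u - g) / delay) / 2)"
        using hazard_during[OF g(1), of u] gs s by (simp add: compensated_def N)
      moreover have "step_mean s u \<omega> = sqrt ((s - g) / (s - g + (u - s))) - 1"
        using 3 False by (simp add: step_mean_def ratio)
      ultimately have "compensated u \<omega> - compensated s \<omega> - step_mean s u \<omega> =
          1 - sqrt ((s - g) / (s - g + (u - s))) - ln ((s - g + (u - s)) / (s - g)) / 2"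
        using diff[OF s(2)] cs by linarith
      moreover have "\<bar>\<dots>\<bar> \<le> c\<^sup>2 / 2" unfolding c_def using pos s by (intro half_ln_bounds) auto
      ultimately show ?thesis using c0 ns False by simp
    next
      \<comment> \<open>Default at e inside the step: the hazard stops growing at e while
        \<open>step_mean\<close> accounts for the whole step up to u. This costs up to c, but only
        in the one step that contains \<tau>.\<close>
      case True
      then obtain e where e: "\<tau> \<omega> = ereal e" "s < e" "e \<le> u" using 3(2) by (cases "\<tau> \<omega>") auto
      then have "hazard u \<omega> = ln ((e - g) / delay) / 2" using gs by (intro hazard_after[OF g(1)]) auto
      then have cu: "compensated u \<omega> = 1 - ln ((e - g) / delay) / 2" using True by (simp add: compensated_def N)
      let ?d = "ln ((s - g + (e - s)) / (s - g)) / 2" and ?r = "sqrt ((s - g) / (s - g + (u - s)))"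
      have sm: "step_mean s u \<omega> = ?r"
        using 3 True by (simp add: step_mean_def ratio)
      have "compensated u \<omega> - compensated s \<omega> - step_mean s u \<omega> = 1 - ?r - ?d"
        using diff[of e] e cs cu sm by simp
      moreover have d: "0 \<le> ?d" "?d \<le> (e - s) / (2 * delay)" using half_ln_bounds(1,2)[OF pos(2), of "e - s"] e by simp_all
      moreover have "(e - s) / (2 * delay) \<le> c" unfolding c_def using e delay_pos by (intro divide_right_mono) auto
      moreover have "\<bar>1 - ?r - ln ((s - g + (u - s)) / (s - g)) / 2\<bar> \<le> c\<^sup>2 / 2" "ln ((s - g + (u - s)) / (s - g)) / 2 \<le> c"
        unfolding c_def using half_ln_bounds(2,3)[OF pos(2), of "u - s"] s by simp_all
      moreover have "?r \<le> 1" using pos s by simp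
      ultimately have "\<bar>compensated u \<omega> - compensated s \<omega> - step_mean s u \<omega>\<bar> \<le> c + c\<^sup>2 / 2" by linarith
      then show ?thesis using ns True 3(2) by simp
    qed
  next
    case 4
    obtain g e where g: "\<sigma> \<omega> = ereal (g + delay)" "g + delay < e" "\<tau> \<omega> = ereal e"
      by (cases rule: default_cases[OF om]) (use 4 in auto)
    have "hazard s \<omega> = ln ((e - g) / delay) / 2" "hazard u \<omega> = ln ((e - g) / delay) / 2"
      by (rule hazard_after[OF g(1) less_imp_le[OF g(2)] g(3)], use 4 g(3) s in simp)+
    moreover have "\<tau> \<omega> \<le> ereal u" using 4 g s by simp
    moreover have "step_mean s u \<omega> = 0" using leD[OF 4] by (simp add: step_mean_def)
    ultimately have "compensated u \<omega> - compensated s \<omega> - step_mean s u \<omega> = 0" using 4 by (simp add: compensated_def N)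
    then show ?thesis using c0 by simp
  qed
qed

lemma default_time_measurable: "\<tau> \<in> borel_measurable M"
  using stopping_measurable[OF stopping_default] by (rule measurable_cong[THEN iffD2, rotated]) (rule default_time_eq)

lemma survival_ratio_bounds:
  assumes om: "\<omega> \<in> space M" and s: "\<sigma> \<omega> \<le> ereal s" "s \<le> u"
  shows "0 \<le> survival_ratio s u \<omega>" "survival_ratio s u \<omega> \<le> 1"
proof -
  have "0 < s - (real_of_ereal (\<sigma> \<omega>) - delay)"
    using s(1) delay_pos by (cases rule: tau_alpha_cases[OF om]) auto
  then show "0 \<le> survival_ratio s u \<omega>" "survival_ratio s u \<omega> \<le> 1" using s(2) by (auto simp: divide_le_eq_1)
qed

lemma step_mean_measurable: "step_mean s u \<in> borel_measurable M"
proof -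
  note [measurable] = default_time_measurable stopping_measurable[OF stopping_tau_alpha]
  show ?thesis unfolding step_mean_def[abs_def] by measurable
qed

lemma step_mean_bound:
  assumes "\<omega> \<in> space M" "s \<le> u"
  shows "\<bar>step_mean s u \<omega>\<bar> \<le> 1"
  using survival_ratio_bounds[OF assms(1) _ assms(2)] by (auto simp: step_mean_def of_bool_def)

text \<open>\<open>default_survival_H\<close> identifies the survival ratio as the conditional
  probability of surviving the step, which makes \<open>step_mean\<close> centred on events of
  \<open>H s\<close>; what remains is the passage from nonnegative to Bochner integrals.\<close>

lemma step_mean_integral:
  assumes B: "B \<in> sets (H s)" and s: "0 \<le> s" "s \<le> u" "u \<le> T"
  shows "(\<integral>\<omega>. indicator B \<omega> * step_mean s u \<omega> \<partial>M) = 0"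
proof -
  have sT: "s \<in> {0..T}" using s by auto
  have BM: "B \<in> sets M" using H_sub[OF sT] B by blast
  note [measurable] = BM default_time_measurable stopping_measurable[OF stopping_tau_alpha]
  let ?f = "\<lambda>\<omega>. indicator (B \<inter> {\<omega>\<in>space M. \<sigma> \<omega> \<le> ereal s \<and> ereal s < \<tau> \<omega>}) \<omega> * survival_ratio s u \<omega> :: real"
  let ?C = "B \<inter> {\<omega>\<in>space M. \<sigma> \<omega> \<le> ereal s \<and> ereal u < \<tau> \<omega>}"
  have f01: "0 \<le> ?f \<omega> \<and> ?f \<omega> \<le> 1" if "\<omega> \<in> space M" for \<omega>
    using survival_ratio_bounds[OF that _ s(2)] by (auto simp: indicator_def)
  have fi: "integrable M ?f"
    using f01 by (intro integrable_const_bound[where B=1]) (auto intro!: AE_I2)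
  have "ennreal (\<integral>\<omega>. ?f \<omega> \<partial>M) = (\<integral>\<^sup>+\<omega>. ennreal (?f \<omega>) \<partial>M)"
    using f01 by (intro nn_integral_eq_integral[OF fi, symmetric]) (auto intro!: AE_I2)
  also have "\<dots> = (\<integral>\<^sup>+\<omega>. indicator (B \<inter> {\<omega>\<in>space M. \<sigma> \<omega> \<le> ereal s \<and> ereal s < \<tau> \<omega>}) \<omega> * ennreal (survival_ratio s u \<omega>) \<partial>M)"
    by (intro nn_integral_cong) (simp add: indicator_def)
  also have "\<dots> = emeasure M ?C" by (rule default_survival_H[OF B s, symmetric])
  also have "\<dots> = ennreal (prob ?C)" by (rule emeasure_eq_measure)
  finally have "(\<integral>\<omega>. ?f \<omega> \<partial>M) = prob ?C"
  proof (rule ennreal_inj[THEN iffD1, rotated 2])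
    show "0 \<le> (\<integral>\<omega>. ?f \<omega> \<partial>M)" using f01 by (intro integral_nonneg_AE) (auto intro!: AE_I2)
  qed simp
  moreover have "prob ?C = (\<integral>\<omega>. indicator ?C \<omega> \<partial>M)"
  proof -
    have "?C \<in> sets M" by measurable
    then show ?thesis by simp
  qed
  moreover have "(\<integral>\<omega>. indicator B \<omega> * step_mean s u \<omega> \<partial>M) = (\<integral>\<omega>. ?f \<omega> - indicator ?C \<omega> \<partial>M)"
  proof (rule Bochner_Integration.integral_cong)
    fix \<omega> assume om: "\<omega> \<in> space M"
    have "ereal s \<le> ereal u" using s by simp
    then have "ereal u < \<tau> \<omega> \<Longrightarrow> ereal s < \<tau> \<omega>" by (rule le_less_trans)
    then show "indicator B \<omega> * step_mean s u \<omega> = ?f \<omega> - indicator ?C \<omega>"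
      using om by (auto simp: step_mean_def indicator_def not_le)
  qed simp
  moreover have "\<dots> = (\<integral>\<omega>. ?f \<omega> \<partial>M) - (\<integral>\<omega>. indicator ?C \<omega> \<partial>M)"
    by (intro Bochner_Integration.integral_diff fi integrable_const_bound[where B=1]) (auto simp: indicator_def)
  ultimately show ?thesis by linarith
qed

text \<open>Over m + 1 equal steps the increments are replaced by \<open>step_mean\<close>, which
  integrates to 0 over B because B belongs to \<open>H\<close> at each partition point. Since
  \<sigma> and \<tau> each fall into at most one step, \<open>step_error\<close> bounds the rest by
  the probability of a default within d of \<sigma>, plus 2 c, plus (m + 1) c^2 / 2; all three
  vanish with the mesh d.\<close>

lemma martingale_H:
  assumes B: "B \<in> sets (H s)" and st: "0 \<le> s" "s \<le> t" "t \<le> T"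
  shows "(\<integral>\<omega>. indicator B \<omega> * compensated t \<omega> \<partial>M) = (\<integral>\<omega>. indicator B \<omega> * compensated s \<omega> \<partial>M)"
proof -
  have sT: "s \<in> {0..T}" and tT: "t \<in> {0..T}" using st by auto
  have BM: "B \<in> sets M" using H_sub[OF sT] B by blast
  note [measurable] = BM default_time_measurable stopping_measurable[OF stopping_tau_alpha] step_mean_measurable
  define d where "d = (\<lambda>m::nat. (t - s) / real (Suc m))"
  define p where "p = (\<lambda>m i. s + d m * real i)"
  define c where "c = (\<lambda>m. d m / (2 * delay))"
  \<comment> \<open>Default within one mesh width of \<sigma>. Finiteness of \<sigma> is required
    because the inequality also holds when both times are infinite. The events shrink to the empty
    set, as \<tau> is strictly later than a finite \<sigma>.\<close>
  let ?D = "\<lambda>m. {\<omega>\<in>space M. \<sigma> \<omega> < \<infinity> \<and> \<tau> \<omega> \<le> \<sigma> \<omega> + ereal (d m)}"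
  let ?I = "\<integral>\<omega>. indicator B \<omega> * (compensated t \<omega> - compensated s \<omega>) \<partial>M"
  have cm: "d m / (2 * delay) = c m" for m by (simp add: c_def)
  have d0: "0 \<le> d m" for m using st by (simp add: d_def)
  have c0: "0 \<le> c m" for m using d0 delay_pos by (simp add: c_def)
  have p0: "p m 0 = s" and pn: "p m (Suc m) = t" for m by (simp_all add: p_def d_def)
  have pinc: "incseq (p m)" for m using d0 by (auto simp: p_def incseq_def intro: mult_left_mono)
  have pb: "s \<le> p m i" "p m i \<le> p m (Suc i)" "i \<le> Suc m \<Longrightarrow> p m i \<le> t" for m i
    using incseqD[OF pinc[of m], of 0 i] incseqD[OF pinc[of m], of i "Suc i"] incseqD[OF pinc[of m], of i "Suc m"] p0[of m] pn[of m] by auto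
  have pdiff: "p m (Suc i) - p m i = d m" for m i by (simp add: p_def algebra_simps)
  have DM: "?D m \<in> sets M" for m by measurable
  have bound: "\<bar>?I\<bar> \<le> prob (?D m) + 2 * c m + real (Suc m) * ((c m)\<^sup>2 / 2)" for m
  proof -
    let ?e = "\<lambda>i \<omega>. step_mean (p m i) (p m (Suc i)) \<omega>"
    let ?R = "\<lambda>\<omega>. compensated t \<omega> - compensated s \<omega> - (\<Sum>i<Suc m. ?e i \<omega>)"
    have e0: "(\<integral>\<omega>. indicator B \<omega> * ?e i \<omega> \<partial>M) = 0" if "i < Suc m" for i
    proof (rule step_mean_integral)
      show "B \<in> sets (H (p m i))" using H_mono[of s "p m i", THEN subsetD, OF _ _ _ B] pb(1)[of m i] pb(3)[of i m] st that by simp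
      show "0 \<le> p m i" "p m i \<le> p m (Suc i)" "p m (Suc i) \<le> T" using pb(1,2)[of m i] pb(3)[of "Suc i" m] st that by auto
    qed
    have ei: "integrable M (\<lambda>\<omega>. indicator B \<omega> * ?e i \<omega>)" if "i < Suc m" for i
    proof (rule integrable_const_bound[where B=1])
      show "AE \<omega> in M. norm (indicator B \<omega> * ?e i \<omega>) \<le> 1"
        using step_mean_bound[OF _ pb(2)[of m i]] by (intro AE_I2) (auto simp: indicator_def)
    qed measurable
    have Zi: "integrable M (\<lambda>\<omega>. indicator B \<omega> * (compensated t \<omega> - compensated s \<omega>))"
      using compensated_integrable[OF tT] compensated_integrable[OF sT] BM
      by (intro integrable_real_mult_indicator[of B M "\<lambda>\<omega>. compensated t \<omega> - compensated s \<omega>", simplified mult.commute[of _ "indicator B _"]]) auto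
    have I1: "?I = (\<integral>\<omega>. indicator B \<omega> * ?R \<omega> \<partial>M)"
    proof -
      have "(\<integral>\<omega>. indicator B \<omega> * ?R \<omega> \<partial>M) = (\<integral>\<omega>. indicator B \<omega> * (compensated t \<omega> - compensated s \<omega>) - (\<Sum>i<Suc m. indicator B \<omega> * ?e i \<omega>) \<partial>M)"
        by (simp only: right_diff_distrib sum_distrib_left)
      also have "\<dots> = ?I - (\<integral>\<omega>. (\<Sum>i<Suc m. indicator B \<omega> * ?e i \<omega>) \<partial>M)"
        by (intro Bochner_Integration.integral_diff Zi Bochner_Integration.integrable_sum ei) simp
      also have "(\<integral>\<omega>. (\<Sum>i<Suc m. indicator B \<omega> * ?e i \<omega>) \<partial>M) = (\<Sum>i<Suc m. \<integral>\<omega>. indicator B \<omega> * ?e i \<omega> \<partial>M)"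
        by (intro Bochner_Integration.integral_sum ei) simp
      also have "\<dots> = 0" by (intro sum.neutral ballI e0) simp
      finally show ?thesis by simp
    qed
    have I2: "\<bar>\<integral>\<omega>. indicator B \<omega> * ?R \<omega> \<partial>M\<bar> \<le> (\<integral>\<omega>. indicator (?D m) \<omega> + (2 * c m + real (Suc m) * ((c m)\<^sup>2 / 2)) \<partial>M)"
    proof (rule order_trans[OF integral_abs_bound integral_mono])
      have "integrable M (\<lambda>\<omega>. indicator B \<omega> * (compensated t \<omega> - compensated s \<omega>) - (\<Sum>i<Suc m. indicator B \<omega> * ?e i \<omega>))"
        by (intro Bochner_Integration.integrable_diff Zi Bochner_Integration.integrable_sum ei) simp
      then have "integrable M (\<lambda>\<omega>. indicator B \<omega> * ?R \<omega>)" by (simp only: right_diff_distrib sum_distrib_left)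
      then show "integrable M (\<lambda>\<omega>. \<bar>indicator B \<omega> * ?R \<omega>\<bar>)" by (rule integrable_abs)
      show "integrable M (\<lambda>\<omega>. indicator (?D m) \<omega> + (2 * c m + real (Suc m) * ((c m)\<^sup>2 / 2)))"
        using DM[of m] by (intro Bochner_Integration.integrable_add) (auto simp: emeasure_eq_measure)
      fix \<omega> assume om: "\<omega> \<in> space M"
      let ?a = "\<lambda>i. of_bool (ereal (p m i) < \<sigma> \<omega> \<and> \<sigma> \<omega> \<le> ereal (p m (Suc i))) :: real"
      let ?b = "\<lambda>i. of_bool (ereal (p m i) < \<tau> \<omega> \<and> \<tau> \<omega> \<le> ereal (p m (Suc i))) :: real"
      have R: "?R \<omega> = (\<Sum>i<Suc m. compensated (p m (Suc i)) \<omega> - compensated (p m i) \<omega> - ?e i \<omega>)"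
        using sum_lessThan_telescope[of "\<lambda>i. compensated (p m i) \<omega>" "Suc m"]
        unfolding sum_subtractf p0 pn by simp
      have "\<bar>indicator B \<omega> * ?R \<omega>\<bar> \<le> \<bar>?R \<omega>\<bar>"
        unfolding abs_mult by (rule mult_left_le_one_le) (simp_all add: indicator_def)
      also have "\<dots> \<le> (\<Sum>i<Suc m. \<bar>compensated (p m (Suc i)) \<omega> - compensated (p m i) \<omega> - ?e i \<omega>\<bar>)"
        unfolding R by (rule sum_abs)
      also have "\<dots> \<le> (\<Sum>i<Suc m. ?a i * (indicator (?D m) \<omega> + c m) + ?b i * c m + (c m)\<^sup>2 / 2)"
      proof (rule sum_mono)
        fix i assume "i \<in> {..<Suc m}"
        then have q: "0 \<le> p m i" "p m i \<le> p m (Suc i)" "p m (Suc i) \<le> T"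
          using pb(1,2)[of m i] pb(3)[of "Suc i" m] st by auto
        have "?a i * (of_bool (\<tau> \<omega> \<le> \<sigma> \<omega> + ereal (d m)) + c m) \<le> ?a i * (indicator (?D m) \<omega> + c m)"
          using om by (auto simp: indicator_def of_bool_def intro: le_less_trans)
        then show "\<bar>compensated (p m (Suc i)) \<omega> - compensated (p m i) \<omega> - ?e i \<omega>\<bar> \<le> ?a i * (indicator (?D m) \<omega> + c m) + ?b i * c m + (c m)\<^sup>2 / 2"
          using step_error[OF om q] unfolding pdiff cm by linarith
      qed
      also have "\<dots> = (\<Sum>i<Suc m. ?a i) * (indicator (?D m) \<omega> + c m) + (\<Sum>i<Suc m. ?b i) * c m + real (Suc m) * ((c m)\<^sup>2 / 2)"
        by (simp only: sum.distrib sum_distrib_right sum_constant card_lessThan)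
      also have "\<dots> \<le> 1 * (indicator (?D m) \<omega> + c m) + 1 * c m + real (Suc m) * ((c m)\<^sup>2 / 2)"
        using c0[of m] by (intro add_mono mult_right_mono sum_step_indicator_le[OF pinc] order_refl) simp_all
      also have "\<dots> = indicator (?D m) \<omega> + (2 * c m + real (Suc m) * ((c m)\<^sup>2 / 2))" by simp
      finally show "\<bar>indicator B \<omega> * ?R \<omega>\<bar> \<le> indicator (?D m) \<omega> + (2 * c m + real (Suc m) * ((c m)\<^sup>2 / 2))" .
    qed
    have I3: "(\<integral>\<omega>. indicator (?D m) \<omega> + (2 * c m + real (Suc m) * ((c m)\<^sup>2 / 2)) \<partial>M) = prob (?D m) + (2 * c m + real (Suc m) * ((c m)\<^sup>2 / 2))"
      using DM[of m] prob_space by (subst Bochner_Integration.integral_add) (auto simp: emeasure_eq_measure)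
    show ?thesis using I2 unfolding I1[symmetric] I3 by (simp only: add.assoc)
  qed
  have dlim: "d \<longlonglongrightarrow> 0"
    using tendsto_mult[OF tendsto_const[of "t - s"] LIMSEQ_inverse_real_of_nat] by (simp add: d_def[abs_def] divide_inverse)
  then have clim: "c \<longlonglongrightarrow> 0"
    unfolding c_def[abs_def] using tendsto_divide_zero[of d sequentially "2 * delay"] by simp
  \<comment> \<open>The number of steps times the mesh is the constant t - s, so the second order
    errors add up to one of first order.\<close>
  have eq: "real (Suc m) * ((c m)\<^sup>2 / 2) = (t - s) / (4 * delay) * c m" for m
  proof -
    have "real (Suc m) * ((c m)\<^sup>2 / 2) = (real (Suc m) * d m) / (4 * delay) * c m"
      by (simp add: c_def power2_eq_square)
    also have "real (Suc m) * d m = t - s" by (simp add: d_def)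
    finally show ?thesis .
  qed
  have "(\<lambda>m. prob (?D m)) \<longlonglongrightarrow> prob (\<Inter>m. ?D m)"
  proof (rule finite_Lim_measure_decseq)
    show "range ?D \<subseteq> sets M" using DM by blast
    show "decseq ?D"
    proof (rule decseq_SucI)
      fix m
      have "d (Suc m) \<le> d m" unfolding d_def using st by (intro divide_left_mono) auto
      then have "\<sigma> \<omega> + ereal (d (Suc m)) \<le> \<sigma> \<omega> + ereal (d m)" for \<omega> by (intro add_left_mono) simp
      then show "?D (Suc m) \<subseteq> ?D m" using order_trans by blast
    qed
  qed
  also have "(\<Inter>m. ?D m) = {}"
  proof -
    have "\<omega> \<notin> (\<Inter>m. ?D m)" if om: "\<omega> \<in> space M" for \<omega>
    proof
      assume D: "\<omega> \<in> (\<Inter>m. ?D m)"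
      show False
      proof (cases rule: default_cases[OF om])
        case 1 then show ?thesis using D by simp
      next
        case (2 g) then show ?thesis using D by simp
      next
        case (3 g e)
        have "e - (g + delay) \<le> d m" for m
        proof -
          have "\<tau> \<omega> \<le> \<sigma> \<omega> + ereal (d m)" using D by blast
          then show ?thesis using 3(1,6) by simp
        qed
        then have "e - (g + delay) \<le> 0" by (intro LIMSEQ_le_const[OF dlim]) auto
        then show ?thesis using 3(7) by simp
      qed
    qed
    then show ?thesis by blast
  qed
  finally have Dlim: "(\<lambda>m. prob (?D m)) \<longlonglongrightarrow> 0" by simp
  have "(\<lambda>m. prob (?D m) + 2 * c m + (t - s) / (4 * delay) * c m) \<longlonglongrightarrow> 0 + 2 * 0 + (t - s) / (4 * delay) * 0"
    by (intro tendsto_intros Dlim clim)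
  then have "\<bar>?I\<bar> \<le> 0 + 2 * 0 + (t - s) / (4 * delay) * 0"
    by (rule LIMSEQ_le_const) (use bound in \<open>auto simp only: eq\<close>)
  then have "?I = 0" by simp
  moreover have "?I = (\<integral>\<omega>. indicator B \<omega> * compensated t \<omega> \<partial>M) - (\<integral>\<omega>. indicator B \<omega> * compensated s \<omega> \<partial>M)"
    unfolding right_diff_distrib
    using integrable_real_mult_indicator[OF BM compensated_integrable[OF tT]] integrable_real_mult_indicator[OF BM compensated_integrable[OF sT]]
    by (intro Bochner_Integration.integral_diff) (simp_all add: mult.commute)
  ultimately show ?thesis by simp
qed

end

section \<open>Uniqueness of the compensator\<close>

lemma abs_divide_sqrt_le_1:
  fixes x :: real
  shows "\<bar>x / sqrt (1 + x\<^sup>2)\<bar> \<le> 1"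
proof -
  have "0 < 1 + x\<^sup>2" by (simp add: add_pos_nonneg)
  moreover have "\<bar>x\<bar> \<le> sqrt (1 + x\<^sup>2)" by (rule real_le_rsqrt) simp
  ultimately show ?thesis by (simp add: divide_le_eq_1)
qed

text \<open>r is the remainder of the first order expansion of sqrt (1 + x^2). It is nonnegative by
  Cauchy-Schwarz; the quadratic bound is the inequality of arithmetic and geometric means and gives
  the limit along partitions, while the linear bound holds because the function is 1-Lipschitz and
  provides the integrable majorant.\<close>

lemma sqrt_tangent:
  fixes x y :: real
  defines "r \<equiv> sqrt (1 + y\<^sup>2) - sqrt (1 + x\<^sup>2) - x / sqrt (1 + x\<^sup>2) * (y - x)"
  shows "0 \<le> r" "r \<le> (y - x)\<^sup>2" "r \<le> 2 * \<bar>y - x\<bar>"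
proof -
  let ?p = "sqrt (1 + x\<^sup>2)" and ?q = "sqrt (1 + y\<^sup>2)"
  have p: "1 \<le> ?p" "?p\<^sup>2 = 1 + x\<^sup>2" and q: "1 \<le> ?q" "?q\<^sup>2 = 1 + y\<^sup>2" by simp_all
  have r: "r = (?p * ?q - (1 + x * y)) / ?p"
  proof -
    have "?p \<noteq> 0" using p(1) by linarith
    then have "x / ?p * (y - x) * ?p = x * (y - x)" by simp
    then have "r * ?p = ?q * ?p - ?p\<^sup>2 - x * (y - x)"
      unfolding r_def left_diff_distrib by (simp only: power2_eq_square)
    then have "r * ?p = ?p * ?q - (1 + x * y)" unfolding p(2) by (simp add: algebra_simps power2_eq_square)
    then show ?thesis by (rule nonzero_eq_divide_eq[OF \<open>?p \<noteq> 0\<close>, THEN iffD2])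
  qed
  have "(1 + x * y)\<^sup>2 \<le> (?p * ?q)\<^sup>2"
  proof -
    have "(?p * ?q)\<^sup>2 - (1 + x * y)\<^sup>2 = (x - y)\<^sup>2"
      unfolding power_mult_distrib p(2) q(2) by (simp add: power2_eq_square algebra_simps)
    then show ?thesis using zero_le_power2[of "x - y"] by linarith
  qed
  then have "1 + x * y \<le> ?p * ?q" by (rule power2_le_imp_le) (use p q in simp)
  then show "0 \<le> r" unfolding r using p by simp
  have "2 * (?p * ?q) \<le> ?p\<^sup>2 + ?q\<^sup>2" using sum_squares_bound[of ?p ?q] by simp
  then have "?p * ?q - (1 + x * y) \<le> (y - x)\<^sup>2 / 2" unfolding p(2) q(2) by (simp add: power2_eq_square algebra_simps)
  also have "\<dots> \<le> (y - x)\<^sup>2" by simp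
  also have "\<dots> \<le> (y - x)\<^sup>2 * ?p" using mult_left_mono[OF p(1) zero_le_power2[of "y - x"]] by simp
  finally have "?p * ?q - (1 + x * y) \<le> (y - x)\<^sup>2 * ?p" .
  moreover have "0 < ?p" using p(1) by linarith
  ultimately show "r \<le> (y - x)\<^sup>2" unfolding r by (simp only: pos_divide_le_eq)
  have "?q \<le> ?p + \<bar>y - x\<bar>"
    using real_sqrt_sum_squares_triangle_ineq[of 1 0 x "y - x"] by simp
  moreover have "- (x / ?p * (y - x)) \<le> \<bar>y - x\<bar>"
  proof -
    have "\<bar>x / ?p * (y - x)\<bar> \<le> 1 * \<bar>y - x\<bar>" unfolding abs_mult by (rule mult_right_mono[OF abs_divide_sqrt_le_1]) simp
    then have "\<bar>x / ?p * (y - x)\<bar> \<le> \<bar>y - x\<bar>" by (simp only: mult_1_left)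
    then show ?thesis by (rule abs_le_D2)
  qed
  moreover have "b - a - k \<le> 2 * m" if "b \<le> a + m" "- k \<le> m" for a b k m :: real
    using that by linarith
  ultimately show "r \<le> 2 * \<bar>y - x\<bar>" unfolding r_def by blast
qed

lemma equidistant_increments_small:
  fixes f :: "real \<Rightarrow> real"
  assumes f: "continuous_on {0..t} f" and t: "0 \<le> t" and e: "0 < e"
  shows "\<forall>\<^sub>F n in sequentially. \<forall>i<Suc n. \<bar>f (t * real (Suc i) / real (Suc n)) - f (t * real i / real (Suc n))\<bar> < e"
proof -
  have "uniformly_continuous_on {0..t} f" using f by (rule compact_uniformly_continuous) simp
  then obtain d where d: "0 < d" "\<And>x y. x \<in> {0..t} \<Longrightarrow> y \<in> {0..t} \<Longrightarrow> dist y x < d \<Longrightarrow> dist (f y) (f x) < e"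
    using e unfolding uniformly_continuous_on_def by metis
  have "(\<lambda>n. t * inverse (real (Suc n))) \<longlonglongrightarrow> t * 0" by (intro tendsto_mult tendsto_const LIMSEQ_inverse_real_of_nat)
  then have "\<forall>\<^sub>F n in sequentially. t * inverse (real (Suc n)) < d" using d(1) by (intro order_tendstoD(2)) auto
  then show ?thesis
  proof eventually_elim
    case (elim n)
    show ?case
    proof (intro allI impI)
      fix i assume i: "i < Suc n"
      have mem: "t * real j / real (Suc n) \<in> {0..t}" if "j \<le> Suc n" for j
      proof -
        have "t * real j \<le> t * real (Suc n)" using that t by (intro mult_left_mono) auto
        then have "t * real j / real (Suc n) \<le> t" by (subst pos_divide_le_eq) auto
        then show ?thesis using t by simp
      qed
      have "t * real (Suc i) / real (Suc n) - t * real i / real (Suc n) = t * inverse (real (Suc n))"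
        unfolding diff_divide_distrib[symmetric] by (simp add: algebra_simps divide_inverse)
      then have "dist (t * real (Suc i) / real (Suc n)) (t * real i / real (Suc n)) < d"
        using elim t by (simp add: dist_real_def)
      then have "dist (f (t * real (Suc i) / real (Suc n))) (f (t * real i / real (Suc n))) < e"
        using mem[of i] mem[of "Suc i"] i by (intro d(2)) auto
      then show "\<bar>f (t * real (Suc i) / real (Suc n)) - f (t * real i / real (Suc n))\<bar> < e"
        by (simp add: dist_real_def)
    qed
  qed
qed

text \<open>The difference \<open>Z\<close> of two compensators is a continuous martingale of integrable variation.
  Expanding \<open>sqrt (1 + Z\<^sup>2)\<close> along partitions shows that its mean stays at \<open>1\<close>; since this
  function has bounded derivatives, no localisation is needed.\<close>

lemma (in prob_space) martingale_finite_variation_zero: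
  fixes Z V :: "real \<Rightarrow> 'a \<Rightarrow> real"
  assumes sub: "\<And>s. s \<in> {0..T} \<Longrightarrow> subalgebra M (G s)"
    and Z: "martingale_on M T G Z" and V: "integrable M (V t)"
    and Z0: "AE \<omega> in M. Z 0 \<omega> = 0" and V0: "AE \<omega> in M. V 0 \<omega> = 0"
    and Vcont: "AE \<omega> in M. continuous_on {0..T} (\<lambda>s. V s \<omega>)"
    and ZV: "AE \<omega> in M. \<forall>r\<in>{0..T}. \<forall>s\<in>{0..T}. r \<le> s \<longrightarrow> \<bar>Z s \<omega> - Z r \<omega>\<bar> \<le> V s \<omega> - V r \<omega>"
    and t: "t \<in> {0..T}"
  shows "AE \<omega> in M. Z t \<omega> = 0"
proof -
  define \<phi> where "\<phi> = (\<lambda>x::real. sqrt (1 + x\<^sup>2))"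
  define p where "p = (\<lambda>n i. t * real i / real (Suc n))"
  define r where "r = (\<lambda>n i \<omega>. \<phi> (Z (p n (Suc i)) \<omega>) - \<phi> (Z (p n i) \<omega>) - Z (p n i) \<omega> / \<phi> (Z (p n i) \<omega>) * (Z (p n (Suc i)) \<omega> - Z (p n i) \<omega>))"
  have rb: "0 \<le> r n i \<omega>" "r n i \<omega> \<le> (Z (p n (Suc i)) \<omega> - Z (p n i) \<omega>)\<^sup>2"
    "r n i \<omega> \<le> 2 * \<bar>Z (p n (Suc i)) \<omega> - Z (p n i) \<omega>\<bar>" for n i \<omega>
    unfolding r_def \<phi>_def by (rule sqrt_tangent)+
  have pmem: "p n i \<in> {0..t}" if "i \<le> Suc n" for n i
  proof -
    have "t * real i \<le> t * real (Suc n)" using that t by (intro mult_left_mono) auto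
    then have "p n i \<le> t" unfolding p_def by (subst pos_divide_le_eq) auto
    then show ?thesis using t by (simp add: p_def)
  qed
  have pT: "p n i \<in> {0..T}" if "i \<le> Suc n" for n i using pmem[OF that] t by auto
  have pinc: "p n i \<le> p n (Suc i)" for n i using t unfolding p_def by (intro divide_right_mono mult_left_mono) auto
  have p0: "p n 0 = 0" and pn: "p n (Suc n) = t" for n by (simp_all add: p_def)
  have Zi: "integrable M (Z s)" and Zm: "Z s \<in> borel_measurable (G s)" if "s \<in> {0..T}" for s
    using Z that by (auto simp: martingale_on_def)
  have \<phi>c: "\<phi> \<in> borel_measurable borel" unfolding \<phi>_def by measurable
  have \<phi>1: "1 \<le> \<phi> x" for x by (simp add: \<phi>_def)
  have \<phi>le: "\<phi> x \<le> 1 + \<bar>x\<bar>" for x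
    unfolding \<phi>_def using real_sqrt_sum_squares_triangle_ineq[of 1 0 0 x] by simp
  have \<phi>i: "integrable M (\<lambda>\<omega>. \<phi> (Z s \<omega>))" if s: "s \<in> {0..T}" for s
  proof (rule Bochner_Integration.integrable_bound)
    show "integrable M (\<lambda>\<omega>. 1 + \<bar>Z s \<omega>\<bar>)" using Zi[OF s] by (intro Bochner_Integration.integrable_add integrable_abs) auto
    show "(\<lambda>\<omega>. \<phi> (Z s \<omega>)) \<in> borel_measurable M"
      using borel_measurable_integrable[OF Zi[OF s]] \<phi>c by (rule measurable_compose)
    show "AE \<omega> in M. norm (\<phi> (Z s \<omega>)) \<le> norm (1 + \<bar>Z s \<omega>\<bar>)"
    proof (rule AE_I2)
      fix \<omega> show "norm (\<phi> (Z s \<omega>)) \<le> norm (1 + \<bar>Z s \<omega>\<bar>)"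
        using \<phi>1[of "Z s \<omega>"] \<phi>le[of "Z s \<omega>"] by simp
    qed
  qed
  \<comment> \<open>The first order term. Its coefficient, the derivative of \<phi> at Z s, is
    bounded by 1 and known to \<open>G s\<close>, so it can be taken out of the conditional
    expectation of the increment, which vanishes.\<close>
  have \<psi>: "integrable M (\<lambda>\<omega>. Z s \<omega> / \<phi> (Z s \<omega>) * (Z u \<omega> - Z s \<omega>))" "(\<integral>\<omega>. Z s \<omega> / \<phi> (Z s \<omega>) * (Z u \<omega> - Z s \<omega>) \<partial>M) = 0"
    if su: "s \<in> {0..T}" "u \<in> {0..T}" "s \<le> u" for s u
  proof -
    interpret S: finite_measure_subalgebra M "G s" by unfold_locales (rule sub[OF su(1)])
    let ?f = "\<lambda>\<omega>. Z s \<omega> / \<phi> (Z s \<omega>)"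
    have f: "?f \<in> borel_measurable (G s)" using Zm[OF su(1)] measurable_compose[OF Zm[OF su(1)] \<phi>c] by measurable
    have fM: "?f \<in> borel_measurable M" using measurable_from_subalg[OF sub[OF su(1)] f] .
    have f1: "\<bar>?f \<omega>\<bar> \<le> 1" for \<omega>
      unfolding \<phi>_def by (rule abs_divide_sqrt_le_1)
    have int: "integrable M (\<lambda>\<omega>. ?f \<omega> * Z v \<omega>)" if "v \<in> {0..T}" for v
    proof (rule Bochner_Integration.integrable_bound[OF Zi[OF that]])
      show "(\<lambda>\<omega>. ?f \<omega> * Z v \<omega>) \<in> borel_measurable M"
        using fM borel_measurable_integrable[OF Zi[OF that]] by measurable
      show "AE \<omega> in M. norm (?f \<omega> * Z v \<omega>) \<le> norm (Z v \<omega>)"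
      proof (rule AE_I2)
        fix \<omega>
        show "norm (?f \<omega> * Z v \<omega>) \<le> norm (Z v \<omega>)"
          unfolding real_norm_def abs_mult by (rule mult_left_le_one_le[OF _ _ f1]) simp_all
      qed
    qed
    have "(\<integral>\<omega>. ?f \<omega> * Z u \<omega> \<partial>M) = (\<integral>\<omega>. ?f \<omega> * real_cond_exp M (G s) (Z u) \<omega> \<partial>M)"
      using S.real_cond_exp_intg(2)[OF int[OF su(2)] f] borel_measurable_integrable[OF Zi[OF su(2)]] by simp
    also have "\<dots> = (\<integral>\<omega>. ?f \<omega> * Z s \<omega> \<partial>M)"
    proof (rule integral_cong_AE)
      have "real_cond_exp M (G s) (Z u) \<in> borel_measurable M" by simp
      then show "(\<lambda>\<omega>. ?f \<omega> * real_cond_exp M (G s) (Z u) \<omega>) \<in> borel_measurable M" using fM by measurable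
      show "(\<lambda>\<omega>. ?f \<omega> * Z s \<omega>) \<in> borel_measurable M" using borel_measurable_integrable[OF int[OF su(1)]] .
      have "AE \<omega> in M. real_cond_exp M (G s) (Z u) \<omega> = Z s \<omega>" using Z su by (simp add: martingale_on_def)
      then show "AE \<omega> in M. ?f \<omega> * real_cond_exp M (G s) (Z u) \<omega> = ?f \<omega> * Z s \<omega>" by eventually_elim simp
    qed
    finally have "(\<integral>\<omega>. ?f \<omega> * Z u \<omega> \<partial>M) = (\<integral>\<omega>. ?f \<omega> * Z s \<omega> \<partial>M)" .
    then show "integrable M (\<lambda>\<omega>. Z s \<omega> / \<phi> (Z s \<omega>) * (Z u \<omega> - Z s \<omega>))" "(\<integral>\<omega>. Z s \<omega> / \<phi> (Z s \<omega>) * (Z u \<omega> - Z s \<omega>) \<partial>M) = 0"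
      using int[OF su(1)] int[OF su(2)] by (simp_all add: right_diff_distrib)
  qed
  have ri: "integrable M (r n i)" "(\<integral>\<omega>. r n i \<omega> \<partial>M) = (\<integral>\<omega>. \<phi> (Z (p n (Suc i)) \<omega>) \<partial>M) - (\<integral>\<omega>. \<phi> (Z (p n i) \<omega>) \<partial>M)" if i: "i < Suc n" for n i
  proof -
    have m: "p n i \<in> {0..T}" "p n (Suc i) \<in> {0..T}" using pT[of i n] pT[of "Suc i" n] i by auto
    show "integrable M (r n i)" unfolding r_def by (intro Bochner_Integration.integrable_diff \<phi>i m \<psi>(1) pinc)
    have "(\<integral>\<omega>. r n i \<omega> \<partial>M) = (\<integral>\<omega>. \<phi> (Z (p n (Suc i)) \<omega>) - \<phi> (Z (p n i) \<omega>) \<partial>M) - (\<integral>\<omega>. Z (p n i) \<omega> / \<phi> (Z (p n i) \<omega>) * (Z (p n (Suc i)) \<omega> - Z (p n i) \<omega>) \<partial>M)"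
      unfolding r_def by (intro Bochner_Integration.integral_diff Bochner_Integration.integrable_diff \<phi>i m \<psi>(1) pinc)
    also have "\<dots> = (\<integral>\<omega>. \<phi> (Z (p n (Suc i)) \<omega>) \<partial>M) - (\<integral>\<omega>. \<phi> (Z (p n i) \<omega>) \<partial>M)"
      unfolding \<psi>(2)[OF m pinc] using \<phi>i[OF m(1)] \<phi>i[OF m(2)] by simp
    finally show "(\<integral>\<omega>. r n i \<omega> \<partial>M) = (\<integral>\<omega>. \<phi> (Z (p n (Suc i)) \<omega>) \<partial>M) - (\<integral>\<omega>. \<phi> (Z (p n i) \<omega>) \<partial>M)" .
  qed
  have total: "(\<integral>\<omega>. (\<Sum>i<Suc n. r n i \<omega>) \<partial>M) = (\<integral>\<omega>. \<phi> (Z t \<omega>) \<partial>M) - (\<integral>\<omega>. \<phi> (Z 0 \<omega>) \<partial>M)" for n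
  proof -
    have "(\<integral>\<omega>. (\<Sum>i<Suc n. r n i \<omega>) \<partial>M) = (\<Sum>i<Suc n. \<integral>\<omega>. r n i \<omega> \<partial>M)"
      by (intro Bochner_Integration.integral_sum ri(1)) simp
    also have "\<dots> = (\<Sum>i<Suc n. (\<integral>\<omega>. \<phi> (Z (p n (Suc i)) \<omega>) \<partial>M) - (\<integral>\<omega>. \<phi> (Z (p n i) \<omega>) \<partial>M))"
      by (intro sum.cong ri(2)) simp_all
    also have "\<dots> = (\<integral>\<omega>. \<phi> (Z t \<omega>) \<partial>M) - (\<integral>\<omega>. \<phi> (Z 0 \<omega>) \<partial>M)"
      by (subst sum_lessThan_telescope[where f="\<lambda>i. \<integral>\<omega>. \<phi> (Z (p n i) \<omega>) \<partial>M"]) (simp only: p0 pn)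
    finally show ?thesis .
  qed
  have "AE \<omega> in M. V 0 \<omega> = 0 \<and> continuous_on {0..T} (\<lambda>s. V s \<omega>) \<and> (\<forall>r\<in>{0..T}. \<forall>s\<in>{0..T}. r \<le> s \<longrightarrow> \<bar>Z s \<omega> - Z r \<omega>\<bar> \<le> V s \<omega> - V r \<omega>)"
    using V0 Vcont ZV by eventually_elim blast
  note good = this
  have sumV: "(\<Sum>i<Suc n. V (p n (Suc i)) \<omega> - V (p n i) \<omega>) = V t \<omega> - V 0 \<omega>" for n \<omega>
    by (subst sum_lessThan_telescope[where f="\<lambda>i. V (p n i) \<omega>"]) (simp only: p0 pn)
  have "(\<lambda>n. \<integral>\<omega>. (\<Sum>i<Suc n. r n i \<omega>) \<partial>M) \<longlonglongrightarrow> (\<integral>\<omega>. 0 \<partial>M)"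
  \<comment> \<open>The linear bound on each remainder, summed over the partition, telescopes to 2 V
    t. The absolute value serves the points outside the good event.\<close>
  proof (rule integral_dominated_convergence[where w="\<lambda>\<omega>. 2 * \<bar>V t \<omega>\<bar>"])
    show "(\<lambda>\<omega>. \<Sum>i<Suc n. r n i \<omega>) \<in> borel_measurable M" for n
      using borel_measurable_integrable[OF ri(1)[of _ n]] by (intro borel_measurable_sum) simp
    show "integrable M (\<lambda>\<omega>. 2 * \<bar>V t \<omega>\<bar>)" using V by simp
    show "AE \<omega> in M. norm (\<Sum>i<Suc n. r n i \<omega>) \<le> 2 * \<bar>V t \<omega>\<bar>" for n
      using good
    proof eventually_elim
      case (elim \<omega>)
      have "norm (\<Sum>i<Suc n. r n i \<omega>) \<le> (\<Sum>i<Suc n. 2 * (V (p n (Suc i)) \<omega> - V (p n i) \<omega>))"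
      proof (rule sum_norm_le)
        fix i assume "i \<in> {..<Suc n}"
        then have "\<bar>Z (p n (Suc i)) \<omega> - Z (p n i) \<omega>\<bar> \<le> V (p n (Suc i)) \<omega> - V (p n i) \<omega>"
          using elim pT[of i n] pT[of "Suc i" n] pinc[of n i] by simp
        then show "norm (r n i \<omega>) \<le> 2 * (V (p n (Suc i)) \<omega> - V (p n i) \<omega>)"
          unfolding real_norm_def abs_of_nonneg[OF rb(1)] by (intro order_trans[OF rb(3)] mult_left_mono) simp_all
      qed
      also have "\<dots> = 2 * V t \<omega>" unfolding sum_distrib_left[symmetric] sumV using elim by simp
      finally show ?case by linarith
    qed
    show "AE \<omega> in M. (\<lambda>n. \<Sum>i<Suc n. r n i \<omega>) \<longlonglongrightarrow> 0"
      using good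
    proof eventually_elim
      case (elim \<omega>)
      have inc: "\<bar>Z (p n (Suc i)) \<omega> - Z (p n i) \<omega>\<bar> \<le> V (p n (Suc i)) \<omega> - V (p n i) \<omega>" if "i < Suc n" for n i
        using elim pT[of i n] pT[of "Suc i" n] pinc[of n i] that by simp
      have Vt: "0 \<le> V t \<omega>"
      proof -
        have "0 \<in> {0..T}" using t by auto
        moreover have "0 \<le> t" using t by simp
        ultimately have "\<bar>Z t \<omega> - Z 0 \<omega>\<bar> \<le> V t \<omega> - V 0 \<omega>" using elim t by blast
        then have "0 \<le> V t \<omega> - V 0 \<omega>" by (rule order_trans[OF abs_ge_zero])
        then show ?thesis using elim by simp
      qed
      show ?case
      proof (rule tendstoI)
        fix e :: real assume e: "0 < e"
        \<comment> \<open>Small enough that the quadratic remainders, at most ?d times the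
          increments of V, sum to less than e; the summand 1 prevents division by 0.\<close>
        let ?d = "e / (V t \<omega> + 1)"
        have d: "0 < ?d" "?d * V t \<omega> < e" using e Vt by (simp_all add: field_simps)
        have "continuous_on {0..t} (\<lambda>s. V s \<omega>)" using elim t by (auto intro: continuous_on_subset)
        from equidistant_increments_small[OF this _ d(1)] t
        have "\<forall>\<^sub>F n in sequentially. \<forall>i<Suc n. \<bar>V (p n (Suc i)) \<omega> - V (p n i) \<omega>\<bar> < ?d" by (simp add: p_def)
        then show "\<forall>\<^sub>F n in sequentially. dist (\<Sum>i<Suc n. r n i \<omega>) 0 < e"
        proof eventually_elim
          case (elim n)
          have "norm (\<Sum>i<Suc n. r n i \<omega>) \<le> (\<Sum>i<Suc n. ?d * (V (p n (Suc i)) \<omega> - V (p n i) \<omega>))"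
          proof (rule sum_norm_le)
            fix i assume "i \<in> {..<Suc n}"
            then have i: "i < Suc n" by simp
            let ?v = "V (p n (Suc i)) \<omega> - V (p n i) \<omega>" and ?z = "Z (p n (Suc i)) \<omega> - Z (p n i) \<omega>"
            have v: "\<bar>?z\<bar> \<le> ?v" "?v \<le> ?d" using inc[OF i] elim i by (auto simp: abs_less_iff less_imp_le)
            have "?z\<^sup>2 = \<bar>?z\<bar> * \<bar>?z\<bar>" by (simp add: power2_eq_square)
            also have "\<dots> \<le> ?d * ?v" using v by (intro mult_mono) auto
            finally show "norm (r n i \<omega>) \<le> ?d * ?v"
              unfolding real_norm_def abs_of_nonneg[OF rb(1)] by (rule order_trans[OF rb(2)])
          qed
          also have "\<dots> = ?d * V t \<omega>" unfolding sum_distrib_left[symmetric] sumV using \<open>V 0 \<omega> = 0 \<and> _\<close> by simp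
          also have "\<dots> < e" by (rule d(2))
          finally show ?case by (simp add: dist_real_def)
        qed
      qed
    qed
  qed simp
  then have "(\<integral>\<omega>. \<phi> (Z t \<omega>) \<partial>M) - (\<integral>\<omega>. \<phi> (Z 0 \<omega>) \<partial>M) = 0"
    unfolding total by (simp add: LIMSEQ_const_iff)
  moreover have "(\<integral>\<omega>. \<phi> (Z 0 \<omega>) \<partial>M) = 1"
  proof -
    have 0: "0 \<in> {0..T}" using t by auto
    have "(\<integral>\<omega>. \<phi> (Z 0 \<omega>) \<partial>M) = (\<integral>\<omega>. 1 \<partial>M)"
    proof (rule integral_cong_AE)
      show "AE \<omega> in M. \<phi> (Z 0 \<omega>) = 1" using Z0 by eventually_elim (simp add: \<phi>_def)
    qed (use borel_measurable_integrable[OF \<phi>i[OF 0]] in auto)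
    then show ?thesis using prob_space by simp
  qed
  ultimately have "(\<integral>\<omega>. \<phi> (Z t \<omega>) - 1 \<partial>M) = 0"
    using \<phi>i[OF t] prob_space by simp
  moreover have "integrable M (\<lambda>\<omega>. \<phi> (Z t \<omega>) - 1)" using \<phi>i[OF t] by simp
  moreover have "AE \<omega> in M. 0 \<le> \<phi> (Z t \<omega>) - 1" using \<phi>1 by simp
  ultimately have "AE \<omega> in M. \<phi> (Z t \<omega>) - 1 = 0" by (simp add: integral_nonneg_eq_0_iff_AE)
  then show ?thesis by eventually_elim (simp add: \<phi>_def)
qed

lemma continuous_zero_on_rationals:
  fixes f :: "real \<Rightarrow> real"
  assumes T: "0 < T" and f: "continuous_on {0..T} f" and z: "\<And>q. q \<in> \<rat> \<inter> {0..T} \<Longrightarrow> f q = 0" and t: "t \<in> {0..T}"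
  shows "f t = 0"
proof (rule ccontr)
  assume "f t \<noteq> 0"
  then have e: "0 < \<bar>f t\<bar>" by simp
  have "continuous (at t within {0..T}) f" using f t by (auto simp: continuous_on_eq_continuous_within)
  then obtain d where d: "0 < d" "\<And>y. y \<in> {0..T} \<Longrightarrow> dist y t < d \<Longrightarrow> dist (f y) (f t) < \<bar>f t\<bar>"
    unfolding continuous_within_eps_delta using e by metis
  have "max 0 (t - d) < min T (t + d)" using T t d by auto
  then obtain q where q: "q \<in> \<rat>" "max 0 (t - d) < q" "q < min T (t + d)" using Rats_dense_in_real by blast
  then have "dist (f q) (f t) < \<bar>f t\<bar>" by (intro d(2)) (auto simp: dist_real_def)
  moreover have "f q = 0" using q by (intro z) auto
  ultimately show False by (simp add: dist_real_def)
qed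

text \<open>The increments of A - B are dominated by those of the continuous increasing process A +
  B, so \<open>martingale_finite_variation_zero\<close> applies at each fixed time. Rational times
  and continuity merge the null sets into one.\<close>

lemma (in prob_space) compensator_unique:
  assumes T: "0 < T" and sub: "\<And>s. s \<in> {0..T} \<Longrightarrow> subalgebra M (G s)"
    and N: "\<And>s. s \<in> {0..T} \<Longrightarrow> integrable M (N s)"
    and A: "compensator M T G N A" and B: "compensator M T G N B"
  shows "AE \<omega> in M. \<forall>t\<in>{0..T}. A t \<omega> = B t \<omega>"
proof -
  have mA: "martingale_on M T G (\<lambda>t \<omega>. N t \<omega> - A t \<omega>)" and mB: "martingale_on M T G (\<lambda>t \<omega>. N t \<omega> - B t \<omega>)"
    using A B by (auto simp: compensator_def)
  have good: "AE \<omega> in M. A 0 \<omega> = 0" "AE \<omega> in M. B 0 \<omega> = 0"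
    "AE \<omega> in M. continuous_on {0..T} (\<lambda>t. A t \<omega>)" "AE \<omega> in M. continuous_on {0..T} (\<lambda>t. B t \<omega>)"
    "AE \<omega> in M. mono_on {0..T} (\<lambda>t. A t \<omega>)" "AE \<omega> in M. mono_on {0..T} (\<lambda>t. B t \<omega>)"
    using A B by (auto simp: compensator_def)
  let ?Z = "\<lambda>t \<omega>. A t \<omega> - B t \<omega>" and ?V = "\<lambda>t \<omega>. A t \<omega> + B t \<omega>"
  have int: "integrable M (\<lambda>\<omega>. N t \<omega> - A t \<omega>)" "integrable M (\<lambda>\<omega>. N t \<omega> - B t \<omega>)" if "t \<in> {0..T}" for t
    using mA mB that by (auto simp: martingale_on_def)
  have intAB: "integrable M (A t)" "integrable M (B t)" if "t \<in> {0..T}" for t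
    using Bochner_Integration.integrable_diff[OF N[OF that] int(1)[OF that]] Bochner_Integration.integrable_diff[OF N[OF that] int(2)[OF that]] by simp_all
  have Zeq: "?Z t = (\<lambda>\<omega>. (N t \<omega> - B t \<omega>) - (N t \<omega> - A t \<omega>))" for t by auto
  have Z: "martingale_on M T G ?Z"
    unfolding martingale_on_def
  proof (intro conjI ballI impI)
    fix t assume t: "t \<in> {0..T}"
    show "?Z t \<in> borel_measurable (G t)"
      unfolding Zeq by (rule borel_measurable_diff) (use mA mB t in \<open>auto simp: martingale_on_def\<close>)
    show "integrable M (?Z t)" unfolding Zeq by (rule Bochner_Integration.integrable_diff[OF int(2)[OF t] int(1)[OF t]])
  next
    fix s t assume s: "s \<in> {0..T}" and t: "t \<in> {0..T}" and st: "s \<le> t"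
    interpret S: finite_measure_subalgebra M "G s" by unfold_locales (rule sub[OF s])
    have "AE \<omega> in M. real_cond_exp M (G s) (\<lambda>\<omega>. N t \<omega> - A t \<omega>) \<omega> = N s \<omega> - A s \<omega>"
      "AE \<omega> in M. real_cond_exp M (G s) (\<lambda>\<omega>. N t \<omega> - B t \<omega>) \<omega> = N s \<omega> - B s \<omega>"
      using mA mB s t st by (auto simp: martingale_on_def)
    with S.real_cond_exp_diff[OF int(2)[OF t] int(1)[OF t]]
    show "AE \<omega> in M. real_cond_exp M (G s) (?Z t) \<omega> = ?Z s \<omega>"
      unfolding Zeq[of t] by eventually_elim simp
  qed
  have each: "AE \<omega> in M. ?Z t \<omega> = 0" if t: "t \<in> {0..T}" for t
  proof (rule martingale_finite_variation_zero[where Z="?Z" and V="?V" and G=G and T=T])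
    show "subalgebra M (G s)" if "s \<in> {0..T}" for s by (rule sub[OF that])
    show "martingale_on M T G ?Z" by (rule Z)
    show "integrable M (?V t)" using intAB[OF t] by simp
    show "AE \<omega> in M. ?Z 0 \<omega> = 0" using good(1,2) by eventually_elim simp
    show "AE \<omega> in M. ?V 0 \<omega> = 0" using good(1,2) by eventually_elim simp
    show "AE \<omega> in M. continuous_on {0..T} (\<lambda>s. ?V s \<omega>)" using good(3,4) by eventually_elim (intro continuous_on_add)
    show "AE \<omega> in M. \<forall>r\<in>{0..T}. \<forall>s\<in>{0..T}. r \<le> s \<longrightarrow> \<bar>?Z s \<omega> - ?Z r \<omega>\<bar> \<le> ?V s \<omega> - ?V r \<omega>"
      using good(5,6)
    proof eventually_elim
      case (elim \<omega>)
      show ?case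
      proof (intro ballI impI)
        fix r s assume "r \<in> {0..T}" "s \<in> {0..T}" "r \<le> s"
        then have "A r \<omega> \<le> A s \<omega>" "B r \<omega> \<le> B s \<omega>" using elim by (auto simp: mono_on_def)
        then show "\<bar>?Z s \<omega> - ?Z r \<omega>\<bar> \<le> ?V s \<omega> - ?V r \<omega>" by linarith
      qed
    qed
  qed (rule t)
  have "AE \<omega> in M. \<forall>q\<in>\<rat> \<inter> {0..T}. ?Z q \<omega> = 0"
  proof (subst AE_ball_countable)
    show "countable (\<rat> \<inter> {0..T})" using countable_rat by (auto intro: countable_subset)
  qed (use each in blast)
  with good(3,4) show ?thesis
  proof eventually_elim
    case (elim \<omega>)
    have "continuous_on {0..T} (\<lambda>t. ?Z t \<omega>)" using elim by (intro continuous_on_diff)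
    then show ?case using continuous_zero_on_rationals[OF T, of "\<lambda>t. ?Z t \<omega>"] elim(3) by auto
  qed
qed

section \<open>Predictability and the intensity\<close>

lemma space_predictable_sigma [simp]: "space (predictable_sigma M T G) = {0..T} \<times> space M"
  by (simp add: predictable_sigma_def space_measure_of_conv)

lemma predictable_gen_sub:
  fixes T :: real
  assumes "\<And>s. s \<in> {0..T} \<Longrightarrow> sets (G s) \<subseteq> Pow (space M)" "0 \<le> T"
  shows "{{0} \<times> B | B. B \<in> sets (G 0)} \<union> {{s<..t} \<times> B | s t B. 0 \<le> s \<and> s < t \<and> t \<le> T \<and> B \<in> sets (G s)}
    \<subseteq> Pow ({0..T} \<times> space M)"
proof (intro Un_least subsetI)
  fix x :: "(real \<times> 'a) set" assume "x \<in> {{0} \<times> B | B. B \<in> sets (G 0)}"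
  then obtain B where x: "x = {0} \<times> B" and B: "B \<in> sets (G 0)" by blast
  have "(0::real) \<in> {0..T}" using assms(2) by simp
  then have "B \<subseteq> space M" using assms(1) B by blast
  then show "x \<in> Pow ({0..T} \<times> space M)" unfolding x using assms(2) by auto
next
  fix x assume "x \<in> {{s<..t} \<times> B | s t B. 0 \<le> s \<and> s < t \<and> t \<le> T \<and> B \<in> sets (G s)}"
  then obtain s t B where x: "x = {s<..t} \<times> B" and st: "0 \<le> s" "s < t" "t \<le> T" and B: "B \<in> sets (G s)" by blast
  have "B \<subseteq> space M" using assms(1)[of s] B st by auto
  then show "x \<in> Pow ({0..T} \<times> space M)" unfolding x using st by auto
qed

lemma sets_predictable_sigma:
  assumes G: "\<And>s. s \<in> {0..T} \<Longrightarrow> sets (G s) \<subseteq> Pow (space M)" and T: "0 \<le> T"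
  shows "B \<in> sets (G 0) \<Longrightarrow> {0} \<times> B \<in> sets (predictable_sigma M T G)"
    and "0 \<le> s \<Longrightarrow> s < t \<Longrightarrow> t \<le> T \<Longrightarrow> B \<in> sets (G s) \<Longrightarrow> {s<..t} \<times> B \<in> sets (predictable_sigma M T G)"
proof -
  have eq: "sets (predictable_sigma M T G) = sigma_sets ({0..T} \<times> space M)
    ({{0} \<times> B | B. B \<in> sets (G 0)} \<union> {{s<..t} \<times> B | s t B. 0 \<le> s \<and> s < t \<and> t \<le> T \<and> B \<in> sets (G s)})"
    unfolding predictable_sigma_def by (rule sets_measure_of) (rule predictable_gen_sub[OF G T])
  show "B \<in> sets (G 0) \<Longrightarrow> {0} \<times> B \<in> sets (predictable_sigma M T G)"
    unfolding eq by (rule sigma_sets.Basic) blast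
  show "0 \<le> s \<Longrightarrow> s < t \<Longrightarrow> t \<le> T \<Longrightarrow> B \<in> sets (G s) \<Longrightarrow> {s<..t} \<times> B \<in> sets (predictable_sigma M T G)"
    unfolding eq by (rule sigma_sets.Basic) blast
qed

lemma predictable_step:
  fixes f :: "'a \<Rightarrow> real"
  assumes G: "\<And>s. s \<in> {0..T} \<Longrightarrow> space (G s) = space M" and T: "0 \<le> T"
  shows "f \<in> borel_measurable (G 0) \<Longrightarrow> (\<lambda>(t, \<omega>). indicator {0} t * f \<omega>) \<in> borel_measurable (predictable_sigma M T G)"
    and "0 \<le> s \<Longrightarrow> s < u \<Longrightarrow> u \<le> T \<Longrightarrow> f \<in> borel_measurable (G s) \<Longrightarrow>
      (\<lambda>(t, \<omega>). indicator {s<..u} t * f \<omega>) \<in> borel_measurable (predictable_sigma M T G)"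
proof -
  have sub: "sets (G s) \<subseteq> Pow (space M)" if "s \<in> {0..T}" for s
    using G[OF that] sets.space_closed[of "G s"] by simp
  note gen = sets_predictable_sigma[of T G M, OF sub T]
  have *: "(\<lambda>(t, \<omega>). indicator I t * f \<omega>) \<in> borel_measurable (predictable_sigma M T G)"
    if f: "f \<in> borel_measurable (G s)" and s: "s \<in> {0..T}" and I: "I \<subseteq> {0..T}" and rect: "\<And>B. B \<in> sets (G s) \<Longrightarrow> I \<times> B \<in> sets (predictable_sigma M T G)" for I s
  proof (rule measurableI)
    fix S :: "real set" assume S: "S \<in> sets borel"
    have 1: "I \<times> (f -` S \<inter> space (G s)) \<in> sets (predictable_sigma M T G)"
      by (rule rect[OF measurable_sets[OF f S]])
    have "I \<times> space (G s) \<in> sets (predictable_sigma M T G)" by (rule rect[OF sets.top])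
    then have 2: "{0..T} \<times> space M - I \<times> space M \<in> sets (predictable_sigma M T G)"
      using sets.compl_sets[of "I \<times> space M" "predictable_sigma M T G"] G[OF s] by simp
    have "(\<lambda>(t, \<omega>). indicator I t * f \<omega>) -` S \<inter> space (predictable_sigma M T G) =
      I \<times> (f -` S \<inter> space (G s)) \<union> (if 0 \<in> S then {0..T} \<times> space M - I \<times> space M else {})"
    proof (rule set_eqI)
      fix x :: "real \<times> 'a"
      obtain t \<omega> where x: "x = (t, \<omega>)" by fastforce
      show "x \<in> (\<lambda>(t, \<omega>). indicator I t * f \<omega>) -` S \<inter> space (predictable_sigma M T G) \<longleftrightarrow>
        x \<in> I \<times> (f -` S \<inter> space (G s)) \<union> (if 0 \<in> S then {0..T} \<times> space M - I \<times> space M else {})"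
      proof (cases "t \<in> I")
        case True
        then have "t \<in> {0..T}" using I by blast
        then show ?thesis using True G[OF s] by (simp add: x)
      next
        case False
        then show ?thesis by (simp add: x)
      qed
    qed
    also have "\<dots> \<in> sets (predictable_sigma M T G)"
      using sets.Un[OF 1 2] 1 by simp
    finally show "(\<lambda>(t, \<omega>). indicator I t * f \<omega>) -` S \<inter> space (predictable_sigma M T G) \<in> sets (predictable_sigma M T G)" .
  qed simp
  show "f \<in> borel_measurable (G 0) \<Longrightarrow> (\<lambda>(t, \<omega>). indicator {0} t * f \<omega>) \<in> borel_measurable (predictable_sigma M T G)"
    using T gen(1) by (intro *[of 0]) auto
  show "(\<lambda>(t, \<omega>). indicator {s<..u} t * f \<omega>) \<in> borel_measurable (predictable_sigma M T G)"
    if "0 \<le> s" "s < u" "u \<le> T" "f \<in> borel_measurable (G s)"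
    using that gen(2)[of s u] by (intro *[of s]) auto
qed

text \<open>Freezing Z at the left ends of the cells of a partition gives predictable step
  processes, which converge to Z pointwise by left continuity. Time 0 lies in no left-open cell and
  has its own term.\<close>

lemma continuous_adapted_predictable:
  assumes G: "\<And>s. s \<in> {0..T} \<Longrightarrow> space (G s) = space M" and T: "0 < T"
    and Z: "\<And>s. s \<in> {0..T} \<Longrightarrow> Z s \<in> borel_measurable (G s)"
    and cont: "\<And>\<omega>. \<omega> \<in> space M \<Longrightarrow> continuous_on {0..T} (\<lambda>t. Z t \<omega>)"
  shows "predictable M T G Z"
  unfolding predictable_def
proof (rule borel_measurable_LIMSEQ_real)
  define p where "p = (\<lambda>n i. T * real i / real (Suc n))"
  define A where "A = (\<lambda>n (x :: real \<times> 'a). (\<lambda>(t, \<omega>). indicator {0} t * Z 0 \<omega>) x +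
     (\<Sum>i<Suc n. (\<lambda>(t, \<omega>). indicator {p n i<..p n (Suc i)} t * Z (p n i) \<omega>) x))"
  have p: "0 \<le> p n i" "p n i < p n (Suc i)" for n i
    using T by (auto simp: p_def intro!: divide_strict_right_mono mult_strict_left_mono)
  have pT: "p n i \<le> T" if "i \<le> Suc n" for n i
  proof -
    have "T * real i \<le> T * real (Suc n)" using that T by (intro mult_left_mono) auto
    then show ?thesis unfolding p_def by (subst pos_divide_le_eq) auto
  qed
  show "A n \<in> borel_measurable (predictable_sigma M T G)" for n
    unfolding A_def
  proof (intro borel_measurable_add borel_measurable_sum)
    show "(\<lambda>(t, \<omega>). indicator {0} t * Z 0 \<omega>) \<in> borel_measurable (predictable_sigma M T G)"
      using T by (intro predictable_step(1) G Z) auto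
    fix i assume "i \<in> {..<Suc n}"
    then show "(\<lambda>(t, \<omega>). indicator {p n i<..p n (Suc i)} t * Z (p n i) \<omega>) \<in> borel_measurable (predictable_sigma M T G)"
      using T p[of n i] pT[of i n] pT[of "Suc i" n] by (intro predictable_step(2) G Z) auto
  qed
  fix x assume "x \<in> space (predictable_sigma M T G)"
  then obtain t \<omega> where x: "x = (t, \<omega>)" "t \<in> {0..T}" "\<omega> \<in> space M" by auto
  show "(\<lambda>n. A n x) \<longlonglongrightarrow> (case x of (t, \<omega>) \<Rightarrow> Z t \<omega>)"
  proof (cases "t = 0")
    case True
    have "A n x = Z 0 \<omega>" for n
    proof -
      have "indicator {p n i<..p n (Suc i)} t * Z (p n i) \<omega> = 0" for i
        using True p(1)[of n i] by (simp add: indicator_def)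
      then have "(\<Sum>i<Suc n. indicator {p n i<..p n (Suc i)} t * Z (p n i) \<omega>) = 0" by (intro sum.neutral) blast
      then show ?thesis unfolding A_def x prod.case by (simp add: True del: sum.lessThan_Suc)
    qed
    then show ?thesis by (simp add: x True)
  next
    case False
    then have t: "0 < t" "t \<le> T" using x by auto
    \<comment> \<open>Cells are open on the left and closed on the right, so the cell of t > 0 has
      the index ceiling minus 1; the floor would be one too large at grid points.\<close>
    define k where "k = (\<lambda>n. nat (\<lceil>t * real (Suc n) / T\<rceil> - 1))"
    have k: "p n (k n) < t" "t \<le> p n (Suc (k n))" "k n < Suc n" for n
    proof -
      have pos: "0 < t * real (Suc n) / T" using t T by simp
      then have c: "1 \<le> \<lceil>t * real (Suc n) / T\<rceil>" by linarith
      then have rk: "real (k n) = of_int \<lceil>t * real (Suc n) / T\<rceil> - 1" unfolding k_def by simp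
      have "real (k n) < t * real (Suc n) / T" unfolding rk by linarith
      then have "T * real (k n) < t * real (Suc n)" using T by (simp add: pos_less_divide_eq mult.commute)
      then show "p n (k n) < t" unfolding p_def by (subst pos_divide_less_eq) auto
      have "t * real (Suc n) / T \<le> real (Suc (k n))" using rk by linarith
      then have "t * real (Suc n) \<le> T * real (Suc (k n))" using T by (simp add: pos_divide_le_eq mult.commute)
      then show "t \<le> p n (Suc (k n))" unfolding p_def by (subst pos_le_divide_eq) auto
      have "t * real (Suc n) \<le> T * real (Suc n)" using t by (intro mult_right_mono) auto
      then have "t * real (Suc n) / T \<le> real (Suc n)" using T by (simp add: pos_divide_le_eq mult.commute)
      then have "real (k n) < real (Suc n)" using \<open>real (k n) < t * real (Suc n) / T\<close> by linarith
      then show "k n < Suc n" by simp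
    qed
    have pmono: "p n i \<le> p n j" if "i \<le> j" for n i j
      using that T unfolding p_def by (intro divide_right_mono mult_left_mono) auto
    have A: "A n x = Z (p n (k n)) \<omega>" for n
    proof -
      have "(\<Sum>i<Suc n. indicator {p n i<..p n (Suc i)} t * Z (p n i) \<omega>) = (\<Sum>i<Suc n. if i = k n then Z (p n (k n)) \<omega> else 0)"
      proof (rule sum.cong)
        fix i assume "i \<in> {..<Suc n}"
        have "t \<notin> {p n i<..p n (Suc i)}" if "i \<noteq> k n"
        proof (cases "i < k n")
          case True then show ?thesis using pmono[of "Suc i" "k n" n] k(1)[of n] by simp
        next
          case False then show ?thesis using pmono[of "Suc (k n)" i n] k(2)[of n] that by simp
        qed
        then show "indicator {p n i<..p n (Suc i)} t * Z (p n i) \<omega> = (if i = k n then Z (p n (k n)) \<omega> else 0)"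
          using k(1,2)[of n] by (simp add: indicator_def)
      qed simp
      also have "\<dots> = Z (p n (k n)) \<omega>" using k(3)[of n] by (simp add: sum.delta del: sum.lessThan_Suc)
      finally show ?thesis using False by (simp add: A_def x del: sum.lessThan_Suc)
    qed
    have "(\<lambda>n. p n (k n)) \<longlonglongrightarrow> t"
    proof (rule tendsto_sandwich[OF always_eventually always_eventually])
      show "(\<lambda>n. t - T * inverse (real (Suc n))) \<longlonglongrightarrow> t"
        using tendsto_diff[OF tendsto_const tendsto_mult[OF tendsto_const LIMSEQ_inverse_real_of_nat], of t T] by simp
      show "(\<lambda>n. t) \<longlonglongrightarrow> t" by simp
      show "\<forall>n. t - T * inverse (real (Suc n)) \<le> p n (k n)"
      proof
        fix n
        have "p n (Suc (k n)) = p n (k n) + T * inverse (real (Suc n))"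
          unfolding p_def divide_inverse by (simp only: of_nat_Suc[of "k n"] ring_distribs mult_1_right)
        then show "t - T * inverse (real (Suc n)) \<le> p n (k n)" using k(2)[of n] by linarith
      qed
      show "\<forall>n. p n (k n) \<le> t" using k(1) less_imp_le by blast
    qed
    then have "(\<lambda>n. Z (p n (k n)) \<omega>) \<longlonglongrightarrow> Z t \<omega>"
    proof (rule continuous_on_tendsto_compose[OF cont[OF x(3)]])
      show "t \<in> {0..T}" by (rule x(2))
      show "\<forall>\<^sub>F n in sequentially. p n (k n) \<in> {0..T}"
        using p(1) pT[OF less_imp_le[OF k(3)]] by (intro always_eventually) simp
    qed
    then show ?thesis unfolding A unfolding x prod.case .
  qed
qed

context market
begin

section \<open>From the sign filtration to the market's filtration, and the intensity\<close>

lemma hazard_arg: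
  assumes om: "\<omega> \<in> space M" and t: "0 \<le> t"
  shows "real_of_ereal (min (ereal t) (\<sigma> \<omega>)) \<le> real_of_ereal (min (ereal t) (\<tau> \<omega>))"
  by (cases rule: default_cases[OF om]) (use t delay_pos in \<open>auto simp: min_def\<close>)

lemma hazard_continuous:
  assumes om: "\<omega> \<in> space M"
  shows "continuous_on {0..T} (\<lambda>t. hazard t \<omega>)"
proof -
  have c: "continuous_on {0..T} (\<lambda>t. real_of_ereal (min (ereal t) x))" if x: "x = \<infinity> \<or> (\<exists>r. x = ereal r)" for x
  proof -
    consider "x = \<infinity>" | r where "x = ereal r" using x by blast
    then show ?thesis
    proof cases
      case 1
      then show ?thesis by (simp add: continuous_on_id)
    next
      case (2 r)
      have "(\<lambda>t. real_of_ereal (min (ereal t) x)) = (\<lambda>t. min t r)" by (simp add: 2 fun_eq_iff min_def)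
      then show ?thesis by (simp only:) (intro continuous_intros)
    qed
  qed
  have "\<sigma> \<omega> = \<infinity> \<or> (\<exists>r. \<sigma> \<omega> = ereal r)" "\<tau> \<omega> = \<infinity> \<or> (\<exists>r. \<tau> \<omega> = ereal r)"
    by (cases rule: default_cases[OF om]; simp)+
  note c[OF this(1)] c[OF this(2)]
  then show ?thesis unfolding hazard_def
  proof (intro continuous_intros)
    show "\<forall>t\<in>{0..T}. (real_of_ereal (min (ereal t) (\<tau> \<omega>)) - real_of_ereal (min (ereal t) (\<sigma> \<omega>)) + delay) / delay \<noteq> 0"
    proof
      fix t assume "t \<in> {0..T}"
      then show "(real_of_ereal (min (ereal t) (\<tau> \<omega>)) - real_of_ereal (min (ereal t) (\<sigma> \<omega>)) + delay) / delay \<noteq> 0"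
        using hazard_arg[OF om, of t] delay_pos by auto
    qed
  qed (use delay_pos in auto)
qed

lemma hazard_mono:
  assumes om: "\<omega> \<in> space M"
  shows "mono_on {0..T} (\<lambda>t. hazard t \<omega>)"
proof (rule mono_onI)
  fix s t assume st: "s \<in> {0..T}" "t \<in> {0..T}" "s \<le> t"
  have "real_of_ereal (min (ereal s) (\<tau> \<omega>)) - real_of_ereal (min (ereal s) (\<sigma> \<omega>)) \<le>
     real_of_ereal (min (ereal t) (\<tau> \<omega>)) - real_of_ereal (min (ereal t) (\<sigma> \<omega>))"
    by (cases rule: default_cases[OF om]) (use st delay_pos in \<open>auto simp: min_def\<close>)
  then show "hazard s \<omega> \<le> hazard t \<omega>"
    unfolding hazard_def using hazard_arg[OF om, of s] st(1) delay_pos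
    by (intro divide_right_mono ln_mono) auto
qed

text \<open>The hazard is continuous, and the default indicator is right continuous because it
  already equals 1 at \<tau>. This is what the passage to the right-continuous filtration
  needs.\<close>

lemma compensated_right_cont:
  assumes om: "\<omega> \<in> space M" and s: "0 \<le> s" "s < t" "t \<le> T"
  shows "(\<lambda>n. compensated (s + (t - s) * inverse (real (Suc (Suc n)))) \<omega>) \<longlonglongrightarrow> compensated s \<omega>"
proof -
  let ?u = "\<lambda>n. s + (t - s) * inverse (real (Suc (Suc n)))"
  have u: "s < ?u n" "?u n < t" for n
  proof -
    show "s < ?u n" using s by simp
    have "(t - s) * inverse (real (Suc (Suc n))) < (t - s) * 1"
      using s by (intro mult_strict_left_mono) (auto simp: inverse_less_1_iff)
    then show "?u n < t" by simp
  qed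
  have lim: "?u \<longlonglongrightarrow> s"
    using tendsto_add[OF tendsto_const tendsto_mult[OF tendsto_const LIMSEQ_Suc[OF LIMSEQ_inverse_real_of_nat]], of s "t - s"] by simp
  have "(\<lambda>n. hazard (?u n) \<omega>) \<longlonglongrightarrow> hazard s \<omega>"
  proof (rule continuous_on_tendsto_compose[OF hazard_continuous[OF om] lim])
    show "s \<in> {0..T}" using s by auto
    show "\<forall>\<^sub>F n in sequentially. ?u n \<in> {0..T}"
    proof (rule always_eventually, rule allI)
      fix n show "?u n \<in> {0..T}" using u[of n] s by simp
    qed
  qed
  moreover have "(\<lambda>n. default_indicator \<alpha> T X (?u n) \<omega>) \<longlonglongrightarrow> default_indicator \<alpha> T X s \<omega>"
  proof (rule tendsto_eventually)
    show "\<forall>\<^sub>F n in sequentially. default_indicator \<alpha> T X (?u n) \<omega> = default_indicator \<alpha> T X s \<omega>"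
    proof (cases "\<tau> \<omega> \<le> ereal s")
      case True
      have "\<tau> \<omega> \<le> ereal (?u n)" for n
      proof -
        have "ereal s \<le> ereal (?u n)" using u(1)[of n] by simp
        with True show ?thesis by (rule order_trans)
      qed
      then show ?thesis using True by (intro always_eventually allI) (simp only: default_indicator_def)
    next
      case False
      then have "ereal s < \<tau> \<omega>" by simp
      then obtain e where e: "s < e" "ereal e \<le> \<tau> \<omega>" by (cases "\<tau> \<omega>") (auto intro: that[of "s + 1"])
      have "\<forall>\<^sub>F n in sequentially. ?u n < e" using order_tendstoD(2)[OF lim e(1)] .
      then show ?thesis
      proof eventually_elim
        case (elim n)
        then have "ereal (?u n) < ereal e" by simp
        then have "ereal (?u n) < \<tau> \<omega>" using e(2) by (rule less_le_trans)
        then show ?case using False by (simp only: default_indicator_def not_le[symmetric])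
      qed
    qed
  qed
  ultimately show ?thesis unfolding compensated_def by (intro tendsto_diff)
qed

lemma martingale_K:
  assumes B: "B \<in> sets (K s)" and st: "0 \<le> s" "s \<le> t" "t \<le> T"
  shows "(\<integral>\<omega>. indicator B \<omega> * compensated t \<omega> \<partial>M) = (\<integral>\<omega>. indicator B \<omega> * compensated s \<omega> \<partial>M)"
proof -
  have sT: "s \<in> {0..T}" and tT: "t \<in> {0..T}" using st by auto
  obtain B' where B': "B' \<in> sets (H s)" "AE \<omega> in M. \<omega> \<in> B \<longleftrightarrow> \<omega> \<in> B'" using B sets_K_iff[OF sT] by blast
  have BM: "B \<in> sets M" "B' \<in> sets M" using K_sub[OF sT] H_sub[OF sT] B B'(1) by blast+
  have eq: "(\<integral>\<omega>. indicator B \<omega> * compensated v \<omega> \<partial>M) = (\<integral>\<omega>. indicator B' \<omega> * compensated v \<omega> \<partial>M)" if v: "v \<in> {0..T}" for v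
  proof (rule integral_cong_AE)
    note [measurable] = BM measurable_G_M[OF v compensated_measurable_G[OF v]]
    show "(\<lambda>\<omega>. indicator B \<omega> * compensated v \<omega>) \<in> borel_measurable M"
      "(\<lambda>\<omega>. indicator B' \<omega> * compensated v \<omega>) \<in> borel_measurable M" by measurable
    show "AE \<omega> in M. indicator B \<omega> * compensated v \<omega> = indicator B' \<omega> * compensated v \<omega>"
      using B'(2) by eventually_elim (simp add: indicator_def)
  qed
  show ?thesis unfolding eq[OF sT] eq[OF tT] by (rule martingale_H[OF B'(1) st])
qed

text \<open>An event of \<open>G s\<close> belongs to \<open>K u\<close> for every u after s, so the
  identity holds with u in place of s; letting u decrease to s is justified by right continuity and
  the uniform bound on \<open>compensated\<close>.\<close>

lemma martingale_G:
  assumes B: "B \<in> sets (G s)" and st: "0 \<le> s" "s \<le> t" "t \<le> T"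
  shows "(\<integral>\<omega>. indicator B \<omega> * compensated t \<omega> \<partial>M) = (\<integral>\<omega>. indicator B \<omega> * compensated s \<omega> \<partial>M)"
proof (cases "s = t")
  case False
  then have lt: "s < t" using st by simp
  have sT: "s \<in> {0..T}" using st by auto
  have BM: "B \<in> sets M" using G_sub[OF sT] B by blast
  \<comment> \<open>The double successor keeps the fraction strictly between 0 and 1, hence the
    times strictly between s and t from n = 0 on.\<close>
  let ?u = "\<lambda>n. s + (t - s) * inverse (real (Suc (Suc n)))"
  have u: "s < ?u n" "?u n < t" for n
  proof -
    show "s < ?u n" using lt by simp
    have "(t - s) * inverse (real (Suc (Suc n))) < (t - s) * 1"
      using lt by (intro mult_strict_left_mono) (auto simp: inverse_less_1_iff)
    then show "?u n < t" by simp
  qed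
  have uT: "?u n \<in> {0..T}" for n using u[of n] st by simp
  have eq: "(\<integral>\<omega>. indicator B \<omega> * compensated (?u n) \<omega> \<partial>M) = (\<integral>\<omega>. indicator B \<omega> * compensated t \<omega> \<partial>M)" for n
  proof (rule martingale_K[symmetric])
    show "B \<in> sets (K (?u n))" using G_sub_K[of s "?u n", THEN subsetD, OF _ _ _ B] st u[of n] by simp
    show "0 \<le> ?u n" "?u n \<le> t" "t \<le> T" using u[of n] st by simp_all
  qed
  have m: "(\<lambda>\<omega>. indicator B \<omega> * compensated v \<omega>) \<in> borel_measurable M" if v: "v \<in> {0..T}" for v
  proof -
    note [measurable] = BM measurable_G_M[OF v compensated_measurable_G[OF v]]
    show ?thesis by measurable
  qed
  have "(\<lambda>n. \<integral>\<omega>. indicator B \<omega> * compensated (?u n) \<omega> \<partial>M) \<longlonglongrightarrow> (\<integral>\<omega>. indicator B \<omega> * compensated s \<omega> \<partial>M)"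
  proof (rule integral_dominated_convergence[where w="\<lambda>_. 1 + hazard_bound"])
    show "AE \<omega> in M. (\<lambda>n. indicator B \<omega> * compensated (?u n) \<omega>) \<longlonglongrightarrow> indicator B \<omega> * compensated s \<omega>"
      using compensated_right_cont[OF _ st(1) lt st(3)] by (intro AE_I2 tendsto_mult tendsto_const)
    show "AE \<omega> in M. norm (indicator B \<omega> * compensated (?u n) \<omega>) \<le> 1 + hazard_bound" for n
    proof (rule AE_I2)
      fix \<omega> assume "\<omega> \<in> space M"
      from compensated_bound[OF this uT[of n]]
      show "norm (indicator B \<omega> * compensated (?u n) \<omega>) \<le> 1 + hazard_bound"
        unfolding real_norm_def abs_mult by (rule order_trans[rotated]) (rule mult_left_le_one_le, simp_all add: indicator_def)
    qed
  qed (use m sT uT in simp_all)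
  then show ?thesis unfolding eq by (simp add: LIMSEQ_const_iff)
qed simp

lemma compensator_hazard: "compensator M T G (default_indicator \<alpha> T X) hazard"
  unfolding compensator_def
proof (intro conjI)
  have T: "0 < T" by (rule T_pos)
  show "predictable M T G hazard"
    using measurable_K_G[OF _ hazard_measurable_K] by (intro continuous_adapted_predictable T hazard_continuous) auto
  show "AE \<omega> in M. hazard 0 \<omega> = 0"
  proof (rule AE_I2)
    fix \<omega> assume om: "\<omega> \<in> space M"
    have "0 \<le> \<sigma> \<omega>" "0 \<le> \<tau> \<omega>"
      using stopping_nonneg[OF stopping_tau_alpha om] tau_alpha_le_default[OF om] by (auto intro: order_trans)
    then show "hazard 0 \<omega> = 0" by (intro hazard_before) (simp_all add: zero_ereal_def)
  qed
  show "AE \<omega> in M. continuous_on {0..T} (\<lambda>t. hazard t \<omega>)" by (intro AE_I2 hazard_continuous)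
  show "AE \<omega> in M. mono_on {0..T} (\<lambda>t. hazard t \<omega>)" by (intro AE_I2 hazard_mono)
  show "martingale_on M T G (\<lambda>t \<omega>. default_indicator \<alpha> T X t \<omega> - hazard t \<omega>)"
    unfolding martingale_on_def compensated_def[symmetric]
  proof (intro conjI ballI impI)
    fix t assume t: "t \<in> {0..T}"
    show "compensated t \<in> borel_measurable (G t)" by (rule compensated_measurable_G[OF t])
    show "integrable M (compensated t)" by (rule compensated_integrable[OF t])
  next
    fix s t assume s: "s \<in> {0..T}" and t: "t \<in> {0..T}" and st: "s \<le> t"
    interpret S: finite_measure_subalgebra M "G s" by unfold_locales (rule subalgebra_G[OF s])
    show "AE \<omega> in M. real_cond_exp M (G s) (compensated t) \<omega> = compensated s \<omega>"
    proof (rule S.real_cond_exp_charact)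
      fix B assume "B \<in> sets (G s)"
      then show "(\<integral>\<omega>\<in>B. compensated t \<omega> \<partial>M) = (\<integral>\<omega>\<in>B. compensated s \<omega> \<partial>M)"
        unfolding set_lebesgue_integral_def real_scaleR_def using s t st by (intro martingale_G) auto
    qed (use compensated_integrable[OF s] compensated_integrable[OF t] compensated_measurable_G[OF s] in auto)
  qed
qed

text \<open>The left limit matters at s = \<tau>: there Y is 0 and the last zero itself jumps to
  \<tau>, whereas its left limit is still the start g of the excursion.\<close>

lemma last_zero_left_Y:
  assumes om: "\<omega> \<in> space M" and g: "\<sigma> \<omega> = ereal (g + delay)" and s: "g < s" "ereal s \<le> \<tau> \<omega>" "s \<le> T"
  shows "last_zero_left Y s \<omega> = g"
proof (rule last_zero_left_eqI[OF s(1)])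
  have g0: "0 \<le> g" "X g \<omega> = 0" by (cases rule: tau_alpha_cases[OF om]; use g in simp)+
  have "Y g \<omega> = 0" using g g0 delay_pos by (simp add: Y_before)
  fix r assume r: "g < r" "r < s"
  show "last_zero Y r \<omega> = g"
  proof (rule last_zero_eqI)
    fix q assume q: "g < q" "q \<le> r"
    have "ereal q < ereal s" using q r by simp
    then have "ereal q < \<tau> \<omega>" using s(2) by (rule less_le_trans)
    then have "Y q \<omega> < 0" using q r s by (intro Y_neg[OF om g]) auto
    then show "Y q \<omega> \<noteq> 0" by simp
  qed (use g0 r \<open>Y g \<omega> = 0\<close> in auto)
qed

text \<open>Up to b = min t \<tau> the intensity vanishes before \<sigma> and is 1 / (2 (s - g))
  afterwards, with primitive ln (s - g) / 2. Its value at \<sigma> = g + \<open>delay\<close> is ln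
  \<open>delay\<close> / 2, which explains the divisor in \<open>hazard\<close>.\<close>

lemma hazard_eq_integral:
  assumes om: "\<omega> \<in> space M" and t: "t \<in> {0..T}"
  shows "interval_lebesgue_integrable lborel 0 (min (ereal t) (\<tau> \<omega>)) (\<lambda>s. default_intensity \<alpha> T X s \<omega>)"
    and "hazard t \<omega> = interval_lebesgue_integral lborel 0 (min (ereal t) (\<tau> \<omega>)) (\<lambda>s. default_intensity \<alpha> T X s \<omega>)"
proof -
  let ?f = "\<lambda>s. default_intensity \<alpha> T X s \<omega>"
  obtain b where b: "min (ereal t) (\<tau> \<omega>) = ereal b" "0 \<le> b" "b \<le> t" "ereal b \<le> \<tau> \<omega>"
  proof -
    have "0 \<le> \<tau> \<omega>"
      using stopping_nonneg[OF stopping_tau_alpha om] tau_alpha_le_default[OF om] by (rule order_trans)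
    show thesis
    proof (cases "ereal t \<le> \<tau> \<omega>")
      case True
      then show thesis using t by (intro that[of t]) (simp_all add: min_absorb1)
    next
      case False
      then obtain r where r: "\<tau> \<omega> = ereal r" "r < t"
        using \<open>0 \<le> \<tau> \<omega>\<close> by (cases "\<tau> \<omega>") auto
      then show thesis using \<open>0 \<le> \<tau> \<omega>\<close> by (intro that[of r]) (simp_all add: min_absorb2 zero_ereal_def)
    qed
  qed
  have bT: "b \<le> T" using b t by simp
  have f: "?f s = of_bool (\<sigma> \<omega> < ereal s) * (1 / (2 * (s - last_zero_left Y s \<omega>)))" if "s \<in> {0<..<b}" for s
  proof -
    have "ereal s \<le> ereal b" using that by simp
    then have "ereal s \<le> \<tau> \<omega>" using b(4) by (rule order_trans)
    then show ?thesis by (simp add: default_intensity_def)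
  qed
  have main: "set_integrable lborel {0<..<b} ?f \<and> (LBINT s:{0<..<b}. ?f s) = hazard t \<omega>"
  proof (cases "ereal b \<le> \<sigma> \<omega>")
    case True
    have "?f s = 0" if "s \<in> {0<..<b}" for s
    proof -
      have "ereal s < ereal b" using that by simp
      then have "ereal s < \<sigma> \<omega>" using True by (rule less_le_trans)
      then have "of_bool (\<sigma> \<omega> < ereal s) = (0::real)" by (simp add: not_less)
      then show ?thesis unfolding f[OF that] by (simp only: mult_zero_left)
    qed
    then have z: "indicator {0<..<b} s *\<^sub>R ?f s = 0" for s by (simp add: indicator_def)
    have "hazard t \<omega> = 0"
    proof (cases "ereal t \<le> \<tau> \<omega>")
      case t\<tau>: True
      then have "b = t" using b(1) by (simp add: min_absorb1)
      then show ?thesis using True t\<tau> by (intro hazard_before) auto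
    next
      case False
      then have "\<tau> \<omega> = ereal b" using b(1) by (simp add: min_absorb2)
      then have "\<tau> \<omega> \<le> \<sigma> \<omega>" using True by simp
      then show ?thesis using \<open>\<tau> \<omega> = ereal b\<close> by (cases rule: default_cases[OF om]) auto
    qed
    then show ?thesis unfolding set_integrable_def set_lebesgue_integral_def z by simp
  next
    case False
    then obtain g where g: "\<sigma> \<omega> = ereal (g + delay)" "g + delay < b" "0 \<le> g"
      by (cases rule: tau_alpha_cases[OF om]) auto
    have h: "hazard t \<omega> = ln ((b - g) / delay) / 2"
    proof (cases "ereal t \<le> \<tau> \<omega>")
      case True
      then have "b = t" using b(1) by (simp add: min_absorb1)
      then show ?thesis using g(2) by (simp only:) (rule hazard_during[OF g(1) less_imp_le True])
    next
      case F: False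
      then have "\<tau> \<omega> = ereal b" using b(1) by (simp add: min_absorb2)
      then show ?thesis using g b by (intro hazard_after[OF g(1)]) auto
    qed
    let ?d = "\<lambda>s. 1 / (2 * (s - g))"
    have eq: "indicator {0<..<b} s *\<^sub>R ?f s = ?d s * indicator {g + delay<..<b} s" for s
    proof (cases "s \<in> {0<..<b}")
      case True
      show ?thesis
      proof (cases "g + delay < s")
        case s: True
        have "ereal s \<le> ereal b" using True by simp
        then have "ereal s \<le> \<tau> \<omega>" using b(4) by (rule order_trans)
        moreover have "s \<le> T" using True bT by simp
        ultimately have "last_zero_left Y s \<omega> = g" using s delay_pos by (intro last_zero_left_Y[OF om g(1)]) auto
        then show ?thesis using True s f[OF True] by (simp add: g(1))
      next
        case False
        then show ?thesis using True f[OF True] by (simp add: g(1))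
      qed
    next
      case False
      then show ?thesis using g delay_pos by (auto simp: indicator_def)
    qed
    let ?F = "\<lambda>s. ln (s - g) / 2"
    have der: "DERIV ?F s :> ?d s" if "g + delay \<le> s" for s
      using that delay_pos by (auto intro!: derivative_eq_intros simp: field_simps)
    have pos: "0 \<le> ?d s" if "g + delay \<le> s" for s using that delay_pos by simp
    have ae: "AE s in lborel. ?d s * indicator {g + delay..b} s = ?d s * indicator {g + delay<..<b} s"
      using AE_lborel_singleton[of "g + delay"] AE_lborel_singleton[of b]
      by eventually_elim (auto simp: indicator_def)
    have meas: "?d \<in> borel_measurable borel" by measurable
    have int: "integrable lborel (\<lambda>s. ?d s * indicator {g + delay..b} s)"
      and I: "(\<integral>s. ?d s * indicator {g + delay..b} s \<partial>lborel) = ?F b - ?F (g + delay)"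
      using integrable_FTC_Icc_nonneg[OF meas, of "g + delay" b ?F] integral_FTC_Icc_nonneg[OF meas, of "g + delay" b ?F] der pos g(2)
      by auto
    have "integrable lborel (\<lambda>s. ?d s * indicator {g + delay<..<b} s)"
      using int ae meas by (subst integrable_cong_AE[symmetric, OF _ _ ae]) auto
    moreover have "(\<integral>s. ?d s * indicator {g + delay<..<b} s \<partial>lborel) = hazard t \<omega>"
    proof -
      have "(\<integral>s. ?d s * indicator {g + delay<..<b} s \<partial>lborel) = (\<integral>s. ?d s * indicator {g + delay..b} s \<partial>lborel)"
        using meas by (intro integral_cong_AE[symmetric, OF _ _ ae]) auto
      also have "\<dots> = (ln (b - g) - ln delay) / 2" unfolding I by (simp add: diff_divide_distrib)
      also have "\<dots> = hazard t \<omega>" unfolding h using g delay_pos by (simp add: ln_divide_pos)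
      finally show ?thesis .
    qed
    ultimately show ?thesis unfolding set_integrable_def set_lebesgue_integral_def eq by blast
  qed
  have e: "einterval (0::ereal) (ereal b) = {0<..<b}" by (auto simp: einterval_def zero_ereal_def)
  have le: "(0::ereal) \<le> ereal b" using b by (simp add: zero_ereal_def)
  show "interval_lebesgue_integrable lborel 0 (min (ereal t) (\<tau> \<omega>)) ?f"
    unfolding b(1) interval_lebesgue_integrable_def using main le e by simp
  show "hazard t \<omega> = interval_lebesgue_integral lborel 0 (min (ereal t) (\<tau> \<omega>)) ?f"
    unfolding b(1) interval_lebesgue_integral_def using main le e by simp
qed

lemma default_indicator_integrable:
  assumes t: "t \<in> {0..T}"
  shows "integrable M (default_indicator \<alpha> T X t)"
  using measurable_G_M[OF t measurable_K_G[OF t default_indicator_measurable_K[OF t]]]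
  by (intro integrable_const_bound[where B=1]) (auto simp: default_indicator_def)

theorem default_intensity_compensator:
  "compensator M T G (default_indicator \<alpha> T X) hazard"
  "compensator M T G (default_indicator \<alpha> T X) A \<Longrightarrow>
    AE \<omega> in M. \<forall>t\<in>{0..T}.
      interval_lebesgue_integrable lborel 0 (min (ereal t) (\<tau> \<omega>)) (\<lambda>s. default_intensity \<alpha> T X s \<omega>) \<and>
      A t \<omega> = interval_lebesgue_integral lborel 0 (min (ereal t) (\<tau> \<omega>)) (\<lambda>s. default_intensity \<alpha> T X s \<omega>)"
proof -
  show "compensator M T G (default_indicator \<alpha> T X) hazard" by (rule compensator_hazard)
  assume A: "compensator M T G (default_indicator \<alpha> T X) A"
  have "AE \<omega> in M. \<forall>t\<in>{0..T}. A t \<omega> = hazard t \<omega>"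
    by (rule compensator_unique[OF T_pos _ _ A compensator_hazard])
      (rule subalgebra_G default_indicator_integrable, assumption)+
  then show "AE \<omega> in M. \<forall>t\<in>{0..T}.
      interval_lebesgue_integrable lborel 0 (min (ereal t) (\<tau> \<omega>)) (\<lambda>s. default_intensity \<alpha> T X s \<omega>) \<and>
      A t \<omega> = interval_lebesgue_integral lborel 0 (min (ereal t) (\<tau> \<omega>)) (\<lambda>s. default_intensity \<alpha> T X s \<omega>)"
  proof (rule AE_mp, intro AE_I2 impI ballI)
    fix \<omega> t assume om: "\<omega> \<in> space M" and eq: "\<forall>t\<in>{0..T}. A t \<omega> = hazard t \<omega>" and t: "t \<in> {0..T}"
    show "interval_lebesgue_integrable lborel 0 (min (ereal t) (\<tau> \<omega>)) (\<lambda>s. default_intensity \<alpha> T X s \<omega>) \<and>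
      A t \<omega> = interval_lebesgue_integral lborel 0 (min (ereal t) (\<tau> \<omega>)) (\<lambda>s. default_intensity \<alpha> T X s \<omega>)"
      using hazard_eq_integral[OF om t] eq t by simp
  qed
qed

end

section \<open>Regular versions\<close>

text \<open>By completeness all parts of a null set are null, so changing an event on a null set
  does not lead out of a sigma-algebra that contains the null sets.\<close>

lemma sets_AE_cong:
  assumes M: "complete_measure M" and null: "null_sets M \<subseteq> sets N" and sp: "space N = space M"
    and A: "A \<in> sets N" and B: "B \<subseteq> space M" and eq: "AE \<omega> in M. \<omega> \<in> A \<longleftrightarrow> \<omega> \<in> B"
  shows "B \<in> sets N"
proof -
  interpret complete_measure M by (rule M)
  have D: "{\<omega>\<in>space M. \<not> (\<omega> \<in> A \<longleftrightarrow> \<omega> \<in> B)} \<in> null_sets M" (is "?D \<in> _") by (rule AE_complete_sets[OF M eq])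
  have "B \<inter> ?D \<in> null_sets M" by (rule complete2[OF _ D]) blast
  then have "(A - ?D) \<union> (B \<inter> ?D) \<in> sets N" using A D null by (intro sets.Un sets.Diff) blast+
  moreover have "(A - ?D) \<union> (B \<inter> ?D) = B" using B sets.sets_into_space[OF A] sp by blast
  ultimately show ?thesis by simp
qed

lemma measurable_AE_cong:
  fixes f g :: "'a \<Rightarrow> real"
  assumes M: "complete_measure M" and null: "null_sets M \<subseteq> sets N" and sp: "space N = space M"
    and f: "f \<in> borel_measurable N" and eq: "AE \<omega> in M. f \<omega> = g \<omega>"
  shows "g \<in> borel_measurable N"
proof (rule measurableI)
  fix S :: "real set" assume "S \<in> sets borel"
  then have "f -` S \<inter> space N \<in> sets N" by (rule measurable_sets[OF f])
  then show "g -` S \<inter> space N \<in> sets N"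
  proof (rule sets_AE_cong[OF M null sp])
    show "AE \<omega> in M. \<omega> \<in> f -` S \<inter> space N \<longleftrightarrow> \<omega> \<in> g -` S \<inter> space N" using eq by eventually_elim simp
  qed (simp add: sp)
qed simp

lemma completed_sign_filtration_mono:
  assumes M: "complete_measure M" and eq: "AE \<omega> in M. \<forall>t. Y t \<omega> = Z t \<omega>"
  shows "sigma_sets (space M) (sets (sign_filtration M Y t) \<union> null_sets M) \<subseteq>
    sigma_sets (space M) (sets (sign_filtration M Z t) \<union> null_sets M)"
proof -
  let ?C = "completed_filtration M (sign_filtration M Z) t"
  have Pow: "sets (sign_filtration M Z t) \<union> null_sets M \<subseteq> Pow (space M)"
    using sets.space_closed[of "sign_filtration M Z t"] null_setsD2[of _ M] sets.sets_into_space[of _ M]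
    by auto
  have C: "sets ?C = sigma_sets (space M) (sets (sign_filtration M Z t) \<union> null_sets M)"
    unfolding completed_filtration_def by (rule sets_measure_of[OF Pow])
  have sp: "space ?C = space M" by (simp add: completed_filtration_def space_measure_of_conv)
  have null: "null_sets M \<subseteq> sets ?C" unfolding C by (auto intro: sigma_sets.Basic)
  let ?g = "\<lambda>Y. \<Union>s\<in>{0..t}. {(\<lambda>\<omega>. sign_left (Y s \<omega>)) -` B \<inter> space M | B. B \<in> sets borel}"
  have gen: "sets (sign_filtration M Y t) = sigma_sets (space M) (?g Y)" for Y :: "real \<Rightarrow> 'a \<Rightarrow> real"
    unfolding sign_filtration_def by (rule sets_measure_of) blast
  have "?g Y \<subseteq> sets ?C"
  proof
    fix A assume "A \<in> ?g Y"
    then obtain s B where s: "s \<in> {0..t}" and B: "B \<in> sets borel" and A: "A = (\<lambda>\<omega>. sign_left (Y s \<omega>)) -` B \<inter> space M"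
      by blast
    let ?A = "(\<lambda>\<omega>. sign_left (Z s \<omega>)) -` B \<inter> space M"
    have "?A \<in> ?g Z" using s B by blast
    then have "?A \<in> sets ?C" unfolding C gen by (intro sigma_sets.Basic UnI1)
    moreover have "A \<subseteq> space M" unfolding A by blast
    moreover have "AE \<omega> in M. \<omega> \<in> ?A \<longleftrightarrow> \<omega> \<in> A" unfolding A using eq by eventually_elim simp
    ultimately show "A \<in> sets ?C" by (rule sets_AE_cong[OF M null sp])
  qed
  then have "sets (sign_filtration M Y t) \<subseteq> sets ?C"
    unfolding gen using sets.sigma_sets_subset[of "?g Y" ?C] sp by simp
  then show ?thesis
    using sets.sigma_sets_subset[of "sets (sign_filtration M Y t) \<union> null_sets M" ?C] null sp unfolding C by simp
qed

lemma completed_sign_filtration_cong: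
  assumes M: "complete_measure M" and eq: "AE \<omega> in M. \<forall>t. Y t \<omega> = Z t \<omega>"
  shows "completed_filtration M (sign_filtration M Y) = completed_filtration M (sign_filtration M Z)"
proof
  fix t
  have Pow: "sets (sign_filtration M Y t) \<union> null_sets M \<subseteq> Pow (space M)" for Y :: "real \<Rightarrow> 'a \<Rightarrow> real"
    using sets.space_closed[of "sign_filtration M Y t"] null_setsD2[of _ M] sets.sets_into_space[of _ M]
    by auto
  have eq': "AE \<omega> in M. \<forall>t. Z t \<omega> = Y t \<omega>" using eq by eventually_elim simp
  show "completed_filtration M (sign_filtration M Y) t = completed_filtration M (sign_filtration M Z) t"
    unfolding completed_filtration_def
    by (intro sigma_eqI Pow subset_antisym completed_sign_filtration_mono M eq eq')
qed

text \<open>Everything here is defined path by path, so the values at a point depend only on the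
  path of that point. Almost sure equality of two processes thus transfers to all derived objects on
  the same event.\<close>

lemma path_cong:
  assumes "\<And>t. X t \<omega> = X' t \<omega>"
  shows tau_alpha_cong: "tau_alpha \<alpha> T X \<omega> = tau_alpha \<alpha> T X' \<omega>"
    and default_time_cong: "default_time \<alpha> T X \<omega> = default_time \<alpha> T X' \<omega>"
    and Y_process_cong: "Y_process \<alpha> T X t \<omega> = Y_process \<alpha> T X' t \<omega>"
    and default_indicator_cong: "default_indicator \<alpha> T X t \<omega> = default_indicator \<alpha> T X' t \<omega>"
    and default_intensity_cong: "default_intensity \<alpha> T X t \<omega> = default_intensity \<alpha> T X' t \<omega>"
proof -
  have lz: "last_zero_left Z t \<omega> = last_zero_left Z' t \<omega>" if "\<And>t. Z t \<omega> = Z' t \<omega>" for Z Z' :: "real \<Rightarrow> 'a \<Rightarrow> real" and t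
    by (simp add: last_zero_left_def last_zero_def that)
  show tau: "tau_alpha \<alpha> T X \<omega> = tau_alpha \<alpha> T X' \<omega>"
    by (simp add: tau_alpha_def lz[of X X', OF assms] last_zero_def assms)
  have val: "X_tau_alpha \<alpha> T X \<omega> = X_tau_alpha \<alpha> T X' \<omega>"
    by (simp add: X_tau_alpha_def tau assms)
  show def: "default_time \<alpha> T X \<omega> = default_time \<alpha> T X' \<omega>"
    by (simp add: default_time_def tau val assms)
  show "default_indicator \<alpha> T X t \<omega> = default_indicator \<alpha> T X' t \<omega>"
    by (simp add: default_indicator_def def)
  have Y: "Y_process \<alpha> T X t \<omega> = Y_process \<alpha> T X' t \<omega>" for t
    by (simp add: Y_process_def tau val assms)
  then show "Y_process \<alpha> T X t \<omega> = Y_process \<alpha> T X' t \<omega>" .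
  show "default_intensity \<alpha> T X t \<omega> = default_intensity \<alpha> T X' t \<omega>"
    by (simp add: default_intensity_def def tau lz[of "Y_process \<alpha> T X" "Y_process \<alpha> T X'", OF Y])
qed

text \<open>The sign events of the two versions differ by null sets, which the completion absorbs;
  the filtrations are therefore equal and not merely equal up to null sets.\<close>

lemma market_filtration_cong:
  assumes "complete_measure M" and "AE \<omega> in M. \<forall>t. X t \<omega> = X' t \<omega>"
  shows "market_filtration M \<alpha> T X = market_filtration M \<alpha> T X'"
proof -
  have "AE \<omega> in M. \<forall>t. Y_process \<alpha> T X t \<omega> = Y_process \<alpha> T X' t \<omega>"
    using assms(2) by eventually_elim (intro allI Y_process_cong, blast)
  then show ?thesis unfolding market_filtration_def by (simp only: completed_sign_filtration_cong[OF assms(1)])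
qed

lemma martingale_on_AE_cong:
  assumes M: "complete_measure M" "prob_space M" and G: "\<And>t. t \<in> {0..T} \<Longrightarrow> subalgebra M (G t)"
    and null: "\<And>t. t \<in> {0..T} \<Longrightarrow> null_sets M \<subseteq> sets (G t)"
    and eq: "AE \<omega> in M. \<forall>t. Z t \<omega> = Z' t \<omega>" and Z: "martingale_on M T G Z"
  shows "martingale_on M T G Z'"
  unfolding martingale_on_def
proof (intro conjI ballI impI)
  interpret prob_space M by (rule M(2))
  have eqt: "AE \<omega> in M. Z t \<omega> = Z' t \<omega>" for t using eq by eventually_elim simp
  have Zm: "Z t \<in> borel_measurable (G t)" "integrable M (Z t)" if "t \<in> {0..T}" for t
    using Z that unfolding martingale_on_def by auto
  show m: "Z' t \<in> borel_measurable (G t)" if t: "t \<in> {0..T}" for t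
    using G[OF t] by (intro measurable_AE_cong[OF M(1) null[OF t] _ Zm(1)[OF t] eqt]) (simp add: subalgebra_def)
  have mM: "Z' t \<in> borel_measurable M" if t: "t \<in> {0..T}" for t
    by (rule measurable_from_subalg[OF G[OF t] m[OF t]])
  show "integrable M (Z' t)" if t: "t \<in> {0..T}" for t
    by (rule integrable_cong_AE_imp[OF Zm(2)[OF t] mM[OF t] eqt])
  fix s t assume s: "s \<in> {0..T}" and t: "t \<in> {0..T}" and st: "s \<le> t"
  interpret S: finite_measure_subalgebra M "G s" by unfold_locales (rule G[OF s])
  have "AE \<omega> in M. real_cond_exp M (G s) (Z t) \<omega> = real_cond_exp M (G s) (Z' t) \<omega>"
    using Zm(2)[OF t] mM[OF t] by (intro S.real_cond_exp_cong eqt) auto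
  moreover have "AE \<omega> in M. real_cond_exp M (G s) (Z t) \<omega> = Z s \<omega>"
    using Z s t st unfolding martingale_on_def by blast
  ultimately show "AE \<omega> in M. real_cond_exp M (G s) (Z' t) \<omega> = Z' s \<omega>"
    using eqt[of s] by eventually_elim simp
qed

lemma compensator_AE_cong:
  fixes N N' :: "real \<Rightarrow> 'a \<Rightarrow> real"
  assumes M: "complete_measure M" "prob_space M" and G: "\<And>t. t \<in> {0..T} \<Longrightarrow> subalgebra M (G t)"
    and null: "\<And>t. t \<in> {0..T} \<Longrightarrow> null_sets M \<subseteq> sets (G t)"
    and eq: "AE \<omega> in M. \<forall>t. N t \<omega> = N' t \<omega>" and A: "compensator M T G N A"
  shows "compensator M T G N' A"
proof -
  have "AE \<omega> in M. \<forall>t. N t \<omega> - A t \<omega> = N' t \<omega> - A t \<omega>" using eq by eventually_elim simp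
  then show ?thesis using A martingale_on_AE_cong[OF M G null, where Z="\<lambda>t \<omega>. N t \<omega> - A t \<omega>" and Z'="\<lambda>t \<omega>. N' t \<omega> - A t \<omega>"]
    unfolding compensator_def by simp
qed

lemma (in market) null_sets_G:
  assumes t: "t \<in> {0..T}"
  shows "null_sets M \<subseteq> sets (G t)"
proof
  fix B assume B: "B \<in> null_sets M"
  have "AE \<omega> in M. \<omega> \<in> B \<longleftrightarrow> \<omega> \<in> {}" using AE_not_in[OF B] by eventually_elim simp
  then have "B \<in> sets (K t)"
    using sets.sets_into_space[OF null_setsD2[OF B]] sets.empty_sets[of "H t"] unfolding sets_K_iff[OF t] by blast
  then show "B \<in> sets (G t)" using K_sub_G[OF t] by blast
qed

lemma brownian_motion_increment:
  assumes M: "prob_space M" and W: "brownian_motion M T F W" and st: "s \<in> {0..T}" "t \<in> {0..T}" "s < t"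
    and E: "E \<in> sets (F s)" and S: "S \<in> sets borel"
  shows "measure M (E \<inter> {\<omega>\<in>space M. (W t \<omega> - W s \<omega>) / sqrt (t - s) \<in> S}) =
    measure M E * measure std_normal_distribution S"
proof -
  interpret prob_space M by (rule M)
  let ?D = "\<lambda>\<omega>. W t \<omega> - W s \<omega>" and ?r = "sqrt (t - s)"
  have ind: "indep_set (sets (F s)) (sets (vimage_algebra (space M) ?D borel))"
    and dist: "distributed M lborel ?D (normal_density 0 ?r)"
    using W st unfolding brownian_motion_def by blast+
  have S': "(\<lambda>x. x / ?r) -` S \<in> sets borel"
    using measurable_sets[OF borel_measurable_divide[OF measurable_ident borel_measurable_const, of ?r] S] by simp
  have eq: "{\<omega>\<in>space M. ?D \<omega> / ?r \<in> S} = ?D -` ((\<lambda>x. x / ?r) -` S) \<inter> space M" by blast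
  have "prob (E \<inter> {\<omega>\<in>space M. ?D \<omega> / ?r \<in> S}) = prob E * prob {\<omega>\<in>space M. ?D \<omega> / ?r \<in> S}"
    unfolding eq by (rule indep_setD[OF ind E in_vimage_algebra[OF S']])
  also have "prob {\<omega>\<in>space M. ?D \<omega> / ?r \<in> S} = measure std_normal_distribution S"
  proof -
    have d: "distributed M lborel (\<lambda>\<omega>. ?D \<omega> / ?r) std_normal_density"
      using dist normal_standard_normal_convert[of ?r ?D 0] st by simp
    have "measure std_normal_distribution S = measure (distr M lborel (\<lambda>\<omega>. ?D \<omega> / ?r)) S"
      by (simp add: distributed_distr_eq_density[OF d])
    also have "\<dots> = prob ((\<lambda>\<omega>. ?D \<omega> / ?r) -` S \<inter> space M)"
      using distributed_measurable[OF d] S by (intro measure_distr) auto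
    also have "(\<lambda>\<omega>. ?D \<omega> / ?r) -` S \<inter> space M = {\<omega>\<in>space M. ?D \<omega> / ?r \<in> S}" by blast
    finally show ?thesis by simp
  qed
  finally show ?thesis .
qed

text \<open>Paths that are discontinuous or do not start at 0 are replaced as a whole by the zero
  path. Whether a path is replaced depends on its entire course, yet the new process is adapted,
  because this happens on a null set and each \<open>F t\<close> contains all null sets.\<close>

lemma brownian_motion_regular_version:
  assumes M: "prob_space M" and T: "0 < T" and \<alpha>: "0 < \<alpha>"
    and F: "filtration_usual M T F" and X: "brownian_motion M T F X"
  obtains X' where "market M T F X' \<alpha>" "AE \<omega> in M. \<forall>t. X t \<omega> = X' t \<omega>"
proof -
  interpret prob_space M by (rule M)
  have complete: "complete_measure M" and sub: "\<And>t. t \<in> {0..T} \<Longrightarrow> subalgebra M (F t)"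
    and mono: "\<And>s t. s \<in> {0..T} \<Longrightarrow> t \<in> {0..T} \<Longrightarrow> s \<le> t \<Longrightarrow> sets (F s) \<subseteq> sets (F t)"
    and null0: "null_sets M \<subseteq> sets (F 0)"
    using F unfolding filtration_usual_def by simp_all
  have null: "null_sets M \<subseteq> sets (F t)" if "t \<in> {0..T}" for t
    using null0 mono[of 0 t] that T by auto
  define X' where "X' = (\<lambda>t \<omega>. if X 0 \<omega> = 0 \<and> continuous_on {0..T} (\<lambda>t. X t \<omega>) then X t \<omega> else 0)"
  have reg: "AE \<omega> in M. X 0 \<omega> = 0 \<and> continuous_on {0..T} (\<lambda>t. X t \<omega>)"
    using X unfolding brownian_motion_def by simp
  have eq: "AE \<omega> in M. \<forall>t. X t \<omega> = X' t \<omega>" using reg by eventually_elim (simp add: X'_def)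
  have eqt: "AE \<omega> in M. X t \<omega> = X' t \<omega>" for t using eq by eventually_elim simp
  have meas: "X t \<in> borel_measurable (F t)" if "t \<in> {0..T}" for t
    using X that unfolding brownian_motion_def by blast
  have meas': "X' t \<in> borel_measurable (F t)" if t: "t \<in> {0..T}" for t
    using sub[OF t] by (intro measurable_AE_cong[OF complete null[OF t] _ meas[OF t] eqt]) (simp add: subalgebra_def)
  have "market M T F X' \<alpha>"
  proof (intro market.intro market_axioms.intro cash_balance.intro cash_balance_axioms.intro brownian.intro
      brownian_axioms.intro)
    show "prob_space M" "0 < T" "0 < \<alpha>" "complete_measure M" by (rule M T \<alpha> complete)+
    show "subalgebra M (F t)" if "t \<in> {0..T}" for t by (rule sub[OF that])
    show "X' t \<in> borel_measurable (F t)" if "t \<in> {0..T}" for t by (rule meas'[OF that])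
    show "sets (F s) \<subseteq> sets (F t)" if "0 \<le> s" "s \<le> t" "t \<le> T" for s t using that by (intro mono) auto
    show "X' 0 \<omega> = 0" for \<omega> by (simp add: X'_def)
    show "continuous_on {0..T} (\<lambda>t. X' t \<omega>)" for \<omega>
    proof (cases "X 0 \<omega> = 0 \<and> continuous_on {0..T} (\<lambda>t. X t \<omega>)")
      case False
      show ?thesis unfolding X'_def if_not_P[OF False] by (rule continuous_on_const)
    qed (simp add: X'_def)
    fix s t :: real and E :: "'a set" and S :: "real set"
    assume st: "0 \<le> s" "s < t" "t \<le> T" and E: "E \<in> sets (F s)" and S: "S \<in> sets borel"
    have sT: "s \<in> {0..T}" and tT: "t \<in> {0..T}" using st by auto
    have [measurable]: "E \<in> sets M" "S \<in> sets borel" "X s \<in> borel_measurable M" "X t \<in> borel_measurable M"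
      "X' s \<in> borel_measurable M" "X' t \<in> borel_measurable M"
      using E S sub[OF sT] measurable_from_subalg[OF sub[OF sT] meas[OF sT]] measurable_from_subalg[OF sub[OF tT] meas[OF tT]]
        measurable_from_subalg[OF sub[OF sT] meas'[OF sT]] measurable_from_subalg[OF sub[OF tT] meas'[OF tT]]
      by (auto simp: subalgebra_def)
    have "prob (E \<inter> {\<omega>\<in>space M. (X' t \<omega> - X' s \<omega>) / sqrt (t - s) \<in> S}) =
      prob (E \<inter> {\<omega>\<in>space M. (X t \<omega> - X s \<omega>) / sqrt (t - s) \<in> S})"
    proof (rule measure_eq_AE)
      show "AE \<omega> in M. \<omega> \<in> E \<inter> {\<omega>\<in>space M. (X' t \<omega> - X' s \<omega>) / sqrt (t - s) \<in> S} \<longleftrightarrow>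
        \<omega> \<in> E \<inter> {\<omega>\<in>space M. (X t \<omega> - X s \<omega>) / sqrt (t - s) \<in> S}"
        using eqt[of s] eqt[of t] by eventually_elim simp
    qed measurable
    also have "\<dots> = prob E * measure std_normal_distribution S"
      by (rule brownian_motion_increment[OF M X sT tT st(2) E S])
    finally show "prob (E \<inter> {\<omega>\<in>space M. (X' t \<omega> - X' s \<omega>) / sqrt (t - s) \<in> S}) =
      prob E * measure std_normal_distribution S" .
  qed
  then show thesis using eq by (rule that)
qed

theorem theorem3p1:
  fixes M :: "'a measure" and F :: "real \<Rightarrow> 'a measure"
    and X :: "real \<Rightarrow> 'a \<Rightarrow> real" and \<alpha> T :: real
  assumes "prob_space M"
    and "T > 0"
    and "\<alpha> > 0"
    and "filtration_usual M T F"
    and "brownian_motion M T F X"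
  shows "(\<exists>A. compensator M T (market_filtration M \<alpha> T X) (default_indicator \<alpha> T X) A) \<and>
    (\<forall>A. compensator M T (market_filtration M \<alpha> T X) (default_indicator \<alpha> T X) A \<longrightarrow>
      (AE \<omega> in M. \<forall>t\<in>{0..T}.
         interval_lebesgue_integrable lborel 0 (min (ereal t) (default_time \<alpha> T X \<omega>))
           (\<lambda>s. default_intensity \<alpha> T X s \<omega>) \<and>
         A t \<omega> = interval_lebesgue_integral lborel 0 (min (ereal t) (default_time \<alpha> T X \<omega>))
           (\<lambda>s. default_intensity \<alpha> T X s \<omega>)))"
proof -
  obtain X' where market: "market M T F X' \<alpha>" and eq: "AE \<omega> in M. \<forall>t. X t \<omega> = X' t \<omega>"
    using brownian_motion_regular_version[OF assms] .
  interpret market M T F X' \<alpha> by (rule market)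
  have G: "market_filtration M \<alpha> T X = G" by (rule market_filtration_cong[OF complete eq])
  have N: "AE \<omega> in M. \<forall>t. default_indicator \<alpha> T X t \<omega> = default_indicator \<alpha> T X' t \<omega>"
    using eq by eventually_elim (intro allI default_indicator_cong, blast)
  then have N': "AE \<omega> in M. \<forall>t. default_indicator \<alpha> T X' t \<omega> = default_indicator \<alpha> T X t \<omega>"
    by eventually_elim simp
  \<comment> \<open>Used in both directions: existence carries \<open>hazard\<close> from the
    regular version to X, and uniqueness carries an arbitrary compensator for X to the regular
    version.\<close>
  note transfer = compensator_AE_cong[OF complete assms(1) subalgebra_G null_sets_G]
  show ?thesis unfolding G
  proof (intro conjI exI allI impI)
    show "compensator M T G (default_indicator \<alpha> T X) hazard"
      by (rule transfer[rotated 2, OF N' compensator_hazard])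
    fix A assume "compensator M T G (default_indicator \<alpha> T X) A"
    then have "compensator M T G (default_indicator \<alpha> T X') A"
      by (rule transfer[rotated 2, OF N])
    from default_intensity_compensator(2)[OF this] eq
    show "AE \<omega> in M. \<forall>t\<in>{0..T}.
         interval_lebesgue_integrable lborel 0 (min (ereal t) (default_time \<alpha> T X \<omega>))
           (\<lambda>s. default_intensity \<alpha> T X s \<omega>) \<and>
         A t \<omega> = interval_lebesgue_integral lborel 0 (min (ereal t) (default_time \<alpha> T X \<omega>))
           (\<lambda>s. default_intensity \<alpha> T X s \<omega>)"
    proof eventually_elim
      case (elim \<omega>)
      have c: "X t \<omega> = X' t \<omega>" for t using elim(2) by blast
      show ?case using elim(1) by (simp only: default_time_cong[of X \<omega> X', OF c] default_intensity_cong[of X \<omega> X', OF c])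
    qed
  qed
qed

end
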